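(* Let $\alpha$ be a smooth function of involutive and non-generic type, and let $F_2\colon I_2\times J_2\to\mathbb R^3$ be the map associated with the integral manifold $S_2$ determined by smooth functions $\xi(t),\mu(t)$ as described in the context. Write $G=\widetilde{\overline{\alpha_q+\alpha\alpha_p}}\colon I_2\times J_2\to\mathbb R$. Assume that $(s_0,t_0)\in S(F_2)$ satisfies $G_s(s_0,t_0)\neq0$. Then: (1) $F_2$ is a cuspidal edge at $(s_0,t_0)$ if and only if $G_t(s_0,t_0)-\xi'''(t_0)\ne0$. (2) $F_2$ is a swallowtail at $(s_0,t_0)$ if and only if $G_t(s_0,t_0)-\xi'''(t_0)=0$ and $G_{tt}(s_0,t_0)-\xi^{(4)}(t_0)\neq0$. (3) $F_2$ is a butterfly at $(s_0,t_0)$ if and only if $G_t(s_0,t_0)-\xi'''(t_0)=0$, $G_{tt}(s_0,t_0)-\xi^{(4)}(t_0)=0$ and $G_{ttt}(s_0,t_0)-\xi^{(5)}(t_0)\neq0$.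
   Context: All objects are $C^\infty$ and all considerations are local. $(x,y,z,p,q)$ are canonical coordinates on $J^1(2,1)=PT^*J^0(2,1)$, $\dim J^0(2,1)=3$, in which the contact form is $dz-p\,dx-q\,dy$; $J^0(2,1)$ is locally identified with $\mathbb R^3$ via $(x,y,z)$. The function $\alpha=\alpha(x,y,z,p,q)$ is of involutive type if $\alpha_x+p\alpha_z-\alpha(\alpha_y+q\alpha_z)=0$ on its domain, and of non-generic type if $1+x(\alpha_y+q\alpha_z)=0$ on its domain. Define the local diffeomorphism $\Phi_2(x,y,z,p,q)=(x_0,\dots,x_4)=(x,\ \alpha,\ z-px-qy,\ p,\ q)$, with a local inverse $\Phi_2^{-1}$ on an open set $V_2\subset\mathbb R\times U_2$ (product of an open interval and an open $U_2\subset\mathbb R^4$); let $\varphi_2,\psi_2$ be its second ($y$) and third ($z$) components. Put $\beta=y+\alpha x$; the function $\overline\beta=\beta\circ\Phi_2^{-1}$ does not depend on $x_0$ and is regarded as a function of $(x_1,x_2,x_3,x_4)$. Let $\xi(t)$ be a smooth function and $\mu(t)$ a solution of $\mu'(t)=-\overline\beta(\xi'(t),\mu(t),\xi(t),t)$. For open intervals $I_2,J_2$ with $(s,\xi'(t),\mu(t),\xi(t),t)\in V_2$ for $(s,t)\in I_2\times J_2$, put $\Theta_2(s,t)=\Phi_2^{-1}(s,\xi'(t),\mu(t),\xi(t),t)$; its image $S_2$ is a two-dimensional integral manifold of the ideal generated by $dz-p\,dx-q\,dy$, $dp-\alpha\,dq$ and their exterior derivatives. For a function $g$ of $(x,y,z,p,q)$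 write $\widetilde{\overline g}=g\circ\Theta_2\colon I_2\times J_2\to\mathbb R$. The map associated with $S_2$ is $$F_2(s,t)=(s,\ \varphi_2(s,\xi'(t),\mu(t),\xi(t),t),\ \psi_2(s,\xi'(t),\mu(t),\xi(t),t)),$$ and $S(F_2)$ is the set of its singular points (where $\mathrm{rank}\,dF_2<2$). Two map germs $f\colon(\mathbb R^2,a)\to(\mathbb R^3,f(a))$, $g\colon(\mathbb R^2,b)\to(\mathbb R^3,g(b))$ are right-left equivalent if $\psi\circ f=g\circ\varphi$ for some diffeomorphism germs $\varphi\colon(\mathbb R^2,a)\to(\mathbb R^2,b)$ and $\psi\colon(\mathbb R^3,f(a))\to(\mathbb R^3,g(b))$. A map is, at a point, a cuspidal edge, swallowtail or butterfly if its germ there is right-left equivalent to the germ at the origin of, respectively, $(u,v)\mapsto(u,v^2,v^3)$, $(u,v)\mapsto(u,3v^4+uv^2,4v^3+2uv)$, $(u,v)\mapsto(u,5v^4+2uv,uv^2+4v^5)$. *)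

theory Defs
  imports "HOL-Analysis.Analysis"
begin

section \<open>Smooth maps and diffeomorphisms between open sets\<close>

text \<open>On an open set \<open>S\<close> and with a finite-dimensional domain, differentiability together with
  the corresponding condition on every directional derivative is the usual notion of class
  \<open>C\<^sup>k\<close>.\<close>

primrec Ck_on ::
  "nat \<Rightarrow> 'a::real_normed_vector set \<Rightarrow> ('a \<Rightarrow> 'b::real_normed_vector) \<Rightarrow> bool" where
  "Ck_on 0 S f \<longleftrightarrow> continuous_on S f"
| "Ck_on (Suc k) S f \<longleftrightarrow>
     (\<forall>x\<in>S. f differentiable (at x)) \<and>
     (\<forall>v. Ck_on k S (\<lambda>x. frechet_derivative f (at x) v))"

definition smooth_on ::
  "'a::real_normed_vector set \<Rightarrow> ('a \<Rightarrow> 'b::real_normed_vector) \<Rightarrow> bool" where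
  "smooth_on S f \<longleftrightarrow> (\<forall>k. Ck_on k S f)"

text \<open>\<open>f\<close> restricts to a diffeomorphism of the open set \<open>U\<close> onto the open set \<open>V\<close>, with
  inverse \<open>g\<close>.\<close>

definition diffeo_between ::
  "'a::real_normed_vector set \<Rightarrow> 'b::real_normed_vector set \<Rightarrow> ('a \<Rightarrow> 'b) \<Rightarrow> ('b \<Rightarrow> 'a) \<Rightarrow> bool"
  where
  "diffeo_between U V f g \<longleftrightarrow>
     open U \<and> open V \<and> smooth_on U f \<and> smooth_on V g \<and>
     (\<forall>x\<in>U. f x \<in> V \<and> g (f x) = x) \<and>
     (\<forall>y\<in>V. g y \<in> U \<and> f (g y) = y)"

definition singular_points :: "(real \<times> real \<Rightarrow> real \<times> real \<times> real) \<Rightarrow> (real \<times> real) set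
    \<Rightarrow> (real \<times> real) set" where
  "singular_points f M = {x \<in> M. dim (range (frechet_derivative f (at x))) < 2}"

section \<open>Right-left equivalence of map germs\<close>

text \<open>Germs are given by maps on the whole type; only their values near the base point matter.\<close>

definition right_left_equivalent ::
  "('a::real_normed_vector \<Rightarrow> 'b::real_normed_vector) \<Rightarrow> 'a \<Rightarrow> ('a \<Rightarrow> 'b) \<Rightarrow> 'a \<Rightarrow> bool" where
  "right_left_equivalent f a g b \<longleftrightarrow>
     (\<exists>U U' \<phi> \<phi>' V V' \<psi> \<psi>'.
        diffeo_between U U' \<phi> \<phi>' \<and> a \<in> U \<and> \<phi> a = b \<and>
        diffeo_between V V' \<psi> \<psi>' \<and> f a \<in> V \<and> \<psi> (f a) = g b \<and>
        (\<forall>\<^sub>F x in nhds a. f x \<in> V \<and> \<psi> (f x) = g (\<phi> x)))"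

definition cuspidal_edge_at :: "(real \<times> real \<Rightarrow> real \<times> real \<times> real) \<Rightarrow> real \<times> real \<Rightarrow> bool" where
  "cuspidal_edge_at f a \<longleftrightarrow>
     right_left_equivalent f a (\<lambda>(u, v). (u, v^2, v^3)) (0, 0)"

definition swallowtail_at :: "(real \<times> real \<Rightarrow> real \<times> real \<times> real) \<Rightarrow> real \<times> real \<Rightarrow> bool" where
  "swallowtail_at f a \<longleftrightarrow>
     right_left_equivalent f a (\<lambda>(u, v). (u, 3 * v^4 + u * v^2, 4 * v^3 + 2 * u * v)) (0, 0)"

definition butterfly_at :: "(real \<times> real \<Rightarrow> real \<times> real \<times> real) \<Rightarrow> real \<times> real \<Rightarrow> bool" where
  "butterfly_at f a \<longleftrightarrow>
     right_left_equivalent f a (\<lambda>(u, v). (u, 5 * v^4 + 2 * u * v, u * v^2 + 4 * v^5)) (0, 0)"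

section \<open>The function \<open>\<alpha>\<close> on the jet space\<close>

text \<open>Canonical coordinates \<open>(x, y, z, p, q)\<close> of the jet space. The target \<open>(x\<^sub>0, \<dots>, x\<^sub>4)\<close> of
  \<open>Phi2\<close> has the same type; as tuples nest to the right, it is also \<open>\<real> \<times> \<real>\<^sup>4\<close>.\<close>

type_synonym jet = "real \<times> real \<times> real \<times> real \<times> real"

definition pd_x :: "(jet \<Rightarrow> real) \<Rightarrow> jet \<Rightarrow> real" where
  "pd_x g m = frechet_derivative g (at m) (1, 0, 0, 0, 0)"

definition pd_y :: "(jet \<Rightarrow> real) \<Rightarrow> jet \<Rightarrow> real" where
  "pd_y g m = frechet_derivative g (at m) (0, 1, 0, 0, 0)"

definition pd_z :: "(jet \<Rightarrow> real) \<Rightarrow> jet \<Rightarrow> real" where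
  "pd_z g m = frechet_derivative g (at m) (0, 0, 1, 0, 0)"

definition pd_p :: "(jet \<Rightarrow> real) \<Rightarrow> jet \<Rightarrow> real" where
  "pd_p g m = frechet_derivative g (at m) (0, 0, 0, 1, 0)"

definition pd_q :: "(jet \<Rightarrow> real) \<Rightarrow> jet \<Rightarrow> real" where
  "pd_q g m = frechet_derivative g (at m) (0, 0, 0, 0, 1)"

definition involutive_type :: "jet set \<Rightarrow> (jet \<Rightarrow> real) \<Rightarrow> bool" where
  "involutive_type D \<alpha> \<longleftrightarrow>
     (\<forall>(x, y, z, p, q) \<in> D. let m = (x, y, z, p, q) in
        pd_x \<alpha> m + p * pd_z \<alpha> m - \<alpha> m * (pd_y \<alpha> m + q * pd_z \<alpha> m) = 0)"

definition non_generic_type :: "jet set \<Rightarrow> (jet \<Rightarrow> real) \<Rightarrow> bool" where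
  "non_generic_type D \<alpha> \<longleftrightarrow>
     (\<forall>(x, y, z, p, q) \<in> D. let m = (x, y, z, p, q) in
        1 + x * (pd_y \<alpha> m + q * pd_z \<alpha> m) = 0)"

section \<open>The integral manifold and its associated map\<close>

definition Phi2 :: "(jet \<Rightarrow> real) \<Rightarrow> jet \<Rightarrow> jet" where
  "Phi2 \<alpha> = (\<lambda>(x, y, z, p, q). (x, \<alpha> (x, y, z, p, q), z - p * x - q * y, p, q))"

definition beta2 :: "(jet \<Rightarrow> real) \<Rightarrow> jet \<Rightarrow> real" where
  "beta2 \<alpha> = (\<lambda>(x, y, z, p, q). y + \<alpha> (x, y, z, p, q) * x)"

text \<open>For a local inverse \<open>\<Psi>\<close> of \<open>Phi2 \<alpha>\<close> on \<open>A \<times> U\<close> (with \<open>A\<close> an open interval and \<open>\<alpha>\<close> of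
  involutive type) the value \<open>beta2 \<alpha> (\<Psi> (x\<^sub>0, w))\<close> does not depend on \<open>x\<^sub>0 \<in> A\<close>;
  \<open>beta2_bar \<alpha> \<Psi> A w\<close> is this common value.\<close>

definition beta2_bar ::
  "(jet \<Rightarrow> real) \<Rightarrow> (jet \<Rightarrow> jet) \<Rightarrow> real set \<Rightarrow> real \<times> real \<times> real \<times> real \<Rightarrow> real" where
  "beta2_bar \<alpha> \<Psi> A w = (THE b. \<forall>x\<^sub>0\<in>A. beta2 \<alpha> (\<Psi> (x\<^sub>0, w)) = b)"

definition phi2 :: "(jet \<Rightarrow> jet) \<Rightarrow> jet \<Rightarrow> real" where
  "phi2 \<Psi> m = fst (snd (\<Psi> m))"

definition psi2 :: "(jet \<Rightarrow> jet) \<Rightarrow> jet \<Rightarrow> real" where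
  "psi2 \<Psi> m = fst (snd (snd (\<Psi> m)))"

definition Theta2 ::
  "(jet \<Rightarrow> jet) \<Rightarrow> (real \<Rightarrow> real) \<Rightarrow> (real \<Rightarrow> real) \<Rightarrow> real \<times> real \<Rightarrow> jet" where
  "Theta2 \<Psi> \<xi> \<mu> = (\<lambda>(s, t). \<Psi> (s, deriv \<xi> t, \<mu> t, \<xi> t, t))"

definition F2 ::
  "(jet \<Rightarrow> jet) \<Rightarrow> (real \<Rightarrow> real) \<Rightarrow> (real \<Rightarrow> real) \<Rightarrow> real \<times> real \<Rightarrow> real \<times> real \<times> real" where
  "F2 \<Psi> \<xi> \<mu> = (\<lambda>(s, t).
     (s, phi2 \<Psi> (s, deriv \<xi> t, \<mu> t, \<xi> t, t), psi2 \<Psi> (s, deriv \<xi> t, \<mu> t, \<xi> t, t)))"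

end

theory Submission
  imports Defs "HOL-Complex_Analysis.Cauchy_Integral_Formula"
    "HOL-Computational_Algebra.Fundamental_Theorem_Algebra"
begin

text \<open>
  Along the curves on which only \<open>x\<^sub>0\<close> varies, the involutive equation gives \<open>y' = - \<alpha>\<close>; hence
  \<open>\<beta>\<close> is constant there and \<open>F\<^sub>2(s,t) = (s, y, \<mu> + s \<xi> + t y)\<close> with \<open>y = - \<mu>' - s \<xi>'\<close>: the map
  parametrises the envelope of the planes \<open>z = \<mu>(t) + x \<xi>(t) + t y\<close>. Non-genericity gives
  \<open>G(s,t) = - \<mu>''(t) / s\<close>. With \<open>M = \<mu> + s\<^sub>0 \<xi>\<close>, the point \<open>(s\<^sub>0,t\<^sub>0)\<close> is singular iff
  \<open>M''(t\<^sub>0) = 0\<close>, the hypothesis \<open>G\<^sub>s \<noteq> 0\<close> gives \<open>\<xi>''(t\<^sub>0) \<noteq> 0\<close>, and the expressions in the three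
  conditions are \<open>- M\<^sup>(\<^sup>k\<^sup>)(t\<^sub>0) / s\<^sub>0\<close> for \<open>k = 3, 4, 5\<close>.

  Let \<open>n\<close> be the least \<open>k \<ge> 2\<close> with \<open>M\<^sup>(\<^sup>k\<^sup>)(t\<^sub>0) \<noteq> 0\<close>. By Malgrange's division theorem in one
  variable the family of functions whose double zeros give the envelope is, up to a unit, a family
  of monic polynomials of degree \<open>n\<close>; the envelope is its set of parameters with a double root.
  For \<open>n = 3, 4\<close> completing the power yields the normal form. For \<open>n = 5\<close> the depressed quintic
  has four coefficients on a three-dimensional space, and a Tschirnhaus transformation, found by
  the implicit function theorem, removes the cubic one.

  The division theorem is proved by dividing the exponentials of a Fourier series: Cauchy's
  formula over a thin rectangle, of height about \<open>1/j\<close> for the frequency \<open>j\<close> and avoiding the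
  roots of the divisor, gives quotients that grow polynomially in \<open>j\<close> with all derivatives.

  Conversely, the least \<open>m\<close> with \<open>\<bar>f p - f p\<^sub>0\<bar> \<ge> c \<bar>p - p\<^sub>0\<bar>\<^sup>m\<close> near \<open>p\<^sub>0\<close> is invariant under
  right-left equivalence. It is \<open>2, 3, 4\<close> for the three normal forms and \<open>n - 1\<close> for the envelope.
\<close>

section \<open>Calculus of smooth maps\<close>

text \<open>The data are only smooth, so power series cannot produce the normal forms; the division
  theorem takes their place. Its version without parameters is enough: the family
  \<open>\<mu>(t) + x \<xi>(t) + t y - z\<close> is affine in \<open>(x, y, z)\<close>, so dividing
  \<open>\<mu>\<close> and \<open>\<xi>\<close> separately by the generic monic polynomial divides
  the whole family. The obstacle there is that no single height of the contour suits all polynomials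
  in a fixed neighbourhood of \<open>t^n\<close> and all frequencies, and a choice that jumps is not
  smooth. Several heights are therefore averaged with smooth weights; this is legitimate because the
  identity of quotient and remainder holds for every admissible contour, wherever the roots lie. For
  the quintic, asking directly that the squares of the transformed roots sum to zero is a degenerate
  equation at the base point, where all coefficients vanish. But \<open>a\<close>, \<open>b\<close>,
  \<open>c\<close> are coordinates of the target, so \<open>d\<close> lies in the ideal they
  generate, and with it the sum of squares. Making its three cofactors vanish is a nondegenerate
  system for three coefficients of the transformation.\<close>

lemma frechet_derivative_unique:
  "(f has_derivative f') (at x) \<Longrightarrow> frechet_derivative f (at x) = f'"
  using frechet_derivative_at by metis

text \<open>\<open>Ck_on_cong\<close> is itself proved with this rule, at its induction step. The
  congruence at the lower level is therefore a hypothesis here, which \<open>Ck_on_SucI'\<close>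
  discharges afterwards.\<close>

lemma Ck_on_SucI:
  fixes f :: "'a::real_normed_vector \<Rightarrow> 'b::real_normed_vector"
  assumes "\<And>x. x \<in> S \<Longrightarrow> (f has_derivative f' x) (at x)"
    and "\<And>v. Ck_on k S (\<lambda>x. f' x v)"
    and "open S"
    and cong: "\<And>g h :: 'a \<Rightarrow> 'b. (\<And>x. x \<in> S \<Longrightarrow> g x = h x) \<Longrightarrow> Ck_on k S g \<Longrightarrow> Ck_on k S h"
  shows "Ck_on (Suc k) S f"
proof -
  have "Ck_on k S (\<lambda>x. frechet_derivative f (at x) v)" for v
    by (rule cong[of "\<lambda>x. f' x v"]) (simp_all add: frechet_derivative_unique[OF assms(1)] assms(2))
  then show ?thesis
    using assms(1) by (auto simp: differentiable_def)
qed

lemma Ck_on_cong: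
  assumes "open S" "\<And>x. x \<in> S \<Longrightarrow> f x = g x" "Ck_on k S f"
  shows "Ck_on k S g"
  using assms
proof (induction k arbitrary: f g)
  case 0
  then show ?case
    by (simp cong: continuous_on_cong)
next
  case (Suc k)
  have d: "(g has_derivative frechet_derivative f (at x)) (at x)" if "x \<in> S" for x
    using Suc.prems(3) that frechet_derivative_works[of f "at x"]
    by (auto intro: has_derivative_transform_within_open[OF _ Suc.prems(1) that Suc.prems(2)])
  show ?case
    by (rule Ck_on_SucI[OF d]) (use Suc in auto)
qed

lemma Ck_on_SucI':
  assumes "open S" "\<And>x. x \<in> S \<Longrightarrow> (f has_derivative f' x) (at x)"
    and "\<And>v. Ck_on k S (\<lambda>x. f' x v)"
  shows "Ck_on (Suc k) S f"
  by (rule Ck_on_SucI[OF assms(2,3,1)]) (auto intro: Ck_on_cong[OF assms(1)])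

lemma Ck_on_Suc_has_derivative:
  "Ck_on (Suc k) S f \<Longrightarrow> x \<in> S \<Longrightarrow> (f has_derivative frechet_derivative f (at x)) (at x)"
  by (auto simp: frechet_derivative_works)

lemma Ck_on_Suc_imp: "Ck_on (Suc k) S f \<Longrightarrow> Ck_on k S f"
proof (induction k arbitrary: f)
  case 0
  then show ?case
    by (auto intro!: differentiable_imp_continuous_on
        simp: differentiable_on_def differentiable_at_withinI)
next
  case (Suc k)
  from Suc.prems have a: "\<forall>x\<in>S. f differentiable at x"
    and b: "\<forall>v. Ck_on (Suc k) S (\<lambda>x. frechet_derivative f (at x) v)"
    unfolding Ck_on.simps(2)[of "Suc k"] by blast+
  from b Suc.IH have "\<forall>v. Ck_on k S (\<lambda>x. frechet_derivative f (at x) v)"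
    by blast
  with a show ?case
    unfolding Ck_on.simps(2) by blast
qed

lemma Ck_on_imp_continuous_on: "Ck_on k S f \<Longrightarrow> continuous_on S f"
  by (induction k arbitrary: f) (simp, metis Ck_on_Suc_imp)

lemma Ck_on_subset: "Ck_on k S f \<Longrightarrow> T \<subseteq> S \<Longrightarrow> Ck_on k T f"
  by (induction k arbitrary: f) (auto intro: continuous_on_subset)

lemma Ck_on_local:
  assumes "\<And>x. x \<in> S \<Longrightarrow> \<exists>T. open T \<and> x \<in> T \<and> Ck_on k T f"
  shows "Ck_on k S f"
  using assms
proof (induction k arbitrary: f)
  case 0
  then show ?case
    by (auto intro!: continuous_at_imp_continuous_on)
      (meson continuous_on_eq_continuous_at)
next
  case (Suc k)
  show ?case
    unfolding Ck_on.simps(2)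
  proof (intro conjI ballI allI)
    fix x assume "x \<in> S"
    then show "f differentiable at x"
      using Suc.prems by force
  next
    fix v
    show "Ck_on k S (\<lambda>x. frechet_derivative f (at x) v)"
      by (rule Suc.IH) (use Suc.prems in fastforce)
  qed
qed

lemma Ck_on_const: "open S \<Longrightarrow> Ck_on k S (\<lambda>x. c)"
proof (induction k arbitrary: c)
  case (Suc k)
  show ?case
    by (rule Ck_on_SucI'[where f' = "\<lambda>_ _. 0"]) (use Suc in auto)
qed simp

lemma Ck_on_bounded_linear:
  assumes "bounded_linear L" "open S" "Ck_on k S f"
  shows "Ck_on k S (\<lambda>x. L (f x))"
  using assms(3)
proof (induction k arbitrary: f)
  case 0
  then show ?case
    using assms(1) by (simp add: bounded_linear.continuous_on)
next
  case (Suc k)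
  show ?case
    by (rule Ck_on_SucI'[OF assms(2) bounded_linear.has_derivative[OF assms(1)
            Ck_on_Suc_has_derivative[OF Suc.prems]]])
      (use Suc in auto)
qed

lemma Ck_on_id: "open S \<Longrightarrow> Ck_on k S (\<lambda>x. x)"
  by (cases k) (auto intro!: Ck_on_SucI'[where f' = "\<lambda>_ v. v"] Ck_on_const continuous_intros
      simp del: Ck_on.simps(2))

lemma Ck_on_add:
  assumes "open S" "Ck_on k S f" "Ck_on k S g"
  shows "Ck_on k S (\<lambda>x. f x + g x)"
  using assms(2,3)
proof (induction k arbitrary: f g)
  case (Suc k)
  show ?case
    by (rule Ck_on_SucI'[OF assms(1) has_derivative_add[OF Ck_on_Suc_has_derivative[OF Suc.prems(1)]
            Ck_on_Suc_has_derivative[OF Suc.prems(2)]]])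
      (use Suc in auto)
qed (auto intro!: continuous_intros)

lemma Ck_on_bilinear:
  assumes B: "bounded_bilinear B" and "open S" "Ck_on k S f" "Ck_on k S g"
  shows "Ck_on k S (\<lambda>x. B (f x) (g x))"
  using assms(3,4)
proof (induction k arbitrary: f g)
  case 0
  then show ?case
    using B by (simp add: bounded_bilinear.continuous_on)
next
  case (Suc k)
  show ?case
  proof (rule Ck_on_SucI'[OF assms(2) bounded_bilinear.FDERIV[OF B Ck_on_Suc_has_derivative[OF Suc.prems(1)]
            Ck_on_Suc_has_derivative[OF Suc.prems(2)]]])
    fix v
    show "Ck_on k S (\<lambda>x. B (f x) (frechet_derivative g (at x) v) + B (frechet_derivative f (at x) v) (g x))"
      using Suc.prems by (intro Ck_on_add assms(2) Suc.IH) (auto simp: Ck_on_Suc_imp)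
  qed
qed

lemma Ck_on_sum:
  assumes "open S" "\<And>i. i \<in> I \<Longrightarrow> Ck_on k S (f i)"
  shows "Ck_on k S (\<lambda>x. \<Sum>i\<in>I. f i x)"
  using assms(2) by (induction I rule: infinite_finite_induct) (auto intro: Ck_on_const Ck_on_add assms(1))

text \<open>The chain rule differentiates \<open>g\<close> in the moving direction
  \<open>Df(x) v\<close>, while \<open>Ck_on\<close> speaks of fixed directions only. Expanding the
  direction in a basis reduces one to the other, hence the Euclidean space in the middle.\<close>

lemma Ck_on_compose:
  fixes g :: "'b::euclidean_space \<Rightarrow> 'c::real_normed_vector"
  assumes "open S" "open T" "\<And>x. x \<in> S \<Longrightarrow> f x \<in> T" "Ck_on k S f" "Ck_on k T g"
  shows "Ck_on k S (\<lambda>x. g (f x))"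
  using assms(4,5)
proof (induction k arbitrary: g)
  case 0
  then show ?case
    using assms(3) by (auto intro: continuous_on_compose2)
next
  case (Suc k)
  define D where "D = (\<lambda>x. frechet_derivative g (at x))"
  have lin: "D (f x) w = (\<Sum>b\<in>Basis. (w \<bullet> b) *\<^sub>R D (f x) b)" if "x \<in> S" for x w
  proof -
    have "linear (D (f x))"
      using Suc.prems(2) assms(3)[OF that] unfolding D_def by (auto intro: linear_frechet_derivative)
    then have "D (f x) (\<Sum>b\<in>Basis. (w \<bullet> b) *\<^sub>R b) = (\<Sum>b\<in>Basis. (w \<bullet> b) *\<^sub>R D (f x) b)"
      by (simp add: linear_sum linear_cmul)
    then show ?thesis by (simp add: euclidean_representation)
  qed
  show ?case
  proof (rule Ck_on_SucI'[OF assms(1)])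
    fix x assume x: "x \<in> S"
    have "((\<lambda>x. g (f x)) has_derivative (\<lambda>v. D (f x) (frechet_derivative f (at x) v))) (at x)"
      unfolding D_def
      using has_derivative_compose[OF Ck_on_Suc_has_derivative[OF Suc.prems(1) x]
          Ck_on_Suc_has_derivative[OF Suc.prems(2) assms(3)[OF x]]] .
    then show "((\<lambda>x. g (f x)) has_derivative
      (\<lambda>v. \<Sum>b\<in>Basis. (frechet_derivative f (at x) v \<bullet> b) *\<^sub>R D (f x) b)) (at x)"
      unfolding lin[OF x, symmetric] .
  next
    fix v
    have "Ck_on k S (\<lambda>x. D (f x) b)" for b
      using Suc.prems Ck_on_Suc_imp by (intro Suc.IH) (auto simp: D_def)
    moreover have "Ck_on k S (\<lambda>x. frechet_derivative f (at x) v \<bullet> b)" for b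
      by (rule Ck_on_bounded_linear[OF bounded_linear_inner_left assms(1)]) (use Suc.prems in auto)
    ultimately show "Ck_on k S (\<lambda>x. \<Sum>b\<in>Basis. (frechet_derivative f (at x) v \<bullet> b) *\<^sub>R D (f x) b)"
      by (intro Ck_on_sum Ck_on_bilinear[OF bounded_bilinear_scaleR] assms(1)) auto
  qed
qed

lemma Ck_on_inverse:
  fixes f :: "'a::real_normed_vector \<Rightarrow> 'b::real_normed_field"
  assumes "open S" "\<And>x. x \<in> S \<Longrightarrow> f x \<noteq> 0" "Ck_on k S f"
  shows "Ck_on k S (\<lambda>x. inverse (f x))"
  using assms(3)
proof (induction k)
  case (Suc k)
  show ?case
  proof (rule Ck_on_SucI'[OF assms(1) Deriv.has_derivative_inverse[OF assms(2) Ck_on_Suc_has_derivative[OF Suc.prems]]])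
    fix v
    have "Ck_on k S (\<lambda>x. inverse (f x))"
      using Suc Ck_on_Suc_imp by blast
    moreover have "Ck_on k S (\<lambda>x. frechet_derivative f (at x) v)"
      using Suc.prems by simp
    ultimately show "Ck_on k S (\<lambda>x. - (inverse (f x) * frechet_derivative f (at x) v * inverse (f x)))"
      by (intro Ck_on_bounded_linear[OF bounded_linear_minus[OF bounded_linear_ident]]
          Ck_on_bilinear[OF bounded_bilinear_mult] assms(1))
  qed auto
qed (auto intro!: continuous_intros assms)

lemma smooth_on_has_derivative:
  "smooth_on S f \<Longrightarrow> x \<in> S \<Longrightarrow> (f has_derivative frechet_derivative f (at x)) (at x)"
  using Ck_on_Suc_has_derivative[of 0] unfolding smooth_on_def by blast

lemma smooth_on_imp_continuous_on: "smooth_on S f \<Longrightarrow> continuous_on S f"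
  unfolding smooth_on_def using Ck_on.simps(1) by blast

lemma smooth_on_directional:
  assumes "smooth_on S f"
  shows "smooth_on S (\<lambda>x. frechet_derivative f (at x) v)"
  unfolding smooth_on_def
proof
  fix k
  from assms have "Ck_on (Suc k) S f"
    unfolding smooth_on_def by blast
  then show "Ck_on k S (\<lambda>x. frechet_derivative f (at x) v)"
    by simp
qed

lemma smooth_on_cong:
  "open S \<Longrightarrow> smooth_on S f \<Longrightarrow> (\<And>x. x \<in> S \<Longrightarrow> f x = g x) \<Longrightarrow> smooth_on S g"
  unfolding smooth_on_def using Ck_on_cong by blast

lemma smooth_on_subset: "smooth_on S f \<Longrightarrow> T \<subseteq> S \<Longrightarrow> smooth_on T f"
  unfolding smooth_on_def using Ck_on_subset by blast

lemma smooth_on_local: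
  "(\<And>x. x \<in> S \<Longrightarrow> \<exists>T. open T \<and> x \<in> T \<and> smooth_on T f) \<Longrightarrow> smooth_on S f"
  unfolding smooth_on_def using Ck_on_local by metis

lemma smooth_on_const: "open S \<Longrightarrow> smooth_on S (\<lambda>x. c)"
  by (simp add: smooth_on_def Ck_on_const)

lemma smooth_on_id: "open S \<Longrightarrow> smooth_on S (\<lambda>x. x)"
  by (simp add: smooth_on_def Ck_on_id)

lemma smooth_on_linear:
  "open S \<Longrightarrow> bounded_linear L \<Longrightarrow> smooth_on S f \<Longrightarrow> smooth_on S (\<lambda>x. L (f x))"
  by (simp add: smooth_on_def Ck_on_bounded_linear)

lemma smooth_on_add:
  "open S \<Longrightarrow> smooth_on S f \<Longrightarrow> smooth_on S g \<Longrightarrow> smooth_on S (\<lambda>x. f x + g x)"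
  by (simp add: smooth_on_def Ck_on_add)

lemma smooth_on_sum:
  "open S \<Longrightarrow> (\<And>i. i \<in> I \<Longrightarrow> smooth_on S (f i)) \<Longrightarrow> smooth_on S (\<lambda>x. \<Sum>i\<in>I. f i x)"
  by (simp add: smooth_on_def Ck_on_sum)

lemma smooth_on_bilinear:
  "open S \<Longrightarrow> bounded_bilinear B \<Longrightarrow> smooth_on S f \<Longrightarrow> smooth_on S g \<Longrightarrow>
    smooth_on S (\<lambda>x. B (f x) (g x))"
  by (simp add: smooth_on_def Ck_on_bilinear)

lemma smooth_on_mult:
  fixes f g :: "'a::real_normed_vector \<Rightarrow> 'b::real_normed_algebra"
  shows "open S \<Longrightarrow> smooth_on S f \<Longrightarrow> smooth_on S g \<Longrightarrow> smooth_on S (\<lambda>x. f x * g x)"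
  by (rule smooth_on_bilinear[OF _ bounded_bilinear_mult])

lemma smooth_on_scaleR:
  "open S \<Longrightarrow> smooth_on S f \<Longrightarrow> smooth_on S g \<Longrightarrow> smooth_on S (\<lambda>x. f x *\<^sub>R g x)"
  by (rule smooth_on_bilinear[OF _ bounded_bilinear_scaleR])

lemma smooth_on_minus: "open S \<Longrightarrow> smooth_on S f \<Longrightarrow> smooth_on S (\<lambda>x. - f x)"
  by (rule smooth_on_linear[OF _ bounded_linear_minus[OF bounded_linear_ident]])

lemma smooth_on_diff:
  "open S \<Longrightarrow> smooth_on S f \<Longrightarrow> smooth_on S g \<Longrightarrow> smooth_on S (\<lambda>x. f x - g x)"
  using smooth_on_add[OF _ _ smooth_on_minus, of S f g] by simp

lemma smooth_on_power:
  fixes f :: "'a::real_normed_vector \<Rightarrow> 'b::real_normed_field"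
  shows "open S \<Longrightarrow> smooth_on S f \<Longrightarrow> smooth_on S (\<lambda>x. f x ^ n)"
  by (induction n) (auto intro: smooth_on_const smooth_on_mult)

lemma smooth_on_inverse:
  fixes f :: "'a::real_normed_vector \<Rightarrow> 'b::real_normed_field"
  shows "open S \<Longrightarrow> smooth_on S f \<Longrightarrow> (\<And>x. x \<in> S \<Longrightarrow> f x \<noteq> 0) \<Longrightarrow> smooth_on S (\<lambda>x. inverse (f x))"
  by (simp add: smooth_on_def Ck_on_inverse)

lemma smooth_on_divide:
  fixes f g :: "'a::real_normed_vector \<Rightarrow> 'b::real_normed_field"
  shows "open S \<Longrightarrow> smooth_on S f \<Longrightarrow> smooth_on S g \<Longrightarrow> (\<And>x. x \<in> S \<Longrightarrow> g x \<noteq> 0)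
    \<Longrightarrow> smooth_on S (\<lambda>x. f x / g x)"
  unfolding divide_inverse by (intro smooth_on_mult smooth_on_inverse)

lemma smooth_on_Pair:
  assumes "open S" "smooth_on S f" "smooth_on S g"
  shows "smooth_on S (\<lambda>x. (f x, g x))"
proof -
  have "smooth_on S (\<lambda>x. (f x, 0) + (0, g x))"
    by (intro smooth_on_add assms smooth_on_linear[OF _ _ assms(2), of "\<lambda>u. (u, 0)"]
        smooth_on_linear[OF _ _ assms(3), of "\<lambda>u. (0, u)"] bounded_linear_Pair bounded_linear_ident
        bounded_linear_zero)
  then show ?thesis by simp
qed

lemma smooth_on_fst: "open S \<Longrightarrow> smooth_on S f \<Longrightarrow> smooth_on S (\<lambda>x. fst (f x))"
  by (rule smooth_on_linear[OF _ bounded_linear_fst])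

lemma smooth_on_snd: "open S \<Longrightarrow> smooth_on S f \<Longrightarrow> smooth_on S (\<lambda>x. snd (f x))"
  by (rule smooth_on_linear[OF _ bounded_linear_snd])

lemma smooth_on_inner_const: "open S \<Longrightarrow> smooth_on S f \<Longrightarrow> smooth_on S (\<lambda>x. f x \<bullet> b)"
  by (rule smooth_on_linear[OF _ bounded_linear_inner_left])

lemma smooth_on_compose:
  fixes g :: "'b::euclidean_space \<Rightarrow> 'c::real_normed_vector"
  assumes "smooth_on T g" "open S" "open T" "smooth_on S f" "\<And>x. x \<in> S \<Longrightarrow> f x \<in> T"
  shows "smooth_on S (\<lambda>x. g (f x))"
  using assms unfolding smooth_on_def by (auto intro: Ck_on_compose)

lemmas smooth_intros = smooth_on_const smooth_on_id smooth_on_add smooth_on_diff smooth_on_minus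
  smooth_on_mult smooth_on_scaleR smooth_on_power smooth_on_sum smooth_on_Pair smooth_on_fst
  smooth_on_snd smooth_on_inner_const

lemma smooth_on_deriv:
  fixes f :: "real \<Rightarrow> real"
  assumes "open S" "smooth_on S f"
  shows "smooth_on S (deriv f)"
    and "x \<in> S \<Longrightarrow> (f has_real_derivative deriv f x) (at x)"
proof -
  have d: "frechet_derivative f (at x) = (\<lambda>h. h * deriv f x)" and
    d': "(f has_real_derivative deriv f x) (at x)" if "x \<in> S" for x
  proof -
    have "f differentiable (at x)"
      using smooth_on_has_derivative[OF assms(2) that] by (auto simp: differentiable_def)
    then show d': "(f has_real_derivative deriv f x) (at x)"
      using DERIV_deriv_iff_real_differentiable by blast
    then show "frechet_derivative f (at x) = (\<lambda>h. h * deriv f x)"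
      using frechet_derivative_unique[of f "\<lambda>h. h * deriv f x" x]
      by (auto simp: has_field_derivative_def mult.commute[of _ "deriv f x"])
  qed
  show "smooth_on S (deriv f)"
    by (rule smooth_on_cong[OF assms(1) smooth_on_directional[OF assms(2), of 1]]) (simp add: d)
  show "x \<in> S \<Longrightarrow> (f has_real_derivative deriv f x) (at x)"
    by (rule d')
qed

lemma smooth_on_deriv_iterate:
  fixes f :: "real \<Rightarrow> real"
  assumes "open S" "smooth_on S f"
  shows "smooth_on S ((deriv ^^ n) f)"
  by (induction n) (auto intro: smooth_on_deriv assms)

lemma smooth_on_realI:
  fixes d :: "nat \<Rightarrow> real \<Rightarrow> 'b::real_normed_vector"
  assumes "open S" "\<And>n x. x \<in> S \<Longrightarrow> (d n has_vector_derivative d (Suc n) x) (at x)"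
  shows "smooth_on S (d n)"
proof -
  have "Ck_on k S (d n)" for k n
  proof (induction k arbitrary: n)
    case 0
    show ?case
      using assms by (auto intro!: continuous_at_imp_continuous_on has_vector_derivative_continuous)
  next
    case (Suc k)
    show ?case
      by (rule Ck_on_SucI'[OF assms(1) assms(2)[unfolded has_vector_derivative_def]])
        (auto intro: Ck_on_bounded_linear[OF bounded_linear_scaleR_right assms(1)] Suc)
  qed
  then show ?thesis by (simp add: smooth_on_def)
qed

section \<open>Inverse and implicit functions\<close>

text \<open>A product is differentiable at a zero of one factor even if the other factor is merely
  continuous. This is used for an inverse operator, whose differentiability is exactly what is being
  shown.\<close>

lemma has_derivative_scaleR_vanishing:
  fixes r :: "'a::real_normed_vector \<Rightarrow> real" and c :: "'a \<Rightarrow> 'b::real_normed_vector"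
  assumes r: "(r has_derivative r') (at x)" and "r x = 0" and c: "isCont c x"
  shows "((\<lambda>y. r y *\<^sub>R c y) has_derivative (\<lambda>h. r' h *\<^sub>R c x)) (at x)"
proof -
  interpret r': bounded_linear r'
    using r by (rule has_derivative_bounded_linear)
  obtain K where K: "K > 0" "\<And>h. norm (r' h) \<le> norm h * K"
    using r'.pos_bounded by blast
  have quot: "((\<lambda>h. \<bar>r (x + h) - r' h\<bar> / norm h) \<longlongrightarrow> 0) (at 0)"
    using r \<open>r x = 0\<close> by (simp add: has_derivative_at)
  have cont: "((\<lambda>h. c (x + h) - c x) \<longlongrightarrow> 0) (at 0)"
    using c by (simp add: LIM_zero isCont_iff)
  have lim: "((\<lambda>h. \<bar>r (x + h) - r' h\<bar> / norm h * norm (c (x + h)) + K * norm (c (x + h) - c x))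
      \<longlongrightarrow> 0 * norm (c x) + K * 0) (at 0)"
    by (intro tendsto_add tendsto_mult tendsto_norm_zero quot cont tendsto_const tendsto_norm)
      (use c in \<open>simp add: isCont_iff\<close>)
  show ?thesis
    unfolding has_derivative_at
  proof (intro conjI)
    show "bounded_linear (\<lambda>h. r' h *\<^sub>R c x)"
      by (rule bounded_linear_scaleR_const[OF r'.bounded_linear_axioms])
    show "(\<lambda>h. norm (r (x + h) *\<^sub>R c (x + h) - r x *\<^sub>R c x - r' h *\<^sub>R c x) / norm h) \<midarrow>0\<rightarrow> 0"
    proof (rule tendsto_sandwich[OF _ _ tendsto_const lim[simplified]])
      show "\<forall>\<^sub>F h in at 0. norm (r (x + h) *\<^sub>R c (x + h) - r x *\<^sub>R c x - r' h *\<^sub>R c x) / norm h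
        \<le> \<bar>r (x + h) - r' h\<bar> * norm (c (x + h)) / norm h + K * norm (c (x + h) - c x)"
        unfolding eventually_at_filter
      proof (intro always_eventually allI impI)
        fix h :: 'a assume "h \<noteq> 0"
        have "r (x + h) *\<^sub>R c (x + h) - r x *\<^sub>R c x - r' h *\<^sub>R c x
            = (r (x + h) - r' h) *\<^sub>R c (x + h) + r' h *\<^sub>R (c (x + h) - c x)"
          using \<open>r x = 0\<close> by (simp add: algebra_simps)
        also have "norm \<dots> \<le> \<bar>r (x + h) - r' h\<bar> * norm (c (x + h)) + \<bar>r' h\<bar> * norm (c (x + h) - c x)"
          using norm_triangle_ineq by (metis norm_scaleR)
        also have "\<dots> \<le> \<bar>r (x + h) - r' h\<bar> * norm (c (x + h)) + (norm h * K) * norm (c (x + h) - c x)"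
          using K(2)[of h] by (intro add_left_mono mult_right_mono) auto
        finally show "norm (r (x + h) *\<^sub>R c (x + h) - r x *\<^sub>R c x - r' h *\<^sub>R c x) / norm h
          \<le> \<bar>r (x + h) - r' h\<bar> * norm (c (x + h)) / norm h + K * norm (c (x + h) - c x)"
          using \<open>h \<noteq> 0\<close> by (simp add: field_simps)
      qed
    qed auto
  qed
qed

text \<open>\<open>A x0\<close> is bounded below, and \<open>N x\<close> controls how far
  \<open>A x\<close> is from it; so \<open>A x\<close> is bounded below uniformly near
  \<open>x0\<close>. The bound is applied to \<open>B x v - B x0 v\<close>, which \<open>A x\<close>
  maps to \<open>v - A x (B x0 v)\<close>.\<close>

lemma linear_inverse_continuous:
  fixes A B :: "'x::t2_space \<Rightarrow> 'a::euclidean_space \<Rightarrow> 'a"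
  assumes "open V" "x0 \<in> V"
    and lin: "\<And>x. x \<in> V \<Longrightarrow> linear (A x)" "\<And>x. x \<in> V \<Longrightarrow> linear (B x)"
    and inv: "\<And>x v. x \<in> V \<Longrightarrow> A x (B x v) = v" "\<And>x v. x \<in> V \<Longrightarrow> B x (A x v) = v"
    and cont: "\<And>v. isCont (\<lambda>x. A x v) x0"
  shows "isCont (\<lambda>x. B x v) x0"
proof -
  obtain K where K: "K > 0" "\<And>w. norm (B x0 w) \<le> K * norm w"
    using linear_bounded_pos[OF lin(2)[OF assms(2)]] by blast
  define N where "N = (\<lambda>x. \<Sum>b\<in>Basis. norm (A x b - A x0 b))"
  have AN: "norm (A x w - A x0 w) \<le> N x * norm w" if "x \<in> V" for x w
  proof -
    have "A x w - A x0 w = (\<Sum>b\<in>Basis. (w \<bullet> b) *\<^sub>R (A x b - A x0 b))"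
    proof -
      have "linear (\<lambda>w. A x w - A x0 w)"
        using lin(1) that assms(2) by (intro linear_compose_sub)
      then have "A x (\<Sum>b\<in>Basis. (w \<bullet> b) *\<^sub>R b) - A x0 (\<Sum>b\<in>Basis. (w \<bullet> b) *\<^sub>R b)
          = (\<Sum>b\<in>Basis. (w \<bullet> b) *\<^sub>R (A x b - A x0 b))"
        by (simp only: linear_sum[of "\<lambda>w. A x w - A x0 w"] linear_cmul[of "\<lambda>w. A x w - A x0 w"])
      then show ?thesis by (simp only: euclidean_representation)
    qed
    also have "norm \<dots> \<le> (\<Sum>b\<in>Basis. norm w * norm (A x b - A x0 b))"
      by (rule sum_norm_le) (auto intro!: mult_right_mono Basis_le_norm)
    finally show ?thesis by (simp add: N_def sum_distrib_left mult.commute[of _ "norm w"])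
  qed
  have "(N \<longlongrightarrow> 0) (at x0)"
    unfolding N_def
    by (rule tendsto_null_sum) (use cont in \<open>auto simp: isCont_def LIM_zero tendsto_norm_zero\<close>)
  \<comment> \<open>With the threshold \<open>1 / (2 * K)\<close> the perturbation is absorbed into
    the left-hand side below, at the price of a factor 2.\<close>
  then have "\<forall>\<^sub>F x in at x0. N x < 1 / (2 * K)"
    by (rule order_tendstoD) (use K in auto)
  moreover have "\<forall>\<^sub>F x in at x0. x \<in> V"
    using assms(1,2) eventually_at_topological by blast
  ultimately have "\<forall>\<^sub>F x in at x0. norm (B x v - B x0 v) \<le> 2 * K * norm (A x (B x0 v) - v)"
  proof eventually_elim
    case (elim x)
    define w where "w = B x v - B x0 v"
    have Aw: "A x w = v - A x (B x0 v)"
      using elim inv(1) lin(1) by (simp add: w_def linear_diff)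
    have "norm w = norm (B x0 (A x0 w))"
      using inv(2) assms(2) by simp
    also have "\<dots> \<le> K * norm (A x0 w)" by (rule K)
    also have "norm (A x0 w) \<le> norm (A x w) + norm (A x w - A x0 w)"
      by (metis norm_triangle_sub norm_minus_commute)
    also have "norm (A x w - A x0 w) \<le> N x * norm w"
      using AN elim by blast
    also have "N x * norm w \<le> 1 / (2 * K) * norm w"
      using elim by (intro mult_right_mono) auto
    finally have "norm w \<le> K * (norm (A x w) + 1 / (2 * K) * norm w)"
      using K(1) by simp
    then have "norm w \<le> 2 * K * norm (A x w)"
      using K(1) by (simp add: field_simps)
    then show ?case unfolding Aw by (simp add: w_def norm_minus_commute)
  qed
  moreover have "((\<lambda>x. 2 * K * norm (A x (B x0 v) - v)) \<longlongrightarrow> 2 * K * norm (A x0 (B x0 v) - v)) (at x0)"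
    using cont[of "B x0 v"] unfolding isCont_def by (intro tendsto_intros)
  then have "((\<lambda>x. 2 * K * norm (A x (B x0 v) - v)) \<longlongrightarrow> 0) (at x0)"
    using inv(1) assms(2) by simp
  ultimately have "((\<lambda>x. B x v - B x0 v) \<longlongrightarrow> 0) (at x0)"
    by (rule Lim_null_comparison)
  then show ?thesis
    by (simp add: isCont_def LIM_zero_iff)
qed

text \<open>From \<open>B y v - B x v = - B y ((A y - A x) (B x v))\<close>, where the middle factor
  vanishes at \<open>y = x\<close> and \<open>B\<close> is continuous, the derivative is
  \<open>- B A' B\<close>. This expression is of class C^k if \<open>A'\<close> and \<open>B\<close>
  are, so the class rises by one.\<close>

lemma Ck_on_linear_inverse:
  fixes A B :: "'x::real_normed_vector \<Rightarrow> 'a::euclidean_space \<Rightarrow> 'a"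
  assumes "open V"
    and lin: "\<And>x. x \<in> V \<Longrightarrow> linear (A x)" "\<And>x. x \<in> V \<Longrightarrow> linear (B x)"
    and inv: "\<And>x v. x \<in> V \<Longrightarrow> A x (B x v) = v" "\<And>x v. x \<in> V \<Longrightarrow> B x (A x v) = v"
    and "\<And>v. Ck_on k V (\<lambda>x. A x v)"
  shows "Ck_on k V (\<lambda>x. B x v)"
  using assms(6)
proof (induction k arbitrary: v)
  case 0
  then have "isCont (\<lambda>x. A x v) x" if "x \<in> V" for v x
    using that assms(1) by (simp add: continuous_on_eq_continuous_at)
  then show ?case
    using linear_inverse_continuous[OF assms(1) _ lin inv]
    by (auto intro!: continuous_at_imp_continuous_on)
next
  case (Suc k)
  have Ak: "Ck_on k V (\<lambda>x. A x v)" for v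
    using Ck_on_Suc_imp Suc.prems by blast
  have Acont: "isCont (\<lambda>x. A x v) x" if "x \<in> V" for v x
    using that assms(1) Ck_on_imp_continuous_on[OF Ak] by (simp add: continuous_on_eq_continuous_at)
  have Bcont: "isCont (\<lambda>x. B x v) x" if "x \<in> V" for v x
    by (rule linear_inverse_continuous[of V x A B, OF assms(1) that lin inv Acont[OF that]])
  define A' where "A' = (\<lambda>h x w. frechet_derivative (\<lambda>x. A x w) (at x) h)"
  have Bexp: "B x u = (\<Sum>b\<in>Basis. (u \<bullet> b) *\<^sub>R B x b)" if "x \<in> V" for x u
  proof -
    have "B x (\<Sum>b\<in>Basis. (u \<bullet> b) *\<^sub>R b) = (\<Sum>b\<in>Basis. (u \<bullet> b) *\<^sub>R B x b)"
      using lin(2)[OF that] by (simp only: linear_sum linear_cmul)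
    then show ?thesis by (simp only: euclidean_representation)
  qed
  have Aexp: "A x w = (\<Sum>c\<in>Basis. (w \<bullet> c) *\<^sub>R A x c)" if "x \<in> V" for x w
  proof -
    have "A x (\<Sum>b\<in>Basis. (w \<bullet> b) *\<^sub>R b) = (\<Sum>b\<in>Basis. (w \<bullet> b) *\<^sub>R A x b)"
      using lin(1)[OF that] by (simp only: linear_sum linear_cmul)
    then show ?thesis by (simp only: euclidean_representation)
  qed
  have Ad: "((\<lambda>x. A x w) has_derivative (\<lambda>h. \<Sum>c\<in>Basis. (w \<bullet> c) *\<^sub>R A' h x c)) (at x)" if "x \<in> V" for x w
  proof -
    have "((\<lambda>x. \<Sum>c\<in>Basis. (w \<bullet> c) *\<^sub>R A x c) has_derivative (\<lambda>h. \<Sum>c\<in>Basis. (w \<bullet> c) *\<^sub>R A' h x c)) (at x)"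
      unfolding A'_def
      by (intro has_derivative_sum has_derivative_scaleR_right Ck_on_Suc_has_derivative[OF Suc.prems that])
    then show ?thesis
      by (rule has_derivative_transform_within_open[OF _ assms(1) that]) (use Aexp in auto)
  qed
  define E where "E = (\<lambda>h x. \<Sum>b\<in>Basis. ((\<Sum>c\<in>Basis. (B x v \<bullet> c) *\<^sub>R A' h x c) \<bullet> b) *\<^sub>R B x b)"
  show ?case
  proof (rule Ck_on_SucI'[OF assms(1)])
    fix x assume x: "x \<in> V"
    have "((\<lambda>y. \<Sum>b\<in>Basis. ((A y (B x v) - A x (B x v)) \<bullet> b) *\<^sub>R B y b) has_derivative (\<lambda>h. E h x)) (at x)"
      unfolding E_def
      by (intro has_derivative_sum has_derivative_scaleR_vanishing has_derivative_inner_left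
          has_derivative_diff[OF Ad[OF x] has_derivative_const, simplified] Bcont x) simp
    then have "((\<lambda>y. B x v - (\<Sum>b\<in>Basis. ((A y (B x v) - A x (B x v)) \<bullet> b) *\<^sub>R B y b)) has_derivative (\<lambda>h. - E h x)) (at x)"
      using has_derivative_diff[OF has_derivative_const] by fastforce
    then show "((\<lambda>y. B y v) has_derivative (\<lambda>h. - E h x)) (at x)"
    proof (rule has_derivative_transform_within_open[OF _ assms(1) x])
      fix y assume y: "y \<in> V"
      have "(\<Sum>b\<in>Basis. ((A y (B x v) - A x (B x v)) \<bullet> b) *\<^sub>R B y b) = B y (A y (B x v) - A x (B x v))"
        using Bexp[OF y] by metis
      also have "\<dots> = B x v - B y v"
        using x y inv lin by (simp add: linear_diff)
      finally show "B x v - (\<Sum>b\<in>Basis. ((A y (B x v) - A x (B x v)) \<bullet> b) *\<^sub>R B y b) = B y v"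
        by simp
    qed
  next
    fix h
    have B: "Ck_on k V (\<lambda>x. B x b)" for b
      using Ak by (rule Suc.IH)
    have A': "Ck_on k V (\<lambda>x. A' h x c)" for c
      using Suc.prems by (auto simp: A'_def)
    show "Ck_on k V (\<lambda>x. - E h x)"
      unfolding E_def
      by (intro Ck_on_bounded_linear[OF bounded_linear_minus[OF bounded_linear_ident] assms(1)]
          Ck_on_sum Ck_on_bilinear[OF bounded_bilinear_scaleR] assms(1)
          Ck_on_bounded_linear[OF bounded_linear_inner_left assms(1)] B A')
  qed
qed

text \<open>The inverse function theorem gives the derivative of the inverse as the inverse operator
  of \<open>D (g y)\<close>. If \<open>g\<close> is of class C^k, so is that operator, and the class
  of \<open>g\<close> rises by one.\<close>

theorem smooth_local_inverse:
  fixes f :: "'a::euclidean_space \<Rightarrow> 'a"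
  assumes "open U" "smooth_on U f" "x0 \<in> U"
    and inj: "\<And>v. frechet_derivative f (at x0) v = 0 \<Longrightarrow> v = 0"
  obtains U' V g where "U' \<subseteq> U" "x0 \<in> U'" "diffeo_between U' V f g"
proof -
  define D where "D = (\<lambda>x. frechet_derivative f (at x))"
  have der: "(f has_derivative D x) (at x)" if "x \<in> U" for x
    unfolding D_def by (rule smooth_on_has_derivative[OF assms(2) that])
  have bl: "bounded_linear (D x)" if "x \<in> U" for x
    using der[OF that] by (rule has_derivative_bounded_linear)
  have bap: "blinfun_apply (Blinfun (D x)) = D x" if "x \<in> U" for x
    by (rule bounded_linear_Blinfun_apply[OF bl[OF that]])
  have Dsmooth: "smooth_on U (\<lambda>x. D x v)" for v
    unfolding D_def by (rule smooth_on_directional[OF assms(2)])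
  have cont: "continuous_on U (\<lambda>x. Blinfun (D x))"
  proof (rule continuous_on_blinfun_componentwise)
    fix i :: 'a
    have "continuous_on U (\<lambda>x. D x i)"
      by (rule smooth_on_imp_continuous_on[OF Dsmooth])
    then show "continuous_on U (\<lambda>x. blinfun_apply (Blinfun (D x)) i)"
      by (rule continuous_on_eq) (simp add: bap)
  qed
  have linD: "linear (D x0)"
    using bl[OF assms(3)] by (simp add: bounded_linear.linear)
  have "inj (D x0)"
    using linear_injective_0[OF linD] inj unfolding D_def by blast
  then obtain L where L: "linear L" "L \<circ> D x0 = id"
    using linear_injective_left_inverse[OF linD] by blast
  have "Blinfun L o\<^sub>L Blinfun (D x0) = id_blinfun"
    by (rule blinfun_eqI)
      (use L bap[OF assms(3)] in \<open>simp add: bounded_linear_Blinfun_apply linear_linear fun_eq_iff\<close>)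
  from inverse_function_theorem[OF assms(1) _ cont assms(3) this]
  obtain U' V g g' where *: "open U'" "U' \<subseteq> U" "x0 \<in> U'" "open V" "f x0 \<in> V"
    "homeomorphism U' V f g"
    and g: "\<And>y. y \<in> V \<Longrightarrow> (g has_derivative (g' y)) (at y)"
      "\<And>y. y \<in> V \<Longrightarrow> g' y = inv (blinfun_apply (Blinfun (D (g y))))"
      "\<And>y. y \<in> V \<Longrightarrow> bij (blinfun_apply (Blinfun (D (g y))))"
    using der bap by metis
  have gU: "g y \<in> U" "g y \<in> U'" if "y \<in> V" for y
    using *(2,6) that by (auto simp: homeomorphism_def)
  have g': "g' y = inv (D (g y))" and bij: "bij (D (g y))" if "y \<in> V" for y
    using g(2,3)[OF that] bap[OF gU(1)[OF that]] by auto
  have "Ck_on k V g" for k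
  proof (induction k)
    case 0
    then show ?case using *(6) by (simp add: homeomorphism_def)
  next
    case (Suc k)
    show ?case
    proof (rule Ck_on_SucI'[OF *(4) g(1)])
      fix v
      show "Ck_on k V (\<lambda>x. g' x v)"
      proof (rule Ck_on_linear_inverse[OF *(4), where A = "\<lambda>y. D (g y)"])
        fix x v assume x: "x \<in> V"
        show "linear (D (g x))"
          using bl[OF gU(1)[OF x]] by (simp add: bounded_linear.linear)
        show "linear (g' x)"
          using g(1)[OF x] has_derivative_linear by blast
        show "D (g x) (g' x v) = v" "g' x (D (g x) v) = v"
          using bij[OF x] by (simp_all add: g'[OF x] bij_is_surj surj_f_inv_f bij_is_inj)
      next
        fix v
        show "Ck_on k V (\<lambda>x. D (g x) v)"
          using Dsmooth[of v] unfolding smooth_on_def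
          by (intro Ck_on_compose[OF *(4) assms(1) gU(1) Suc]) auto
      qed
    qed auto
  qed
  then have "diffeo_between U' V f g"
    using * smooth_on_subset[OF assms(2) *(2)]
    unfolding diffeo_between_def smooth_on_def[of V] homeomorphism_def by auto
  with *(2,3) show thesis by (rule that)
qed

lemma smooth_implicit_function:
  fixes \<rho> :: "'x::euclidean_space \<times> 'e::euclidean_space \<Rightarrow> 'e"
  assumes "open U" "smooth_on U \<rho>" "(x0, e0) \<in> U" "\<rho> (x0, e0) = 0"
    and inj: "\<And>v. frechet_derivative \<rho> (at (x0, e0)) (0, v) = 0 \<Longrightarrow> v = 0"
  obtains N \<eta> where "open N" "x0 \<in> N" "smooth_on N \<eta>" "\<eta> x0 = e0"
    "\<And>x. x \<in> N \<Longrightarrow> (x, \<eta> x) \<in> U \<and> \<rho> (x, \<eta> x) = 0"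
proof -
  define f where "f = (\<lambda>z. (fst z, \<rho> z))"
  have smf: "smooth_on U f"
    unfolding f_def by (intro smooth_intros assms)
  have df: "(f has_derivative (\<lambda>h. (fst h, frechet_derivative \<rho> (at (x0, e0)) h))) (at (x0, e0))"
    unfolding f_def by (intro has_derivative_Pair has_derivative_fst has_derivative_ident
        smooth_on_has_derivative[OF assms(2,3)])
  have "v = 0" if "frechet_derivative f (at (x0, e0)) v = 0" for v
  proof -
    obtain v1 v2 where "v = (v1, v2)" by force
    with that inj show ?thesis
      unfolding frechet_derivative_unique[OF df] by (auto simp: zero_prod_def)
  qed
  from smooth_local_inverse[OF assms(1) smf assms(3) this]
  obtain U' V g where *: "U' \<subseteq> U" "(x0, e0) \<in> U'" "diffeo_between U' V f g" .
  define N where "N = (\<lambda>x. (x, 0)) -` V"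
  define \<eta> where "\<eta> = (\<lambda>x. snd (g (x, 0)))"
  have "open N"
    unfolding N_def by (rule continuous_open_vimage)
      (use *(3) in \<open>auto simp: diffeo_between_def intro!: continuous_intros\<close>)
  have fx0: "f (x0, e0) = (x0, 0)"
    using assms(4) by (simp add: f_def)
  have inv: "f (g y) = y" "g y \<in> U'" if "y \<in> V" for y
    using *(3) that by (auto simp: diffeo_between_def)
  show thesis
  proof
    show "open N" by fact
    show "x0 \<in> N"
      using *(2,3) fx0 by (auto simp: N_def diffeo_between_def)
    show "\<eta> x0 = e0"
      using *(2,3) fx0 by (auto simp: \<eta>_def diffeo_between_def)
    have "smooth_on V g" "open V"
      using *(3) by (auto simp: diffeo_between_def)
    then show "smooth_on N \<eta>"
      unfolding \<eta>_def
      by (intro smooth_on_snd[OF \<open>open N\<close>] smooth_on_compose[of V g N "\<lambda>x. (x, 0)"]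
          smooth_on_Pair smooth_on_id smooth_on_const \<open>open N\<close>) (auto simp: N_def)
  next
    fix x assume "x \<in> N"
    then have "(x, 0) \<in> V" by (simp add: N_def)
    from inv[OF this] have "fst (g (x, 0)) = x" "\<rho> (g (x, 0)) = 0" "g (x, 0) \<in> U"
      using *(1) by (auto simp: f_def)
    then show "(x, \<eta> x) \<in> U \<and> \<rho> (x, \<eta> x) = 0"
      unfolding \<eta>_def by (metis prod.collapse)
  qed
qed

section \<open>Families of polynomial growth\<close>

text \<open>A family indexed by the frequency \<open>j\<close> all of whose derivatives grow at most polynomially
  in \<open>j\<close> can be summed termwise against rapidly decreasing (Fourier) coefficients.\<close>

definition poly_bounded :: "'a set \<Rightarrow> (nat \<Rightarrow> 'a \<Rightarrow> 'b::real_normed_vector) \<Rightarrow> bool" where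
  "poly_bounded S f \<longleftrightarrow> (\<exists>A B. \<forall>j. \<forall>x\<in>S. norm (f j x) \<le> A * (1 + real j) ^ B)"

primrec tempered ::
  "nat \<Rightarrow> 'a::real_normed_vector set \<Rightarrow> (nat \<Rightarrow> 'a \<Rightarrow> 'b::real_normed_vector) \<Rightarrow> bool" where
  "tempered 0 S f \<longleftrightarrow> poly_bounded S f \<and> (\<forall>j. continuous_on S (f j))"
| "tempered (Suc k) S f \<longleftrightarrow> poly_bounded S f \<and> (\<forall>j. \<forall>x\<in>S. f j differentiable (at x)) \<and>
     (\<forall>v. tempered k S (\<lambda>j x. frechet_derivative (f j) (at x) v))"

lemma poly_boundedE:
  assumes "poly_bounded S f"
  obtains A B where "A > 0" "\<And>j x. x \<in> S \<Longrightarrow> norm (f j x) \<le> A * (1 + real j) ^ B"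
proof -
  obtain A B where *: "\<And>j x. x \<in> S \<Longrightarrow> norm (f j x) \<le> A * (1 + real j) ^ B"
    using assms unfolding poly_bounded_def by blast
  show thesis
  proof
    show "\<bar>A\<bar> + 1 > 0" by simp
    show "norm (f j x) \<le> (\<bar>A\<bar> + 1) * (1 + real j) ^ B" if "x \<in> S" for j x
      by (rule order_trans[OF *[OF that]]) (intro mult_right_mono, auto)
  qed
qed

lemma poly_boundedI:
  "(\<And>j x. x \<in> S \<Longrightarrow> norm (f j x) \<le> A * (1 + real j) ^ B) \<Longrightarrow> poly_bounded S f"
  unfolding poly_bounded_def by blast

lemma poly_bounded_add:
  assumes "poly_bounded S f" "poly_bounded S g"
  shows "poly_bounded S (\<lambda>j x. f j x + g j x)"
proof -
  obtain A B where f: "A > 0" "\<And>j x. x \<in> S \<Longrightarrow> norm (f j x) \<le> A * (1 + real j) ^ B"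
    using poly_boundedE[OF assms(1)] by metis
  obtain C D where g: "C > 0" "\<And>j x. x \<in> S \<Longrightarrow> norm (g j x) \<le> C * (1 + real j) ^ D"
    using poly_boundedE[OF assms(2)] by metis
  show ?thesis
  proof (rule poly_boundedI)
    fix j x assume x: "x \<in> S"
    have "norm (f j x + g j x) \<le> A * (1 + real j) ^ B + C * (1 + real j) ^ D"
      using norm_triangle_mono[OF f(2)[OF x] g(2)[OF x]] .
    also have "\<dots> \<le> A * (1 + real j) ^ (B + D) + C * (1 + real j) ^ (B + D)"
      using f(1) g(1) by (intro add_mono mult_left_mono power_increasing) auto
    finally show "norm (f j x + g j x) \<le> (A + C) * (1 + real j) ^ (B + D)"
      by (simp add: algebra_simps)
  qed
qed

lemma poly_bounded_bilinear:
  assumes "bounded_bilinear P" "poly_bounded S f" "poly_bounded S g"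
  shows "poly_bounded S (\<lambda>j x. P (f j x) (g j x))"
proof -
  obtain A B where f: "A > 0" "\<And>j x. x \<in> S \<Longrightarrow> norm (f j x) \<le> A * (1 + real j) ^ B"
    using poly_boundedE[OF assms(2)] by metis
  obtain C D where g: "C > 0" "\<And>j x. x \<in> S \<Longrightarrow> norm (g j x) \<le> C * (1 + real j) ^ D"
    using poly_boundedE[OF assms(3)] by metis
  obtain K where K: "K > 0" "\<And>a b. norm (P a b) \<le> norm a * norm b * K"
    using bounded_bilinear.pos_bounded[OF assms(1)] by blast
  show ?thesis
  proof (rule poly_boundedI)
    fix j x assume x: "x \<in> S"
    have "norm (P (f j x) (g j x)) \<le> norm (f j x) * norm (g j x) * K" by (rule K)
    also have "\<dots> \<le> (A * (1 + real j) ^ B) * (C * (1 + real j) ^ D) * K"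
      using f(1) g(1) K(1) by (intro mult_right_mono mult_mono f(2)[OF x] g(2)[OF x]) auto
    finally show "norm (P (f j x) (g j x)) \<le> (A * C * K) * (1 + real j) ^ (B + D)"
      by (simp add: power_add algebra_simps)
  qed
qed

lemma poly_bounded_linear:
  assumes "bounded_linear L" "poly_bounded S f"
  shows "poly_bounded S (\<lambda>j x. L (f j x))"
proof -
  obtain A B where f: "A > 0" "\<And>j x. x \<in> S \<Longrightarrow> norm (f j x) \<le> A * (1 + real j) ^ B"
    using poly_boundedE[OF assms(2)] by metis
  obtain K where K: "K > 0" "\<And>a. norm (L a) \<le> norm a * K"
    using bounded_linear.pos_bounded[OF assms(1)] by blast
  show ?thesis
  proof (rule poly_boundedI)
    fix j x assume x: "x \<in> S"
    have "norm (L (f j x)) \<le> norm (f j x) * K" by (rule K)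
    also have "\<dots> \<le> (A * (1 + real j) ^ B) * K"
      using K(1) by (intro mult_right_mono f(2)[OF x]) auto
    finally show "norm (L (f j x)) \<le> (A * K) * (1 + real j) ^ B"
      by (simp add: algebra_simps)
  qed
qed

lemma poly_bounded_const: "norm c \<le> C \<Longrightarrow> poly_bounded S (\<lambda>j x. c)"
  by (rule poly_boundedI[where A = C and B = 0]) simp

lemma poly_bounded_cong:
  "poly_bounded S f \<Longrightarrow> (\<And>j x. x \<in> S \<Longrightarrow> f j x = g j x) \<Longrightarrow> poly_bounded S g"
  unfolding poly_bounded_def by force

lemma tempered_imp_poly_bounded: "tempered k S f \<Longrightarrow> poly_bounded S f"
  by (cases k) auto

lemma tempered_Suc_has_derivative:
  "tempered (Suc k) S f \<Longrightarrow> x \<in> S \<Longrightarrow> (f j has_derivative frechet_derivative (f j) (at x)) (at x)"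
  by (auto simp: frechet_derivative_works)

lemma tempered_Suc_directional:
  "tempered (Suc k) S f \<Longrightarrow> tempered k S (\<lambda>j x. frechet_derivative (f j) (at x) v)"
  by simp

lemma tempered_cong:
  assumes "open S" "\<And>j x. x \<in> S \<Longrightarrow> f j x = g j x" "tempered k S f"
  shows "tempered k S g"
  using assms
proof (induction k arbitrary: f g)
  case 0
  then have "poly_bounded S g"
    by (auto intro: poly_bounded_cong)
  with 0 show ?case
    by (simp cong: continuous_on_cong)
next
  case (Suc k)
  have d: "(g j has_derivative frechet_derivative (f j) (at x)) (at x)" if "x \<in> S" for j x
    by (rule has_derivative_transform_within_open[OF tempered_Suc_has_derivative[OF Suc.prems(3) that]
          Suc.prems(1) that Suc.prems(2)])
  have "tempered k S (\<lambda>j x. frechet_derivative (g j) (at x) v)" for v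
    by (rule Suc.IH[OF Suc.prems(1) _ tempered_Suc_directional[OF Suc.prems(3)]])
      (simp add: frechet_derivative_unique[OF d])
  moreover have "poly_bounded S g"
    by (rule poly_bounded_cong[OF tempered_imp_poly_bounded[OF Suc.prems(3)] Suc.prems(2)])
  moreover have "\<forall>j. \<forall>x\<in>S. g j differentiable at x"
    using d unfolding differentiable_def by blast
  ultimately show ?case by simp
qed

lemma tempered_SucI:
  assumes "open S" "poly_bounded S f" "\<And>j x. x \<in> S \<Longrightarrow> (f j has_derivative f' j x) (at x)"
    and "\<And>v. tempered k S (\<lambda>j x. f' j x v)"
  shows "tempered (Suc k) S f"
proof -
  have "tempered k S (\<lambda>j x. frechet_derivative (f j) (at x) v)" for v
    by (rule tempered_cong[OF assms(1) _ assms(4)[of v]])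
      (simp add: frechet_derivative_unique[OF assms(3)])
  moreover have "\<forall>j. \<forall>x\<in>S. f j differentiable at x"
    using assms(3) unfolding differentiable_def by blast
  ultimately show ?thesis
    using assms(2) by simp
qed

lemma tempered_Suc_imp: "tempered (Suc k) S f \<Longrightarrow> tempered k S f"
proof (induction k arbitrary: f)
  case 0
  then show ?case
    by (auto intro!: differentiable_imp_continuous_on
        simp: differentiable_on_def differentiable_at_withinI)
next
  case (Suc k)
  from Suc.prems have a: "poly_bounded S f" "\<forall>j. \<forall>x\<in>S. f j differentiable at x"
    and b: "\<forall>v. tempered (Suc k) S (\<lambda>j x. frechet_derivative (f j) (at x) v)"
    unfolding tempered.simps(2)[of "Suc k"] by blast+
  from b Suc.IH have "\<forall>v. tempered k S (\<lambda>j x. frechet_derivative (f j) (at x) v)"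
    by blast
  with a show ?case
    unfolding tempered.simps(2) by blast
qed

lemma tempered_imp_continuous_on: "tempered k S f \<Longrightarrow> continuous_on S (f j)"
  by (induction k arbitrary: f) (simp, metis tempered_Suc_imp)

lemma tempered_add:
  assumes "open S" "tempered k S f" "tempered k S g"
  shows "tempered k S (\<lambda>j x. f j x + g j x)"
  using assms(2,3)
proof (induction k arbitrary: f g)
  case 0
  then show ?case by (auto intro!: continuous_intros poly_bounded_add)
next
  case (Suc k)
  show ?case
    by (rule tempered_SucI[OF assms(1) poly_bounded_add[OF Suc.prems[THEN tempered_imp_poly_bounded]]
          has_derivative_add[OF Suc.prems[THEN tempered_Suc_has_derivative]]])
      (use Suc in auto)
qed

lemma tempered_linear:
  assumes "bounded_linear L" "open S" "tempered k S f"
  shows "tempered k S (\<lambda>j x. L (f j x))"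
  using assms(3)
proof (induction k arbitrary: f)
  case 0
  then show ?case
    using assms(1) by (simp add: bounded_linear.continuous_on poly_bounded_linear)
next
  case (Suc k)
  show ?case
    by (rule tempered_SucI[OF assms(2) poly_bounded_linear[OF assms(1) Suc.prems[THEN tempered_imp_poly_bounded]]
          bounded_linear.has_derivative[OF assms(1) Suc.prems[THEN tempered_Suc_has_derivative]]])
      (use Suc in auto)
qed

lemma tempered_bilinear:
  assumes P: "bounded_bilinear P" and "open S" "tempered k S f" "tempered k S g"
  shows "tempered k S (\<lambda>j x. P (f j x) (g j x))"
  using assms(3,4)
proof (induction k arbitrary: f g)
  case 0
  then show ?case
    using P by (simp add: bounded_bilinear.continuous_on poly_bounded_bilinear)
next
  case (Suc k)
  show ?case
  proof (rule tempered_SucI[OF assms(2) poly_bounded_bilinear[OF P Suc.prems[THEN tempered_imp_poly_bounded]]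
          bounded_bilinear.FDERIV[OF P Suc.prems[THEN tempered_Suc_has_derivative]]])
    fix v
    show "tempered k S (\<lambda>j x. P (f j x) (frechet_derivative (g j) (at x) v) + P (frechet_derivative (f j) (at x) v) (g j x))"
      using Suc.prems by (intro tempered_add assms(2) Suc.IH) (auto simp: tempered_Suc_imp)
  qed
qed

lemma tempered_mult:
  fixes f g :: "nat \<Rightarrow> 'a::real_normed_vector \<Rightarrow> 'b::real_normed_algebra"
  shows "open S \<Longrightarrow> tempered k S f \<Longrightarrow> tempered k S g \<Longrightarrow> tempered k S (\<lambda>j x. f j x * g j x)"
  by (rule tempered_bilinear[OF bounded_bilinear_mult])

lemma tempered_minus: "open S \<Longrightarrow> tempered k S f \<Longrightarrow> tempered k S (\<lambda>j x. - f j x)"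
  by (rule tempered_linear[OF bounded_linear_minus[OF bounded_linear_ident]])

lemma tempered_diff:
  "open S \<Longrightarrow> tempered k S f \<Longrightarrow> tempered k S g \<Longrightarrow> tempered k S (\<lambda>j x. f j x - g j x)"
  using tempered_add[OF _ _ tempered_minus, of S k f g] by simp

lemma tempered_const_family:
  assumes "open S" "\<And>j. norm (c j) \<le> A * (1 + real j) ^ B"
  shows "tempered k S (\<lambda>j x. c j)"
proof -
  have z: "tempered k S (\<lambda>j x. 0::'c::real_normed_vector)" for k
  proof (induction k)
    case (Suc k)
    show ?case
      by (rule tempered_SucI[OF assms(1), where f' = "\<lambda>_ _ _. 0"])
        (use Suc in \<open>auto intro: poly_bounded_const\<close>)
  qed (auto intro: poly_bounded_const)
  have b: "poly_bounded S (\<lambda>j x. c j)"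
    by (rule poly_boundedI) (rule assms(2))
  show ?thesis
  proof (cases k)
    case (Suc m)
    show ?thesis
      unfolding Suc by (rule tempered_SucI[OF assms(1) b has_derivative_const z])
  qed (use b in auto)
qed

lemma tempered_const: "open S \<Longrightarrow> tempered k S (\<lambda>j x. c)"
  by (rule tempered_const_family[where A = "norm c" and B = 0]) auto

lemma tempered_bounded_id:
  assumes "open S" "bounded S"
  shows "tempered k S (\<lambda>j x. x)"
proof -
  obtain K where "\<And>x. x \<in> S \<Longrightarrow> norm x \<le> K"
    using assms(2) by (auto simp: bounded_iff)
  then have b: "poly_bounded S (\<lambda>j x. x)"
    by (intro poly_boundedI[where A = K and B = 0]) auto
  show ?thesis
  proof (cases k)
    case (Suc m)
    show ?thesis
      unfolding Suc by (rule tempered_SucI[OF assms(1) b has_derivative_ident tempered_const[OF assms(1)]])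
  qed (use b in \<open>auto intro: continuous_intros\<close>)
qed

lemma tempered_sum:
  assumes "open S" "\<And>i. i \<in> I \<Longrightarrow> tempered k S (f i)"
  shows "tempered k S (\<lambda>j x. \<Sum>i\<in>I. f i j x)"
  using assms(2)
  by (induction I rule: infinite_finite_induct) (auto intro: tempered_const tempered_add assms(1))

lemma tempered_power:
  fixes f :: "nat \<Rightarrow> 'a::real_normed_vector \<Rightarrow> 'b::real_normed_field"
  shows "open S \<Longrightarrow> tempered k S f \<Longrightarrow> tempered k S (\<lambda>j x. f j x ^ n)"
  by (induction n) (auto intro: tempered_const tempered_mult)

lemma tempered_pullback:
  assumes L: "bounded_linear L" and "open S" "open T" "\<And>x. x \<in> T \<Longrightarrow> L x \<in> S" "tempered k S f"
  shows "tempered k T (\<lambda>j x. f j (L x))"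
  using assms(5)
proof (induction k arbitrary: f)
  case 0
  then have "poly_bounded T (\<lambda>j x. f j (L x))"
    using assms(4) unfolding poly_bounded_def tempered.simps(1) by meson
  moreover have "continuous_on T (\<lambda>x. f j (L x))" for j
    using 0 assms(4) bounded_linear.continuous_on[OF L continuous_on_id]
    by (intro continuous_on_compose2[of S "f j" T L]) auto
  ultimately show ?case by simp
next
  case (Suc k)
  have b: "poly_bounded T (\<lambda>j x. f j (L x))"
    using tempered_imp_poly_bounded[OF Suc.prems] assms(4) unfolding poly_bounded_def by blast
  show ?case
  proof (rule tempered_SucI[OF assms(3) b])
    show "((\<lambda>x. f j (L x)) has_derivative (\<lambda>v. frechet_derivative (f j) (at (L x)) (L v))) (at x)"
      if "x \<in> T" for j x
      by (rule has_derivative_compose[OF bounded_linear_imp_has_derivative[OF L]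
            tempered_Suc_has_derivative[OF Suc.prems assms(4)[OF that]]])
    show "tempered k T (\<lambda>j x. frechet_derivative (f j) (at (L x)) (L v))" for v
      by (rule Suc.IH) (use Suc.prems in auto)
  qed
qed

text \<open>The inner family may grow with \<open>j\<close>, so bounds on the outer function over
  compact sets would not help: all its derivatives have to be bounded globally, as those of the
  cutoff are.\<close>

lemma tempered_compose_real:
  fixes d :: "nat \<Rightarrow> real \<Rightarrow> real"
  assumes "open S" "tempered k S f"
    and d: "\<And>n x. (d n has_real_derivative d (Suc n) x) (at x)" "\<And>n. \<exists>M. \<forall>x. \<bar>d n x\<bar> \<le> M"
  shows "tempered k S (\<lambda>j x. d n (f j x))"
  using assms(2)
proof (induction k arbitrary: n)
  have b: "poly_bounded S (\<lambda>j x. d n (f j x))" for n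
  proof -
    obtain M where "\<And>x. \<bar>d n x\<bar> \<le> M" using d(2) by blast
    then show ?thesis by (intro poly_boundedI[where A = M and B = 0]) auto
  qed
  {
    case 0
    have "continuous_on UNIV (d n)"
      using d(1) DERIV_continuous_on by blast
    with 0 b show ?case
      by (auto intro: continuous_on_compose2)
  next
    case (Suc k)
    show ?case
    proof (rule tempered_SucI[OF assms(1) b])
      show "((\<lambda>x. d n (f j x)) has_derivative (\<lambda>v. frechet_derivative (f j) (at x) v * d (Suc n) (f j x))) (at x)"
        if "x \<in> S" for j x
        by (rule DERIV_compose_FDERIV[OF d(1) tempered_Suc_has_derivative[OF Suc.prems that]])
      show "tempered k S (\<lambda>j x. frechet_derivative (f j) (at x) v * d (Suc n) (f j x))" for v
        by (rule tempered_mult[OF assms(1) tempered_Suc_directional[OF Suc.prems]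
              Suc.IH[OF tempered_Suc_imp[OF Suc.prems]]])
    qed
  }
qed

text \<open>Where the numerator vanishes nothing is required of the denominator; the junk value
  \<open>a / 0 = 0\<close> is then the right one.\<close>

lemma tempered_divide:
  fixes a f :: "nat \<Rightarrow> 'a::real_normed_vector \<Rightarrow> 'b::real_normed_field"
  assumes "open S" "A > 0"
    and "tempered k S a" and "tempered k S f"
    and "\<And>j x. x \<in> S \<Longrightarrow> a j x \<noteq> 0 \<Longrightarrow> 1 \<le> A * (1 + real j) ^ B * norm (f j x)"
  shows "tempered k S (\<lambda>j x. a j x / f j x)"
  using assms(3-5)
proof (induction k arbitrary: a)
  have bound: "poly_bounded S (\<lambda>j x. a j x / f j x)"
    if pb: "poly_bounded S a" and "\<And>j x. x \<in> S \<Longrightarrow> a j x \<noteq> 0 \<Longrightarrow> 1 \<le> A * (1 + real j) ^ B * norm (f j x)"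
    for a :: "nat \<Rightarrow> 'a \<Rightarrow> 'b"
  proof -
    obtain C D where C: "C > 0" "\<And>j x. x \<in> S \<Longrightarrow> norm (a j x) \<le> C * (1 + real j) ^ D"
      using poly_boundedE[OF pb] by metis
    show ?thesis
    proof (rule poly_boundedI)
      fix j x assume x: "x \<in> S"
      show "norm (a j x / f j x) \<le> (C * A) * (1 + real j) ^ (D + B)"
      proof (cases "a j x = 0")
        case True
        then show ?thesis using C(1) assms(2) by simp
      next
        case False
        from that(2)[OF x this] have le: "1 \<le> A * (1 + real j) ^ B * norm (f j x)" .
        then have "f j x \<noteq> 0" by auto
        then have "inverse (norm (f j x)) \<le> A * (1 + real j) ^ B"
          using le by (simp add: field_simps)
        then have "norm (a j x) * inverse (norm (f j x)) \<le> (C * (1 + real j) ^ D) * (A * (1 + real j) ^ B)"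
          using C x by (intro mult_mono) auto
        then show ?thesis
          by (simp add: norm_divide norm_inverse norm_mult divide_inverse power_add algebra_simps)
      qed
    qed
  qed
  \<comment> \<open>Failure of the lower bound is an open condition, so the numerator vanishes on a
    whole neighbourhood and its derivatives vanish with it.\<close>
  have near: "\<exists>T. open T \<and> x \<in> T \<and> T \<subseteq> S \<and> (\<forall>y\<in>T. a j y = 0)"
    if "x \<in> S" "A * (1 + real j) ^ B * norm (f j x) < 1" "continuous_on S (f j)"
      "\<And>j x. x \<in> S \<Longrightarrow> a j x \<noteq> 0 \<Longrightarrow> 1 \<le> A * (1 + real j) ^ B * norm (f j x)"
    for a :: "nat \<Rightarrow> 'a \<Rightarrow> 'b" and j x
  proof -
    have "continuous_on S (\<lambda>y. A * (1 + real j) ^ B * norm (f j y))"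
      using that(3) by (intro continuous_intros)
    then have "open (S \<inter> (\<lambda>y. A * (1 + real j) ^ B * norm (f j y)) -` {..<1})"
      using assms(1) by (simp add: continuous_on_open_vimage Int_commute)
    then show ?thesis
      using that by (intro exI[of _ "S \<inter> (\<lambda>y. A * (1 + real j) ^ B * norm (f j y)) -` {..<1}"]) force
  qed
  {
    case 0
    have "continuous_on S (\<lambda>x. a j x / f j x)" for j
    proof (rule continuous_at_imp_continuous_on, rule ballI)
      fix x assume x: "x \<in> S"
      have c: "isCont (a j) x" "isCont (f j) x"
        using 0 x assms(1) by (simp_all add: continuous_on_eq_continuous_at)
      show "isCont (\<lambda>x. a j x / f j x) x"
      proof (cases "f j x = 0")
        case False
        then show ?thesis using c by (intro isCont_divide)
      next
        case True
        have "\<exists>T. open T \<and> x \<in> T \<and> T \<subseteq> S \<and> (\<forall>y\<in>T. a j y = 0)"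
          by (rule near[OF x _ _ 0(3)]) (use True 0(2) in simp_all)
        then obtain T where T: "open T" "x \<in> T" "\<forall>y\<in>T. a j y = 0"
          by blast
        have "\<forall>\<^sub>F y in nhds x. a j y / f j y = 0"
          unfolding eventually_nhds using T by (intro exI[of _ T]) auto
        then show ?thesis
          by (subst isCont_cong[where g = "\<lambda>_. 0"]) auto
      qed
    qed
    with bound[OF _ 0(3)] 0 show ?case by simp
  next
    case (Suc k)
    define a' where "a' = (\<lambda>v j x. frechet_derivative (a j) (at x) v)"
    define f' where "f' = (\<lambda>v j x. frechet_derivative (f j) (at x) v)"
    have cf: "continuous_on S (f j)" for j
      using tempered_imp_continuous_on[OF Suc.prems(2)] .
    have low': "1 \<le> A * (1 + real j) ^ B * norm (f j x)" if "x \<in> S" "a' v j x \<noteq> 0" for v j x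
    proof (rule ccontr)
      assume "\<not> ?thesis"
      then have "A * (1 + real j) ^ B * norm (f j x) < 1" by simp
      from near[OF that(1) this cf Suc.prems(3)]
      obtain T where T: "open T" "x \<in> T" "\<forall>y\<in>T. a j y = 0" by blast
      have "(a j has_derivative (\<lambda>_. 0)) (at x)"
        by (rule has_derivative_transform_within_open[OF has_derivative_const T(1,2)]) (use T in auto)
      with that(2) show False
        by (simp add: a'_def frechet_derivative_unique)
    qed
    have ta: "tempered k S a" "tempered k S f" "tempered k S (a' v)" "tempered k S (f' v)" for v
      using Suc.prems by (auto simp: a'_def f'_def tempered_Suc_imp simp del: tempered.simps(2)
          intro: tempered_Suc_directional)
    show ?case
    proof (rule tempered_SucI[OF assms(1) bound[OF tempered_imp_poly_bounded[OF Suc.prems(1)] Suc.prems(3)]])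
      fix j x assume x: "x \<in> S"
      show "((\<lambda>x. a j x / f j x) has_derivative (\<lambda>v. a' v j x / f j x - a j x * f' v j x / f j x / f j x)) (at x)"
      proof (cases "f j x = 0")
        case False
        have "((\<lambda>x. a j x / f j x) has_derivative (\<lambda>v. - a j x * (inverse (f j x) * f' v j x * inverse (f j x)) + a' v j x / f j x)) (at x)"
          unfolding a'_def f'_def
          by (intro has_derivative_divide False tempered_Suc_has_derivative[OF Suc.prems(1) x]
              tempered_Suc_has_derivative[OF Suc.prems(2) x])
        moreover have "(\<lambda>v. - a j x * (inverse (f j x) * f' v j x * inverse (f j x)) + a' v j x / f j x)
            = (\<lambda>v. a' v j x / f j x - a j x * f' v j x / f j x / f j x)"
          using False by (simp add: fun_eq_iff field_simps)
        ultimately show ?thesis by simp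
      next
        case True
        have "\<exists>T. open T \<and> x \<in> T \<and> T \<subseteq> S \<and> (\<forall>y\<in>T. a j y = 0)"
          by (rule near[OF x _ cf Suc.prems(3)]) (use True in simp_all)
        then obtain T where T: "open T" "x \<in> T" "\<forall>y\<in>T. a j y = 0"
          by blast
        have "((\<lambda>x. a j x / f j x) has_derivative (\<lambda>_. 0)) (at x)"
          by (rule has_derivative_transform_within_open[OF has_derivative_const T(1,2)]) (use T in auto)
        with True show ?thesis by simp
      qed
    next
      fix v
      \<comment> \<open>The derivative is kept as iterated quotients by the one denominator
        \<open>f\<close>, and every numerator inherits the support condition. Hence the induction
        hypothesis applies three times.\<close>
      have "tempered k S (\<lambda>j x. a' v j x / f j x)"
        by (rule Suc.IH) (use ta low' in auto)
      moreover have "tempered k S (\<lambda>j x. a j x * f' v j x / f j x)"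
        by (rule Suc.IH) (use ta Suc.prems(3) in \<open>auto intro: tempered_mult assms(1)\<close>)
      then have "tempered k S (\<lambda>j x. a j x * f' v j x / f j x / f j x)"
        by (rule Suc.IH) (use ta Suc.prems(3) in auto)
      ultimately show "tempered k S (\<lambda>j x. a' v j x / f j x - a j x * f' v j x / f j x / f j x)"
        by (intro tempered_diff assms(1))
    qed
  }
qed

lemma poly_bounded_integral:
  fixes F :: "nat \<Rightarrow> real \<times> 'x::euclidean_space \<Rightarrow> 'b::euclidean_space"
  assumes "{0..1} \<subseteq> U" "poly_bounded (U \<times> S) F" "\<And>j. continuous_on (U \<times> S) (F j)"
  shows "poly_bounded S (\<lambda>j x. integral {0..1} (\<lambda>u. F j (u, x)))"
proof -
  obtain A B where A: "A > 0" "\<And>j y. y \<in> U \<times> S \<Longrightarrow> norm (F j y) \<le> A * (1 + real j) ^ B"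
    using poly_boundedE[OF assms(2)] by metis
  show ?thesis
  proof (rule poly_boundedI)
    fix j x assume x: "x \<in> S"
    have "continuous_on {0..1} (\<lambda>u. F j (u, x))"
      using x assms(1) by (intro continuous_on_compose2[OF assms(3)[of j]] continuous_intros) auto
    then have "norm (integral {0..1} (\<lambda>u. F j (u, x))) \<le> (A * (1 + real j) ^ B) * (1 - 0)"
      by (intro integral_bound) (use x A(2) assms(1) in auto)
    then show "norm (integral {0..1} (\<lambda>u. F j (u, x))) \<le> A * (1 + real j) ^ B" by simp
  qed
qed

text \<open>Differentiation under the integral sign. The neighbourhood \<open>U\<close> of the
  interval is there because the derivatives of \<open>F\<close> are full derivatives, also at the
  end points.\<close>

lemma tempered_integral:
  fixes F :: "nat \<Rightarrow> real \<times> 'x::euclidean_space \<Rightarrow> 'b::euclidean_space"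
  assumes "open U" "{0..1} \<subseteq> U" "open S" "tempered k (U \<times> S) F"
  shows "tempered k S (\<lambda>j x. integral {0..1} (\<lambda>u. F j (u, x)))"
  using assms(4)
proof (induction k arbitrary: F)
  case 0
    have "continuous_on S (\<lambda>x. integral (cbox 0 1) (\<lambda>u. F j (u, x)))" for j
    proof (rule integral_continuous_on_param)
      have "continuous_on (U \<times> S) (F j)" using 0 by simp
      moreover have "continuous_on (S \<times> cbox 0 1) (\<lambda>z :: 'x \<times> real. (snd z, fst z))"
        by (intro continuous_intros)
      ultimately have "continuous_on (S \<times> cbox 0 1) (\<lambda>z. F j (snd z, fst z))"
        by (rule continuous_on_compose2) (use assms(2) in auto)
      then show "continuous_on (S \<times> cbox 0 1) (\<lambda>(x, u). F j (u, x))"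
        by (simp add: split_beta)
    qed
    with poly_bounded_integral[OF assms(2), of S F] 0 show ?case by simp
  next
    case (Suc k)
    define D where "D = (\<lambda>j y. frechet_derivative (F j) (at y))"
    have cF: "continuous_on (U \<times> S) (F j)" for j
      by (rule tempered_imp_continuous_on[OF Suc.prems])
    have der: "(F j has_derivative D j y) (at y)" if "y \<in> U \<times> S" for j y
      unfolding D_def by (rule tempered_Suc_has_derivative[OF Suc.prems that])
    have tD: "tempered k (U \<times> S) (\<lambda>j y. D j y v)" for v
      unfolding D_def by (rule tempered_Suc_directional[OF Suc.prems])
    have bl: "bounded_linear (\<lambda>h. D j y (0, h))" if "y \<in> U \<times> S" for j y
      by (rule bounded_linear_compose[OF has_derivative_bounded_linear[OF der[OF that]]])
        (intro bounded_linear_Pair bounded_linear_zero bounded_linear_ident)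
    show ?case
    proof (rule tempered_SucI[OF assms(3) poly_bounded_integral[OF assms(2) tempered_imp_poly_bounded[OF Suc.prems] cF]])
      fix j x assume x: "x \<in> S"
      obtain r where r: "r > 0" "ball x r \<subseteq> S"
        using assms(3) x open_contains_ball by blast
      define fx where "fx = (\<lambda>x u. Blinfun (\<lambda>h. D j (u, x) (0, h)))"
      have fx: "blinfun_apply (fx x u) = (\<lambda>h. D j (u, x) (0, h))" if "u \<in> U" "x \<in> S" for u x
        unfolding fx_def by (rule bounded_linear_Blinfun_apply) (use bl that in auto)
      have cont: "continuous_on (ball x r \<times> cbox 0 1) (\<lambda>(x, u). fx x u)"
      proof (rule continuous_on_blinfun_componentwise)
        fix i :: 'x
        have "continuous_on (ball x r \<times> cbox 0 1) (\<lambda>z. D j (snd z, fst z) (0, i))"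
          by (rule continuous_on_compose2[OF tempered_imp_continuous_on[OF tD]])
            (use assms(2) r in \<open>auto intro!: continuous_intros\<close>)
        then show "continuous_on (ball x r \<times> cbox 0 1) (\<lambda>z. blinfun_apply (case z of (x, u) \<Rightarrow> fx x u) i)"
        proof (rule continuous_on_eq)
          fix z assume "z \<in> ball x r \<times> cbox (0::real) 1"
          then have "snd z \<in> U" "fst z \<in> S" using assms(2) r by auto
          then show "D j (snd z, fst z) (0, i) = blinfun_apply (case z of (x, u) \<Rightarrow> fx x u) i"
            using fx by (simp add: split_beta)
        qed
      qed
      have "((\<lambda>x. integral (cbox 0 1) (\<lambda>u. F j (u, x))) has_derivative integral (cbox 0 1) (fx x)) (at x within ball x r)"
      proof (rule leibniz_rule[OF _ _ cont _ convex_ball])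
        fix y u assume y: "y \<in> ball x r" and u: "u \<in> cbox (0::real) 1"
        then have yu: "u \<in> U" "y \<in> S" using assms(2) r by auto
        have "((\<lambda>y. F j (u, y)) has_derivative (\<lambda>h. D j (u, y) (0, h))) (at y)"
          by (rule has_derivative_compose[OF _ der, of "\<lambda>y. (u, y)"])
            (use yu in \<open>auto intro!: derivative_eq_intros\<close>)
        then show "((\<lambda>y. F j (u, y)) has_derivative blinfun_apply (fx y u)) (at y within ball x r)"
          unfolding fx[OF yu] by (rule has_derivative_at_withinI)
      next
        fix y assume "y \<in> ball x r"
        then show "(\<lambda>u. F j (u, y)) integrable_on cbox 0 1"
          by (intro integrable_continuous continuous_on_compose2[OF cF] continuous_intros)
            (use assms(2) r in auto)
      qed (use r in auto)
      then have "((\<lambda>x. integral (cbox 0 1) (\<lambda>u. F j (u, x))) has_derivative (\<lambda>h. blinfun_apply (integral (cbox 0 1) (fx x)) h)) (at x)"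
        using at_within_open[of x "ball x r"] r by simp
      moreover have "blinfun_apply (integral (cbox 0 1) (fx x)) h = integral {0..1} (\<lambda>u. D j (u, x) (0, h))" for h
      proof -
        have "continuous_on (cbox 0 1) (fx x)"
        proof -
          have "continuous_on (cbox 0 1) (Pair x :: real \<Rightarrow> _)"
            by (intro continuous_intros)
          then have "continuous_on (cbox 0 1) (\<lambda>u. case (x, u) of (x, u) \<Rightarrow> fx x u)"
            by (rule continuous_on_compose2[OF cont]) (use r in auto)
          then show ?thesis by simp
        qed
        then have "blinfun_apply (integral (cbox 0 1) (fx x)) h = integral (cbox 0 1) (\<lambda>u. blinfun_apply (fx x u) h)"
          by (intro blinfun_apply_integral integrable_continuous)
        also have "\<dots> = integral (cbox 0 1) (\<lambda>u. D j (u, x) (0, h))"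
          by (rule integral_cong) (use fx x assms(2) in auto)
        finally show ?thesis by simp
      qed
      ultimately show "((\<lambda>x. integral {0..1} (\<lambda>u. F j (u, x))) has_derivative
          (\<lambda>h. integral {0..1} (\<lambda>u. D j (u, x) (0, h)))) (at x)"
        unfolding cbox_interval by (simp only:)
    next
      fix v
      show "tempered k S (\<lambda>j x. integral {0..1} (\<lambda>u. D j (u, x) (0, v)))"
        by (rule Suc.IH[OF tD])
    qed
qed

definition rapidly_decreasing :: "(nat \<Rightarrow> 'a::real_normed_vector) \<Rightarrow> bool" where
  "rapidly_decreasing c \<longleftrightarrow> (\<forall>B. \<exists>A. \<forall>j. norm (c j) * (1 + real j) ^ B \<le> A)"

lemma rapidly_decreasing_summable:
  fixes c :: "nat \<Rightarrow> 'a::real_normed_vector"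
  assumes "rapidly_decreasing c"
  shows "summable (\<lambda>j. norm (c j) * (A * (1 + real j) ^ B))"
proof -
  \<comment> \<open>The two extra powers buy the convergent majorant with terms
    \<open>1 / (1 + j)^2\<close>.\<close>
  obtain M where M: "\<And>j. norm (c j) * (1 + real j) ^ (B + 2) \<le> M"
    using assms unfolding rapidly_decreasing_def by blast
  have "summable (\<lambda>j. inverse ((1 + real j) ^ 2))"
    using inverse_power_summable[of 2, where 'a = real] summable_Suc_iff[of "\<lambda>n. inverse (real n ^ 2)"]
    by (simp add: add.commute)
  then have "summable (\<lambda>j. \<bar>A\<bar> * M * inverse ((1 + real j) ^ 2))"
    by (rule summable_mult)
  then show ?thesis
  proof (rule summable_comparison_test'[where N = 0])
    fix j :: nat
    have "norm (c j) * (1 + real j) ^ B * (1 + real j) ^ 2 \<le> M"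
      using M[of j] by (simp add: power_add power2_eq_square algebra_simps)
    then have "norm (c j) * (1 + real j) ^ B \<le> M * inverse ((1 + real j) ^ 2)"
      by (simp add: field_simps)
    then have "\<bar>A\<bar> * (norm (c j) * (1 + real j) ^ B) \<le> \<bar>A\<bar> * (M * inverse ((1 + real j) ^ 2))"
      by (intro mult_left_mono) auto
    then show "norm (norm (c j) * (A * (1 + real j) ^ B)) \<le> \<bar>A\<bar> * M * inverse ((1 + real j) ^ 2)"
      by (simp add: abs_mult algebra_simps)
  qed
qed

lemma has_derivative_suminf:
  fixes f :: "nat \<Rightarrow> 'a::real_normed_vector \<Rightarrow> 'b::banach"
  assumes "open S" "x \<in> S" "summable K"
    and "\<And>n x. x \<in> S \<Longrightarrow> (f n has_derivative f' n x) (at x)"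
    and "\<And>n x h. x \<in> S \<Longrightarrow> norm (f' n x h) \<le> K n * norm h"
    and "\<And>x. x \<in> S \<Longrightarrow> summable (\<lambda>n. f n x)"
  shows "((\<lambda>x. \<Sum>n. f n x) has_derivative (\<lambda>h. \<Sum>n. f' n x h)) (at x)"
proof -
  obtain r where r: "r > 0" "ball x r \<subseteq> S"
    using assms(1,2) open_contains_ball by blast
  have summ: "summable (\<lambda>n. norm (f' n y h))" if "y \<in> S" for y h
    by (rule summable_comparison_test'[OF summable_mult2[OF assms(3)], where N = 0]) (use assms(5) that in auto)
  have "\<exists>g. \<forall>y\<in>ball x r. (\<lambda>n. f n y) sums g y \<and> (g has_derivative (\<lambda>h. \<Sum>n. f' n y h)) (at y within ball x r)"
  proof (rule has_derivative_series[OF convex_ball])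
    fix e :: real assume "e > 0"
    have "(\<lambda>n. \<Sum>i. K (i + n)) \<longlonglongrightarrow> 0"
      using assms(3) by (rule suminf_exist_split2)
    then have "\<forall>\<^sub>F n in sequentially. (\<Sum>i. K (i + n)) < e"
      by (rule order_tendstoD) fact
    then show "\<forall>\<^sub>F n in sequentially. \<forall>y\<in>ball x r. \<forall>h.
        norm (sum (\<lambda>i. f' i y h) {..<n} - (\<Sum>n. f' n y h)) \<le> e * norm h"
    proof (eventually_elim, intro ballI allI)
      fix n y h assume n: "(\<Sum>i. K (i + n)) < e" and "y \<in> ball x r"
      then have y: "y \<in> S" using r by auto
      have sK: "summable (\<lambda>i. K (i + n))"
        using assms(3) by (simp add: summable_iff_shift[of K])
      have "(\<Sum>n. f' n y h) = (\<Sum>i. f' (i + n) y h) + (\<Sum>i<n. f' i y h)"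
        by (rule suminf_split_initial_segment[OF summable_norm_cancel[OF summ[OF y]]])
      then have "norm (sum (\<lambda>i. f' i y h) {..<n} - (\<Sum>n. f' n y h)) = norm (\<Sum>i. f' (i + n) y h)"
        by (simp add: norm_minus_commute)
      also have "\<dots> \<le> (\<Sum>i. norm (f' (i + n) y h))"
        using summ[OF y, of h] by (intro summable_norm) (simp add: summable_iff_shift[of "\<lambda>i. norm (f' i y h)"])
      also have "\<dots> \<le> (\<Sum>i. K (i + n) * norm h)"
        using summ[OF y, of h] assms(5)[OF y]
        by (intro suminf_le summable_mult2 sK) (simp_all add: summable_iff_shift[of "\<lambda>i. norm (f' i y h)"])
      also have "\<dots> = (\<Sum>i. K (i + n)) * norm h"
        using sK by (rule suminf_mult2[symmetric])
      also have "\<dots> \<le> e * norm h"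
        using n by (intro mult_right_mono) auto
      finally show "norm (sum (\<lambda>i. f' i y h) {..<n} - (\<Sum>n. f' n y h)) \<le> e * norm h" .
    qed
  next
    show "(f n has_derivative f' n y) (at y within ball x r)" if "y \<in> ball x r" for n y
      using assms(4) that r by (blast intro: has_derivative_at_withinI)
    show "(\<lambda>n. f n x) sums (\<Sum>n. f n x)"
      using assms(2,6) by auto
  qed (use r in auto)
  then obtain g where g: "\<And>y. y \<in> ball x r \<Longrightarrow> (\<lambda>n. f n y) sums g y"
    "\<And>y. y \<in> ball x r \<Longrightarrow> (g has_derivative (\<lambda>h. \<Sum>n. f' n y h)) (at y within ball x r)"
    by blast
  have "(g has_derivative (\<lambda>h. \<Sum>n. f' n x h)) (at x)"
    using g(2)[of x] r at_within_open[of x "ball x r"] by simp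
  then show ?thesis
    by (rule has_derivative_transform_within_open[OF _ open_ball[of x r]]) (use r g(1) in \<open>auto simp: sums_iff\<close>)
qed

lemma smooth_on_tempered_series:
  fixes F :: "nat \<Rightarrow> 'a::euclidean_space \<Rightarrow> complex"
  assumes "open S" "rapidly_decreasing c" "\<And>k. tempered k S F"
  shows "smooth_on S (\<lambda>x. \<Sum>j. c j * F j x)"
    and "\<And>x. x \<in> S \<Longrightarrow> summable (\<lambda>j. c j * F j x)"
proof -
  have dom: "\<exists>K. summable K \<and> (\<forall>j. \<forall>x\<in>S. norm (c j * F j x) \<le> K j)"
    if F: "poly_bounded S F" for F :: "nat \<Rightarrow> 'a \<Rightarrow> complex"
  proof -
    obtain A B where A: "\<And>j x. x \<in> S \<Longrightarrow> norm (F j x) \<le> A * (1 + real j) ^ B"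
      using poly_boundedE[OF F] by metis
    then have "norm (c j * F j x) \<le> norm (c j) * (A * (1 + real j) ^ B)" if "x \<in> S" for j x
      using that by (simp add: norm_mult mult_left_mono)
    then show ?thesis
      using rapidly_decreasing_summable[OF assms(2)] by blast
  qed
  have summ: "summable (\<lambda>j. c j * F j x)" if F: "poly_bounded S F" and "x \<in> S" for F :: "nat \<Rightarrow> 'a \<Rightarrow> complex" and x
  proof -
    obtain K where K: "summable K" "\<And>j x. x \<in> S \<Longrightarrow> norm (c j * F j x) \<le> K j"
      using dom[OF F] by blast
    show ?thesis
      by (rule summable_comparison_test'[OF K(1), where N = 0]) (use K(2) that(2) in auto)
  qed
  show "summable (\<lambda>j. c j * F j x)" if "x \<in> S" for x
    using summ[OF tempered_imp_poly_bounded[OF assms(3)] that] .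
  have "Ck_on k S (\<lambda>x. \<Sum>j. c j * F j x)" if "\<And>k. tempered k S F" for k and F :: "nat \<Rightarrow> 'a \<Rightarrow> complex"
    using that
  proof (induction k arbitrary: F)
    case 0
    obtain K where K: "summable K" "\<And>j x. x \<in> S \<Longrightarrow> norm (c j * F j x) \<le> K j"
      using dom[OF tempered_imp_poly_bounded[OF 0]] by blast
    have "uniform_limit S (\<lambda>n x. \<Sum>j<n. c j * F j x) (\<lambda>x. \<Sum>j. c j * F j x) sequentially"
      using K by (intro Weierstrass_m_test)
    then have "continuous_on S (\<lambda>x. \<Sum>j. c j * F j x)"
      by (rule uniform_limit_theorem[rotated])
        (auto intro!: always_eventually continuous_intros tempered_imp_continuous_on[OF 0])
    then show ?case by simp
  next
    case (Suc k)
    define D where "D = (\<lambda>v j x. frechet_derivative (F j) (at x) v)"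
    have tD: "tempered k S (D v)" for k v
      using Suc.prems[of "Suc k"] unfolding D_def by (rule tempered_Suc_directional)
    have der: "(F j has_derivative (\<lambda>v. D v j x)) (at x)" if "x \<in> S" for j x
      unfolding D_def using tempered_Suc_has_derivative[OF Suc.prems that] .
    obtain K where K: "\<And>b. summable (K b)" "\<And>b j x. x \<in> S \<Longrightarrow> norm (c j * D b j x) \<le> K b j"
      using dom[OF tempered_imp_poly_bounded[OF tD]] by metis
    show ?case
    proof (rule Ck_on_SucI'[OF assms(1)])
      fix x assume x: "x \<in> S"
      show "((\<lambda>x. \<Sum>j. c j * F j x) has_derivative (\<lambda>v. \<Sum>j. c j * D v j x)) (at x)"
      \<comment> \<open>Domination is known for each fixed direction; summing the majorants over the
        basis bounds the derivative in all directions at once.\<close>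
      proof (rule has_derivative_suminf[OF assms(1) x, where K = "\<lambda>j. \<Sum>b\<in>Basis. K b j"])
        show "summable (\<lambda>j. \<Sum>b\<in>Basis. K b j)"
          by (intro summable_sum K)
        show "((\<lambda>x. c n * F n x) has_derivative (\<lambda>v. c n * D v n y)) (at y)" if "y \<in> S" for n y
          by (intro has_derivative_mult_right der that)
        show "summable (\<lambda>n. c n * F n y)" if "y \<in> S" for y
          using summ[OF tempered_imp_poly_bounded[OF Suc.prems] that] .
        fix n y h assume y: "y \<in> S"
        have "linear (\<lambda>v. D v n y)"
          using has_derivative_linear[OF der[OF y]] .
        then have "D (\<Sum>b\<in>Basis. (h \<bullet> b) *\<^sub>R b) n y = (\<Sum>b\<in>Basis. (h \<bullet> b) *\<^sub>R D b n y)"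
          by (simp only: linear_sum[of "\<lambda>v. D v n y"] linear_cmul[of "\<lambda>v. D v n y"])
        then have "c n * D h n y = (\<Sum>b\<in>Basis. (h \<bullet> b) *\<^sub>R (c n * D b n y))"
          by (simp add: euclidean_representation sum_distrib_left)
        also have "norm \<dots> \<le> (\<Sum>b\<in>Basis. norm h * K b n)"
          by (rule sum_norm_le) (use K(2)[OF y] in \<open>auto intro!: mult_mono Basis_le_norm\<close>)
        finally show "norm (c n * D h n y) \<le> (\<Sum>b\<in>Basis. K b n) * norm h"
          by (simp add: sum_distrib_left mult.commute[of _ "norm h"])
      qed
    next
      fix v
      show "Ck_on k S (\<lambda>x. \<Sum>j. c j * D v j x)"
        by (rule Suc.IH[OF tD])
    qed
  qed
  then show "smooth_on S (\<lambda>x. \<Sum>j. c j * F j x)"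
    using assms(3) by (simp add: smooth_on_def)
qed

section \<open>Cutoff functions\<close>

text \<open>The functions \<open>x\<^sup>-\<^sup>k exp (-1/x)\<close> are closed under differentiation up to linear combinations.\<close>

definition flat_exp :: "nat \<Rightarrow> real \<Rightarrow> real" where
  "flat_exp k x = (if x > 0 then inverse x ^ k * exp (- inverse x) else 0)"

lemma flat_exp_tendsto_0: "(flat_exp k \<longlongrightarrow> 0) (at 0)"
proof -
  have "((\<lambda>x. inverse x ^ k / exp (inverse x)) \<longlongrightarrow> (0::real)) (at_right 0)"
    by (rule filterlim_compose[OF tendsto_power_div_exp_0 filterlim_inverse_at_top_right])
  moreover have "\<forall>\<^sub>F x in at_right 0. inverse x ^ k / exp (inverse x) = flat_exp k x"
    by (auto simp: eventually_at_right_less flat_exp_def exp_minus divide_inverse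
        intro!: eventually_mono[OF eventually_at_right_less])
  ultimately have "(flat_exp k \<longlongrightarrow> 0) (at_right 0)"
    by (rule Lim_transform_eventually)
  moreover have "(flat_exp k \<longlongrightarrow> 0) (at_left 0)"
    by (rule Lim_transform_eventually[OF tendsto_const])
      (auto simp: eventually_at_filter flat_exp_def intro!: always_eventually)
  ultimately show ?thesis
    by (simp add: filterlim_at_split)
qed

lemma flat_exp_has_real_derivative:
  "(flat_exp k has_real_derivative flat_exp (k + 2) x - real k * flat_exp (k + 1) x) (at x)"
proof -
  consider "x > 0" | "x < 0" | "x = 0" by linarith
  then show ?thesis
  proof cases
    case 1
    have "((\<lambda>x. inverse x ^ k * exp (- inverse x)) has_real_derivative
        flat_exp (k + 2) x - real k * flat_exp (k + 1) x) (at x)"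
    proof -
      have p: "real k * inverse x ^ (k - Suc 0) * inverse x = real k * inverse x ^ k"
        by (cases k) auto
      have d: "((\<lambda>x. inverse x ^ k * exp (- inverse x)) has_real_derivative
          (real k * inverse x ^ (k - Suc 0) * inverse x) * (- inverse x) * exp (- inverse x)
          + inverse x ^ k * (exp (- inverse x) * (inverse x)\<^sup>2)) (at x)"
        using 1 by (auto intro!: derivative_eq_intros simp: power2_eq_square algebra_simps)
      show ?thesis
        using d[unfolded p] 1 by (simp add: flat_exp_def power2_eq_square algebra_simps)
    qed
    then show ?thesis
      by (rule has_field_derivative_transform_within_open[OF _ open_greaterThan[of 0]])
        (use 1 in \<open>auto simp: flat_exp_def\<close>)
  next
    case 2
    have "((\<lambda>x. 0) has_real_derivative flat_exp (k + 2) x - real k * flat_exp (k + 1) x) (at x)"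
      using 2 by (auto simp: flat_exp_def)
    then show ?thesis
      by (rule has_field_derivative_transform_within_open[OF _ open_lessThan[of 0]])
        (use 2 in \<open>auto simp: flat_exp_def\<close>)
  next
    case 3
    \<comment> \<open>At 0 the difference quotient is itself a member of the family, whose limit is
      already known.\<close>
    have "(\<lambda>h. (flat_exp k (0 + h) - flat_exp k 0) / h) = flat_exp (k + 1)"
      by (auto simp: fun_eq_iff flat_exp_def divide_inverse)
    then show ?thesis
      using flat_exp_tendsto_0[of "k + 1"] 3 by (simp add: DERIV_def flat_exp_def)
  qed
qed

lemma smooth_on_flat_exp: "smooth_on UNIV (flat_exp m)"
proof -
  have "Ck_on k UNIV (flat_exp m)" for k
  proof (induction k arbitrary: m)
    case 0
    show ?case
      unfolding Ck_on.simps(1)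
      by (rule DERIV_continuous_on[OF has_field_derivative_at_within[OF flat_exp_has_real_derivative]])
  next
    case (Suc k)
    show ?case
    proof (rule Ck_on_SucI'[OF open_UNIV flat_exp_has_real_derivative[unfolded has_field_derivative_def]])
      show "Ck_on k UNIV (\<lambda>x. (flat_exp (m + 2) x - real m * flat_exp (m + 1) x) * v)" for v
        using Ck_on_bounded_linear[OF bounded_linear_mult_left open_UNIV, of k _ v]
          Ck_on_add[OF open_UNIV Suc[of "m + 2"]
            Ck_on_bounded_linear[OF bounded_linear_mult_right open_UNIV Suc[of "m + 1"], of "- real m"]]
        by fastforce
    qed
  qed
  then show ?thesis by (simp add: smooth_on_def)
qed

lemma deriv_iterate_locally_const:
  fixes f :: "real \<Rightarrow> real"
  assumes "open T" "\<And>x. x \<in> T \<Longrightarrow> f x = c" "x \<in> T"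
  shows "(deriv ^^ Suc n) f x = 0"
  using assms(3)
proof (induction n arbitrary: x)
  case 0
  have "(f has_real_derivative 0) (at x)"
    by (rule has_field_derivative_transform_within_open[OF DERIV_const assms(1) 0]) (use assms(2) in auto)
  then show ?case by (simp add: DERIV_imp_deriv)
next
  case (Suc n)
  have "((deriv ^^ Suc n) f has_real_derivative 0) (at x)"
    by (rule has_field_derivative_transform_within_open[OF DERIV_const assms(1) Suc.prems]) (use Suc.IH in auto)
  then show ?case by (simp add: DERIV_imp_deriv)
qed

text \<open>The function comes with the whole sequence of its derivatives and their global bounds,
  the form in which \<open>tempered_compose_real\<close> takes it.\<close>

lemma smooth_cutoff:
  obtains d :: "nat \<Rightarrow> real \<Rightarrow> real"
  where "\<And>n x. (d n has_real_derivative d (Suc n) x) (at x)"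
    and "\<And>n. \<exists>M. \<forall>x. \<bar>d n x\<bar> \<le> M"
    and "\<And>x. 0 \<le> d 0 x" "\<And>x. d 0 x \<le> 1"
    and "\<And>x. x \<le> 1/2 \<Longrightarrow> d 0 x = 0" "\<And>x. x \<ge> 1 \<Longrightarrow> d 0 x = 1"
proof -
  define f where "f = flat_exp 0"
  have f: "f x \<ge> 0" "f x > 0 \<longleftrightarrow> x > 0" "f x = 0 \<longleftrightarrow> x \<le> 0" for x
    by (auto simp: f_def flat_exp_def)
  have pos: "f (x - 1/2) + f (1 - x) > 0" for x
    using f(1)[of "x - 1/2"] f(1)[of "1 - x"] f(2)[of "x - 1/2"] f(2)[of "1 - x"] by (cases "x < 1") linarith+
  define c where "c = (\<lambda>x. f (x - 1/2) / (f (x - 1/2) + f (1 - x)))"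
  have smf: "smooth_on UNIV f" unfolding f_def by (rule smooth_on_flat_exp)
  have smc: "smooth_on UNIV c"
    unfolding c_def
    by (intro smooth_on_divide smooth_on_add open_UNIV
        smooth_on_compose[OF smf open_UNIV open_UNIV, of "\<lambda>x. x - 1/2"]
        smooth_on_compose[OF smf open_UNIV open_UNIV, of "\<lambda>x. 1 - x"] smooth_on_diff smooth_on_id smooth_on_const)
      (use pos in \<open>auto simp: less_le\<close>)
  have c0: "c x = 0" if "x \<le> 1/2" for x
    using f(3)[of "x - 1/2"] that by (simp add: c_def)
  have c1: "c x = 1" if "x \<ge> 1" for x
    using f(3)[of "1 - x"] pos[of x] that by (simp add: c_def)
  have c01: "0 \<le> c x" "c x \<le> 1" for x
    using f(1)[of "x - 1/2"] f(1)[of "1 - x"] pos[of x] by (auto simp: c_def divide_simps)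
  show thesis
  proof (rule that[of "\<lambda>n. (deriv ^^ n) c"])
    show "((deriv ^^ n) c has_real_derivative (deriv ^^ Suc n) c x) (at x)" for n x
      using smooth_on_deriv(2)[OF open_UNIV smooth_on_deriv_iterate[OF open_UNIV smc]] by simp
    show "\<exists>M. \<forall>x. \<bar>(deriv ^^ n) c x\<bar> \<le> M" for n
    proof (cases n)
      case 0
      then show ?thesis using c01 by (intro exI[of _ 1]) (auto simp: abs_le_iff intro: order_trans[of _ 0])
    next
      case (Suc m)
      \<comment> \<open>A derivative of positive order vanishes where the function is locally
        constant, in particular outside \<open>{0..2}\<close>; a bound on this compact interval is
        global.\<close>
      have "continuous_on {0..2} ((deriv ^^ n) c)"
        using smooth_on_imp_continuous_on[OF smooth_on_deriv_iterate[OF open_UNIV smc]]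
        by (rule continuous_on_subset) auto
      then have "compact ((deriv ^^ n) c ` {0..2})"
        by (rule compact_continuous_image) auto
      then obtain M where M: "\<And>x. x \<in> {0..2} \<Longrightarrow> \<bar>(deriv ^^ n) c x\<bar> \<le> M"
        using compact_imp_bounded[of "(deriv ^^ n) c ` {0..2}"] unfolding bounded_iff real_norm_def by blast
      have "(deriv ^^ n) c x = 0" if "x \<notin> {0..2}" for x
      proof (cases "x < 0")
        case True
        then show ?thesis
          unfolding Suc by (intro deriv_iterate_locally_const[of "{..<1/2}" c 0]) (auto simp: c0)
      next
        case False
        then show ?thesis
          unfolding Suc using that
          by (intro deriv_iterate_locally_const[of "{1<..}" c 1]) (auto simp: c1)
      qed
      then have "\<bar>(deriv ^^ n) c x\<bar> \<le> max M 0" for x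
        using M[of x] by (cases "x \<in> {0..2}") auto
      then show ?thesis by blast
    qed
  qed (use c0 c1 c01 in auto)
qed

section \<open>Hadamard quotients\<close>

text \<open>A single map seen as a family that does not depend on \<open>j\<close>; the compact set
  supplies the bounds. In this way \<open>tempered_integral\<close> also serves to differentiate
  ordinary parameter integrals.\<close>

lemma Ck_on_imp_tempered:
  fixes f :: "'a::real_normed_vector \<Rightarrow> 'b::real_normed_vector"
  assumes "Ck_on k S f" "compact K" "K \<subseteq> S" "open T" "T \<subseteq> K"
  shows "tempered k T (\<lambda>j. f)"
  using assms(1)
proof (induction k arbitrary: f)
  have b: "poly_bounded T (\<lambda>j. f)" if "continuous_on S f" for f :: "'a \<Rightarrow> 'b"
  proof -
    have "compact (f ` K)"
      by (rule compact_continuous_image[OF continuous_on_subset[OF that assms(3)] assms(2)])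
    then obtain M where "\<And>x. x \<in> K \<Longrightarrow> norm (f x) \<le> M"
      using compact_imp_bounded[of "f ` K"] unfolding bounded_iff by blast
    then show ?thesis
      using assms(5) by (intro poly_boundedI[where A = M and B = 0]) auto
  qed
  {
    case 0
    then show ?case
      using b[of f] assms(3,5) by (auto intro: continuous_on_subset)
  next
    case (Suc k)
    then show ?case
      using b[OF Ck_on_imp_continuous_on[OF Suc.prems]] assms(3,5) by auto
  }
qed

lemma tempered_imp_Ck_on: "tempered k T (\<lambda>j. f) \<Longrightarrow> Ck_on k T f"
  by (induction k arbitrary: f) auto

text \<open>The quotient in direction \<open>b\<close> is the integral over \<open>s\<close> in
  \<open>{0..1}\<close> of the partial derivative at \<open>s x\<close>, by the fundamental theorem
  along the segment from 0 to \<open>x\<close>.\<close>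

lemma hadamard_quotient:
  fixes f :: "'a::euclidean_space \<Rightarrow> 'b::euclidean_space"
  assumes "smooth_on (ball 0 r) f" "f 0 = 0" "0 < r'" "r' < r"
  obtains h where "\<And>b. b \<in> Basis \<Longrightarrow> smooth_on (ball 0 r') (h b)"
    and "\<And>x. x \<in> ball 0 r' \<Longrightarrow> f x = (\<Sum>b\<in>Basis. (x \<bullet> b) *\<^sub>R h b x)"
    and "\<And>b. h b 0 = frechet_derivative f (at 0) b"
proof -
  define D where "D = (\<lambda>b x. frechet_derivative f (at x) b)"
  define h where "h = (\<lambda>b x. integral {0..1} (\<lambda>s. D b (s *\<^sub>R x)))"
  \<comment> \<open>The midpoint of 1 and \<open>r / r'\<close>. It lets \<open>s\<close> range over
    an open interval around \<open>{0..1}\<close> while \<open>s x\<close> stays in the ball of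
    radius \<open>r\<close>.\<close>
  define q where "q = (1 + r / r') / 2"
  have q: "q > 1" "q * r' < r"
    using assms(3,4) by (auto simp: q_def field_simps)
  define Q where "Q = {x :: real \<times> 'a. fst x *\<^sub>R snd x \<in> ball 0 r}"
  have "open Q"
  proof -
    have "Q = (\<lambda>x. fst x *\<^sub>R snd x) -` ball 0 r" by (auto simp: Q_def)
    then show ?thesis by (auto intro!: open_vimage continuous_intros)
  qed
  have smD: "smooth_on (ball 0 r) (D b)" for b
    unfolding D_def by (rule smooth_on_directional[OF assms(1)])
  have smS: "smooth_on Q (\<lambda>x. fst x *\<^sub>R snd x)"
    by (intro smooth_on_scaleR smooth_on_fst smooth_on_snd smooth_on_id \<open>open Q\<close>)
  have smQ: "smooth_on Q (\<lambda>x. D b (fst x *\<^sub>R snd x))" for b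
    by (rule smooth_on_compose[OF smD \<open>open Q\<close> open_ball smS]) (simp add: Q_def)
  have sub: "{1-q..q} \<times> cball 0 r' \<subseteq> Q"
  proof (clarsimp simp: Q_def)
    fix s :: real and x :: 'a assume *: "1 - q \<le> s" "s \<le> q" "norm x \<le> r'"
    then have "\<bar>s\<bar> * norm x \<le> q * r'"
      by (intro mult_mono) (use q assms in auto)
    then show "\<bar>s\<bar> * norm x < r" using q by simp
  qed
  have "Ck_on k (ball 0 r') (h b)" for k b
  proof -
    define F where "F = (\<lambda>(j::nat) x. D b (fst x *\<^sub>R snd x))"
    have "tempered k ({1 - q<..<q} \<times> ball 0 r') F"
      unfolding F_def by (rule Ck_on_imp_tempered[OF _ _ sub])
        (use smQ in \<open>auto simp: smooth_on_def intro!: compact_Times open_Times\<close>)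
    then have "tempered k (ball 0 r') (\<lambda>j x. integral {0..1} (\<lambda>u. F j (u, x)))"
      by (rule tempered_integral[rotated 3]) (use q in auto)
    then have "tempered k (ball 0 r') (\<lambda>j. h b)"
      by (simp add: F_def h_def)
    then show ?thesis by (rule tempered_imp_Ck_on)
  qed
  then have 1: "smooth_on (ball 0 r') (h b)" for b
    by (simp add: smooth_on_def)
  have 2: "f x = (\<Sum>b\<in>Basis. (x \<bullet> b) *\<^sub>R h b x)" if x: "x \<in> ball 0 r'" for x
  proof -
    have sx: "s *\<^sub>R x \<in> ball 0 r" if "s \<in> {0..1}" for s
    proof -
      have "\<bar>s\<bar> * norm x \<le> 1 * norm x" using that by (intro mult_right_mono) auto
      then show ?thesis using x assms(4) by auto
    qed
    have lin: "frechet_derivative f (at y) x = (\<Sum>b\<in>Basis. (x \<bullet> b) *\<^sub>R D b y)" if "y \<in> ball 0 r" for y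
    proof -
      have "linear (frechet_derivative f (at y))"
        using has_derivative_linear[OF smooth_on_has_derivative[OF assms(1) that]] .
      then have "frechet_derivative f (at y) (\<Sum>b\<in>Basis. (x \<bullet> b) *\<^sub>R b) = (\<Sum>b\<in>Basis. (x \<bullet> b) *\<^sub>R D b y)"
        unfolding D_def by (simp only: linear_sum linear_cmul)
      then show ?thesis by (simp only: euclidean_representation)
    qed
    have "((\<lambda>s. f (s *\<^sub>R x)) has_vector_derivative (\<Sum>b\<in>Basis. (x \<bullet> b) *\<^sub>R D b (s *\<^sub>R x))) (at s within {0..1})"
      if "s \<in> {0..1}" for s
    proof -
      have l: "linear (frechet_derivative f (at (s *\<^sub>R x)))"
        using has_derivative_linear[OF smooth_on_has_derivative[OF assms(1) sx[OF that]]] .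
      have "((\<lambda>s. f (s *\<^sub>R x)) has_derivative (\<lambda>t. frechet_derivative f (at (s *\<^sub>R x)) (t *\<^sub>R x))) (at s)"
        by (rule has_derivative_compose[of "\<lambda>s. s *\<^sub>R x" "\<lambda>t. t *\<^sub>R x",
              OF _ smooth_on_has_derivative[OF assms(1) sx[OF that]]])
          (auto intro!: derivative_eq_intros)
      then show ?thesis
        unfolding has_vector_derivative_def lin[OF sx[OF that], symmetric]
        by (auto simp: linear_cmul[OF l] intro: has_derivative_at_withinI)
    qed
    then have "((\<lambda>s. \<Sum>b\<in>Basis. (x \<bullet> b) *\<^sub>R D b (s *\<^sub>R x)) has_integral (f (1 *\<^sub>R x) - f (0 *\<^sub>R x))) {0..1}"
      by (intro fundamental_theorem_of_calculus) auto
    then have "f x = integral {0..1} (\<lambda>s. \<Sum>b\<in>Basis. (x \<bullet> b) *\<^sub>R D b (s *\<^sub>R x))"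
      using assms(2) by (simp add: integral_unique)
    also have "\<dots> = (\<Sum>b\<in>Basis. (x \<bullet> b) *\<^sub>R h b x)"
    proof -
      have "(\<lambda>s. D b (s *\<^sub>R x)) integrable_on {0..1}" for b
        by (intro integrable_continuous_interval continuous_on_compose2[OF smooth_on_imp_continuous_on[OF smD]]
            continuous_intros) (use sx in auto)
      then show ?thesis
        unfolding h_def by (subst integral_sum) (auto intro: integrable_cmul)
    qed
    finally show ?thesis .
  qed
  have "h b 0 = frechet_derivative f (at 0) b" for b
    by (simp add: h_def D_def)
  from that[of h, OF 1 2 this] show thesis by blast
qed

section \<open>Fourier series of compactly supported functions\<close>

lemma has_vector_derivative_cis:
  "((\<lambda>u. cis (c * u)) has_vector_derivative (\<i> * of_real c * cis (c * x))) (at x within S)"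
  unfolding cis_conv_exp of_real_mult
  by (rule has_vector_derivative_real_field[of "\<lambda>z. exp (\<i> * (of_real c * z))", simplified])
    (auto intro!: derivative_eq_intros simp: algebra_simps)

text \<open>Unnormalised; the factor \<open>1 / (2 * pi)\<close> enters only when the series is
  summed.\<close>

definition fourier_int :: "(real \<Rightarrow> complex) \<Rightarrow> int \<Rightarrow> complex" where
  "fourier_int f j = integral {-pi..pi} (\<lambda>u. f u * cis (- (of_int j * u)))"

text \<open>The boundary terms are kept. They vanish for a function supported inside the interval,
  but not for the quotient in \<open>fourier_quotient\<close>, where it suffices that they stay
  bounded.\<close>

lemma fourier_int_by_parts:
  assumes "\<And>u. u \<in> {-pi..pi} \<Longrightarrow> (f has_vector_derivative f' u) (at u within {-pi..pi})"
    and "continuous_on {-pi..pi} f'"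
  shows "\<i> * of_int j * fourier_int f j =
    fourier_int f' j - (f pi * cis (- (of_int j * pi)) - f (- pi) * cis (of_int j * pi))"
proof -
  define e where "e = (\<lambda>u. cis (- (real_of_int j * u)))"
  have e: "(e has_vector_derivative (- (\<i> * of_int j) * e u)) (at u within {-pi..pi})" for u
    using has_vector_derivative_cis[of "- of_int j" u "{-pi..pi}"] by (simp add: e_def)
  have ce: "continuous_on {-pi..pi} e"
    unfolding e_def by (intro continuous_intros)
  have cf: "continuous_on {-pi..pi} f"
    using assms(1) by (intro continuous_on_vector_derivative)
  have "((\<lambda>u. f u * (- (\<i> * of_int j) * e u) + f' u * e u) has_integral (f pi * e pi - f (- pi) * e (- pi))) {-pi..pi}"
    by (rule fundamental_theorem_of_calculus) (simp, erule has_vector_derivative_mult[OF assms(1) e])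
  moreover have "integral {-pi..pi} (\<lambda>u. f u * (- (\<i> * of_int j) * e u) + f' u * e u)
      = - (\<i> * of_int j) * integral {-pi..pi} (\<lambda>u. f u * e u) + integral {-pi..pi} (\<lambda>u. f' u * e u)"
  proof -
    have i: "(\<lambda>u. f u * e u) integrable_on {-pi..pi}" "(\<lambda>u. f' u * e u) integrable_on {-pi..pi}"
      by (intro integrable_continuous_interval continuous_on_mult cf ce assms)+
    have "integral {-pi..pi} (\<lambda>u. f u * (- (\<i> * of_int j) * e u) + f' u * e u)
      = integral {-pi..pi} (\<lambda>u. - (\<i> * of_int j) * (f u * e u) + f' u * e u)"
      by (simp add: mult_ac)
    also have "\<dots> = integral {-pi..pi} (\<lambda>u. - (\<i> * of_int j) * (f u * e u)) + integral {-pi..pi} (\<lambda>u. f' u * e u)"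
      by (rule integral_add[OF integrable_on_mult_right[OF i(1)] i(2)])
    also have "integral {-pi..pi} (\<lambda>u. - (\<i> * of_int j) * (f u * e u)) = - (\<i> * of_int j) * integral {-pi..pi} (\<lambda>u. f u * e u)"
      by (rule integral_mult_right)
    finally show ?thesis .
  qed
  ultimately have "- (\<i> * of_int j) * integral {-pi..pi} (\<lambda>u. f u * e u) + integral {-pi..pi} (\<lambda>u. f' u * e u)
      = f pi * e pi - f (- pi) * e (- pi)"
    using integral_unique by metis
  then show ?thesis
    unfolding fourier_int_def e_def by (simp add: algebra_simps)
qed

lemma norm_fourier_int_le:
  assumes "continuous_on {-pi..pi} f" "\<And>u. u \<in> {-pi..pi} \<Longrightarrow> norm (f u) \<le> M"
  shows "norm (fourier_int f j) \<le> M * (2 * pi)"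
proof -
  have "norm (fourier_int f j) \<le> M * (pi - (- pi))"
    unfolding fourier_int_def
    by (rule integral_bound) (use assms in \<open>auto intro!: continuous_intros simp: norm_mult\<close>)
  then show ?thesis by simp
qed

lemma smooth_on_cis: "smooth_on UNIV (\<lambda>u. cis u)"
proof -
  have d: "((\<lambda>u. \<i> ^ n * cis u) has_vector_derivative (\<i> ^ Suc n * cis x)) (at x)" for n x
    using has_vector_derivative_mult_right[OF has_vector_derivative_cis[of 1 x UNIV], of "\<i> ^ n"]
    by (simp add: mult_ac)
  show ?thesis
    using smooth_on_realI[OF open_UNIV, of "\<lambda>n u. \<i> ^ n * cis u", OF d, of 0] by simp
qed

text \<open>Dividing \<open>g - g(t)\<close> by \<open>exp (i(u - t)) - 1\<close> makes the partial sums of the Fourier series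
  telescope.\<close>

lemma fourier_quotient:
  fixes g :: "real \<Rightarrow> real"
  assumes "smooth_on UNIV g" "\<bar>t\<bar> \<le> 1/2"
  obtains k M where "\<And>u. u \<in> {-pi..pi} \<Longrightarrow> of_real (g u - g t) = (cis (u - t) - 1) * k u"
    and "continuous_on {-pi..pi} k" "\<And>j. norm (of_int j * fourier_int k j) \<le> M"
proof -
  define G where "G = (\<lambda>w. complex_of_real (g (t + w) - g t))"
  have smG: "smooth_on (ball 0 (2 * pi)) G"
  proof -
    have "smooth_on UNIV G"
      unfolding G_def
      by (intro smooth_on_linear[OF open_UNIV bounded_linear_of_real] smooth_on_diff open_UNIV
          smooth_on_compose[OF assms(1) open_UNIV open_UNIV, of "\<lambda>w. t + w"] smooth_on_add smooth_on_const smooth_on_id) auto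
    then show ?thesis by (rule smooth_on_subset) auto
  qed
  have smE: "smooth_on (ball 0 (2 * pi)) (\<lambda>w. cis w - 1)"
    by (rule smooth_on_subset[of UNIV])
      (auto intro!: smooth_on_diff smooth_on_cis smooth_on_const)
  \<comment> \<open>Large enough to contain \<open>u - t\<close> for \<open>u\<close> in the period
    and \<open>\<bar>t\<bar> \<le> 1/2\<close>, yet below \<open>2 * pi\<close>, so that 0 is the
    only zero of \<open>cis w - 1\<close> in the ball.\<close>
  define r where "r = pi + 1"
  have r: "0 < r" "r < 2 * pi" using pi_gt3 by (auto simp: r_def)
  obtain hA where "\<And>b. b \<in> Basis \<Longrightarrow> smooth_on (ball 0 r) (hA b)"
    "\<And>x. x \<in> ball 0 r \<Longrightarrow> G x = (\<Sum>b\<in>Basis. (x \<bullet> b) *\<^sub>R hA b x)"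
    by (rule hadamard_quotient[OF smG _ r]) (auto simp: G_def)
  then have A: "smooth_on (ball 0 r) (hA 1)" "\<And>x. x \<in> ball 0 r \<Longrightarrow> G x = x *\<^sub>R hA 1 x"
    by auto
  obtain hB where "\<And>b. b \<in> Basis \<Longrightarrow> smooth_on (ball 0 r) (hB b)"
    "\<And>x. x \<in> ball 0 r \<Longrightarrow> cis x - 1 = (\<Sum>b\<in>Basis. (x \<bullet> b) *\<^sub>R hB b x)"
    "\<And>b. hB b 0 = frechet_derivative (\<lambda>w. cis w - 1) (at 0) b"
    by (rule hadamard_quotient[OF smE _ r]) auto
  then have B: "smooth_on (ball 0 r) (hB 1)" "\<And>x. x \<in> ball 0 r \<Longrightarrow> cis x - 1 = x *\<^sub>R hB 1 x"
    "hB 1 0 = frechet_derivative (\<lambda>w. cis w - 1) (at 0) 1"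
    by auto
  have "((\<lambda>w. cis w - 1) has_derivative (\<lambda>h. h *\<^sub>R \<i>)) (at 0)"
    using has_vector_derivative_diff[OF has_vector_derivative_cis[of 1 0 UNIV] has_vector_derivative_const]
    by (simp add: has_vector_derivative_def)
  then have "hB 1 0 = \<i>"
    unfolding B(3) by (simp add: frechet_derivative_unique)
  have Bnz: "hB 1 w \<noteq> 0" if "w \<in> ball 0 r" for w
  proof (cases "w = 0")
    case False
    have "cis w \<noteq> 1"
    proof
      assume "cis w = 1"
      then have "cos w = 1" by (simp add: complex_eq_iff)
      then obtain n :: int where n: "w = of_int n * (2 * pi)"
        using cos_one_2pi_int by (metis mult.commute mult.left_commute)
      have "\<bar>w\<bar> < 2 * pi" using that r by auto
      then have "\<bar>real_of_int n\<bar> < 1"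
        unfolding n by (simp add: abs_mult)
      then show False using n False by auto
    qed
    then show ?thesis using B(2)[OF that] by auto
  qed (use \<open>hB 1 0 = \<i>\<close> in auto)
  \<comment> \<open>Numerator and denominator have each been divided by \<open>w\<close>; the
    divided denominator has the value \<open>\<i>\<close> at 0 and no zeros, so the quotient extends
    smoothly across 0.\<close>
  define q where "q = (\<lambda>w. hA 1 w / hB 1 w)"
  have smq: "smooth_on (ball 0 r) q"
    unfolding q_def by (intro smooth_on_divide A B Bnz) auto
  define k where "k = (\<lambda>u. q (u - t))"
  define I where "I = {-(pi + 1/2)<..<pi + 1/2}"
  have smk: "smooth_on I k"
    unfolding k_def
    by (rule smooth_on_compose[OF smq _ open_ball, of I "\<lambda>u. u - t"])
      (use assms(2) in \<open>auto simp: I_def r_def dist_real_def intro!: smooth_on_diff smooth_on_id smooth_on_const\<close>)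
  have sub: "{-pi..pi} \<subseteq> I" by (auto simp: I_def)
  define k' where "k' = (\<lambda>u. frechet_derivative k (at u) 1)"
  have kd: "(k has_vector_derivative k' u) (at u within {-pi..pi})" if "u \<in> {-pi..pi}" for u
  proof -
    have "u \<in> I" using that sub by auto
    note d = smooth_on_has_derivative[OF smk this]
    have "frechet_derivative k (at u) = (\<lambda>h. h *\<^sub>R k' u)"
    proof
      show "frechet_derivative k (at u) h = h *\<^sub>R k' u" for h
        using linear_cmul[OF has_derivative_linear[OF d], of h 1] by (simp add: k'_def)
    qed
    then have "(k has_vector_derivative k' u) (at u)"
      unfolding has_vector_derivative_def using d by simp
    then show ?thesis by (rule has_vector_derivative_at_within)
  qed
  have ck': "continuous_on {-pi..pi} k'"
    unfolding k'_def using smooth_on_imp_continuous_on[OF smooth_on_directional[OF smk]] sub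
    by (rule continuous_on_subset)
  have ck: "continuous_on {-pi..pi} k"
    using smooth_on_imp_continuous_on[OF smk] sub by (rule continuous_on_subset)
  have "bounded (k' ` {-pi..pi})"
    by (intro compact_imp_bounded compact_continuous_image ck') auto
  then obtain K where K: "\<And>u. u \<in> {-pi..pi} \<Longrightarrow> norm (k' u) \<le> K"
    unfolding bounded_iff by blast
  show thesis
  proof (rule that[of k "K * (2 * pi) + (norm (k pi) + norm (k (- pi)))"])
    fix u assume "u \<in> {-pi..pi}"
    then have u: "u - t \<in> ball 0 r" using assms(2) by (auto simp: r_def dist_real_def)
    show "of_real (g u - g t) = (cis (u - t) - 1) * k u"
      using A(2)[OF u] B(2)[OF u] Bnz[OF u] by (simp add: k_def q_def G_def scaleR_conv_of_real)
  next
    fix j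
    have "norm (of_int j * fourier_int k j) = norm (\<i> * of_int j * fourier_int k j)"
      by (simp add: norm_mult)
    also have "\<dots> = norm (fourier_int k' j - (k pi * cis (- (of_int j * pi)) - k (- pi) * cis (of_int j * pi)))"
      by (subst fourier_int_by_parts[OF kd ck']) auto
    also have "\<dots> \<le> norm (fourier_int k' j) + (norm (k pi * cis (- (of_int j * pi))) + norm (k (- pi) * cis (of_int j * pi)))"
      by (intro norm_triangle_le_diff add_mono order_refl norm_triangle_ineq4)
    also have "\<dots> \<le> K * (2 * pi) + (norm (k pi) + norm (k (- pi)))"
      using norm_fourier_int_le[OF ck' K] by (simp add: norm_mult)
    finally show "norm (of_int j * fourier_int k j) \<le> K * (2 * pi) + (norm (k pi) + norm (k (- pi)))" .
  qed (rule ck)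
qed

text \<open>For real \<open>g\<close> the frequencies \<open>j\<close> and \<open>- j\<close>
  contribute conjugate terms, so real parts over natural frequencies suffice; families indexed by
  natural numbers are what is divided later. Rapid decrease comes from iterated integration by
  parts.\<close>

theorem fourier_series_compact_support:
  fixes g :: "real \<Rightarrow> real"
  assumes "smooth_on UNIV g" "\<And>u. \<bar>u\<bar> > 1/2 \<Longrightarrow> g u = 0"
  obtains c where "rapidly_decreasing c"
    "\<And>t. \<bar>t\<bar> \<le> 1/2 \<Longrightarrow> (\<lambda>j. Re (c j * cis (real j * t))) sums g t"
proof -
  define f where "f = (\<lambda>n u. complex_of_real ((deriv ^^ n) g u))"
  have fd: "(f n has_vector_derivative f (Suc n) u) (at u within S)" for n u S
    using smooth_on_deriv(2)[OF open_UNIV smooth_on_deriv_iterate[OF open_UNIV assms(1)], of u n]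
    unfolding f_def
    by (auto intro!: has_vector_derivative_of_real simp: has_real_derivative_iff_has_vector_derivative
        intro: has_vector_derivative_at_within)
  have cf: "continuous_on S (f n)" for n S
    by (rule continuous_on_vector_derivative[OF fd])
  have zero: "(deriv ^^ n) g u = 0" if "\<bar>u\<bar> > 1/2" for n u
  proof (cases n)
    case (Suc m)
    have "open {u :: real. \<bar>u\<bar> > 1/2}"
      by (intro open_Collect_less continuous_intros)
    then show ?thesis
      unfolding Suc by (rule deriv_iterate_locally_const[where c = 0]) (use that assms(2) in auto)
  qed (use that assms(2) in auto)
  have f0: "f n pi = 0" "f n (- pi) = 0" for n
    using pi_gt3 by (auto simp: f_def zero)
  have parts: "(\<i> * of_int j) ^ n * fourier_int (f 0) j = fourier_int (f n) j" for n j
  proof (induction n)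
    case (Suc n)
    have "(\<i> * of_int j) ^ Suc n * fourier_int (f 0) j = \<i> * of_int j * fourier_int (f n) j"
      using Suc by (simp add: mult.assoc)
    also have "\<dots> = fourier_int (f (Suc n)) j"
      by (subst fourier_int_by_parts[OF fd cf]) (simp add: f0)
    finally show ?case .
  qed simp
  have bdd: "\<exists>M. \<forall>j. norm (fourier_int (f n) j) \<le> M" for n
  proof -
    have "bounded (f n ` {-pi..pi})"
      by (intro compact_imp_bounded compact_continuous_image cf) auto
    then obtain K where K: "\<And>u. u \<in> {-pi..pi} \<Longrightarrow> norm (f n u) \<le> K"
      unfolding bounded_iff by blast
    show ?thesis
      using norm_fourier_int_le[OF cf K] by blast
  qed
  have pile: "x \<le> x * pi" "x \<le> x * (2 * pi)" if "x \<ge> 0" for x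
    using mult_left_mono[of 1 pi x] mult_left_mono[of 1 "2 * pi" x] that pi_gt3 by auto
  define a where "a = (\<lambda>j. fourier_int (f 0) j / (2 * pi))"
  define c where "c = (\<lambda>j. (if j = 0 then a 0 else 2 * a (int j)))"
  have "rapidly_decreasing c"
    unfolding rapidly_decreasing_def
  proof
    fix B
    obtain M where M: "\<And>j. norm (fourier_int (f 0) j) \<le> M" using bdd by blast
    obtain N where N: "\<And>j. norm (fourier_int (f B) j) \<le> N" using bdd by blast
    \<comment> \<open>\<open>M\<close> takes care of \<open>j = 0\<close>; for
      \<open>j \<ge> 1\<close> the inequality \<open>1 + j \<le> 2 * j\<close> produces the factor
      \<open>2 ^ B\<close>.\<close>
    have "norm (c j) * (1 + real j) ^ B \<le> M + 2 ^ B * N" for j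
    proof -
      have M0: "0 \<le> M" "0 \<le> N" using M[of 0] N[of 0] norm_ge_zero order_trans by blast+
      have ca: "norm (c j) \<le> norm (fourier_int (f 0) j)"
        using pile[of "norm (fourier_int (f 0) j)"]
        by (auto simp: c_def a_def norm_divide norm_mult divide_le_eq)
      show ?thesis
      proof (cases "j = 0")
        case True
        then show ?thesis using ca M[of 0] M0 by (simp add: add_increasing2)
      next
        case False
        have "norm (c j) * (1 + real j) ^ B \<le> norm (fourier_int (f 0) j) * (2 * real j) ^ B"
          using False ca by (intro mult_mono power_mono) auto
        also have "\<dots> = 2 ^ B * norm ((\<i> * of_int (int j)) ^ B * fourier_int (f 0) j)"
          by (simp add: norm_mult norm_power power_mult_distrib)
        also have "\<dots> \<le> 2 ^ B * N"
          unfolding parts using N by simp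
        finally show ?thesis using M0 by simp
      qed
    qed
    then show "\<exists>A. \<forall>j. norm (c j) * (1 + real j) ^ B \<le> A" by blast
  qed
  moreover have "(\<lambda>j. Re (c j * cis (real j * t))) sums g t" if t: "\<bar>t\<bar> \<le> 1/2" for t
  proof -
    obtain k M where k: "\<And>u. u \<in> {-pi..pi} \<Longrightarrow> of_real (g u - g t) = (cis (u - t) - 1) * k u"
      "continuous_on {-pi..pi} k" "\<And>j. norm (of_int j * fourier_int k j) \<le> M"
      using fourier_quotient[OF assms(1) t] by metis
    define b where "b = (\<lambda>j. cis (of_int j * t) * fourier_int k j / (2 * pi))"
    have ik: "(\<lambda>u. k u * cis (- (of_int j * u))) integrable_on {-pi..pi}" for j
      by (intro integrable_continuous_interval continuous_intros k)
    \<comment> \<open>Multiplication by \<open>cis (u - t)\<close> shifts the frequency by one, up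
      to the constant \<open>cis (- t)\<close>.\<close>
    have i1: "fourier_int (\<lambda>u. of_real (g u - g t)) j = cis (- t) * fourier_int k (j - 1) - fourier_int k j" for j
    proof -
      have "fourier_int (\<lambda>u. of_real (g u - g t)) j
        = integral {-pi..pi} (\<lambda>u. cis (- t) * (k u * cis (- (of_int (j - 1) * u))) - k u * cis (- (of_int j * u)))"
        unfolding fourier_int_def
      proof (rule integral_cong)
        fix u assume u: "u \<in> {-pi..pi}"
        have "cis (u - t) * cis (- (of_int j * u)) = cis (- t) * cis (- (of_int (j - 1) * u))"
          by (simp add: cis_mult algebra_simps)
        then show "of_real (g u - g t) * cis (- (of_int j * u)) =
            cis (- t) * (k u * cis (- (of_int (j - 1) * u))) - k u * cis (- (of_int j * u))"
          unfolding k(1)[OF u] by (simp add: algebra_simps)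
      qed
      also have "\<dots> = cis (- t) * fourier_int k (j - 1) - fourier_int k j"
        unfolding fourier_int_def
        by (subst integral_diff[OF integrable_on_mult_right[OF ik] ik]) simp
      finally show ?thesis .
    qed
    have i2: "fourier_int (\<lambda>u. of_real (g u - g t)) j = fourier_int (f 0) j - (if j = 0 then 2 * pi * g t else 0)" for j
    proof -
      have "fourier_int (\<lambda>u. of_real (g u - g t)) j
        = integral {-pi..pi} (\<lambda>u. f 0 u * cis (- (of_int j * u)) - of_real (g t) * cis (- (of_int j * u)))"
        unfolding fourier_int_def by (simp add: f_def algebra_simps)
      also have "\<dots> = fourier_int (f 0) j - of_real (g t) * integral {-pi..pi} (\<lambda>u. cis (- (of_int j * u)))"
        unfolding fourier_int_def
        by (subst integral_diff)
          (auto intro!: integrable_continuous_interval continuous_intros cf)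
      also have "integral {-pi..pi} (\<lambda>u. cis (- (of_int j * u))) = (if j = 0 then 2 * pi else 0)"
      proof (cases "j = 0")
        case False
        have "\<i> * of_int j * fourier_int (\<lambda>_. 1) j = fourier_int (\<lambda>_. 0) j
            - (1 * cis (- (of_int j * pi)) - 1 * cis (of_int j * pi))"
          by (rule fourier_int_by_parts) auto
        moreover have "cis (of_int j * pi) = cis (- (of_int j * pi))"
          by (simp add: complex_eq_iff sin_zero_iff_int2)
        ultimately show ?thesis
          using False by (simp add: fourier_int_def)
      qed (simp add: cis_zero scaleR_conv_of_real)
      finally show ?thesis by (simp add: mult.commute)
    qed
    have step: "cis (of_int j * t) * a j - (if j = 0 then g t else 0) = b (j - 1) - b j" for j
    proof -
      have "cis (of_int j * t) * cis (- t) = cis (of_int (j - 1) * t)"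
        by (simp add: cis_mult algebra_simps)
      then have "cis (of_int j * t) * (cis (- t) * fourier_int k (j - 1) - fourier_int k j) / (2 * pi) = b (j - 1) - b j"
        unfolding b_def by (simp add: algebra_simps diff_divide_distrib flip: mult.assoc)
      then show ?thesis
        unfolding i1[symmetric] i2 a_def by (auto simp: field_simps)
    qed
    have cnja: "a (- j) = cnj (a j)" for j
    proof -
      have "fourier_int (f 0) (- j) = cnj (fourier_int (f 0) j)"
        unfolding fourier_int_def integral_cnj by (simp add: f_def cis_cnj)
      then show ?thesis by (simp add: a_def)
    qed
    define \<rho> where "\<rho> = (\<lambda>j. Re (c j * cis (real j * t)))"
    have part: "complex_of_real ((\<Sum>j\<le>N. \<rho> j) - g t) = b (- int N - 1) - b (int N)" for N
    proof (induction N)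
      case 0
      have "Im (a 0) = 0" using cnja[of 0] by (simp add: complex_eq_iff)
      then have "complex_of_real (Re (a 0)) = a 0" by (simp add: complex_eq_iff)
      then show ?case using step[of 0] by (simp add: c_def \<rho>_def)
    next
      case (Suc N)
      define z where "z = cis (of_int (int (Suc N)) * t) * a (int (Suc N))"
      have z1: "z = b (int N) - b (int (Suc N))"
        using step[of "int (Suc N)"] by (simp add: z_def)
      have "cnj z = cis (of_int (- int (Suc N)) * t) * a (- int (Suc N))"
        unfolding cnja by (simp add: z_def cis_cnj left_diff_distrib distrib_right)
      then have z2: "cnj z = b (- int (Suc N) - 1) - b (- int (Suc N))"
        using step[of "- int (Suc N)"] by simp
      have re: "complex_of_real (\<rho> (Suc N)) = z + cnj z"
      proof -
        have "c (Suc N) * cis (real (Suc N) * t) = 2 * z"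
          by (simp add: c_def z_def mult_ac)
        then have "\<rho> (Suc N) = Re (2 * z)" by (simp only: \<rho>_def)
        then show ?thesis by (simp add: complex_add_cnj)
      qed
      have "complex_of_real ((\<Sum>j\<le>Suc N. \<rho> j) - g t)
          = complex_of_real ((\<Sum>j\<le>N. \<rho> j) - g t) + complex_of_real (\<rho> (Suc N))"
        by simp
      also have "\<dots> = b (- int N - 1) - b (int N) + (z + cnj z)"
        unfolding Suc re ..
      also have "\<dots> = b (- int (Suc N) - 1) - b (int (Suc N))"
      proof -
        have eq: "- int (Suc N) = - int N - 1" by simp
        have "cnj z = b (- int (Suc N) - 1) - b (- int N - 1)"
          using z2 unfolding eq .
        then show ?thesis by (simp only:) (subst z1, simp)
      qed
      finally show ?case .
    qed
    \<comment> \<open>Both ends of the telescoped sum tend to 0, because the coefficients of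
      \<open>k\<close> are bounded by a multiple of \<open>1 / j\<close>.\<close>
    have b0: "(\<lambda>N. b (int N)) \<longlonglongrightarrow> 0" "(\<lambda>N. b (- int N - 1)) \<longlonglongrightarrow> 0"
    proof -
      have bb: "norm (b j) \<le> M * inverse \<bar>of_int j\<bar>" if "j \<noteq> 0" for j
      proof -
        have "norm (b j) \<le> norm (fourier_int k j)"
          using pile[of "norm (fourier_int k j)"]
          by (auto simp: b_def norm_divide norm_mult divide_le_eq)
        also have "\<dots> = norm (of_int j * fourier_int k j) * inverse \<bar>of_int j\<bar>"
          using that by (simp add: norm_mult)
        also have "\<dots> \<le> M * inverse \<bar>of_int j\<bar>"
          by (intro mult_right_mono k(3)) auto
        finally show ?thesis .
      qed
      have l: "(\<lambda>N. M * inverse (real (Suc N))) \<longlonglongrightarrow> 0"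
        using LIMSEQ_inverse_real_of_nat tendsto_mult_right_zero by blast
      have "(\<lambda>N. b (int (Suc N))) \<longlonglongrightarrow> 0"
        by (rule Lim_null_comparison[OF always_eventually l]) (use bb[of "int (Suc _)"] in auto)
      then show "(\<lambda>N. b (int N)) \<longlonglongrightarrow> 0"
        using LIMSEQ_imp_Suc[of "\<lambda>N. b (int N)"] by simp
      show "(\<lambda>N. b (- int N - 1)) \<longlonglongrightarrow> 0"
      proof (rule Lim_null_comparison[OF always_eventually l], rule allI)
        fix N
        show "norm (b (- int N - 1)) \<le> M * inverse (real (Suc N))"
          using bb[of "- int N - 1"] by (simp add: abs_if add.commute split: if_splits)
      qed
    qed
    have "(\<lambda>N. complex_of_real ((\<Sum>j\<le>N. \<rho> j) - g t)) \<longlonglongrightarrow> 0"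
      unfolding part using tendsto_diff[OF b0(2,1)] by simp
    then have "(\<lambda>N. (\<Sum>j\<le>N. \<rho> j) - g t) \<longlonglongrightarrow> 0"
      using tendsto_of_real_iff[where 'a = complex and c = 0] by (metis of_real_0)
    then show ?thesis
      by (simp only: sums_def_le LIM_zero_iff \<rho>_def)
  qed
  ultimately show thesis by (rule that)
qed

section \<open>The generic polynomial\<close>

text \<open>The coefficients form a point of an abstract Euclidean space with an enumerated basis,
  so that the implicit function theorem applies to them directly. Degrees 3, 4 and 5 are later
  instantiated with tuples.\<close>

locale generic_polynomial =
  fixes n :: nat and b :: "nat \<Rightarrow> 'e::euclidean_space"
  assumes bij_basis: "bij_betw b {..<n} Basis"
begin

definition pcoeff :: "'e \<Rightarrow> nat \<Rightarrow> real" where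
  "pcoeff e m = (if m < n then e \<bullet> b m else 1)"

text \<open>Polymorphic in the field, since the contours run through complex arguments while the
  division theorem is a real identity.\<close>

definition P :: "'e \<Rightarrow> 'f \<Rightarrow> 'f::real_normed_field" where
  "P e z = (\<Sum>m\<le>n. of_real (pcoeff e m) * z ^ m)"

text \<open>The coefficients of \<open>(P e z - P e t) / (z - t)\<close> as a polynomial in \<open>t\<close>.\<close>

definition Pquot :: "'e \<Rightarrow> nat \<Rightarrow> 'f \<Rightarrow> 'f::real_normed_field" where
  "Pquot e i z = (\<Sum>m\<in>{Suc i..n}. of_real (pcoeff e m) * z ^ (m - Suc i))"

lemma P_eq: "P e z = z ^ n + (\<Sum>m<n. of_real (e \<bullet> b m) * z ^ m)"
proof -
  have "{..n} = insert n {..<n}" by auto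
  then show ?thesis by (simp add: P_def pcoeff_def)
qed

lemma P_diff: "P e z - P e t = (z - t) * (\<Sum>i<n. Pquot e i z * t ^ i)"
proof -
  have "P e z - P e t = (\<Sum>m\<le>n. of_real (pcoeff e m) * (z ^ m - t ^ m))"
    by (simp add: P_def sum_subtractf algebra_simps)
  also have "\<dots> = (\<Sum>m\<le>n. \<Sum>i<m. (z - t) * (of_real (pcoeff e m) * z ^ (m - Suc i) * t ^ i))"
  proof (rule sum.cong[OF refl])
    fix m
    have "z ^ m - t ^ m = (z - t) * (\<Sum>i<m. z ^ (m - Suc i) * t ^ i)"
    proof -
      have "z ^ m - t ^ m = - (t ^ m - z ^ m)" by simp
      also have "\<dots> = (z - t) * (\<Sum>i<m. z ^ (m - Suc i) * t ^ i)"
        unfolding power_diff_sumr2[of t m z] by (simp flip: mult_minus_left)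
      finally show ?thesis .
    qed
    then show "of_real (pcoeff e m) * (z ^ m - t ^ m)
        = (\<Sum>i<m. (z - t) * (of_real (pcoeff e m) * z ^ (m - Suc i) * t ^ i))"
      by (simp add: sum_distrib_left mult_ac)
  qed
  also have "\<dots> = (\<Sum>i<n. \<Sum>m\<in>{Suc i..n}. (z - t) * (of_real (pcoeff e m) * z ^ (m - Suc i) * t ^ i))"
    by (subst sum.Sigma, simp, simp, subst sum.Sigma, simp, simp,
        rule sum.reindex_bij_witness[of _ "\<lambda>(i, m). (m, i)" "\<lambda>(m, i). (i, m)"]) auto
  also have "\<dots> = (z - t) * (\<Sum>i<n. Pquot e i z * t ^ i)"
    by (simp add: Pquot_def sum_distrib_left sum_distrib_right mult_ac)
  finally show ?thesis .
qed

lemma of_real_P: "of_real (P e t) = P e (of_real t)"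
  by (simp add: P_def)

lemma cnj_P: "cnj (P e z) = P e (cnj z)"
  by (simp add: P_def)

lemma abs_inner_b_le: "i < n \<Longrightarrow> \<bar>e \<bullet> b i\<bar> \<le> norm e"
  using bij_basis by (intro Basis_le_norm) (auto simp: bij_betw_def)

text \<open>Chosen so that for \<open>1 \<le> norm z\<close> and \<open>norm z \<le> 2\<close> the
  lower terms of the polynomial add up to at most \<open>n * rad * 2 ^ n \<le> 1/2\<close>. Hence it
  has modulus at least 1/2 on this annulus.\<close>

definition rad :: real where "rad = 1 / (2 * (real n + 1) * 2 ^ n)"

lemma rad_pos: "rad > 0"
  by (simp add: rad_def)

lemma rad_le: "rad \<le> 1"
proof -
  have "1 * 1 \<le> (2 * (real n + 1)) * (2 ^ n :: real)"
    by (intro mult_mono) auto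
  then show ?thesis by (simp add: rad_def divide_le_eq)
qed

lemma abs_pcoeff_le: "e \<in> ball 0 rad \<Longrightarrow> \<bar>pcoeff e m\<bar> \<le> 1"
  using abs_inner_b_le[of m e] rad_le by (auto simp: pcoeff_def)

lemma P_lower_bound:
  fixes z :: complex
  assumes "e \<in> ball 0 rad" "1 \<le> norm z" "norm z \<le> 2"
  shows "1/2 \<le> norm (P e z)"
proof -
  have "norm (\<Sum>m<n. of_real (e \<bullet> b m) * z ^ m) \<le> (\<Sum>m<n. rad * 2 ^ n)"
  proof (rule sum_norm_le)
    fix m assume "m \<in> {..<n}"
    then have m: "m < n" by simp
    have "norm z ^ m \<le> 2 ^ m" using assms by (intro power_mono) auto
    also have "\<dots> \<le> (2::real) ^ n" using m by (intro power_increasing) auto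
    finally have "norm z ^ m \<le> 2 ^ n" .
    then show "norm (complex_of_real (e \<bullet> b m) * z ^ m) \<le> rad * 2 ^ n"
      using abs_inner_b_le[OF m, of e] assms(1)
      by (auto simp: norm_mult norm_power intro!: mult_mono)
  qed
  also have "\<dots> = real n / (2 * (real n + 1))"
    by (simp add: rad_def)
  also have "\<dots> \<le> 1/2"
    by (simp add: divide_simps)
  finally have "norm (\<Sum>m<n. of_real (e \<bullet> b m) * z ^ m) \<le> 1/2" .
  moreover have "norm (z ^ n) \<ge> 1"
    using assms(2) by (simp add: norm_power one_le_power)
  ultimately show ?thesis
    unfolding P_eq using norm_diff_ineq[of "z ^ n" "\<Sum>m<n. of_real (e \<bullet> b m) * z ^ m"] by linarith
qed

text \<open>A bound for the divided difference of \<open>P\<close> on the disc of radius 2: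
  \<open>n\<close> terms, each at most \<open>(n + 1) * 2 ^ n\<close> from \<open>Pquot\<close>
  times \<open>2 ^ n\<close> from the power. The added 1 only ensures
  \<open>lip \<ge> 1\<close>.\<close>

definition lip :: real where "lip = real n * ((real n + 1) * 2 ^ n * 2 ^ n) + 1"

lemma lip_ge: "lip \<ge> 1" by (simp add: lip_def)

lemma norm_Pquot_le:
  fixes z :: complex
  assumes "e \<in> ball 0 rad" "norm z \<le> 2"
  shows "norm (Pquot e i z) \<le> (real n + 1) * 2 ^ n"
proof -
  have "norm (Pquot e i z) \<le> (\<Sum>m\<in>{Suc i..n}. 2 ^ n)"
    unfolding Pquot_def
  proof (rule sum_norm_le)
    fix m assume m: "m \<in> {Suc i..n}"
    have "norm z ^ (m - Suc i) \<le> 2 ^ (m - Suc i)" using assms by (intro power_mono) auto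
    also have "\<dots> \<le> (2::real) ^ n" using m by (intro power_increasing) auto
    finally have "\<bar>pcoeff e m\<bar> * norm z ^ (m - Suc i) \<le> 1 * 2 ^ n"
      by (intro mult_mono abs_pcoeff_le assms) auto
    then show "norm (complex_of_real (pcoeff e m) * z ^ (m - Suc i)) \<le> 2 ^ n"
      by (simp add: norm_mult norm_power)
  qed
  also have "\<dots> = real (card {Suc i..n}) * 2 ^ n" by simp
  also have "\<dots> \<le> (real n + 1) * 2 ^ n" by (intro mult_right_mono) auto
  finally show ?thesis .
qed

lemma P_lipschitz:
  fixes z w :: complex
  assumes "e \<in> ball 0 rad" "norm z \<le> 2" "norm w \<le> 2"
  shows "norm (P e z - P e w) \<le> lip * norm (z - w)"
proof -
  have "norm (\<Sum>i<n. Pquot e i z * w ^ i) \<le> (\<Sum>i<n. ((real n + 1) * 2 ^ n) * 2 ^ n)"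
  proof (rule sum_norm_le)
    fix i assume i: "i \<in> {..<n}"
    have "norm w ^ i \<le> 2 ^ i" using assms by (intro power_mono) auto
    also have "\<dots> \<le> (2::real) ^ n" using i by (intro power_increasing) auto
    finally show "norm (Pquot e i z * w ^ i) \<le> ((real n + 1) * 2 ^ n) * 2 ^ n"
      using norm_Pquot_le[OF assms(1,2)] by (auto simp: norm_mult norm_power intro!: mult_mono)
  qed
  also have "\<dots> \<le> lip" by (simp add: lip_def)
  finally show ?thesis
    unfolding P_diff norm_mult by (metis mult.commute mult_right_mono norm_ge_zero)
qed

text \<open>The candidate heights of the integration contour for the frequency \<open>j\<close>. One of these
  \<open>n + 1\<close> lines keeps a distance of order \<open>1/j\<close> from all roots.\<close>

definition ht :: "nat \<Rightarrow> nat \<Rightarrow> real" where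
  "ht j \<nu> = (real \<nu> + 1) / ((real n + 1) * (1 + real j))"

text \<open>The \<open>n\<close>-th power of half the spacing of the candidate lines: a lower bound
  for a product of \<open>n\<close> linear factors, each at least half the spacing in
  modulus.\<close>

definition gap :: "nat \<Rightarrow> real" where
  "gap j = (1 / (2 * (real n + 1) * (1 + real j))) ^ n"

lemma ht_pos: "ht j \<nu> > 0"
  by (auto simp: ht_def intro!: divide_pos_pos mult_pos_pos add_nonneg_pos)

lemma ht_le: "\<nu> \<le> n \<Longrightarrow> ht j \<nu> * (1 + real j) \<le> 1"
  by (auto simp: ht_def divide_simps)

lemma ht_le_1: "\<nu> \<le> n \<Longrightarrow> ht j \<nu> \<le> 1"
proof -
  assume "\<nu> \<le> n"
  have "ht j \<nu> * 1 \<le> ht j \<nu> * (1 + real j)"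
    using ht_pos[of j \<nu>] by (intro mult_left_mono) auto
  then show ?thesis using ht_le[OF \<open>\<nu> \<le> n\<close>, of j] by linarith
qed

lemma ht_ge: "1 \<le> (real n + 1) * (1 + real j) * ht j \<nu>"
  by (simp add: ht_def)

lemma gap_pos: "gap j > 0"
  by (auto simp: gap_def intro!: zero_less_power divide_pos_pos mult_pos_pos add_nonneg_pos)

lemma gap_le_1: "gap j \<le> 1"
proof -
  have "1 * 1 \<le> (2 * (real n + 1)) * (1 + real j)" by (intro mult_mono) auto
  then show ?thesis unfolding gap_def by (intro power_le_one) (auto simp: divide_le_eq)
qed

lemma inverse_gap: "1 / gap j = (2 * (real n + 1)) ^ n * (1 + real j) ^ n"
  by (simp add: gap_def power_mult_distrib power_divide)

text \<open>Pigeonhole: the open strips whose half-width is half the spacing are disjoint, and at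
  most \<open>n\<close> of the \<open>n + 1\<close> strips can contain a root. On a free line every
  linear factor is at least half the spacing.\<close>

lemma good_height_exists:
  obtains \<nu> where "\<nu> \<le> n" "\<And>x. gap j \<le> norm (P e (Complex x (ht j \<nu>)))"
proof -
  define \<eta> where "\<eta> = 1 / (2 * (real n + 1) * (1 + real j))"
  have \<eta>: "\<eta> > 0"
    by (auto simp: \<eta>_def intro!: divide_pos_pos mult_pos_pos add_nonneg_pos)
  define p where "p = (\<Sum>m\<le>n. monom (complex_of_real (pcoeff e m)) m)"
  have poly_p: "poly p z = P e z" for z
    by (simp add: p_def P_def poly_sum poly_monom)
  have coeff_p: "coeff p k = (if k \<le> n then of_real (pcoeff e k) else 0)" for k
    by (simp add: p_def coeff_sum)
  have deg: "degree p = n"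
  proof (rule antisym)
    show "degree p \<le> n" by (rule degree_le) (simp add: coeff_p)
    show "n \<le> degree p" by (rule le_degree) (simp add: coeff_p pcoeff_def)
  qed
  then have lead: "lead_coeff p = 1" by (simp add: coeff_p pcoeff_def)
  then have "p \<noteq> 0" by auto
  then obtain A where A: "size A = n" "p = (\<Prod>x\<in>#A. [:-x, 1:])"
    using alg_closed_imp_factorization[of p] lead deg by auto
  have prod: "poly (\<Prod>x\<in>#B. [:-x, 1:]) z = (\<Prod>x\<in>#B. z - x)" for B :: "complex multiset" and z
    by (induction B) (auto simp: algebra_simps)
  have prod_ge: "\<eta> ^ size B \<le> norm (\<Prod>x\<in>#B. z - x)" if "\<And>x. x \<in># B \<Longrightarrow> \<eta> \<le> norm (z - x)"
    for B :: "complex multiset" and z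
    using that
  proof (induction B)
    case (add x B)
    have "\<eta> * \<eta> ^ size B \<le> norm (z - x) * norm (\<Prod>x\<in>#B. z - x)"
      using \<eta> by (intro mult_mono add.IH) (use add.prems in auto)
    then show ?case by (simp add: norm_mult)
  qed simp
  define bad where "bad = {\<nu> \<in> {..n}. \<exists>a\<in>set_mset A. \<bar>Im a - ht j \<nu>\<bar> < \<eta>}"
  have "\<exists>g. \<forall>\<nu>\<in>bad. g \<nu> \<in> set_mset A \<and> \<bar>Im (g \<nu>) - ht j \<nu>\<bar> < \<eta>"
    unfolding bad_def by (rule bchoice) blast
  then obtain g where g: "\<And>\<nu>. \<nu> \<in> bad \<Longrightarrow> g \<nu> \<in> set_mset A \<and> \<bar>Im (g \<nu>) - ht j \<nu>\<bar> < \<eta>"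
    by blast
  have "inj_on g bad"
  proof (rule inj_onI, rule ccontr)
    fix \<nu> \<nu>' assume *: "\<nu> \<in> bad" "\<nu>' \<in> bad" "g \<nu> = g \<nu>'" "\<nu> \<noteq> \<nu>'"
    have "\<bar>ht j \<nu> - ht j \<nu>'\<bar> < 2 * \<eta>"
      using g[OF *(1)] g[OF *(2)] *(3) by (smt (verit))
    moreover have "ht j \<nu> - ht j \<nu>' = (real \<nu> - real \<nu>') * (2 * \<eta>)"
    proof -
      define D where "D = (real n + 1) * (1 + real j)"
      have "ht j \<nu> = (real \<nu> + 1) / D" for \<nu> by (simp add: ht_def D_def)
      moreover have "\<eta> = 1 / (2 * D)" unfolding \<eta>_def D_def by (simp only: mult.assoc)
      ultimately show ?thesis by (simp add: diff_divide_distrib add_divide_distrib)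
    qed
    ultimately have "\<bar>real \<nu> - real \<nu>'\<bar> * (2 * \<eta>) < 1 * (2 * \<eta>)"
      using \<eta> by (simp add: abs_mult)
    then have "\<bar>real \<nu> - real \<nu>'\<bar> < 1"
      using \<eta> by (subst (asm) mult_less_cancel_right) auto
    then show False using *(4) by linarith
  qed
  then have "card bad \<le> card (set_mset A)"
    using g by (intro card_inj_on_le) auto
  also have "\<dots> \<le> n"
  proof -
    have "card (set_mset A) \<le> size A"
      by (induction A) (auto simp: card_insert_if)
    then show ?thesis using A by simp
  qed
  finally have "card bad < card {..n}" by simp
  moreover have "bad \<subseteq> {..n}" by (auto simp: bad_def)
  ultimately obtain \<nu> where \<nu>: "\<nu> \<le> n" "\<nu> \<notin> bad"
    by (metis atMost_iff less_irrefl subsetI subset_antisym)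
  show thesis
  proof (rule that[OF \<nu>(1)])
    fix x
    have "\<eta> \<le> norm (Complex x (ht j \<nu>) - a)" if "a \<in># A" for a
    proof -
      have "\<eta> \<le> \<bar>Im (Complex x (ht j \<nu>) - a)\<bar>"
        using \<nu> that unfolding bad_def by force
      then show ?thesis using abs_Im_le_cmod order_trans by blast
    qed
    then have "\<eta> ^ size A \<le> norm (\<Prod>a\<in>#A. Complex x (ht j \<nu>) - a)"
      by (rule prod_ge)
    then show "gap j \<le> norm (P e (Complex x (ht j \<nu>)))"
      using A poly_p[of "Complex x (ht j \<nu>)"] by (simp add: prod gap_def \<eta>_def)
  qed
qed

end

section \<open>Contour integrals over thin rectangles\<close>

text \<open>The sides of the rectangle with corners \<open>Complex (- 1) (- h)\<close> and
  \<open>Complex 1 h\<close>, counterclockwise from the bottom. The affine formula also makes sense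
  for \<open>u\<close> outside \<open>{0..1}\<close>, which \<open>tempered_integral\<close>
  requires.\<close>

definition side :: "real \<Rightarrow> nat \<Rightarrow> real \<Rightarrow> complex" where
  "side h s u = (if s = 0 then Complex (2 * u - 1) (- h) else if s = 1 then Complex 1 (h * (2 * u - 1))
     else if s = 2 then Complex (1 - 2 * u) h else Complex (- 1) (h * (1 - 2 * u)))"

definition side_dir :: "real \<Rightarrow> nat \<Rightarrow> complex" where
  "side_dir h s = (if s = 0 then 2 else if s = 1 then Complex 0 (2 * h) else if s = 2 then - 2
     else Complex 0 (- 2 * h))"

lemma Cauchy_thin_rectangle:
  assumes "f holomorphic_on UNIV" "h > 0" "\<bar>t\<bar> < 1"
  shows "(\<Sum>s<4. integral {0..1} (\<lambda>u. f (side h s u) / (side h s u - of_real t) * side_dir h s))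
     = of_real (2 * pi) * \<i> * f (of_real t)"
proof -
  define a1 a2 a3 a4 where a: "a1 = Complex (- 1) (- h)" "a2 = Complex 1 (- h)" "a3 = Complex 1 h" "a4 = Complex (- 1) h"
  define F where "F = (\<lambda>w. f w / (w - of_real t))"
  have box: "of_real t \<in> box a1 a3"
    using assms by (auto simp: a in_box_complex_iff)
  have "(F has_contour_integral (of_real (2 * pi) * \<i> * winding_number (rectpath a1 a3) (of_real t) * f (of_real t))) (rectpath a1 a3)"
    unfolding F_def
  proof (rule Cauchy_integral_formula_convex_simple[OF convex_UNIV assms(1)])
    show "path_image (rectpath a1 a3) \<subseteq> UNIV - {of_real t}"
      using box assms by (subst path_image_rectpath_cbox_minus_box) (auto simp: a)
  qed auto
  then have tot: "(F has_contour_integral (of_real (2 * pi) * \<i> * f (of_real t))) (rectpath a1 a3)"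
    using winding_number_rectpath[OF box] by simp
  have rp: "rectpath a1 a3 = linepath a1 a2 +++ linepath a2 a3 +++ linepath a3 a4 +++ linepath a4 a1"
    by (simp add: rectpath_def Let_def a)
  have "F contour_integrable_on (rectpath a1 a3)"
    using tot by (auto simp: contour_integrable_on_def)
  then have int: "F contour_integrable_on (linepath a1 a2)" "F contour_integrable_on (linepath a2 a3)"
    "F contour_integrable_on (linepath a3 a4)" "F contour_integrable_on (linepath a4 a1)"
    unfolding rp by (auto simp: contour_integrable_joinI)
  have lin: "contour_integral (linepath p q) F = integral {0..1} (\<lambda>u. F (linepath p q u) * (q - p))" for p q
    unfolding contour_integral_integral by (simp add: vector_derivative_linepath_at)
  have sides: "linepath a1 a2 = side h 0" "linepath a2 a3 = side h 1" "linepath a3 a4 = side h 2" "linepath a4 a1 = side h 3"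
    by (auto simp: fun_eq_iff linepath_def side_def a complex_eq_iff algebra_simps)
  have dirs: "a2 - a1 = side_dir h 0" "a3 - a2 = side_dir h 1" "a4 - a3 = side_dir h 2" "a1 - a4 = side_dir h 3"
    by (auto simp: side_dir_def a complex_eq_iff)
  have "contour_integral (rectpath a1 a3) F = contour_integral (linepath a1 a2) F
      + contour_integral (linepath a2 a3) F + contour_integral (linepath a3 a4) F + contour_integral (linepath a4 a1) F"
    unfolding rp using int by (simp add: contour_integral_join contour_integrable_joinI)
  then have "contour_integral (rectpath a1 a3) F = (\<Sum>s\<in>{0,1,2,3}. integral {0..1} (\<lambda>u. F (side h s u) * side_dir h s))"
    unfolding lin by (simp add: sides dirs)
  moreover have "{0,1,2,3} = {..<4::nat}" by auto
  ultimately have "contour_integral (rectpath a1 a3) F = (\<Sum>s<4. integral {0..1} (\<lambda>u. F (side h s u) * side_dir h s))"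
    by (simp only:)
  moreover have "contour_integral (rectpath a1 a3) F = of_real (2 * pi) * \<i> * f (of_real t)"
    by (rule contour_integral_unique[OF tot])
  ultimately show ?thesis
    unfolding F_def by simp
qed

text \<open>The exponential of a family of polynomial growth need not grow polynomially. The uniform
  bound on the real part repairs this, and it is the reason for contours of height about
  \<open>1/j\<close>.\<close>

lemma tempered_exp:
  fixes f :: "nat \<Rightarrow> 'a::real_normed_vector \<Rightarrow> complex"
  assumes "open S" "tempered k S f" "\<And>j x. x \<in> S \<Longrightarrow> Re (f j x) \<le> M"
  shows "tempered k S (\<lambda>j x. exp (f j x))"
  using assms(2)
proof (induction k)
  have b: "poly_bounded S (\<lambda>j x. exp (f j x))"
    by (rule poly_boundedI[where A = "exp M" and B = 0]) (use assms(3) in \<open>auto simp: norm_exp_eq_Re\<close>)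
  {
    case 0
    then show ?case using b by (auto intro!: continuous_intros)
  next
    case (Suc k)
    show ?case
    proof (rule tempered_SucI[OF assms(1) b])
      show "((\<lambda>x. exp (f j x)) has_derivative (\<lambda>v. exp (f j x) * frechet_derivative (f j) (at x) v)) (at x)"
        if "x \<in> S" for j x
        by (rule has_derivative_compose[OF tempered_Suc_has_derivative[OF Suc.prems that]
              DERIV_exp[unfolded has_field_derivative_def]])
      show "tempered k S (\<lambda>j x. exp (f j x) * frechet_derivative (f j) (at x) v)" for v
        by (rule tempered_mult[OF assms(1) Suc.IH[OF tempered_Suc_imp[OF Suc.prems]]
              tempered_Suc_directional[OF Suc.prems]])
    qed
  }
qed

lemma tempered_of_real:
  "open S \<Longrightarrow> tempered k S f \<Longrightarrow> tempered k S (\<lambda>j x. complex_of_real (f j x))"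
  by (rule tempered_linear[OF bounded_linear_of_real])

lemma side_eq:
  "side h s u = (if s = 0 then of_real (2 * u - 1) - \<i> * of_real h
     else if s = 1 then 1 + \<i> * of_real (h * (2 * u - 1))
     else if s = 2 then of_real (1 - 2 * u) + \<i> * of_real h
     else - 1 + \<i> * of_real (h * (1 - 2 * u)))"
  by (auto simp: side_def complex_eq_iff)

lemma side_dir_eq:
  "side_dir h s = (if s = 0 then 2 else if s = 1 then \<i> * of_real (2 * h) else if s = 2 then - 2
     else \<i> * of_real (- 2 * h))"
  by (auto simp: side_dir_def complex_eq_iff)

text \<open>Fixed once and for all by choice, so that it can occur in the definitions of the
  weights.\<close>

definition cutoff :: "nat \<Rightarrow> real \<Rightarrow> real" where
  "cutoff = (SOME d. (\<forall>n x. (d n has_real_derivative d (Suc n) x) (at x)) \<and>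
     (\<forall>n. \<exists>M. \<forall>x. \<bar>d n x\<bar> \<le> M) \<and> (\<forall>x. 0 \<le> d 0 x \<and> d 0 x \<le> 1) \<and>
     (\<forall>x\<le>1/2. d 0 x = 0) \<and> (\<forall>x\<ge>1. d 0 x = 1))"

lemma cutoff:
  shows "(cutoff n has_real_derivative cutoff (Suc n) x) (at x)"
    and "\<exists>M. \<forall>x. \<bar>cutoff n x\<bar> \<le> M"
    and "0 \<le> cutoff 0 x" "cutoff 0 x \<le> 1"
    and "x \<le> 1/2 \<Longrightarrow> cutoff 0 x = 0" "x \<ge> 1 \<Longrightarrow> cutoff 0 x = 1"
proof -
  have "\<exists>d :: nat \<Rightarrow> real \<Rightarrow> real. (\<forall>n x. (d n has_real_derivative d (Suc n) x) (at x)) \<and>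
     (\<forall>n. \<exists>M. \<forall>x. \<bar>d n x\<bar> \<le> M) \<and> (\<forall>x. 0 \<le> d 0 x \<and> d 0 x \<le> 1) \<and>
     (\<forall>x\<le>1/2. d 0 x = 0) \<and> (\<forall>x\<ge>1. d 0 x = 1)"
    by (rule smooth_cutoff) blast
  from someI_ex[OF this, folded cutoff_def]
  show "(cutoff n has_real_derivative cutoff (Suc n) x) (at x)"
    and "\<exists>M. \<forall>x. \<bar>cutoff n x\<bar> \<le> M"
    and "0 \<le> cutoff 0 x" "cutoff 0 x \<le> 1"
    and "x \<le> 1/2 \<Longrightarrow> cutoff 0 x = 0" "x \<ge> 1 \<Longrightarrow> cutoff 0 x = 1"
    by blast+
qed

section \<open>Weights selecting admissible contours\<close>

context generic_polynomial
begin

text \<open>The interval exceeds \<open>{0..1}\<close> on both sides, but so little that all points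
  of the prolonged sides have norm at most 2, where the estimates for \<open>P\<close> hold.\<close>

definition UB :: "(real \<times> 'e) set" where "UB = {-1/4<..<5/4} \<times> ball 0 rad"

lemma open_UB: "open UB"
  by (auto simp: UB_def intro: open_Times)

lemma bounded_UB: "bounded UB"
  by (auto simp: UB_def intro: bounded_Times)

lemma tempered_fst_UB: "tempered k UB (\<lambda>j p. fst p)"
  by (rule tempered_linear[OF bounded_linear_fst open_UB tempered_bounded_id[OF open_UB bounded_UB]])

lemma tempered_snd_UB: "tempered k UB (\<lambda>j p. snd p)"
  by (rule tempered_linear[OF bounded_linear_snd open_UB tempered_bounded_id[OF open_UB bounded_UB]])

lemma tempered_ht: "\<nu> \<le> n \<Longrightarrow> tempered k UB (\<lambda>j p. ht j \<nu>)"
  using ht_pos[of _ \<nu>] ht_le_1[of \<nu>]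
  by (intro tempered_const_family[where A = 1 and B = 0] open_UB) (auto simp: less_imp_le)

lemma tempered_side: "\<nu> \<le> n \<Longrightarrow> tempered k UB (\<lambda>j p. side (ht j \<nu>) s (fst p))"
  unfolding side_eq
  by (cases "s = 0"; cases "s = 1"; cases "s = 2";
      simp only: if_True if_False simp_thms;
      intro tempered_add tempered_diff tempered_mult tempered_of_real tempered_const tempered_minus
        tempered_fst_UB tempered_ht open_UB; assumption)

lemma tempered_side_dir: "\<nu> \<le> n \<Longrightarrow> tempered k UB (\<lambda>j p. side_dir (ht j \<nu>) s)"
  unfolding side_dir_eq
  by (cases "s = 0"; cases "s = 1"; cases "s = 2";
      simp only: if_True if_False simp_thms;
      intro tempered_mult tempered_of_real tempered_const tempered_ht open_UB; assumption)

lemma tempered_pcoeff: "tempered k UB (\<lambda>j p. pcoeff (snd p) m)"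
proof (cases "m < n")
  case True
  have "tempered k UB (\<lambda>j p. snd p \<bullet> b m)"
    by (rule tempered_linear[OF bounded_linear_inner_left open_UB tempered_snd_UB])
  with True show ?thesis by (simp add: pcoeff_def)
qed (simp add: pcoeff_def tempered_const[OF open_UB])

lemma tempered_P:
  "tempered k UB z \<Longrightarrow> tempered k UB (\<lambda>j p. P (snd p) (z j p :: complex))"
  unfolding P_def
  by (intro tempered_sum tempered_mult tempered_of_real tempered_power tempered_pcoeff open_UB)

lemma tempered_Pquot:
  "tempered k UB z \<Longrightarrow> tempered k UB (\<lambda>j p. Pquot (snd p) i (z j p :: complex))"
  unfolding Pquot_def
  by (intro tempered_sum tempered_mult tempered_of_real tempered_power tempered_pcoeff open_UB)

text \<open>A smooth indicator of small values of \<open>P\<close> on the top side: 0 where the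
  modulus is at least \<open>gap j\<close>, and 1 where its square is at most half of
  \<open>(gap j)^2\<close>. The square of the modulus is used because the modulus is not
  smooth.\<close>

definition bad :: "nat \<Rightarrow> nat \<Rightarrow> real \<times> 'e \<Rightarrow> real" where
  "bad \<nu> j p = 1 - cutoff 0 ((1 / gap j)\<^sup>2 * (cmod (P (snd p) (side (ht j \<nu>) 2 (fst p))))\<^sup>2)"

text \<open>The integral measures how much of the top side is bad. A line without bad points gets
  weight 1; the factor \<open>20 * lip / gap j\<close> is calibrated so that a single point with
  modulus below \<open>gap j / 2\<close> forces weight 0. The weight is smooth in \<open>e\<close>,
  unlike a minimum over the line.\<close>

definition weight :: "nat \<Rightarrow> nat \<Rightarrow> 'e \<Rightarrow> real" where
  "weight \<nu> j e = 1 - cutoff 0 (20 * lip * (1 / gap j) * integral {0..1} (\<lambda>u. bad \<nu> j (u, e)))"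

definition nweight :: "nat \<Rightarrow> nat \<Rightarrow> 'e \<Rightarrow> real" where
  "nweight \<nu> j e = weight \<nu> j e / (\<Sum>\<mu>\<le>n. weight \<mu> j e)"

lemma inverse_gap_le: "norm (1 / gap j) \<le> (2 * (real n + 1)) ^ n * (1 + real j) ^ n"
  using inverse_gap[of j] gap_pos[of j] by simp

lemma tempered_bad: "\<nu> \<le> n \<Longrightarrow> tempered k UB (bad \<nu>)"
proof -
  assume \<nu>: "\<nu> \<le> n"
  have t: "tempered k UB (\<lambda>j p. P (snd p) (side (ht j \<nu>) 2 (fst p)))"
    by (rule tempered_P[OF tempered_side[OF \<nu>]])
  have "tempered k UB (\<lambda>j p. 1 / gap j)"
    by (rule tempered_const_family[OF open_UB inverse_gap_le])
  then show ?thesis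
    unfolding bad_def[abs_def] cmod_power2
    by (intro tempered_diff tempered_const tempered_compose_real[where d = cutoff] cutoff
        tempered_mult tempered_add tempered_power open_UB
        tempered_linear[OF bounded_linear_Re open_UB t] tempered_linear[OF bounded_linear_Im open_UB t])
qed

lemma tempered_weight: "\<nu> \<le> n \<Longrightarrow> tempered k (ball 0 rad) (weight \<nu>)"
proof -
  assume \<nu>: "\<nu> \<le> n"
  have i: "tempered k (ball 0 rad) (\<lambda>j e. integral {0..1} (\<lambda>u. bad \<nu> j (u, e)))"
    by (rule tempered_integral[where U = "{-1/4<..<5/4}"])
      (use tempered_bad[OF \<nu>] in \<open>auto simp: UB_def\<close>)
  have g: "tempered k (ball 0 rad) (\<lambda>j p. 1 / gap j)"
    by (rule tempered_const_family[OF open_ball inverse_gap_le])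
  show ?thesis
    unfolding weight_def[abs_def]
    by (intro tempered_diff tempered_const tempered_compose_real[where d = cutoff] cutoff
        tempered_mult open_ball i g)
qed

lemma weight_bounds: "0 \<le> weight \<nu> j e" "weight \<nu> j e \<le> 1"
  using cutoff(3,4) by (auto simp: weight_def)

lemma continuous_bad:
  assumes "\<nu> \<le> n" "e \<in> ball 0 rad"
  shows "continuous_on {0..1} (\<lambda>u. bad \<nu> j (u, e))"
  by (rule continuous_on_compose2[OF tempered_imp_continuous_on[OF tempered_bad[OF assms(1), of 0]]])
    (use assms(2) in \<open>auto simp: UB_def intro!: continuous_intros\<close>)

lemma norm_side_le: "0 \<le> h \<Longrightarrow> h \<le> 1 \<Longrightarrow> u \<in> {-1/4..5/4} \<Longrightarrow> norm (side h s u) \<le> 2"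
proof -
  assume h: "0 \<le> h" "h \<le> 1" and u: "u \<in> {-1/4..5/4}"
  have u2: "\<bar>2 * u - 1\<bar> \<le> 3/2" "\<bar>1 - 2 * u\<bar> \<le> 3/2" using u unfolding abs_le_iff by auto
  have hu: "\<bar>h * (2 * u - 1)\<bar> \<le> 3/2" "\<bar>h * (1 - 2 * u)\<bar> \<le> 3/2"
    using mult_mono[OF h(2) u2(1)] mult_mono[OF h(2) u2(2)] h by (simp_all add: abs_mult)
  have sq: "a\<^sup>2 \<le> 9/4" if "\<bar>a\<bar> \<le> 3/2" for a :: real
    using power_mono[OF that, of 2] by (simp add: power2_eq_square)
  have "h\<^sup>2 \<le> 1" using h by (simp add: power_le_one)
  then have "(Re (side h s u))\<^sup>2 + (Im (side h s u))\<^sup>2 \<le> 2\<^sup>2"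
    using sq[OF u2(1)] sq[OF u2(2)] sq[OF hu(1)] sq[OF hu(2)] by (auto simp: side_def)
  then show ?thesis
    unfolding cmod_def by (intro real_le_lsqrt) auto
qed

text \<open>If \<open>P\<close> were below \<open>gap j / 2\<close> at one point of the top side,
  the Lipschitz bound would keep it below \<open>6/10 * gap j\<close> on an interval of length
  \<open>gap j / (20 * lip)\<close>. There \<open>bad\<close> is 1, as
  \<open>(6/10)^2 \<le> 1/2\<close>, so its integral is large enough for the weight to
  vanish.\<close>

lemma weight_nonzero_imp:
  assumes "weight \<nu> j e \<noteq> 0" "\<nu> \<le> n" "e \<in> ball 0 rad" "u \<in> {0..1}"
  shows "gap j / 2 \<le> norm (P e (side (ht j \<nu>) 2 u))"
proof (rule ccontr)
  assume neg: "\<not> ?thesis"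
  \<comment> \<open>The side is run through with speed 2, so over a parameter distance
    \<open>\<kappa>\<close> the value of \<open>P\<close> changes by at most
    \<open>2 * lip * \<kappa> = gap j / 10\<close>.\<close>
  define \<kappa> where "\<kappa> = gap j / (20 * lip)"
  have \<kappa>: "0 < \<kappa>" "\<kappa> \<le> 1/2" "2 * lip * \<kappa> = gap j / 10"
    using gap_pos[of j] gap_le_1[of j] lip_ge by (auto simp: \<kappa>_def field_simps)
  have h: "0 \<le> ht j \<nu>" "ht j \<nu> \<le> 1"
    using ht_pos[of j \<nu>] ht_le_1[OF assms(2)] by auto
  have bad1: "bad \<nu> j (v, e) = 1" if v: "v \<in> {0..1}" "\<bar>v - u\<bar> \<le> \<kappa>" for v
  proof -
    have "side (ht j \<nu>) 2 v - side (ht j \<nu>) 2 u = of_real (2 * (u - v))"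
      by (simp add: side_def complex_eq_iff)
    then have "norm (side (ht j \<nu>) 2 v - side (ht j \<nu>) 2 u) \<le> 2 * \<kappa>"
      using v(2) by (simp only: norm_of_real) auto
    then have "lip * norm (side (ht j \<nu>) 2 v - side (ht j \<nu>) 2 u) \<le> lip * (2 * \<kappa>)"
      using lip_ge by (intro mult_left_mono) auto
    then have "norm (P e (side (ht j \<nu>) 2 v) - P e (side (ht j \<nu>) 2 u)) \<le> gap j / 10"
      using P_lipschitz[OF assms(3) norm_side_le[OF h, of v 2] norm_side_le[OF h, of u 2]] v(1) assms(4) \<kappa>(3)
      by simp
    then have "norm (P e (side (ht j \<nu>) 2 v)) \<le> 6/10 * gap j"
      using neg norm_triangle_sub[of "P e (side (ht j \<nu>) 2 v)" "P e (side (ht j \<nu>) 2 u)"] by simp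
    then have "(1 / gap j) * norm (P e (side (ht j \<nu>) 2 v)) \<le> 6/10"
      using gap_pos[of j] by (simp add: field_simps)
    then have "((1 / gap j) * norm (P e (side (ht j \<nu>) 2 v)))\<^sup>2 \<le> (6/10)\<^sup>2"
      using gap_pos[of j] by (intro power_mono) auto
    then show ?thesis
      by (simp add: bad_def cutoff(5) power_mult_distrib power_divide)
  qed
  \<comment> \<open>The interval extends from \<open>u\<close> to the side on which it fits into
    \<open>{0..1}\<close>; there is room because \<open>\<kappa> \<le> 1/2\<close>.\<close>
  obtain a where a: "{a..a + \<kappa>} \<subseteq> {0..1}" "u \<in> {a..a + \<kappa>}"
  proof (cases "u \<le> 1/2")
    case True
    then show thesis using that[of u] \<kappa> assms(4) by auto
  next
    case False
    then show thesis using that[of "u - \<kappa>"] \<kappa> assms(4) by auto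
  qed
  have int: "(\<lambda>v. bad \<nu> j (v, e)) integrable_on {0..1}"
    by (rule integrable_continuous_interval[OF continuous_bad[OF assms(2,3)]])
  have "\<kappa> = integral {a..a + \<kappa>} (\<lambda>v. 1)"
    using \<kappa>(1) by simp
  also have "\<dots> \<le> integral {a..a + \<kappa>} (\<lambda>v. bad \<nu> j (v, e))"
    by (rule integral_le) (use bad1 a in \<open>auto intro!: integrable_subinterval_real[OF int a(1)]\<close>)
  also have "\<dots> \<le> integral {0..1} (\<lambda>v. bad \<nu> j (v, e))"
    by (rule integral_subset_le[OF a(1) integrable_subinterval_real[OF int a(1)] int])
      (use cutoff(4) in \<open>auto simp: bad_def\<close>)
  finally have "1 \<le> 20 * lip * (1 / gap j) * integral {0..1} (\<lambda>v. bad \<nu> j (v, e))"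
    using lip_ge gap_pos[of j] by (simp add: \<kappa>_def field_simps)
  then have "weight \<nu> j e = 0"
    by (simp add: weight_def cutoff(6))
  with assms(1) show False by simp
qed

lemma weight_eq_1_exists:
  obtains \<nu> where "\<nu> \<le> n" "weight \<nu> j e = 1"
proof -
  obtain \<nu> where \<nu>: "\<nu> \<le> n" "\<And>x. gap j \<le> norm (P e (Complex x (ht j \<nu>)))"
    using good_height_exists by blast
  have "bad \<nu> j (u, e) = 0" for u
  proof -
    have "gap j \<le> norm (P e (side (ht j \<nu>) 2 u))"
      using \<nu>(2) by (simp add: side_def)
    then have "1 \<le> (1 / gap j) * norm (P e (side (ht j \<nu>) 2 u))"
      using gap_pos[of j] by (simp add: field_simps)
    then have "1\<^sup>2 \<le> ((1 / gap j) * norm (P e (side (ht j \<nu>) 2 u)))\<^sup>2"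
      by (intro power_mono) auto
    then show ?thesis
      by (simp add: bad_def cutoff(6) power_mult_distrib power_divide)
  qed
  then have "weight \<nu> j e = 1"
    by (simp add: weight_def cutoff(5))
  with \<nu>(1) show thesis by (rule that)
qed

lemma sum_weight_ge: "1 \<le> (\<Sum>\<mu>\<le>n. weight \<mu> j e)"
proof -
  obtain \<nu> where "\<nu> \<le> n" "weight \<nu> j e = 1"
    by (rule weight_eq_1_exists)
  then show ?thesis
    using member_le_sum[of \<nu> "{..n}" "\<lambda>\<mu>. weight \<mu> j e"] weight_bounds by auto
qed

lemma sum_nweight: "(\<Sum>\<nu>\<le>n. nweight \<nu> j e) = 1"
  using sum_weight_ge[of j e] by (simp add: nweight_def flip: sum_divide_distrib)

lemma tempered_nweight: "\<nu> \<le> n \<Longrightarrow> tempered k (ball 0 rad) (nweight \<nu>)"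
  unfolding nweight_def[abs_def]
proof (rule tempered_divide[where A = 1 and B = 0])
  show "tempered k (ball 0 rad) (\<lambda>j e. \<Sum>\<mu>\<le>n. weight \<mu> j e)"
    by (intro tempered_sum tempered_weight) auto
  show "1 \<le> 1 * (1 + real j) ^ 0 * norm (\<Sum>\<mu>\<le>n. weight \<mu> j e)" for j e
    using sum_weight_ge[of j e] by simp
qed (auto intro: tempered_weight)

text \<open>Points with real part of modulus at least 1, that is the vertical sides and the
  prolongations of the horizontal ones, lie in the annulus of \<open>P_lower_bound\<close>. The top
  side is controlled by its weight, and the bottom side is its conjugate, \<open>P\<close> having
  real coefficients.\<close>

lemma P_side_lower_bound:
  assumes "nweight \<nu> j e \<noteq> 0" "\<nu> \<le> n" "(u, e) \<in> UB"
  shows "gap j / 2 \<le> norm (P e (side (ht j \<nu>) s u))"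
proof -
  have w: "weight \<nu> j e \<noteq> 0" using assms(1) by (auto simp: nweight_def)
  have e: "e \<in> ball 0 rad" and u: "u \<in> {-1/4..5/4}" using assms(3) by (auto simp: UB_def)
  have h: "0 \<le> ht j \<nu>" "ht j \<nu> \<le> 1"
    using ht_pos[of j \<nu>] ht_le_1[OF assms(2)] by auto
  show ?thesis
  proof (cases "\<bar>Re (side (ht j \<nu>) s u)\<bar> \<ge> 1")
    case True
    then have "1 \<le> norm (side (ht j \<nu>) s u)"
      using abs_Re_le_cmod order_trans by blast
    then have "1/2 \<le> norm (P e (side (ht j \<nu>) s u))"
      by (rule P_lower_bound[OF e _ norm_side_le[OF h u]])
    then show ?thesis using gap_le_1[of j] by linarith
  next
    case False
    then have "s = 0 \<or> s = 2"
      by (auto simp: side_def split: if_splits)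
    then show ?thesis
    proof
      assume s: "s = 2"
      then have "u \<in> {0..1}" using False by (auto simp: side_def)
      then show ?thesis unfolding s by (rule weight_nonzero_imp[OF w assms(2) e])
    next
      assume s: "s = 0"
      then have "1 - u \<in> {0..1}" using False by (auto simp: side_def)
      then have "gap j / 2 \<le> norm (P e (side (ht j \<nu>) 2 (1 - u)))"
        by (rule weight_nonzero_imp[OF w assms(2) e])
      moreover have "side (ht j \<nu>) s u = cnj (side (ht j \<nu>) 2 (1 - u))"
        by (simp add: s side_def complex_eq_iff)
      ultimately show ?thesis
        by (simp flip: cnj_P)
    qed
  qed
qed

section \<open>Division of exponentials\<close>

text \<open>The weighted form \<open>exp (\<i> j z) dz / P e z\<close> on one side of one contour.
  The denominator can vanish only where the weight vanishes, and there division by zero yields the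
  intended value 0.\<close>

definition kern :: "nat \<Rightarrow> nat \<Rightarrow> nat \<Rightarrow> real \<times> 'e \<Rightarrow> complex" where
  "kern \<nu> s j p = of_real (nweight \<nu> j (snd p)) * exp (\<i> * of_real (real j) * side (ht j \<nu>) s (fst p))
     * side_dir (ht j \<nu>) s / P (snd p) (side (ht j \<nu>) s (fst p))"

definition UTB :: "(real \<times> real \<times> 'e) set" where
  "UTB = {-1/4<..<5/4} \<times> {-1/2<..<1/2} \<times> ball 0 rad"

definition kern_quot :: "nat \<Rightarrow> nat \<Rightarrow> nat \<Rightarrow> real \<times> real \<times> 'e \<Rightarrow> complex" where
  "kern_quot \<nu> s j w = kern \<nu> s j (fst w, snd (snd w)) / (side (ht j \<nu>) s (fst w) - of_real (fst (snd w)))"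

definition quotient :: "nat \<Rightarrow> real \<times> 'e \<Rightarrow> complex" where
  "quotient j x = (\<Sum>\<nu>\<le>n. \<Sum>s<4. integral {0..1} (\<lambda>u. kern_quot \<nu> s j (u, x))) / (of_real (2 * pi) * \<i>)"

definition remainder :: "nat \<Rightarrow> nat \<Rightarrow> 'e \<Rightarrow> complex" where
  "remainder i j e = (\<Sum>\<nu>\<le>n. \<Sum>s<4. integral {0..1} (\<lambda>u. kern \<nu> s j (u, e) * Pquot e i (side (ht j \<nu>) s u)))
     / (of_real (2 * pi) * \<i>)"

lemma tempered_kern: "\<nu> \<le> n \<Longrightarrow> tempered k UB (kern \<nu> s)"
  unfolding kern_def[abs_def]
proof (rule tempered_divide[OF open_UB, where A = "2 * (2 * (real n + 1)) ^ n" and B = n])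
  assume \<nu>: "\<nu> \<le> n"
  have w: "tempered k UB (\<lambda>j p. nweight \<nu> j (snd p))"
    by (rule tempered_pullback[OF bounded_linear_snd open_ball open_UB _ tempered_nweight[OF \<nu>]])
      (auto simp: UB_def)
  have e: "tempered k UB (\<lambda>j p. exp (\<i> * of_real (real j) * side (ht j \<nu>) s (fst p)))"
  \<comment> \<open>On the prolonged sides the imaginary part is at most twice the height in
    modulus, and the height times \<open>j\<close> is at most 1.\<close>
  proof (rule tempered_exp[OF open_UB, where M = 2])
    show "tempered k UB (\<lambda>j p. \<i> * of_real (real j) * side (ht j \<nu>) s (fst p))"
      by (intro tempered_mult tempered_of_real tempered_side[OF \<nu>] tempered_const open_UB
          tempered_const_family[where A = 1 and B = 1]) auto
    fix j and p :: "real \<times> 'e" assume "p \<in> UB"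
    then have u: "\<bar>2 * fst p - 1\<bar> \<le> 2" "\<bar>1 - 2 * fst p\<bar> \<le> 2"
      by (auto simp: UB_def abs_le_iff)
    have h: "0 < ht j \<nu>" by (rule ht_pos)
    have hj: "ht j \<nu> * real j \<le> 1" "0 \<le> ht j \<nu> * real j"
      using ht_le[OF \<nu>, of j] h by (auto simp: algebra_simps)
    have "\<bar>Im (side (ht j \<nu>) s (fst p))\<bar> \<le> 2 * ht j \<nu>"
      using mult_left_mono[OF u(1), of "ht j \<nu>"] mult_left_mono[OF u(2), of "ht j \<nu>"] h
      by (auto simp: side_def abs_mult)
    then have "real j * \<bar>Im (side (ht j \<nu>) s (fst p))\<bar> \<le> real j * (2 * ht j \<nu>)"
      by (intro mult_left_mono) auto
    also have "\<dots> \<le> 2" using hj by (simp add: mult_ac)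
    finally have "\<bar>real j * Im (side (ht j \<nu>) s (fst p))\<bar> \<le> 2"
      by (simp add: abs_mult)
    then show "Re (\<i> * of_real (real j) * side (ht j \<nu>) s (fst p)) \<le> 2"
      by simp
  qed
  show "tempered k UB (\<lambda>j p. of_real (nweight \<nu> j (snd p)) * exp (\<i> * of_real (real j) * side (ht j \<nu>) s (fst p))
     * side_dir (ht j \<nu>) s)"
    by (intro tempered_mult tempered_of_real w e tempered_side_dir[OF \<nu>] open_UB)
  show "tempered k UB (\<lambda>j p. P (snd p) (side (ht j \<nu>) s (fst p)))"
    by (rule tempered_P[OF tempered_side[OF \<nu>]])
  fix j and p :: "real \<times> 'e"
  assume p: "p \<in> UB" and nz: "of_real (nweight \<nu> j (snd p)) * exp (\<i> * of_real (real j) * side (ht j \<nu>) s (fst p))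
     * side_dir (ht j \<nu>) s \<noteq> 0"
  then have "gap j / 2 \<le> norm (P (snd p) (side (ht j \<nu>) s (fst p)))"
    by (intro P_side_lower_bound[OF _ \<nu>]) auto
  then have "1 \<le> 2 * (1 / gap j) * norm (P (snd p) (side (ht j \<nu>) s (fst p)))"
    using gap_pos[of j] by (simp add: field_simps)
  then show "1 \<le> 2 * (2 * (real n + 1)) ^ n * (1 + real j) ^ n * norm (P (snd p) (side (ht j \<nu>) s (fst p)))"
    unfolding inverse_gap by (simp only: mult.assoc)
qed simp

lemma open_UTB: "open UTB"
  by (auto simp: UTB_def intro!: open_Times)

text \<open>With \<open>\<bar>t\<bar> < 1/2\<close> the horizontal sides are at distance at least
  the height from \<open>t\<close>, the vertical ones at distance at least 1/2. The height is of
  order \<open>1/j\<close>, so the Cauchy kernel grows only polynomially in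
  \<open>j\<close>.\<close>

lemma side_minus_real:
  assumes "\<bar>t\<bar> < 1/2" "\<nu> \<le> n"
  shows "1 \<le> 2 * (real n + 1) * (1 + real j) ^ 1 * norm (side (ht j \<nu>) s u - of_real t)"
proof -
  have h: "0 < ht j \<nu>" "ht j \<nu> \<le> 1"
    using ht_pos ht_le_1[OF assms(2)] by auto
  have "ht j \<nu> / 2 \<le> norm (side (ht j \<nu>) s u - of_real t)"
  proof (cases "s = 0 \<or> s = 2")
    case True
    then have "ht j \<nu> \<le> \<bar>Im (side (ht j \<nu>) s u - of_real t)\<bar>"
      using h by (auto simp: side_def)
    then show ?thesis using abs_Im_le_cmod[of "side (ht j \<nu>) s u - of_real t"] h by linarith
  next
    case False
    then have "1/2 \<le> \<bar>Re (side (ht j \<nu>) s u - of_real t)\<bar>"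
      using assms(1) by (auto simp: side_def)
    then show ?thesis using abs_Re_le_cmod[of "side (ht j \<nu>) s u - of_real t"] h by linarith
  qed
  then have "(real n + 1) * (1 + real j) * ht j \<nu> \<le> (real n + 1) * (1 + real j) * (2 * norm (side (ht j \<nu>) s u - of_real t))"
    by (intro mult_left_mono) auto
  from order_trans[OF ht_ge this] show ?thesis by (simp add: algebra_simps)
qed

lemma tempered_kern_quot: "\<nu> \<le> n \<Longrightarrow> tempered k UTB (kern_quot \<nu> s)"
  unfolding kern_quot_def[abs_def]
proof (rule tempered_divide[OF open_UTB, where A = "2 * (real n + 1)" and B = 1])
  assume \<nu>: "\<nu> \<le> n"
  have L: "bounded_linear (\<lambda>w :: real \<times> real \<times> 'e. (fst w, snd (snd w)))"
    by (intro bounded_linear_Pair bounded_linear_fst bounded_linear_compose[OF bounded_linear_snd bounded_linear_snd])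
  have L2: "bounded_linear (\<lambda>w :: real \<times> real \<times> 'e. fst (snd w))"
    by (rule bounded_linear_compose[OF bounded_linear_fst bounded_linear_snd])
  have LU: "w \<in> UTB \<Longrightarrow> (fst w, snd (snd w)) \<in> UB" for w
    by (auto simp: UTB_def UB_def)
  show "tempered k UTB (\<lambda>j w. kern \<nu> s j (fst w, snd (snd w)))"
    by (rule tempered_pullback[OF L open_UB open_UTB LU tempered_kern[OF \<nu>]])
  have "bounded UTB" by (auto simp: UTB_def intro!: bounded_Times)
  then have t: "tempered k UTB (\<lambda>j w. fst (snd w))"
    by (intro tempered_linear[OF L2 open_UTB] tempered_bounded_id open_UTB)
  have s: "tempered k UTB (\<lambda>j w. side (ht j \<nu>) s (fst (fst w, snd (snd w))))"
    by (rule tempered_pullback[OF L open_UB open_UTB LU tempered_side[OF \<nu>]])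
  show "tempered k UTB (\<lambda>j w. side (ht j \<nu>) s (fst w) - of_real (fst (snd w)))"
    using s by (intro tempered_diff tempered_of_real t open_UTB) simp
  fix j and w :: "real \<times> real \<times> 'e" assume "w \<in> UTB"
  then show "1 \<le> 2 * (real n + 1) * (1 + real j) ^ 1 * norm (side (ht j \<nu>) s (fst w) - of_real (fst (snd w)))"
    by (intro side_minus_real \<nu>) (auto simp: UTB_def)
qed simp

lemma tempered_quotient: "tempered k ({-1/2<..<1/2} \<times> ball 0 rad) quotient"
proof -
  have o: "open ({-1/2<..<1/2 :: real} \<times> ball (0::'e) rad)" by (intro open_Times) auto
  have I: "tempered k ({-1/2<..<1/2} \<times> ball 0 rad) (\<lambda>j x. integral {0..1} (\<lambda>u. kern_quot \<nu> s j (u, x)))"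
    if "\<nu> \<le> n" for \<nu> s
    by (rule tempered_integral[where U = "{-1/4<..<5/4}"])
      (use tempered_kern_quot[OF that] o in \<open>auto simp: UTB_def\<close>)
  have eq: "quotient = (\<lambda>j x. (\<Sum>\<nu>\<le>n. \<Sum>s<4. integral {0..1} (\<lambda>u. kern_quot \<nu> s j (u, x)))
      * inverse (of_real (2 * pi) * \<i>))"
    by (intro ext) (simp only: quotient_def divide_inverse)
  show ?thesis
    unfolding eq
    by (rule tempered_mult[OF o _ tempered_const[OF o]], rule tempered_sum[OF o], rule tempered_sum[OF o], rule I) simp
qed

lemma tempered_kern_Pquot: "\<nu> \<le> n \<Longrightarrow>
    tempered k UB (\<lambda>j p. kern \<nu> s j p * Pquot (snd p) i (side (ht j \<nu>) s (fst p)))"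
  by (intro tempered_mult tempered_kern tempered_Pquot tempered_side open_UB)

lemma tempered_remainder: "tempered k (ball 0 rad) (remainder i)"
proof -
  have "tempered k (ball 0 rad) (\<lambda>j e. integral {0..1} (\<lambda>u. (\<lambda>j p. kern \<nu> s j p * Pquot (snd p) i (side (ht j \<nu>) s (fst p))) j (u, e)))"
    if "\<nu> \<le> n" for \<nu> s
    by (rule tempered_integral[where U = "{-1/4<..<5/4}"])
      (use tempered_kern_Pquot[OF that] in \<open>auto simp: UB_def\<close>)
  then show ?thesis
    unfolding remainder_def[abs_def] divide_inverse
    by (intro tempered_mult tempered_sum tempered_const open_ball) auto
qed

text \<open>Cauchy's formula and \<open>P z = (P z - P t) + P t\<close>; it does not matter which roots the
  contours enclose.\<close>

lemma exp_division:
  assumes t: "\<bar>t\<bar> < 1/2" and e: "e \<in> ball 0 rad"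
  shows "exp (\<i> * of_real (real j) * of_real t)
    = quotient j (t, e) * P e (of_real t) + (\<Sum>i<n. remainder i j e * of_real t ^ i)"
proof -
  define f where "f = (\<lambda>z. exp (\<i> * of_real (real j) * z))"
  have hol: "f holomorphic_on UNIV"
    unfolding f_def by (intro holomorphic_intros)
  have one: "of_real (nweight \<nu> j e) * (of_real (2 * pi) * \<i> * f (of_real t))
    = (\<Sum>s<4. integral {0..1} (\<lambda>u. kern_quot \<nu> s j (u, (t, e)))) * P e (of_real t)
      + (\<Sum>i<n. (\<Sum>s<4. integral {0..1} (\<lambda>u. kern \<nu> s j (u, e) * Pquot e i (side (ht j \<nu>) s u))) * of_real t ^ i)"
    if \<nu>: "\<nu> \<le> n" for \<nu>
  proof -
    have "of_real (nweight \<nu> j e) * (of_real (2 * pi) * \<i> * f (of_real t))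
      = (\<Sum>s<4. of_real (nweight \<nu> j e) * integral {0..1} (\<lambda>u. f (side (ht j \<nu>) s u) / (side (ht j \<nu>) s u - of_real t) * side_dir (ht j \<nu>) s))"
      using Cauchy_thin_rectangle[OF hol ht_pos, of t j \<nu>] t by (simp flip: sum_distrib_left)
    also have "\<dots> = (\<Sum>s<4. integral {0..1} (\<lambda>u. kern_quot \<nu> s j (u, (t, e))) * P e (of_real t)
      + (\<Sum>i<n. integral {0..1} (\<lambda>u. kern \<nu> s j (u, e) * Pquot e i (side (ht j \<nu>) s u)) * of_real t ^ i))"
    proof (rule sum.cong[OF refl])
      fix s
      have i1: "(\<lambda>u. kern_quot \<nu> s j (u, (t, e))) integrable_on {0..1}"
        by (intro integrable_continuous_interval
            continuous_on_compose2[OF tempered_imp_continuous_on[OF tempered_kern_quot[OF \<nu>, of 0]]])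
          (use t e in \<open>auto simp: UTB_def intro!: continuous_intros\<close>)
      have i2: "(\<lambda>u. kern \<nu> s j (u, e) * Pquot e i (side (ht j \<nu>) s u)) integrable_on {0..1}" for i
      proof -
        have "continuous_on {0..1} (\<lambda>u::real. (u, e))" by (intro continuous_intros)
        then have "continuous_on {0..1} (\<lambda>u. kern \<nu> s j (u, e) * Pquot (snd (u, e)) i (side (ht j \<nu>) s (fst (u, e))))"
          by (rule continuous_on_compose2[OF tempered_imp_continuous_on[OF tempered_kern_Pquot[OF \<nu>, of 0]]])
            (use e in \<open>auto simp: UB_def\<close>)
        then show ?thesis by (simp add: integrable_continuous_interval)
      qed
      have "of_real (nweight \<nu> j e) * integral {0..1} (\<lambda>u. f (side (ht j \<nu>) s u) / (side (ht j \<nu>) s u - of_real t) * side_dir (ht j \<nu>) s)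
        = integral {0..1} (\<lambda>u. of_real (nweight \<nu> j e) * (f (side (ht j \<nu>) s u) / (side (ht j \<nu>) s u - of_real t) * side_dir (ht j \<nu>) s))"
        by (rule integral_mult_right[symmetric])
      also have "\<dots> = integral {0..1} (\<lambda>u. kern_quot \<nu> s j (u, (t, e)) * P e (of_real t)
          + (\<Sum>i<n. kern \<nu> s j (u, e) * Pquot e i (side (ht j \<nu>) s u) * of_real t ^ i))"
      proof (rule integral_cong)
        fix u :: real assume u: "u \<in> {0..1}"
        define z where "z = side (ht j \<nu>) s u"
        have zt: "z - of_real t \<noteq> 0"
          using side_minus_real[OF t \<nu>, of j s u] by (auto simp: z_def)
        show "of_real (nweight \<nu> j e) * (f (side (ht j \<nu>) s u) / (side (ht j \<nu>) s u - of_real t) * side_dir (ht j \<nu>) s)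
          = kern_quot \<nu> s j (u, (t, e)) * P e (of_real t)
          + (\<Sum>i<n. kern \<nu> s j (u, e) * Pquot e i (side (ht j \<nu>) s u) * of_real t ^ i)"
        proof (cases "nweight \<nu> j e = 0")
          case True
          then show ?thesis by (simp add: kern_quot_def kern_def)
        next
          case False
          have "(u, e) \<in> UB" using u e by (auto simp: UB_def)
          then have "P e z \<noteq> 0"
            using P_side_lower_bound[OF False \<nu>, of u s] gap_pos[of j] by (auto simp: z_def)
          then have k: "of_real (nweight \<nu> j e) * f z * side_dir (ht j \<nu>) s = kern \<nu> s j (u, e) * P e z"
            by (simp add: kern_def f_def z_def)
          have "of_real (nweight \<nu> j e) * (f z / (z - of_real t) * side_dir (ht j \<nu>) s)
              = kern \<nu> s j (u, e) * P e z / (z - of_real t)"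
            unfolding k[symmetric] by simp
          also have "\<dots> = kern \<nu> s j (u, e) / (z - of_real t) * P e (of_real t)
              + kern \<nu> s j (u, e) * ((P e z - P e (of_real t)) / (z - of_real t))"
            by (simp add: algebra_simps diff_divide_distrib)
          also have "(P e z - P e (of_real t)) / (z - of_real t) = (\<Sum>i<n. Pquot e i z * of_real t ^ i)"
            unfolding P_diff using zt by simp
          finally show ?thesis
            by (simp add: kern_quot_def z_def sum_distrib_left mult.assoc)
        qed
      qed
      also have "\<dots> = integral {0..1} (\<lambda>u. kern_quot \<nu> s j (u, (t, e)) * P e (of_real t))
          + integral {0..1} (\<lambda>u. \<Sum>i<n. kern \<nu> s j (u, e) * Pquot e i (side (ht j \<nu>) s u) * of_real t ^ i)"
        by (intro integral_add integrable_on_mult_left i1 i2 integrable_sum) simp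
      also have "integral {0..1} (\<lambda>u. \<Sum>i<n. kern \<nu> s j (u, e) * Pquot e i (side (ht j \<nu>) s u) * of_real t ^ i)
          = (\<Sum>i<n. integral {0..1} (\<lambda>u. kern \<nu> s j (u, e) * Pquot e i (side (ht j \<nu>) s u) * of_real t ^ i))"
        by (intro integral_sum integrable_on_mult_left i2) simp
      finally show "of_real (nweight \<nu> j e) * integral {0..1} (\<lambda>u. f (side (ht j \<nu>) s u) / (side (ht j \<nu>) s u - of_real t) * side_dir (ht j \<nu>) s)
        = integral {0..1} (\<lambda>u. kern_quot \<nu> s j (u, (t, e))) * P e (of_real t)
        + (\<Sum>i<n. integral {0..1} (\<lambda>u. kern \<nu> s j (u, e) * Pquot e i (side (ht j \<nu>) s u)) * of_real t ^ i)"
        by simp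
    qed
    also have "\<dots> = (\<Sum>s<4. integral {0..1} (\<lambda>u. kern_quot \<nu> s j (u, (t, e)))) * P e (of_real t)
      + (\<Sum>s<4. \<Sum>i<n. integral {0..1} (\<lambda>u. kern \<nu> s j (u, e) * Pquot e i (side (ht j \<nu>) s u)) * of_real t ^ i)"
      by (simp only: sum.distrib sum_distrib_right)
    also have "(\<Sum>s<4. \<Sum>i<n. integral {0..1} (\<lambda>u. kern \<nu> s j (u, e) * Pquot e i (side (ht j \<nu>) s u)) * of_real t ^ i)
      = (\<Sum>i<n. (\<Sum>s<4. integral {0..1} (\<lambda>u. kern \<nu> s j (u, e) * Pquot e i (side (ht j \<nu>) s u))) * of_real t ^ i)"
      by (subst sum.swap) (simp only: sum_distrib_right)
    finally show ?thesis .
  qed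
  \<comment> \<open>The identity holds for every contour, multiplied by its weight; as the weights
    sum to 1, adding up restores the left-hand side.\<close>
  have "of_real (2 * pi) * \<i> * f (of_real t)
    = (\<Sum>\<nu>\<le>n. of_real (nweight \<nu> j e) * (of_real (2 * pi) * \<i> * f (of_real t)))"
  proof -
    have "(\<Sum>\<nu>\<le>n. complex_of_real (nweight \<nu> j e)) = 1"
      using sum_nweight[of j e] by (simp flip: of_real_sum)
    then show ?thesis
      by (simp only: sum_distrib_right[symmetric] mult_1)
  qed
  also have "\<dots> = (\<Sum>\<nu>\<le>n. \<Sum>s<4. integral {0..1} (\<lambda>u. kern_quot \<nu> s j (u, (t, e)))) * P e (of_real t)
      + (\<Sum>i<n. (\<Sum>\<nu>\<le>n. \<Sum>s<4. integral {0..1} (\<lambda>u. kern \<nu> s j (u, e) * Pquot e i (side (ht j \<nu>) s u))) * of_real t ^ i)"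
  proof -
    have "(\<Sum>\<nu>\<le>n. of_real (nweight \<nu> j e) * (of_real (2 * pi) * \<i> * f (of_real t)))
      = (\<Sum>\<nu>\<le>n. (\<Sum>s<4. integral {0..1} (\<lambda>u. kern_quot \<nu> s j (u, (t, e)))) * P e (of_real t)
      + (\<Sum>i<n. (\<Sum>s<4. integral {0..1} (\<lambda>u. kern \<nu> s j (u, e) * Pquot e i (side (ht j \<nu>) s u))) * of_real t ^ i))"
      by (rule sum.cong[OF refl]) (simp only: one atMost_iff)
    also have "\<dots> = (\<Sum>\<nu>\<le>n. \<Sum>s<4. integral {0..1} (\<lambda>u. kern_quot \<nu> s j (u, (t, e)))) * P e (of_real t)
      + (\<Sum>\<nu>\<le>n. \<Sum>i<n. (\<Sum>s<4. integral {0..1} (\<lambda>u. kern \<nu> s j (u, e) * Pquot e i (side (ht j \<nu>) s u))) * of_real t ^ i)"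
      by (simp only: sum.distrib sum_distrib_right)
    also have "(\<Sum>\<nu>\<le>n. \<Sum>i<n. (\<Sum>s<4. integral {0..1} (\<lambda>u. kern \<nu> s j (u, e) * Pquot e i (side (ht j \<nu>) s u))) * of_real t ^ i)
      = (\<Sum>i<n. (\<Sum>\<nu>\<le>n. \<Sum>s<4. integral {0..1} (\<lambda>u. kern \<nu> s j (u, e) * Pquot e i (side (ht j \<nu>) s u))) * of_real t ^ i)"
      by (subst sum.swap) (simp only: sum_distrib_right)
    finally show ?thesis .
  qed
  finally have *: "of_real (2 * pi) * \<i> * f (of_real t)
    = (\<Sum>\<nu>\<le>n. \<Sum>s<4. integral {0..1} (\<lambda>u. kern_quot \<nu> s j (u, (t, e)))) * P e (of_real t)
      + (\<Sum>i<n. (\<Sum>\<nu>\<le>n. \<Sum>s<4. integral {0..1} (\<lambda>u. kern \<nu> s j (u, e) * Pquot e i (side (ht j \<nu>) s u))) * of_real t ^ i)" .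
  have "f (of_real t) = of_real (2 * pi) * \<i> * f (of_real t) / (of_real (2 * pi) * \<i>)"
    by simp
  also have "\<dots> = quotient j (t, e) * P e (of_real t) + (\<Sum>i<n. remainder i j e * of_real t ^ i)"
  proof -
    have gen: "(A * p + (\<Sum>i<n. B i * x ^ i)) / c = A / c * p + (\<Sum>i<n. B i / c * x ^ i)"
      for A p c x :: complex and B
      by (simp add: add_divide_distrib sum_divide_distrib)
    show ?thesis
      unfolding * quotient_def remainder_def by (rule gen)
  qed
  finally show ?thesis by (simp add: f_def)
qed

text \<open>After multiplication by a cutoff the function has a Fourier series; each exponential is
  divided by \<open>exp_division\<close>, and rapidly decreasing coefficients outweigh the
  polynomial growth of quotients and remainders. Smoothness in \<open>e\<close> includes the
  polynomials whose roots collide or leave the real line.\<close>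

theorem division:
  fixes f :: "real \<Rightarrow> real"
  assumes "r > 0" "smooth_on (ball 0 r) f"
  obtains \<delta> Q R where "\<delta> > 0" "smooth_on (ball 0 \<delta> \<times> ball 0 \<delta>) Q"
    "\<And>i. smooth_on (ball 0 \<delta>) (R i)"
    "\<And>t e. t \<in> ball 0 \<delta> \<Longrightarrow> e \<in> ball 0 \<delta> \<Longrightarrow> f t = Q (t, e) * P e t + (\<Sum>i<n. R i e * t ^ i)"
proof -
  \<comment> \<open>The support must lie in the region \<open>\<bar>t\<bar> \<le> 1/2\<close> of the
    Fourier theorem and stay away from the boundary of the domain of \<open>f\<close>.\<close>
  define \<rho> where "\<rho> = min (r / 2) (1/2)"
  have \<rho>: "0 < \<rho>" "\<rho> < r" "\<rho> \<le> 1/2" using assms(1) by (auto simp: \<rho>_def)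
  define \<psi> where "\<psi> = (\<lambda>t. 1 - cutoff 0 ((t / \<rho>)\<^sup>2))"
  define g where "g = (\<lambda>t. if \<bar>t\<bar> < r then \<psi> t * f t else 0)"
  have smcut: "smooth_on UNIV (cutoff 0)"
    using smooth_on_realI[OF open_UNIV, of cutoff 0] cutoff(1)
    by (simp add: has_real_derivative_iff_has_vector_derivative)
  have sm\<psi>: "smooth_on UNIV \<psi>"
    unfolding \<psi>_def
    by (intro smooth_on_diff smooth_on_const open_UNIV smooth_on_compose[OF smcut open_UNIV open_UNIV, of "\<lambda>t. (t / \<rho>)\<^sup>2"]
        smooth_on_power smooth_on_divide smooth_on_id) (use \<rho> in auto)
  have \<psi>0: "\<psi> t = 0" if "\<bar>t\<bar> \<ge> \<rho>" for t
  proof -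
    have "1 \<le> \<bar>t / \<rho>\<bar>" using that \<rho> by simp
    then have "1\<^sup>2 \<le> \<bar>t / \<rho>\<bar>\<^sup>2" by (intro power_mono) auto
    then have "1 \<le> (t / \<rho>)\<^sup>2" by (simp only: power2_abs one_power2)
    then show ?thesis by (simp add: \<psi>_def cutoff(6))
  qed
  have \<psi>1: "\<psi> t = 1" if "\<bar>t\<bar> \<le> \<rho> / 2" for t
  proof -
    have "\<bar>t / \<rho>\<bar> \<le> 1/2" using that \<rho> by (simp add: field_simps)
    then have "\<bar>t / \<rho>\<bar>\<^sup>2 \<le> (1/2)\<^sup>2" by (intro power_mono) auto
    then have "(t / \<rho>)\<^sup>2 \<le> (1/2)\<^sup>2" by (simp only: power2_abs)
    also have "\<dots> \<le> (1/2 :: real)" by (simp add: power2_eq_square)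
    finally have "(t / \<rho>)\<^sup>2 \<le> 1/2" .
    then show ?thesis by (simp add: \<psi>_def cutoff(5))
  qed
  have smg: "smooth_on UNIV g"
  proof (rule smooth_on_local)
    fix t :: real
    show "\<exists>T. open T \<and> t \<in> T \<and> smooth_on T g"
    proof (cases "\<bar>t\<bar> < r")
      case True
      have "smooth_on (ball 0 r) (\<lambda>t. \<psi> t * f t)"
        by (intro smooth_on_mult assms(2) open_ball smooth_on_subset[OF sm\<psi>]) auto
      then have "smooth_on (ball 0 r) g"
        by (rule smooth_on_cong[rotated]) (auto simp: g_def)
      then show ?thesis using True by (intro exI[of _ "ball 0 r"]) auto
    next
      case False
      have o: "open {t :: real. \<rho> < \<bar>t\<bar>}" by (intro open_Collect_less continuous_intros)
      have "smooth_on {t :: real. \<rho> < \<bar>t\<bar>} (\<lambda>t. 0 :: real)" by (rule smooth_on_const[OF o])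
      then have "smooth_on {t :: real. \<rho> < \<bar>t\<bar>} g"
        by (rule smooth_on_cong[OF o]) (use \<psi>0 in \<open>auto simp: g_def\<close>)
      then show ?thesis using False \<rho> o by (intro exI[of _ "{t. \<rho> < \<bar>t\<bar>}"]) auto
    qed
  qed
  obtain c where c: "rapidly_decreasing c" "\<And>t. \<bar>t\<bar> \<le> 1/2 \<Longrightarrow> (\<lambda>j. Re (c j * cis (real j * t))) sums g t"
    by (rule fourier_series_compact_support[OF smg]) (use \<psi>0 \<rho> in \<open>auto simp: g_def\<close>)
  define Q where "Q = (\<lambda>x. Re (\<Sum>j. c j * quotient j x))"
  define R where "R = (\<lambda>i e. Re (\<Sum>j. c j * remainder i j e))"
  have o: "open ({-1/2<..<1/2 :: real} \<times> ball (0::'e) rad)" by (intro open_Times) auto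
  note serQ = smooth_on_tempered_series[OF o c(1) tempered_quotient]
  note serR = smooth_on_tempered_series[OF open_ball c(1) tempered_remainder]
  have smQ: "smooth_on ({-1/2<..<1/2} \<times> ball 0 rad) Q"
    unfolding Q_def by (rule smooth_on_linear[OF o bounded_linear_Re serQ(1)])
  have smR: "smooth_on (ball 0 rad) (R i)" for i
    unfolding R_def by (rule smooth_on_linear[OF open_ball bounded_linear_Re serR(1)])
  define \<delta> where "\<delta> = min (\<rho> / 2) rad"
  have \<delta>: "\<delta> > 0" "\<delta> \<le> \<rho> / 2" "\<delta> \<le> rad"
    using \<rho> rad_pos by (auto simp: \<delta>_def)
  show thesis
  proof (rule that[of \<delta> Q R])
    show "smooth_on (ball 0 \<delta> \<times> ball 0 \<delta>) Q"
      by (rule smooth_on_subset[OF smQ]) (use \<delta> \<rho> in auto)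
    show "smooth_on (ball 0 \<delta>) (R i)" for i
      by (rule smooth_on_subset[OF smR]) (use \<delta> in auto)
    fix t :: real and e :: 'e assume "t \<in> ball 0 \<delta>" "e \<in> ball 0 \<delta>"
    then have t: "\<bar>t\<bar> < 1/2" "\<bar>t\<bar> \<le> \<rho> / 2" and e: "e \<in> ball 0 rad"
      using \<delta> \<rho> by auto
    have te: "(t, e) \<in> {-1/2<..<1/2} \<times> ball 0 rad" using t e by auto
    have "f t = g t" using t \<rho> by (simp add: g_def \<psi>1)
    have "(\<lambda>j. Re (c j * quotient j (t, e)) * P e t + (\<Sum>i<n. Re (c j * remainder i j e) * t ^ i))
        sums (Q (t, e) * P e t + (\<Sum>i<n. R i e * t ^ i))"
      unfolding Q_def R_def
      by (intro sums_add sums_mult2 sums_sum sums_Re summable_sums serQ(2)[OF te] serR(2)[OF e])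
    moreover have "Re (c j * quotient j (t, e)) * P e t + (\<Sum>i<n. Re (c j * remainder i j e) * t ^ i)
        = Re (c j * cis (real j * t))" for j
    proof -
      have re_scale: "Re (z * of_real x) = Re z * x" for z x by simp
      have "cis (real j * t) = exp (\<i> * of_real (real j) * of_real t)"
        by (simp add: cis_conv_exp mult.assoc)
      also have "\<dots> = quotient j (t, e) * of_real (P e t) + (\<Sum>i<n. remainder i j e * of_real (t ^ i))"
        unfolding exp_division[OF t(1) e] of_real_P by simp
      finally have "c j * cis (real j * t) = c j * quotient j (t, e) * of_real (P e t)
          + (\<Sum>i<n. c j * remainder i j e * of_real (t ^ i))"
        by (simp add: distrib_left sum_distrib_left mult.assoc)
      then have "Re (c j * cis (real j * t)) = Re (c j * quotient j (t, e) * of_real (P e t))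
          + (\<Sum>i<n. Re (c j * remainder i j e * of_real (t ^ i)))"
        by (simp only: plus_complex.sel Re_sum)
      then show ?thesis
        by (simp only: re_scale)
    qed
    ultimately have "(\<lambda>j. Re (c j * cis (real j * t))) sums (Q (t, e) * P e t + (\<Sum>i<n. R i e * t ^ i))"
      by simp
    moreover have "(\<lambda>j. Re (c j * cis (real j * t))) sums g t"
      using t by (intro c(2)) auto
    ultimately show "f t = Q (t, e) * P e t + (\<Sum>i<n. R i e * t ^ i)"
      unfolding \<open>f t = g t\<close> by (rule sums_unique2[rotated])
  qed (use \<delta> in auto)
qed

end

section \<open>Orders of vanishing\<close>

text \<open>A growth bound instead of a condition on derivatives: it is stable under multiplication
  by functions that merely have a limit at 0, such as the quotients from the division.\<close>

definition order_ge :: "(real \<Rightarrow> real) \<Rightarrow> nat \<Rightarrow> bool" where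
  "order_ge f m \<longleftrightarrow> (\<exists>C. \<forall>\<^sub>F x in at 0. \<bar>f x\<bar> \<le> C * \<bar>x\<bar> ^ m)"

lemma order_ge_cong:
  assumes "order_ge f m" "\<forall>\<^sub>F x in at 0. f x = g x"
  shows "order_ge g m"
proof -
  obtain C where "\<forall>\<^sub>F x in at 0. \<bar>f x\<bar> \<le> C * \<bar>x\<bar> ^ m"
    using assms(1) unfolding order_ge_def by blast
  with assms(2) have "\<forall>\<^sub>F x in at 0. \<bar>g x\<bar> \<le> C * \<bar>x\<bar> ^ m"
    by eventually_elim simp
  then show ?thesis unfolding order_ge_def by blast
qed

lemma order_ge_add:
  assumes "order_ge f m" "order_ge g m"
  shows "order_ge (\<lambda>x. f x + g x) m"
proof -
  obtain C D where "\<forall>\<^sub>F x in at 0. \<bar>f x\<bar> \<le> C * \<bar>x\<bar> ^ m" "\<forall>\<^sub>F x in at 0. \<bar>g x\<bar> \<le> D * \<bar>x\<bar> ^ m"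
    using assms unfolding order_ge_def by blast
  then have "\<forall>\<^sub>F x in at 0. \<bar>f x + g x\<bar> \<le> (C + D) * \<bar>x\<bar> ^ m"
    by eventually_elim (simp add: distrib_right)
  then show ?thesis unfolding order_ge_def by blast
qed

lemma order_ge_minus: "order_ge f m \<Longrightarrow> order_ge (\<lambda>x. - f x) m"
  by (simp add: order_ge_def)

lemma order_ge_diff: "order_ge f m \<Longrightarrow> order_ge g m \<Longrightarrow> order_ge (\<lambda>x. f x - g x) m"
  using order_ge_add[OF _ order_ge_minus] by fastforce

lemma order_ge_zero: "order_ge (\<lambda>x. 0) m"
  unfolding order_ge_def by (rule exI[of _ 0]) simp

lemma order_ge_sum: "(\<And>i. i \<in> I \<Longrightarrow> order_ge (f i) m) \<Longrightarrow> order_ge (\<lambda>x. \<Sum>i\<in>I. f i x) m"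
  by (induction I rule: infinite_finite_induct) (auto intro: order_ge_zero order_ge_add)

lemma order_ge_mult:
  assumes "(g \<longlongrightarrow> l) (at 0)" "order_ge f m"
  shows "order_ge (\<lambda>x. g x * f x) m"
proof -
  obtain C where C: "\<forall>\<^sub>F x in at 0. \<bar>f x\<bar> \<le> C * \<bar>x\<bar> ^ m"
    using assms(2) unfolding order_ge_def by blast
  have "\<forall>\<^sub>F x in at 0. \<bar>g x\<bar> < \<bar>l\<bar> + 1"
    by (rule order_tendstoD(2)[OF tendsto_rabs[OF assms(1)]]) simp
  with C have "\<forall>\<^sub>F x in at 0. \<bar>g x * f x\<bar> \<le> ((\<bar>l\<bar> + 1) * C) * \<bar>x\<bar> ^ m"
  proof eventually_elim
    case (elim x)
    have "\<bar>g x\<bar> * \<bar>f x\<bar> \<le> (\<bar>l\<bar> + 1) * (C * \<bar>x\<bar> ^ m)"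
      using elim by (intro mult_mono) auto
    then show ?case by (simp add: abs_mult mult.assoc)
  qed
  then show ?thesis unfolding order_ge_def by blast
qed

lemma order_ge_cancel:
  assumes "(g \<longlongrightarrow> l) (at 0)" "l \<noteq> 0" "order_ge (\<lambda>x. g x * f x) m"
  shows "order_ge f m"
proof (rule order_ge_cong)
  show "order_ge (\<lambda>x. inverse (g x) * (g x * f x)) m"
    by (rule order_ge_mult[OF tendsto_inverse[OF assms(1,2)] assms(3)])
  show "\<forall>\<^sub>F x in at 0. inverse (g x) * (g x * f x) = f x"
    using tendsto_imp_eventually_ne[OF assms(1,2)] by eventually_elim simp
qed

lemma order_ge_power_mult:
  assumes "(g \<longlongrightarrow> l) (at 0)"
  shows "order_ge (\<lambda>x. g x * x ^ m) m"
  by (rule order_ge_mult[OF assms]) (auto simp: order_ge_def power_abs intro!: exI[of _ 1])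

lemma order_ge_mono:
  assumes "order_ge f m" "k \<le> m"
  shows "order_ge f k"
proof -
  obtain C where C: "\<forall>\<^sub>F x in at 0. \<bar>f x\<bar> \<le> C * \<bar>x\<bar> ^ m"
    using assms(1) unfolding order_ge_def by blast
  have "\<forall>\<^sub>F x in at 0. \<bar>x :: real\<bar> < 1"
    unfolding eventually_at by (intro exI[of _ 1]) auto
  with C have "\<forall>\<^sub>F x in at 0. \<bar>f x\<bar> \<le> \<bar>C\<bar> * \<bar>x\<bar> ^ k"
  proof eventually_elim
    case (elim x)
    have "C * \<bar>x\<bar> ^ m \<le> \<bar>C\<bar> * \<bar>x\<bar> ^ k"
      using elim(2) assms(2) by (intro mult_mono power_decreasing) auto
    with elim(1) show ?case by linarith
  qed
  then show ?thesis unfolding order_ge_def by blast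
qed

lemma order_ge_monom: "m \<le> k \<Longrightarrow> order_ge (\<lambda>x. c * x ^ k) m"
  by (rule order_ge_mono[OF order_ge_power_mult[OF tendsto_const]])

lemma order_ge_monom_imp:
  assumes "order_ge (\<lambda>x. c * x ^ k) (Suc k)"
  shows "c = 0"
proof -
  obtain C where "\<forall>\<^sub>F x in at 0. \<bar>c * x ^ k\<bar> \<le> C * \<bar>x\<bar> ^ Suc k"
    using assms unfolding order_ge_def by blast
  moreover have "\<forall>\<^sub>F x in at 0. x \<noteq> (0::real)"
    by (simp add: eventually_at_filter)
  ultimately have "\<forall>\<^sub>F x in at 0. \<bar>c\<bar> \<le> C * \<bar>x\<bar>"
  proof eventually_elim
    case (elim x)
    then have "\<bar>c\<bar> * \<bar>x\<bar> ^ k \<le> (C * \<bar>x\<bar>) * \<bar>x\<bar> ^ k"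
      by (simp add: abs_mult power_abs mult_ac)
    then show ?case using elim(2) by (simp add: mult_le_cancel_right)
  qed
  moreover have "((\<lambda>x::real. C * \<bar>x\<bar>) \<longlongrightarrow> C * \<bar>0\<bar>) (at 0)"
    by (intro tendsto_intros)
  ultimately have "\<bar>c\<bar> \<le> C * \<bar>0\<bar>"
    by (intro tendsto_lowerbound) auto
  then show ?thesis by simp
qed

lemma order_ge_poly_iff:
  "order_ge (\<lambda>x. \<Sum>i<n. c i * x ^ i) m \<longleftrightarrow> (\<forall>i<n. i < m \<longrightarrow> c i = 0)"
proof
  assume *: "\<forall>i<n. i < m \<longrightarrow> c i = 0"
  show "order_ge (\<lambda>x. \<Sum>i<n. c i * x ^ i) m"
  proof (rule order_ge_sum)
    fix i assume i: "i \<in> {..<n}"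
    show "order_ge (\<lambda>x. c i * x ^ i) m"
    proof (cases "i < m")
      case True
      then show ?thesis using * i by (simp add: order_ge_zero)
    qed (auto intro: order_ge_monom)
  qed
next
  assume *: "order_ge (\<lambda>x. \<Sum>i<n. c i * x ^ i) m"
  have "c k = 0" if "k < n" "k < m" for k
    using that
  proof (induction k rule: less_induct)
    case (less k)
    have "order_ge (\<lambda>x. \<Sum>i\<in>{..<n} - {k}. c i * x ^ i) (Suc k)"
    proof (rule order_ge_sum)
      fix i assume i: "i \<in> {..<n} - {k}"
      show "order_ge (\<lambda>x. c i * x ^ i) (Suc k)"
      proof (cases "i < k")
        case True
        then show ?thesis using less i by (simp add: order_ge_zero)
      next
        case False
        then show ?thesis using i by (intro order_ge_monom) auto
      qed
    qed
    moreover have "order_ge (\<lambda>x. \<Sum>i<n. c i * x ^ i) (Suc k)"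
      by (rule order_ge_mono[OF *]) (use less in auto)
    ultimately have "order_ge (\<lambda>x. (\<Sum>i<n. c i * x ^ i) - (\<Sum>i\<in>{..<n} - {k}. c i * x ^ i)) (Suc k)"
      by (rule order_ge_diff[rotated])
    moreover have "(\<Sum>i<n. c i * x ^ i) - (\<Sum>i\<in>{..<n} - {k}. c i * x ^ i) = c k * x ^ k" for x
      using less by (simp add: sum.remove[of "{..<n}" k])
    ultimately show ?case
      by (simp add: order_ge_monom_imp)
  qed
  then show "\<forall>i<n. i < m \<longrightarrow> c i = 0" by blast
qed

lemma order_ge_taylor:
  fixes f :: "real \<Rightarrow> real"
  assumes "r > 0" "smooth_on (ball 0 r) f"
  shows "order_ge (\<lambda>x. f x - (\<Sum>i<m. (deriv ^^ i) f 0 / fact i * x ^ i)) m"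
proof -
  have sm: "smooth_on (ball 0 r) ((deriv ^^ k) f)" for k
    by (rule smooth_on_deriv_iterate[OF open_ball assms(2)])
  have "continuous_on (cball 0 (r / 2)) ((deriv ^^ m) f)"
    by (rule continuous_on_subset[OF smooth_on_imp_continuous_on[OF sm]]) (use assms(1) in auto)
  then have "bounded ((deriv ^^ m) f ` cball 0 (r / 2))"
    by (intro compact_imp_bounded compact_continuous_image) auto
  then obtain K where K: "\<And>x. \<bar>x\<bar> \<le> r / 2 \<Longrightarrow> \<bar>(deriv ^^ m) f x\<bar> \<le> K"
    unfolding bounded_iff by force
  have "\<forall>\<^sub>F x in at 0. \<bar>x\<bar> < r / 2"
    unfolding eventually_at using assms(1) by (intro exI[of _ "r / 2"]) auto
  then have "\<forall>\<^sub>F x in at 0. \<bar>f x - (\<Sum>i<m. (deriv ^^ i) f 0 / fact i * x ^ i)\<bar> \<le> (K / fact m) * \<bar>x\<bar> ^ m"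
  proof eventually_elim
    case (elim x)
    have "\<exists>t. \<bar>t\<bar> \<le> \<bar>x\<bar> \<and> f x = (\<Sum>i<m. (deriv ^^ i) f 0 / fact i * x ^ i) + (deriv ^^ m) f t / fact m * x ^ m"
    proof (rule Maclaurin_bi_le)
      show "\<forall>k t. k < m \<and> \<bar>t\<bar> \<le> \<bar>x\<bar> \<longrightarrow> DERIV ((deriv ^^ k) f) t :> (deriv ^^ Suc k) f t"
        using smooth_on_deriv(2)[OF open_ball sm] elim assms(1) by auto
    qed simp
    then obtain t where t: "\<bar>t\<bar> \<le> \<bar>x\<bar>" "f x = (\<Sum>i<m. (deriv ^^ i) f 0 / fact i * x ^ i) + (deriv ^^ m) f t / fact m * x ^ m"
      by blast
    have "\<bar>(deriv ^^ m) f t\<bar> * \<bar>x\<bar> ^ m / fact m \<le> K * \<bar>x\<bar> ^ m / fact m"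
      using K[of t] t(1) elim by (intro divide_right_mono mult_right_mono) auto
    then show ?case unfolding t(2) by (simp add: abs_mult power_abs)
  qed
  then show ?thesis unfolding order_ge_def by blast
qed

lemma order_ge_iff_deriv:
  fixes f :: "real \<Rightarrow> real"
  assumes "r > 0" "smooth_on (ball 0 r) f"
  shows "order_ge f m \<longleftrightarrow> (\<forall>i<m. (deriv ^^ i) f 0 = 0)"
proof -
  note taylor = order_ge_taylor[OF assms, of m]
  have "order_ge f m \<longleftrightarrow> order_ge (\<lambda>x. \<Sum>i<m. (deriv ^^ i) f 0 / fact i * x ^ i) m"
    using order_ge_diff[OF _ taylor] order_ge_add[OF _ taylor] by fastforce
  then show ?thesis unfolding order_ge_poly_iff by auto
qed

lemma deriv_iterate_shift:
  fixes f :: "real \<Rightarrow> real"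
  assumes "open J" "smooth_on J f" "t + x \<in> J"
  shows "(deriv ^^ k) (\<lambda>\<tau>. f (t + \<tau>)) x = (deriv ^^ k) f (t + x)"
  using assms(3)
proof (induction k arbitrary: x)
  case (Suc k)
  define J' where "J' = (\<lambda>\<tau>. t + \<tau>) -` J"
  have J': "open J'" "x \<in> J'"
    using assms(1) Suc.prems by (auto simp: J'_def intro!: open_vimage continuous_intros)
  have "((deriv ^^ k) f has_real_derivative (deriv ^^ Suc k) f (t + x)) (at (t + x))"
    using smooth_on_deriv(2)[OF assms(1) smooth_on_deriv_iterate[OF assms(1,2)] Suc.prems] by simp
  then have "((\<lambda>\<tau>. (deriv ^^ k) f (t + \<tau>)) has_real_derivative (deriv ^^ Suc k) f (t + x)) (at x)"
    using DERIV_shift[of "(deriv ^^ k) f" "(deriv ^^ Suc k) f (t + x)" x t]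
    by (simp only: add.commute[of t])
  then have "((deriv ^^ k) (\<lambda>\<tau>. f (t + \<tau>)) has_real_derivative (deriv ^^ Suc k) f (t + x)) (at x)"
    by (rule has_field_derivative_transform_within_open[OF _ J']) (use Suc.IH in \<open>auto simp: J'_def\<close>)
  then show ?case by (simp add: DERIV_imp_deriv)
qed simp

lemma deriv_iterate_linear:
  fixes f g :: "real \<Rightarrow> real"
  assumes "open J" "smooth_on J f" "smooth_on J g" "x \<in> J"
  shows "(deriv ^^ k) (\<lambda>x. f x + c * g x) x = (deriv ^^ k) f x + c * (deriv ^^ k) g x"
  using assms(4)
proof (induction k arbitrary: x)
  case (Suc k)
  have "((\<lambda>x. (deriv ^^ k) f x + c * (deriv ^^ k) g x) has_real_derivative
      (deriv ^^ Suc k) f x + c * (deriv ^^ Suc k) g x) (at x)"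
    using smooth_on_deriv(2)[OF assms(1) smooth_on_deriv_iterate[OF assms(1,2)] Suc.prems, of k]
      smooth_on_deriv(2)[OF assms(1) smooth_on_deriv_iterate[OF assms(1,3)] Suc.prems, of k]
    by (intro DERIV_add DERIV_cmult) auto
  then have "((deriv ^^ k) (\<lambda>x. f x + c * g x) has_real_derivative
      (deriv ^^ Suc k) f x + c * (deriv ^^ Suc k) g x) (at x)"
    by (rule has_field_derivative_transform_within_open[OF _ assms(1) Suc.prems]) (use Suc.IH in auto)
  then show ?case by (simp add: DERIV_imp_deriv)
qed simp

lemma deriv_iterate_affine:
  "(deriv ^^ k) (\<lambda>x. c * (t + x) - d) 0 = (if k = 0 then c * t - d else if k = 1 then c else (0::real))"
proof -
  have d: "deriv (\<lambda>x. c * (t + x) - d) = (\<lambda>x. c)"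
    by (intro ext DERIV_imp_deriv) (auto intro!: derivative_eq_intros)
  have "(deriv ^^ Suc (Suc k)) (\<lambda>x. c * (t + x) - d) = (\<lambda>x. 0)" for k
    by (induction k) (auto simp: d)
  then show ?thesis
    by (cases k; cases "k - 1") (auto simp: d)
qed

section \<open>Preparation of the generating family\<close>

text \<open>The envelope of the planes \<open>z = \<mu>(t) + x \<xi>(t) + t y\<close>, parametrised by \<open>x = s\<close> and \<open>t\<close>.\<close>

definition envelope :: "(real \<Rightarrow> real) \<Rightarrow> (real \<Rightarrow> real) \<Rightarrow> real \<times> real \<Rightarrow> real \<times> real \<times> real" where
  "envelope \<mu> \<xi> = (\<lambda>(s, t). (s, - deriv \<mu> t - s * deriv \<xi> t,
     \<mu> t + s * \<xi> t + t * (- deriv \<mu> t - s * deriv \<xi> t)))"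

lemma smooth_on_envelope:
  assumes "open J" "smooth_on J \<mu>" "smooth_on J \<xi>"
  shows "smooth_on (UNIV \<times> J) (envelope \<mu> \<xi>)"
proof -
  have o: "open (UNIV \<times> J :: (real \<times> real) set)" using assms(1) by (intro open_Times) auto
  have c: "smooth_on (UNIV \<times> J :: (real \<times> real) set) (\<lambda>p. f (snd p))" if "smooth_on J f" for f :: "real \<Rightarrow> real"
    by (rule smooth_on_compose[OF that o assms(1)]) (auto intro!: smooth_on_snd smooth_on_id o)
  show ?thesis
    unfolding envelope_def split_beta
    by (intro smooth_on_Pair smooth_on_add smooth_on_diff smooth_on_minus smooth_on_mult smooth_on_fst smooth_on_snd
        smooth_on_id c assms smooth_on_deriv o)
qed

text \<open>The derivative of \<open>envelope\<close> in \<open>s\<close>. For fixed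
  \<open>t\<close> the envelope is affine in \<open>s\<close>, so this is the direction of the
  straight line that the developable surface contains.\<close>

definition ruling :: "(real \<Rightarrow> real) \<Rightarrow> real \<Rightarrow> real \<times> real \<times> real" where
  "ruling \<xi> t = (1, - deriv \<xi> t, \<xi> t - t * deriv \<xi> t)"

context generic_polynomial
begin

lemma inner_b_sum: "k < n \<Longrightarrow> (\<Sum>i<n. c i *\<^sub>R b i) \<bullet> b k = c k"
proof -
  assume k: "k < n"
  have "b i \<bullet> b k = (if i = k then 1 else 0)" if "i < n" for i
    using bij_basis that k by (subst inner_Basis) (auto simp: bij_betw_def inj_on_def)
  then have "(\<Sum>i<n. c i *\<^sub>R b i) \<bullet> b k = (\<Sum>i<n. if i = k then c i else 0)"
    unfolding inner_sum_left inner_scaleR_left by (intro sum.cong) auto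
  then show ?thesis using k by simp
qed

lemma eq_zero_if_inner_b:
  assumes "\<And>i. i < n \<Longrightarrow> w \<bullet> b i = 0"
  shows "w = 0"
proof (rule euclidean_eqI)
  fix k :: 'e assume "k \<in> Basis"
  then have "k \<in> b ` {..<n}"
    using bij_basis by (simp add: bij_betw_def)
  then show "w \<bullet> k = 0 \<bullet> k" using assms by auto
qed

lemma P_zero: "P 0 z = z ^ n"
  by (simp add: P_eq)

lemma P_has_derivative: "((\<lambda>e. P e (x::real)) has_derivative (\<lambda>w. \<Sum>i<n. (w \<bullet> b i) * x ^ i)) (at e)"
  unfolding P_eq by (auto intro!: derivative_eq_intros)

lemma P_has_real_derivative:
  "(P e has_real_derivative (\<Sum>m\<le>n. pcoeff e m * (real m * x ^ (m - 1)))) (at x)"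
  unfolding P_def[abs_def] by (auto intro!: derivative_eq_intros sum.cong)

text \<open>\<open>H X\<close> is the defining function of the planes at the point \<open>X\<close>,
  in the parameter shifted to \<open>t0\<close>. Setting the remainder of its division to zero and
  solving for the coefficients leaves \<open>H X = Q * P (e X)\<close> with a nonvanishing
  \<open>Q\<close>, so both sides have the same double zeros. The last two conclusions say that the
  first three coefficients are local coordinates and that the ruling is tangent to the common zero
  set of the first two.\<close>

lemma envelope_preparation:
  fixes \<mu> \<xi> :: "real \<Rightarrow> real"
  assumes n: "3 \<le> n" and J: "open J" "t0 \<in> J" and sm: "smooth_on J \<mu>" "smooth_on J \<xi>"
    and M: "\<And>k. 2 \<le> k \<Longrightarrow> k < n \<Longrightarrow> (deriv ^^ k) \<mu> t0 + s0 * (deriv ^^ k) \<xi> t0 = 0"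
      "(deriv ^^ n) \<mu> t0 + s0 * (deriv ^^ n) \<xi> t0 \<noteq> 0"
    and \<xi>2: "(deriv ^^ 2) \<xi> t0 \<noteq> 0"
  obtains N e where "open N" "envelope \<mu> \<xi> (s0, t0) \<in> N" "smooth_on N e" "e (envelope \<mu> \<xi> (s0, t0)) = 0"
    "\<forall>\<^sub>F p in nhds (s0, t0). envelope \<mu> \<xi> p \<in> N \<and> P (e (envelope \<mu> \<xi> p)) (snd p - t0) = 0 \<and>
       (P (e (envelope \<mu> \<xi> p)) has_real_derivative 0) (at (snd p - t0))"
    "\<forall>V. (\<forall>i<3. frechet_derivative e (at (envelope \<mu> \<xi> (s0, t0))) V \<bullet> b i = 0) \<longrightarrow> V = 0"
    "\<forall>i<2. frechet_derivative e (at (envelope \<mu> \<xi> (s0, t0))) (ruling \<xi> t0) \<bullet> b i = 0"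
proof -
  define X0 where "X0 = envelope \<mu> \<xi> (s0, t0)"
  obtain r where r: "r > 0" "ball t0 r \<subseteq> J"
    using J open_contains_ball by blast
  define m where "m = (\<lambda>\<tau>. \<mu> (t0 + \<tau>))"
  define x where "x = (\<lambda>\<tau>. \<xi> (t0 + \<tau>))"
  have rJ: "t0 + \<tau> \<in> J" if "\<tau> \<in> ball 0 r" for \<tau>
    using r that by (auto simp: dist_real_def)
  have smx: "smooth_on (ball 0 r) m" "smooth_on (ball 0 r) x"
    unfolding m_def x_def using rJ
    by (intro smooth_on_compose[OF sm(1) open_ball J(1)] smooth_on_compose[OF sm(2) open_ball J(1)]
        smooth_on_add smooth_on_const smooth_on_id open_ball; simp)+
  have dm: "(deriv ^^ k) m 0 = (deriv ^^ k) \<mu> t0" and dx: "(deriv ^^ k) x 0 = (deriv ^^ k) \<xi> t0" for k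
    using deriv_iterate_shift[OF J(1) sm(1), of t0 0 k] deriv_iterate_shift[OF J(1) sm(2), of t0 0 k] J(2)
    by (simp_all add: m_def x_def)

  \<comment> \<open>Division of both functions by the generic polynomial\<close>
  obtain \<delta>1 Qm Rm where 1: "\<delta>1 > 0" "smooth_on (ball 0 \<delta>1 \<times> ball 0 \<delta>1) Qm" "\<And>i. smooth_on (ball 0 \<delta>1) (Rm i)"
    "\<And>\<tau> e. \<tau> \<in> ball 0 \<delta>1 \<Longrightarrow> e \<in> ball 0 \<delta>1 \<Longrightarrow> m \<tau> = Qm (\<tau>, e) * P e \<tau> + (\<Sum>i<n. Rm i e * \<tau> ^ i)"
    by (rule division[OF r(1) smx(1)]) blast
  obtain \<delta>2 Qx Rx where 2: "\<delta>2 > 0" "smooth_on (ball 0 \<delta>2 \<times> ball 0 \<delta>2) Qx" "\<And>i. smooth_on (ball 0 \<delta>2) (Rx i)"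
    "\<And>\<tau> e. \<tau> \<in> ball 0 \<delta>2 \<Longrightarrow> e \<in> ball 0 \<delta>2 \<Longrightarrow> x \<tau> = Qx (\<tau>, e) * P e \<tau> + (\<Sum>i<n. Rx i e * \<tau> ^ i)"
    by (rule division[OF r(1) smx(2)]) blast
  define \<delta> where "\<delta> = min \<delta>1 (min \<delta>2 r)"
  have \<delta>: "\<delta> > 0" "\<delta> \<le> \<delta>1" "\<delta> \<le> \<delta>2" "\<delta> \<le> r" using 1 2 r by (auto simp: \<delta>_def)
  define B where "B = ball (0::'e) \<delta>"
  define T where "T = ball (0::real) \<delta>"
  have oB: "open B" "open T" "0 \<in> B" "0 \<in> T" "open (T \<times> B)" using \<delta> by (auto simp: B_def T_def intro: open_Times)
  have smQ: "smooth_on (T \<times> B) Qm" "smooth_on (T \<times> B) Qx"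
    by (rule smooth_on_subset[OF 1(2)], use \<delta> in \<open>auto simp: T_def B_def\<close>)
      (rule smooth_on_subset[OF 2(2)], use \<delta> in \<open>auto simp: T_def B_def\<close>)
  have smR: "smooth_on B (Rm i)" "smooth_on B (Rx i)" for i
    by (rule smooth_on_subset[OF 1(3)], use \<delta> in \<open>auto simp: B_def\<close>)
      (rule smooth_on_subset[OF 2(3)], use \<delta> in \<open>auto simp: B_def\<close>)
  \<comment> \<open>The affine part \<open>y (t0 + \<tau>) - z\<close> of the family has degree at
    most 1 in \<open>\<tau>\<close>, below \<open>n\<close>; it goes into the remainder
    undivided.\<close>
  define lin where "lin = (\<lambda>X :: real \<times> real \<times> real. \<lambda>i. if i = 0 then fst (snd X) * t0 - snd (snd X) else if i = (1::nat) then fst (snd X) else 0)"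
  define \<rho> where "\<rho> = (\<lambda>w :: (real \<times> real \<times> real) \<times> 'e. \<Sum>i<n. (Rm i (snd w) + fst (fst w) * Rx i (snd w) + lin (fst w) i) *\<^sub>R b i)"
  define Q where "Q = (\<lambda>\<tau> w :: (real \<times> real \<times> real) \<times> 'e. Qm (\<tau>, snd w) + fst (fst w) * Qx (\<tau>, snd w))"
  define H where "H = (\<lambda>X :: real \<times> real \<times> real. \<lambda>\<tau>. m \<tau> + fst X * x \<tau> + fst (snd X) * (t0 + \<tau>) - snd (snd X))"
  have lin_sum: "(\<Sum>i<n. lin X i * \<tau> ^ i) = fst (snd X) * (t0 + \<tau>) - snd (snd X)" for X \<tau>
  proof -
    have "(\<Sum>i<n. lin X i * \<tau> ^ i) = (\<Sum>i\<in>{0, 1}. lin X i * \<tau> ^ i)"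
      using n by (intro sum.mono_neutral_right) (auto simp: lin_def)
    then show ?thesis by (simp add: lin_def algebra_simps)
  qed
  have ID: "H (fst w) \<tau> = Q \<tau> w * P (snd w) \<tau> + (\<Sum>i<n. (\<rho> w \<bullet> b i) * \<tau> ^ i)"
    if "\<tau> \<in> T" "snd w \<in> B" for \<tau> w
  proof -
    have "\<tau> \<in> ball 0 \<delta>1" "snd w \<in> ball 0 \<delta>1" "\<tau> \<in> ball 0 \<delta>2" "snd w \<in> ball 0 \<delta>2"
      using that \<delta> by (auto simp: T_def B_def)
    note e = 1(4)[OF this(1,2)] 2(4)[OF this(3,4)]
    have "(\<Sum>i<n. (\<rho> w \<bullet> b i) * \<tau> ^ i) = (\<Sum>i<n. (Rm i (snd w) + fst (fst w) * Rx i (snd w) + lin (fst w) i) * \<tau> ^ i)"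
      by (rule sum.cong) (auto simp: \<rho>_def inner_b_sum)
    also have "\<dots> = (\<Sum>i<n. Rm i (snd w) * \<tau> ^ i) + fst (fst w) * (\<Sum>i<n. Rx i (snd w) * \<tau> ^ i) + (\<Sum>i<n. lin (fst w) i * \<tau> ^ i)"
      by (simp add: sum.distrib sum_distrib_left algebra_simps)
    finally show ?thesis
      unfolding lin_sum H_def e Q_def by (simp add: algebra_simps)
  qed
  define U where "U = (UNIV :: (real \<times> real \<times> real) set) \<times> B"
  have oU: "open U" "(X0, 0) \<in> U" using oB by (auto simp: U_def intro: open_Times)
  have smlin: "smooth_on U (\<lambda>w. lin (fst w) i)" for i
  proof -
    have "smooth_on U (\<lambda>w. fst (snd (fst w)) * t0 - snd (snd (fst w)))" "smooth_on U (\<lambda>w. fst (snd (fst w)))" "smooth_on U (\<lambda>w. 0::real)"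
      by (intro smooth_on_diff smooth_on_mult smooth_on_fst smooth_on_snd smooth_on_id smooth_on_const oU(1))+
    then show ?thesis by (cases "i = 0"; cases "i = 1") (simp_all add: lin_def)
  qed
  have sm\<rho>: "smooth_on U \<rho>"
    unfolding \<rho>_def
    by (intro smooth_on_sum smooth_on_scaleR smooth_on_add smooth_on_mult smlin smooth_on_const smooth_on_fst smooth_on_id
        oU(1) smooth_on_compose[OF smR(1) oU(1) oB(1), of snd] smooth_on_compose[OF smR(2) oU(1) oB(1), of snd] smooth_on_snd)
      (auto simp: U_def)
  define D\<rho> where "D\<rho> = frechet_derivative \<rho> (at (X0, 0))"
  have d\<rho>: "(\<rho> has_derivative D\<rho>) (at (X0, 0))"
    unfolding D\<rho>_def by (rule smooth_on_has_derivative[OF sm\<rho> oU(2)])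
  have fX0: "fst X0 = s0" by (simp add: X0_def envelope_def)
  define q where "q = (\<lambda>\<tau>. Q \<tau> (X0, 0))"
  have contQ: "isCont (\<lambda>w. g w) w" if "smooth_on (T \<times> B) g" "w \<in> T \<times> B" for g :: "real \<times> 'e \<Rightarrow> real" and w
    using smooth_on_imp_continuous_on[OF that(1)] that(2)
    unfolding continuous_on_eq_continuous_at[OF oB(5)] by blast
  have lim0: "((\<lambda>\<tau>. g (\<tau>, 0)) \<longlongrightarrow> g (0, 0)) (at 0)" if "smooth_on (T \<times> B) g" for g :: "real \<times> 'e \<Rightarrow> real"
  proof -
    have "isCont (\<lambda>\<tau>. (\<tau>, 0)) (0::real)" by (intro continuous_intros)
    then have "isCont (\<lambda>\<tau>. g (\<tau>, 0)) (0::real)"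
      by (rule isCont_o2) (use contQ[OF that, of "(0, 0)"] oB in simp)
    then show ?thesis by (simp add: isCont_def)
  qed
  have limq: "(q \<longlongrightarrow> q 0) (at 0)"
    unfolding q_def Q_def by (simp, intro tendsto_intros lim0 smQ)

  \<comment> \<open>Linearisation of the division identity at the base point\<close>
  define v where "v = (\<lambda>V :: real \<times> real \<times> real. \<lambda>\<tau>. fst V * x \<tau> + fst (snd V) * (t0 + \<tau>) - snd (snd V))"
  \<comment> \<open>\<open>ID\<close> is differentiated in direction \<open>(V, w)\<close> at
    \<open>(X0, 0)\<close>. There \<open>P 0\<close> is the \<open>n\<close>-th power of
    \<open>\<tau>\<close>, so the terms containing a derivative of \<open>Q\<close> vanish to order
    \<open>n\<close>.\<close>
  have REL: "order_ge (\<lambda>\<tau>. v V \<tau> - q \<tau> * (\<Sum>i<n. (w \<bullet> b i) * \<tau> ^ i) - (\<Sum>i<n. (D\<rho> (V, w) \<bullet> b i) * \<tau> ^ i)) n" for V w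
  proof -
    define DQ where "DQ = (\<lambda>\<tau>. frechet_derivative Qm (at (\<tau>, 0)) (0, w) + fst V * Qx (\<tau>, 0) + s0 * frechet_derivative Qx (at (\<tau>, 0)) (0, w))"
    have "(DQ \<longlongrightarrow> DQ 0) (at 0)"
      unfolding DQ_def
      by (intro tendsto_add tendsto_mult tendsto_const lim0[OF smooth_on_directional[OF smQ(1)]]
          lim0[OF smooth_on_directional[OF smQ(2)]] lim0[OF smQ(2)])
    then have "order_ge (\<lambda>\<tau>. DQ \<tau> * \<tau> ^ n) n"
      by (rule order_ge_power_mult)
    moreover have "\<forall>\<^sub>F \<tau> in at 0. DQ \<tau> * \<tau> ^ n = v V \<tau> - q \<tau> * (\<Sum>i<n. (w \<bullet> b i) * \<tau> ^ i) - (\<Sum>i<n. (D\<rho> (V, w) \<bullet> b i) * \<tau> ^ i)"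
    proof -
      have "\<forall>\<^sub>F \<tau> in at 0. \<tau> \<in> T"
        using oB(2,4) eventually_at_topological by blast
      then show ?thesis
      proof eventually_elim
        case (elim \<tau>)
        have \<tau>B: "(\<tau>, 0) \<in> T \<times> B" using elim oB by auto
        have inner: "((\<lambda>w. (\<tau>, snd w)) has_derivative (\<lambda>h. (0, snd h))) (at (X0, 0::'e))"
          by (auto intro!: derivative_eq_intros)
        have dQm: "((\<lambda>w. Qm (\<tau>, snd w)) has_derivative (\<lambda>h. frechet_derivative Qm (at (\<tau>, 0)) (0, snd h))) (at (X0, 0))"
          by (rule has_derivative_compose[OF inner]) (use smooth_on_has_derivative[OF smQ(1) \<tau>B] in simp)
        have dQx: "((\<lambda>w. Qx (\<tau>, snd w)) has_derivative (\<lambda>h. frechet_derivative Qx (at (\<tau>, 0)) (0, snd h))) (at (X0, 0))"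
          by (rule has_derivative_compose[OF inner]) (use smooth_on_has_derivative[OF smQ(2) \<tau>B] in simp)
        have dQ: "(Q \<tau> has_derivative (\<lambda>h. frechet_derivative Qm (at (\<tau>, 0)) (0, snd h)
            + (fst X0 * frechet_derivative Qx (at (\<tau>, 0)) (0, snd h) + fst (fst h) * Qx (\<tau>, 0)))) (at (X0, 0))"
          unfolding Q_def
          by (rule has_derivative_eq_rhs[OF has_derivative_add[OF dQm has_derivative_mult[OF _ dQx]]])
            (auto intro!: derivative_eq_intros)
        have dP: "((\<lambda>w. P (snd w) \<tau>) has_derivative (\<lambda>h. \<Sum>i<n. (snd h \<bullet> b i) * \<tau> ^ i)) (at (X0, 0))"
          by (rule has_derivative_compose[OF _ P_has_derivative]) (auto intro!: derivative_eq_intros)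
        have dR: "((\<lambda>w. \<Sum>i<n. (\<rho> w \<bullet> b i) * \<tau> ^ i) has_derivative (\<lambda>h. \<Sum>i<n. (D\<rho> h \<bullet> b i) * \<tau> ^ i)) (at (X0, 0))"
          by (intro has_derivative_sum has_derivative_mult_left has_derivative_inner_left d\<rho>)
        have "((\<lambda>w. Q \<tau> w * P (snd w) \<tau> + (\<Sum>i<n. (\<rho> w \<bullet> b i) * \<tau> ^ i)) has_derivative
          (\<lambda>h. (Q \<tau> (X0, 0) * (\<Sum>i<n. (snd h \<bullet> b i) * \<tau> ^ i) + (frechet_derivative Qm (at (\<tau>, 0)) (0, snd h)
            + (fst X0 * frechet_derivative Qx (at (\<tau>, 0)) (0, snd h) + fst (fst h) * Qx (\<tau>, 0))) * P (snd (X0, 0)) \<tau>)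
            + (\<Sum>i<n. (D\<rho> h \<bullet> b i) * \<tau> ^ i))) (at (X0, 0))"
          by (intro has_derivative_add has_derivative_mult dQ dP dR)
        then have d1: "((\<lambda>w. H (fst w) \<tau>) has_derivative
          (\<lambda>h. (Q \<tau> (X0, 0) * (\<Sum>i<n. (snd h \<bullet> b i) * \<tau> ^ i) + (frechet_derivative Qm (at (\<tau>, 0)) (0, snd h)
            + (fst X0 * frechet_derivative Qx (at (\<tau>, 0)) (0, snd h) + fst (fst h) * Qx (\<tau>, 0))) * P (snd (X0, 0)) \<tau>)
            + (\<Sum>i<n. (D\<rho> h \<bullet> b i) * \<tau> ^ i))) (at (X0, 0))"
          by (rule has_derivative_transform_within_open[OF _ oU]) (use ID[OF elim] in \<open>auto simp: U_def\<close>)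
        have d2: "((\<lambda>w :: _ \<times> 'e. H (fst w) \<tau>) has_derivative (\<lambda>h. v (fst h) \<tau>)) (at (X0, 0))"
          unfolding H_def v_def by (auto intro!: derivative_eq_intros)
        from has_derivative_unique[OF d1 d2]
        have "v V \<tau> = (Q \<tau> (X0, 0) * (\<Sum>i<n. (w \<bullet> b i) * \<tau> ^ i) + (frechet_derivative Qm (at (\<tau>, 0)) (0, w)
            + (fst X0 * frechet_derivative Qx (at (\<tau>, 0)) (0, w) + fst V * Qx (\<tau>, 0))) * P (snd (X0, 0)) \<tau>)
            + (\<Sum>i<n. (D\<rho> (V, w) \<bullet> b i) * \<tau> ^ i)"
          by (auto dest!: fun_cong[of _ _ "(V, w)"])
        then show ?case
          by (simp add: DQ_def q_def P_zero fX0 algebra_simps)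
      qed
    qed
    ultimately show ?thesis by (rule order_ge_cong)
  qed
  have smH: "smooth_on (ball 0 r) (H X)" for X
    unfolding H_def
    by (intro smooth_on_diff smooth_on_add smooth_on_mult smx smooth_on_const smooth_on_id open_ball)
  have smv: "smooth_on (ball 0 r) (v V)" for V
    unfolding v_def
    by (intro smooth_on_diff smooth_on_add smooth_on_mult smx smooth_on_const smooth_on_id open_ball)

  \<comment> \<open>Taylor coefficients of the family and of its variations\<close>
  have dH: "(deriv ^^ k) (H X) 0 = (deriv ^^ k) \<mu> t0 + fst X * (deriv ^^ k) \<xi> t0
      + (if k = 0 then fst (snd X) * t0 - snd (snd X) else if k = 1 then fst (snd X) else 0)" for X k
  proof -
    have "H X = (\<lambda>\<tau>. (\<lambda>\<tau>. m \<tau> + fst X * x \<tau>) \<tau> + 1 * (\<lambda>\<tau>. fst (snd X) * (t0 + \<tau>) - snd (snd X)) \<tau>)"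
      by (simp add: H_def fun_eq_iff)
    then have "(deriv ^^ k) (H X) 0 = (deriv ^^ k) (\<lambda>\<tau>. m \<tau> + fst X * x \<tau>) 0
        + 1 * (deriv ^^ k) (\<lambda>\<tau>. fst (snd X) * (t0 + \<tau>) - snd (snd X)) 0"
      by (simp only:) (rule deriv_iterate_linear[OF open_ball[of 0 r]],
        auto intro!: smooth_on_diff smooth_on_add smooth_on_mult smx smooth_on_const smooth_on_id simp: r)
    then show ?thesis
      using deriv_iterate_linear[OF open_ball smx, of 0 k "fst X"] r by (simp add: dm dx deriv_iterate_affine)
  qed
  have dv: "(deriv ^^ k) (v V) 0 = fst V * (deriv ^^ k) \<xi> t0
      + (if k = 0 then fst (snd V) * t0 - snd (snd V) else if k = 1 then fst (snd V) else 0)" for V k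
  proof -
    have "v V = (\<lambda>\<tau>. (\<lambda>\<tau>. fst (snd V) * (t0 + \<tau>) - snd (snd V)) \<tau> + fst V * x \<tau>)"
      by (simp add: v_def fun_eq_iff)
    then have "(deriv ^^ k) (v V) 0 = (deriv ^^ k) (\<lambda>\<tau>. fst (snd V) * (t0 + \<tau>) - snd (snd V)) 0 + fst V * (deriv ^^ k) x 0"
      by (simp only:) (rule deriv_iterate_linear[OF open_ball[of 0 r]],
        auto intro!: smooth_on_diff smooth_on_add smooth_on_mult smx smooth_on_const smooth_on_id simp: r)
    then show ?thesis by (simp add: dx deriv_iterate_affine)
  qed
  have dHX0: "(deriv ^^ k) (H X0) 0 = (if k < 2 then 0 else (deriv ^^ k) \<mu> t0 + s0 * (deriv ^^ k) \<xi> t0)" for k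
  proof -
    consider "k = 0" | "k = 1" | "k \<ge> 2" by linarith
    then show ?thesis
      unfolding dH by cases (simp_all add: X0_def envelope_def algebra_simps)
  qed
  have H_n: "order_ge (H X0) n"
    unfolding order_ge_iff_deriv[OF r(1) smH] dHX0 using M(1) by simp
  have H_Sn: "\<not> order_ge (H X0) (Suc n)"
    unfolding order_ge_iff_deriv[OF r(1) smH] dHX0 using M(2) n by (auto intro!: exI[of _ n])

  \<comment> \<open>Solving the remainder equation for the coefficients\<close>
  have evT: "\<forall>\<^sub>F \<tau> in at 0. \<tau> \<in> T"
    using oB(2,4) eventually_at_topological by blast
  have HQ: "\<forall>\<^sub>F \<tau> in at 0. H X0 \<tau> = q \<tau> * \<tau> ^ n + (\<Sum>i<n. (\<rho> (X0, 0) \<bullet> b i) * \<tau> ^ i)"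
    using evT by eventually_elim (use ID[of _ "(X0, 0)"] oB in \<open>simp add: q_def P_zero\<close>)
  have \<rho>0: "\<rho> (X0, 0) = 0"
  proof (rule eq_zero_if_inner_b)
    fix i assume i: "i < n"
    have "order_ge (\<lambda>\<tau>. H X0 \<tau> - q \<tau> * \<tau> ^ n) n"
      by (rule order_ge_diff[OF H_n order_ge_power_mult[OF limq]])
    then have "order_ge (\<lambda>\<tau>. \<Sum>i<n. (\<rho> (X0, 0) \<bullet> b i) * \<tau> ^ i) n"
      by (rule order_ge_cong) (use HQ in \<open>eventually_elim, simp\<close>)
    then show "\<rho> (X0, 0) \<bullet> b i = 0"
      unfolding order_ge_poly_iff using i by blast
  qed
  \<comment> \<open>Otherwise \<open>H X0\<close>, which equals \<open>q \<tau> * \<tau> ^ n\<close>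
    once the remainder is zero, would vanish to order \<open>n + 1\<close>.\<close>
  have q0: "q 0 \<noteq> 0"
  proof
    assume z: "q 0 = 0"
    have smq: "smooth_on T q"
      unfolding q_def Q_def fst_conv snd_conv
      by (intro smooth_on_add smooth_on_mult smooth_on_const oB
          smooth_on_compose[OF smQ(1) oB(2,5), of "\<lambda>\<tau>. (\<tau>, 0)"] smooth_on_compose[OF smQ(2) oB(2,5), of "\<lambda>\<tau>. (\<tau>, 0)"]
          smooth_on_Pair smooth_on_id) (use oB in auto)
    have "order_ge q 1"
      using order_ge_iff_deriv[OF \<delta>(1) smq[unfolded T_def], of 1] z by simp
    then obtain C where C: "\<forall>\<^sub>F \<tau> in at 0. \<bar>q \<tau>\<bar> \<le> C * \<bar>\<tau>\<bar> ^ 1"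
      unfolding order_ge_def by blast
    have "\<forall>\<^sub>F \<tau> in at 0. \<bar>H X0 \<tau>\<bar> \<le> C * \<bar>\<tau>\<bar> ^ Suc n"
      using C HQ
    proof eventually_elim
      case (elim \<tau>)
      have "\<bar>q \<tau>\<bar> * \<bar>\<tau>\<bar> ^ n \<le> (C * \<bar>\<tau>\<bar> ^ 1) * \<bar>\<tau>\<bar> ^ n"
        using elim(1) by (intro mult_right_mono) auto
      then show ?case using elim(2) by (simp add: \<rho>0 abs_mult power_abs mult_ac)
    qed
    then have "order_ge (H X0) (Suc n)" unfolding order_ge_def by blast
    with H_Sn show False by blast
  qed
  \<comment> \<open>For \<open>V = 0\<close> the linearised identity says that \<open>q\<close>
    times a polynomial of degree below \<open>n\<close> vanishes to order \<open>n\<close>; since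
    \<open>q\<close> is nonzero at 0, the polynomial is zero.\<close>
  have inj: "w = 0" if "D\<rho> (0, w) = 0" for w
  proof (rule eq_zero_if_inner_b)
    fix i assume i: "i < n"
    have "order_ge (\<lambda>\<tau>. - (q \<tau> * (\<Sum>i<n. (w \<bullet> b i) * \<tau> ^ i))) n"
      using REL[of 0 w] that by (simp add: v_def)
    then have "order_ge (\<lambda>\<tau>. q \<tau> * (\<Sum>i<n. (w \<bullet> b i) * \<tau> ^ i)) n"
      using order_ge_minus by fastforce
    then have "order_ge (\<lambda>\<tau>. \<Sum>i<n. (w \<bullet> b i) * \<tau> ^ i) n"
      by (rule order_ge_cancel[OF limq q0])
    then show "w \<bullet> b i = 0"
      unfolding order_ge_poly_iff using i by blast
  qed
  obtain N e where N: "open N" "X0 \<in> N" "smooth_on N e" "e X0 = 0"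
    "\<And>X. X \<in> N \<Longrightarrow> (X, e X) \<in> U \<and> \<rho> (X, e X) = 0"
    by (rule smooth_implicit_function[OF oU(1) sm\<rho> oU(2) \<rho>0]) (use inj in \<open>auto simp: D\<rho>_def\<close>)

  \<comment> \<open>Differentials of the coefficients\<close>
  define De where "De = frechet_derivative e (at X0)"
  have de: "(e has_derivative De) (at X0)"
    unfolding De_def by (rule smooth_on_has_derivative[OF N(3,2)])
  have D0: "D\<rho> (V, De V) = 0" for V
  proof -
    have d1: "((\<lambda>X. \<rho> (X, e X)) has_derivative (\<lambda>V. D\<rho> (V, De V))) (at X0)"
      by (rule has_derivative_compose[OF has_derivative_Pair[OF has_derivative_ident de]]) (simp add: N(4) d\<rho>)
    have d2: "((\<lambda>X. \<rho> (X, e X)) has_derivative (\<lambda>V. 0)) (at X0)"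
      by (rule has_derivative_transform_within_open[OF has_derivative_const N(1,2)]) (use N(5) in auto)
    show ?thesis
      by (rule fun_cong[OF has_derivative_unique[OF d1 d2]])
  qed
  have relV: "order_ge (\<lambda>\<tau>. v V \<tau> - q \<tau> * (\<Sum>i<n. (De V \<bullet> b i) * \<tau> ^ i)) n" for V
    using REL[of V "De V"] by (simp add: D0)
  \<comment> \<open>Up to order 3, which does not exceed \<open>n\<close>, the nonvanishing factor
    \<open>q\<close> is irrelevant. The first coefficient differentials are thus read off from the
    Taylor expansion of \<open>v V\<close>: the ruling gives order 2, and
    \<open>\<xi>''(t0) \<noteq> 0\<close> leaves only \<open>V = 0\<close> at order 3.\<close>
  have key: "order_ge (v V) k \<longleftrightarrow> (\<forall>i<k. De V \<bullet> b i = 0)" if "k \<le> 3" for V k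
  proof -
    have rel: "order_ge (\<lambda>\<tau>. v V \<tau> - q \<tau> * (\<Sum>i<n. (De V \<bullet> b i) * \<tau> ^ i)) k"
      by (rule order_ge_mono[OF relV]) (use that n in auto)
    have "order_ge (v V) k \<longleftrightarrow> order_ge (\<lambda>\<tau>. q \<tau> * (\<Sum>i<n. (De V \<bullet> b i) * \<tau> ^ i)) k"
      using order_ge_diff[OF _ rel] order_ge_add[OF _ rel] by fastforce
    also have "\<dots> \<longleftrightarrow> order_ge (\<lambda>\<tau>. \<Sum>i<n. (De V \<bullet> b i) * \<tau> ^ i) k"
      by (rule iffI[OF order_ge_cancel[OF limq q0] order_ge_mult[OF limq]])
    also have "\<dots> \<longleftrightarrow> (\<forall>i<k. De V \<bullet> b i = 0)"
      unfolding order_ge_poly_iff using that n by auto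
    finally show ?thesis .
  qed
  have B1: "V = 0" if "\<And>i. i < 3 \<Longrightarrow> De V \<bullet> b i = 0" for V
  proof -
    have "order_ge (v V) 3" unfolding key[OF order_refl] using that by blast
    then have z: "(deriv ^^ k) (v V) 0 = 0" if "k < 3" for k
      using order_ge_iff_deriv[OF r(1) smv] that by blast
    have "fst V = 0" using z[of 2] \<xi>2 unfolding dv by simp
    moreover from this have "fst (snd V) = 0" using z[of 1] unfolding dv by simp
    ultimately have "snd (snd V) = 0" using z[of 0] unfolding dv by simp
    with \<open>fst V = 0\<close> \<open>fst (snd V) = 0\<close> show "V = 0"
      by (simp add: prod_eq_iff)
  qed
  have B2: "De (ruling \<xi> t0) \<bullet> b i = 0" if "i < 2" for i
  proof -
    have "order_ge (v (ruling \<xi> t0)) 2"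
      unfolding order_ge_iff_deriv[OF r(1) smv] dv by (auto simp: ruling_def less_2_cases_iff)
    then show ?thesis using key[of 2 "ruling \<xi> t0"] that by simp
  qed

  \<comment> \<open>Double roots along the envelope\<close>
  define E where "E = (UNIV :: real set) \<times> J"
  have E: "open E" "(s0, t0) \<in> E" using J by (auto simp: E_def intro: open_Times)
  have contE: "isCont (envelope \<mu> \<xi>) (s0, t0)"
    using smooth_on_imp_continuous_on[OF smooth_on_envelope[OF J(1) sm]] E
    unfolding E_def[symmetric] continuous_on_eq_continuous_at[OF E(1)] by blast
  have contQE: "isCont (\<lambda>p. Q (snd p - t0) (envelope \<mu> \<xi> p, e (envelope \<mu> \<xi> p))) (s0, t0)"
  proof -
    have ce: "isCont (\<lambda>p. e (envelope \<mu> \<xi> p)) (s0, t0)"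
      by (rule isCont_o2[OF contE])
        (use smooth_on_imp_continuous_on[OF N(3)] N(2) in \<open>simp add: continuous_on_eq_continuous_at[OF N(1)] flip: X0_def\<close>)
    have "isCont (\<lambda>p. g (snd p - t0, e (envelope \<mu> \<xi> p))) (s0, t0)" if "smooth_on (T \<times> B) g" for g :: "real \<times> 'e \<Rightarrow> real"
      by (rule isCont_o2[OF isCont_Pair[OF _ ce]])
        (use contQ[OF that, of "(0, 0)"] oB N(4) in \<open>auto intro!: continuous_intros simp flip: X0_def\<close>)
    from this[OF smQ(1)] this[OF smQ(2)] contE show ?thesis
      unfolding Q_def fst_conv snd_conv by (intro continuous_intros)
  qed
  have ev: "\<forall>\<^sub>F p in nhds (s0, t0). envelope \<mu> \<xi> p \<in> N \<and> P (e (envelope \<mu> \<xi> p)) (snd p - t0) = 0 \<and>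
       (P (e (envelope \<mu> \<xi> p)) has_real_derivative 0) (at (snd p - t0))"
  proof -
    have "\<forall>\<^sub>F p in nhds (s0, t0). envelope \<mu> \<xi> p \<in> N"
      using contE N(1,2) unfolding isCont_def tendsto_at_iff_tendsto_nhds X0_def
      by (rule topological_tendstoD)
    moreover have "\<forall>\<^sub>F p in nhds (s0, t0). Q (snd p - t0) (envelope \<mu> \<xi> p, e (envelope \<mu> \<xi> p)) \<noteq> 0"
    proof -
      define g where "g = (\<lambda>p. Q (snd p - t0) (envelope \<mu> \<xi> p, e (envelope \<mu> \<xi> p)))"
      have "(g \<longlongrightarrow> g (s0, t0)) (nhds (s0, t0))"
        using contQE[folded g_def] unfolding isCont_def tendsto_at_iff_tendsto_nhds .
      moreover have "g (s0, t0) \<noteq> 0"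
        using q0 by (simp add: g_def q_def N(4) flip: X0_def)
      ultimately show ?thesis
        using tendsto_imp_eventually_ne unfolding g_def by blast
    qed
    moreover have "\<forall>\<^sub>F p in nhds (s0, t0). p \<in> UNIV \<times> ((\<lambda>t. t - t0) -` T \<inter> J)"
    proof (rule eventually_nhds_in_open)
      have "open ((\<lambda>t. t - t0) -` T)"
        by (rule open_vimage[OF oB(2)]) (intro continuous_intros)
      then show "open (UNIV \<times> ((\<lambda>t. t - t0) -` T \<inter> J) :: (real \<times> real) set)"
        using J(1) by (intro open_Times open_Int) auto
    qed (use oB(4) J in auto)
    ultimately show ?thesis
    proof eventually_elim
      case (elim p)
      obtain s t where p: "p = (s, t)" by force
      define X where "X = envelope \<mu> \<xi> p"
      define \<tau> where "\<tau> = t - t0"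
      have X: "X = (s, - deriv \<mu> t - s * deriv \<xi> t, \<mu> t + s * \<xi> t + t * (- deriv \<mu> t - s * deriv \<xi> t))"
        by (simp add: X_def p envelope_def)
      have \<tau>: "\<tau> \<in> T" "t \<in> J" "t0 + \<tau> = t" using elim by (auto simp: p \<tau>_def)
      have XN: "(X, e X) \<in> U" "\<rho> (X, e X) = 0" using N(5) elim by (auto simp: X_def)
      then have eB: "e X \<in> B" by (simp add: U_def)
      have HP: "H X \<sigma> = Q \<sigma> (X, e X) * P (e X) \<sigma>" if "\<sigma> \<in> T" for \<sigma>
        using ID[OF that, of "(X, e X)"] eB XN(2) by simp
      have Qnz: "Q \<tau> (X, e X) \<noteq> 0" using elim by (simp add: X_def \<tau>_def p)
      have H0: "H X \<tau> = 0"
        by (simp add: H_def X m_def x_def \<tau>)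
      then have P0: "P (e X) \<tau> = 0" using HP[OF \<tau>(1)] Qnz by simp
      have "(\<mu> has_real_derivative deriv \<mu> t) (at (t0 + \<tau>))" "(\<xi> has_real_derivative deriv \<xi> t) (at (t0 + \<tau>))"
        using smooth_on_deriv(2)[OF J(1) sm(1) \<tau>(2)] smooth_on_deriv(2)[OF J(1) sm(2) \<tau>(2)] \<tau>(3) by auto
      then have "(m has_real_derivative deriv \<mu> t) (at \<tau>)" "(x has_real_derivative deriv \<xi> t) (at \<tau>)"
        unfolding m_def x_def using DERIV_shift[of \<mu> _ \<tau> t0] DERIV_shift[of \<xi> _ \<tau> t0]
        by (simp_all add: add.commute)
      then have dHX: "(H X has_real_derivative 0) (at \<tau>)"
        unfolding H_def by (auto simp: X intro!: derivative_eq_intros)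
      obtain P' where P': "(P (e X) has_real_derivative P') (at \<tau>)"
        using P_has_real_derivative by blast
      have "\<exists>Q'. ((\<lambda>\<sigma>. Q \<sigma> (X, e X)) has_real_derivative Q') (at \<tau>)"
      proof -
        have "smooth_on T (\<lambda>\<sigma>. Q \<sigma> (X, e X))"
          unfolding Q_def fst_conv snd_conv
          by (intro smooth_on_add smooth_on_mult smooth_on_const oB
              smooth_on_compose[OF smQ(1) oB(2,5), of "\<lambda>\<tau>. (\<tau>, e X)"] smooth_on_compose[OF smQ(2) oB(2,5), of "\<lambda>\<tau>. (\<tau>, e X)"]
              smooth_on_Pair smooth_on_id) (use eB in auto)
        from smooth_on_deriv(2)[OF oB(2) this \<tau>(1)] show ?thesis by blast
      qed
      then obtain Q' where Q': "((\<lambda>\<sigma>. Q \<sigma> (X, e X)) has_real_derivative Q') (at \<tau>)" by blast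
      have "((\<lambda>\<sigma>. Q \<sigma> (X, e X) * P (e X) \<sigma>) has_real_derivative (Q' * P (e X) \<tau> + P' * Q \<tau> (X, e X))) (at \<tau>)"
        by (rule DERIV_mult[OF Q' P'])
      then have "(H X has_real_derivative (Q' * P (e X) \<tau> + P' * Q \<tau> (X, e X))) (at \<tau>)"
        by (rule has_field_derivative_transform_within_open[OF _ oB(2) \<tau>(1)]) (use HP in auto)
      from DERIV_unique[OF this dHX] have "P' = 0" using P0 Qnz by simp
      with elim P0 P' show ?case by (simp add: X_def \<tau>_def p)
    qed
  qed
  show thesis
    by (rule that[of N e, folded X0_def De_def]) (use N B1 B2 ev in \<open>auto simp: X0_def\<close>)
qed

end

context generic_polynomial
begin

text \<open>The preparation in terms of scalar coefficient functions, so that the auxiliary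
  coefficient space no longer appears. \<open>D 2\<close> cannot vanish on the ruling, a nonzero
  vector killed by \<open>D 0\<close> and \<open>D 1\<close>.\<close>

lemma envelope_coefficients:
  fixes \<mu> \<xi> :: "real \<Rightarrow> real" and s0 t0 :: real
  assumes n: "3 \<le> n" and J: "open J" "t0 \<in> J" and sm: "smooth_on J \<mu>" "smooth_on J \<xi>"
    and M: "\<And>k. 2 \<le> k \<Longrightarrow> k < n \<Longrightarrow> (deriv ^^ k) \<mu> t0 + s0 * (deriv ^^ k) \<xi> t0 = 0"
      "(deriv ^^ n) \<mu> t0 + s0 * (deriv ^^ n) \<xi> t0 \<noteq> 0"
    and \<xi>2: "(deriv ^^ 2) \<xi> t0 \<noteq> 0"
  shows "\<exists>N a D. open N \<and> envelope \<mu> \<xi> (s0, t0) \<in> N \<and>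
    (\<forall>i. smooth_on N (a i) \<and> a i (envelope \<mu> \<xi> (s0, t0)) = 0 \<and>
       (a i has_derivative D i) (at (envelope \<mu> \<xi> (s0, t0)))) \<and>
    (\<forall>\<^sub>F p in nhds (s0, t0). envelope \<mu> \<xi> p \<in> N \<and>
       (snd p - t0) ^ n + (\<Sum>i<n. a i (envelope \<mu> \<xi> p) * (snd p - t0) ^ i) = 0 \<and>
       real n * (snd p - t0) ^ (n - 1) + (\<Sum>i<n. a i (envelope \<mu> \<xi> p) * (real i * (snd p - t0) ^ (i - 1))) = 0) \<and>
    (\<forall>V. D 0 V = 0 \<longrightarrow> D 1 V = 0 \<longrightarrow> D 2 V = 0 \<longrightarrow> V = 0) \<and>
    D 0 (ruling \<xi> t0) = 0 \<and> D 1 (ruling \<xi> t0) = 0 \<and> D 2 (ruling \<xi> t0) \<noteq> (0::real)"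
proof -
  define X0 where "X0 = envelope \<mu> \<xi> (s0, t0)"
  obtain N e where N: "open N" "X0 \<in> N" "smooth_on N e" "e X0 = 0"
    "\<forall>\<^sub>F p in nhds (s0, t0). envelope \<mu> \<xi> p \<in> N \<and> P (e (envelope \<mu> \<xi> p)) (snd p - t0) = 0 \<and>
       (P (e (envelope \<mu> \<xi> p)) has_real_derivative 0) (at (snd p - t0))"
    and ker: "\<forall>V. (\<forall>i<3. frechet_derivative e (at X0) V \<bullet> b i = 0) \<longrightarrow> V = 0"
    and rul: "\<forall>i<2. frechet_derivative e (at X0) (ruling \<xi> t0) \<bullet> b i = 0"
    unfolding X0_def by (rule envelope_preparation[OF assms]) blast
  define a where "a = (\<lambda>i X. e X \<bullet> b i)"
  define D where "D = (\<lambda>i V. frechet_derivative e (at X0) V \<bullet> b i)"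
  have de: "(e has_derivative frechet_derivative e (at X0)) (at X0)"
    by (rule smooth_on_has_derivative[OF N(3,2)])
  have ker3: "V = 0" if "D 0 V = 0" "D 1 V = 0" "D 2 V = 0" for V
  proof -
    have "frechet_derivative e (at X0) V \<bullet> b i = 0" if "i < 3" for i
    proof -
      have "i = 0 \<or> i = 1 \<or> i = 2" using that by auto
      then show ?thesis using \<open>D 0 V = 0\<close> \<open>D 1 V = 0\<close> \<open>D 2 V = 0\<close> by (auto simp: D_def)
    qed
    then show ?thesis using ker by blast
  qed
  have r01: "D 0 (ruling \<xi> t0) = 0" "D 1 (ruling \<xi> t0) = 0" using rul by (auto simp: D_def)
  have "ruling \<xi> t0 \<noteq> 0" by (simp add: ruling_def zero_prod_def)
  then have r2: "D 2 (ruling \<xi> t0) \<noteq> 0" using ker3 r01 by blast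
  have ev: "\<forall>\<^sub>F p in nhds (s0, t0). envelope \<mu> \<xi> p \<in> N \<and>
       (snd p - t0) ^ n + (\<Sum>i<n. a i (envelope \<mu> \<xi> p) * (snd p - t0) ^ i) = 0 \<and>
       real n * (snd p - t0) ^ (n - 1) + (\<Sum>i<n. a i (envelope \<mu> \<xi> p) * (real i * (snd p - t0) ^ (i - 1))) = 0"
    using N(5)
  proof eventually_elim
    case (elim p)
    have "(\<Sum>m\<le>n. pcoeff (e (envelope \<mu> \<xi> p)) m * (real m * (snd p - t0) ^ (m - 1))) = 0"
      using elim P_has_real_derivative DERIV_unique by blast
    moreover have "{..n} = insert n {..<n}" by auto
    ultimately show ?case
      using elim by (simp add: P_eq a_def pcoeff_def)
  qed
  have "open N \<and> X0 \<in> N \<and> (\<forall>i. smooth_on N (a i) \<and> a i X0 = 0 \<and> (a i has_derivative D i) (at X0))"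
    unfolding a_def D_def using N by (auto intro: smooth_on_inner_const has_derivative_inner_left de)
  with ev ker3 r01 r2 show ?thesis unfolding X0_def by blast
qed

end

lemma Basis_real3: "(Basis :: (real \<times> real \<times> real) set) = {(1,0,0), (0,1,0), (0,0,1)}"
  by (auto simp: Basis_prod_def zero_prod_def)

lemma Basis_real4: "(Basis :: (real \<times> real \<times> real \<times> real) set) = {(1,0,0,0), (0,1,0,0), (0,0,1,0), (0,0,0,1)}"
  by (auto simp: Basis_prod_def zero_prod_def)

lemma Basis_real5: "(Basis :: (real \<times> real \<times> real \<times> real \<times> real) set)
    = {(1,0,0,0,0), (0,1,0,0,0), (0,0,1,0,0), (0,0,0,1,0), (0,0,0,0,1)}"
  by (auto simp: Basis_prod_def zero_prod_def)

lemma bij_betw_nth: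
  assumes "distinct xs" "set xs = B"
  shows "bij_betw ((!) xs) {..<length xs} B"
  using bij_betw_nth[OF assms(1) refl refl] assms(2) by simp

lemmas envelope_coefficients3 =
  generic_polynomial.envelope_coefficients[of 3 "(!) [(1,0,0), (0,1,0), (0,0,1)] :: nat \<Rightarrow> real \<times> real \<times> real"]
lemmas envelope_coefficients4 =
  generic_polynomial.envelope_coefficients[of 4 "(!) [(1,0,0,0), (0,1,0,0), (0,0,1,0), (0,0,0,1)] :: nat \<Rightarrow> real \<times> real \<times> real \<times> real"]
lemmas envelope_coefficients5 =
  generic_polynomial.envelope_coefficients[of 5 "(!) [(1,0,0,0,0), (0,1,0,0,0), (0,0,1,0,0), (0,0,0,1,0), (0,0,0,0,1)] :: nat \<Rightarrow> real \<times> real \<times> real \<times> real \<times> real"]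

lemma generic_polynomial_345:
  "generic_polynomial 3 ((!) [(1,0,0), (0,1,0), (0,0,1)] :: nat \<Rightarrow> real \<times> real \<times> real)"
  "generic_polynomial 4 ((!) [(1,0,0,0), (0,1,0,0), (0,0,1,0), (0,0,0,1)] :: nat \<Rightarrow> real \<times> real \<times> real \<times> real)"
  "generic_polynomial 5 ((!) [(1,0,0,0,0), (0,1,0,0,0), (0,0,1,0,0), (0,0,0,1,0), (0,0,0,0,1)] :: nat \<Rightarrow> real \<times> real \<times> real \<times> real \<times> real)"
  unfolding generic_polynomial_def
  using bij_betw_nth[of "[(1,0,0), (0,1,0), (0,0,1)] :: (real \<times> real \<times> real) list"]
    bij_betw_nth[of "[(1,0,0,0), (0,1,0,0), (0,0,1,0), (0,0,0,1)] :: (real \<times> real \<times> real \<times> real) list"]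
    bij_betw_nth[of "[(1,0,0,0,0), (0,1,0,0,0), (0,0,1,0,0), (0,0,0,1,0), (0,0,0,0,1)] :: (real \<times> real \<times> real \<times> real \<times> real) list"]
  by (simp_all add: Basis_real3 Basis_real4 Basis_real5 numeral_eq_Suc)

section \<open>Recognising the normal forms\<close>

lemma right_left_equivalentI:
  fixes f g :: "real \<times> real \<Rightarrow> real \<times> real \<times> real"
  assumes "open N" "f a \<in> N" "smooth_on N \<psi>" "\<And>v. frechet_derivative \<psi> (at (f a)) v = 0 \<Longrightarrow> v = 0"
    and "open E" "a \<in> E" "smooth_on E \<phi>" "\<And>v. frechet_derivative \<phi> (at a) v = 0 \<Longrightarrow> v = 0"
    and "isCont f a" "\<phi> a = b" "\<forall>\<^sub>F p in nhds a. \<psi> (f p) = g (\<phi> p)"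
  shows "right_left_equivalent f a g b"
proof -
  obtain V V' \<psi>' where V: "f a \<in> V" "diffeo_between V V' \<psi> \<psi>'"
    by (rule smooth_local_inverse[OF assms(1,3,2,4)])
  obtain U U' \<phi>' where U: "a \<in> U" "diffeo_between U U' \<phi> \<phi>'"
    by (rule smooth_local_inverse[OF assms(5,7,6,8)])
  have "open V" using V(2) by (simp add: diffeo_between_def)
  have "(f \<longlongrightarrow> f a) (nhds a)"
    using assms(9) unfolding isCont_def tendsto_at_iff_tendsto_nhds .
  then have "\<forall>\<^sub>F p in nhds a. f p \<in> V"
    using \<open>open V\<close> V(1) by (rule topological_tendstoD)
  with assms(11) have ev: "\<forall>\<^sub>F p in nhds a. f p \<in> V \<and> \<psi> (f p) = g (\<phi> p)"
    by eventually_elim simp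
  have "\<psi> (f a) = g b"
    using eventually_nhds_x_imp_x[OF assms(11)] assms(10) by simp
  with U V ev assms(10) show ?thesis
    unfolding right_left_equivalent_def by blast
qed

lemma envelope_has_derivative:
  assumes J: "open J" "t \<in> J" and sm: "smooth_on J \<mu>" "smooth_on J \<xi>"
  shows "(envelope \<mu> \<xi> has_derivative
    (\<lambda>(h, k). h *\<^sub>R ruling \<xi> t + (k * (- (deriv ^^ 2) \<mu> t - s * (deriv ^^ 2) \<xi> t)) *\<^sub>R (0, 1, t))) (at (s, t))"
proof -
  have c: "((\<lambda>p. f (snd p)) has_derivative (\<lambda>h. snd h * deriv f t)) (at (s, t))" if "smooth_on J f" for f :: "real \<Rightarrow> real"
  proof -
    have "(f has_real_derivative deriv f t) (at (snd (s, t)))"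
      using smooth_on_deriv(2)[OF J(1) that J(2)] by simp
    then show ?thesis
      by (rule DERIV_compose_FDERIV) (auto intro!: derivative_eq_intros)
  qed
  note d = c[OF sm(1)] c[OF sm(2)] c[OF smooth_on_deriv(1)[OF J(1) sm(1)]] c[OF smooth_on_deriv(1)[OF J(1) sm(2)]]
  have *: "(envelope \<mu> \<xi> has_derivative (\<lambda>h. (fst h,
      - (snd h * deriv (deriv \<mu>) t) - (s * (snd h * deriv (deriv \<xi>) t) + fst h * deriv \<xi> t),
      (snd h * deriv \<mu> t + (s * (snd h * deriv \<xi> t) + fst h * \<xi> t)) +
      (t * (- (snd h * deriv (deriv \<mu>) t) - (s * (snd h * deriv (deriv \<xi>) t) + fst h * deriv \<xi> t))
       + snd h * (- deriv \<mu> t - s * deriv \<xi> t))))) (at (s, t))"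
    unfolding envelope_def split_beta
    by (rule has_derivative_eq_rhs, (rule has_derivative_Pair has_derivative_add has_derivative_diff has_derivative_minus
        has_derivative_mult has_derivative_fst has_derivative_snd has_derivative_ident d)+, simp)
  show ?thesis
    by (rule has_derivative_eq_rhs[OF *])
      (auto simp: fun_eq_iff ruling_def numeral_2_eq_2 algebra_simps)
qed

text \<open>At a singular point the differential of the envelope kills the \<open>t\<close>
  direction and sends the \<open>s\<close> direction to the ruling. So the first component of
  \<open>\<psi>\<close> along the envelope together with \<open>v\<close> forms source coordinates,
  provided that component moves along the ruling and \<open>v\<close> moves with
  \<open>t\<close>.\<close>

lemma envelope_equivalence:
  fixes g :: "real \<times> real \<Rightarrow> real \<times> real \<times> real"
  assumes J: "open J" "t0 \<in> J" and sm: "smooth_on J \<mu>" "smooth_on J \<xi>"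
    and sing: "(deriv ^^ 2) \<mu> t0 + s0 * (deriv ^^ 2) \<xi> t0 = 0"
    and N: "open N" "envelope \<mu> \<xi> (s0, t0) \<in> N" "smooth_on N \<psi>" "\<psi> (envelope \<mu> \<xi> (s0, t0)) = 0"
    and d: "(\<psi> has_derivative D) (at (envelope \<mu> \<xi> (s0, t0)))" "\<And>V. D V = 0 \<Longrightarrow> V = 0" "fst (D (ruling \<xi> t0)) \<noteq> 0"
    and E: "open E" "(s0, t0) \<in> E" "smooth_on E v" "v (s0, t0) = 0"
    and v: "(v has_derivative Dv) (at (s0, t0))" "Dv (0, 1) \<noteq> (0::real)"
    and ev: "\<forall>\<^sub>F p in nhds (s0, t0). \<psi> (envelope \<mu> \<xi> p) = g (fst (\<psi> (envelope \<mu> \<xi> p)), v p)"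
  shows "right_left_equivalent (envelope \<mu> \<xi>) (s0, t0) g (0, 0)"
proof -
  define F where "F = envelope \<mu> \<xi>"
  have smF: "smooth_on (UNIV \<times> J) F"
    unfolding F_def by (rule smooth_on_envelope[OF J(1) sm])
  have oJ: "open (UNIV \<times> J :: (real \<times> real) set)" using J by (intro open_Times) auto
  have sing0: "- (deriv ^^ 2) \<mu> t0 - s0 * (deriv ^^ 2) \<xi> t0 = 0" using sing by linarith
  have dF: "(F has_derivative (\<lambda>h. fst h *\<^sub>R ruling \<xi> t0)) (at (s0, t0))"
    unfolding F_def
    by (rule has_derivative_eq_rhs[OF envelope_has_derivative[OF J sm]])
      (use sing0 in \<open>simp add: fun_eq_iff zero_prod_def\<close>)
  define E' where "E' = E \<inter> ((UNIV \<times> J) \<inter> F -` N)"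
  have "open ((UNIV \<times> J) \<inter> F -` N)"
    using continuous_open_preimage[OF smooth_on_imp_continuous_on[OF smF] oJ N(1)] .
  then have E': "open E'" "(s0, t0) \<in> E'"
    using E J N(2) by (auto simp: E'_def F_def)
  define \<phi> where "\<phi> = (\<lambda>p. (fst (\<psi> (F p)), v p))"
  have sm\<phi>: "smooth_on E' \<phi>"
    unfolding \<phi>_def
    by (intro smooth_on_Pair smooth_on_fst smooth_on_compose[OF N(3) E'(1) N(1)] E'
        smooth_on_subset[OF smF] smooth_on_subset[OF E(3)]) (auto simp: E'_def)
  have d\<phi>: "(\<phi> has_derivative (\<lambda>h. (fst (D (fst h *\<^sub>R ruling \<xi> t0)), Dv h))) (at (s0, t0))"
    unfolding \<phi>_def
    by (intro has_derivative_Pair has_derivative_fst v has_derivative_compose[OF dF]) (use d(1) in \<open>simp add: F_def\<close>)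
  have inj\<phi>: "h = 0" if "frechet_derivative \<phi> (at (s0, t0)) h = 0" for h
  proof -
    have "fst (D (fst h *\<^sub>R ruling \<xi> t0)) = 0" "Dv h = 0"
      using that unfolding frechet_derivative_unique[OF d\<phi>] by (simp_all add: zero_prod_def)
    then have "fst h = 0"
      using d(3) linear_cmul[OF has_derivative_linear[OF d(1)]] by simp
    moreover have "h = snd h *\<^sub>R (0, 1)"
      using \<open>fst h = 0\<close> by (simp add: prod_eq_iff)
    then have "snd h * Dv (0, 1) = 0"
      using \<open>Dv h = 0\<close> linear_cmul[OF has_derivative_linear[OF v(1)], of "snd h" "(0, 1)"] by simp
    ultimately show ?thesis using v(2) by (simp add: prod_eq_iff)
  qed
  have contF: "isCont F (s0, t0)" by (rule has_derivative_continuous[OF dF])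
  show ?thesis
    unfolding F_def[symmetric]
    by (rule right_left_equivalentI[OF N(1) _ N(3) _ E' sm\<phi> inj\<phi> contF])
      (use N(2,4) d E(4) ev frechet_derivative_unique[OF d(1)] in \<open>simp_all add: F_def \<phi>_def\<close>)
qed

lemma envelope_preimage:
  fixes N :: "(real \<times> real \<times> real) set"
  assumes J: "open J" "t0 \<in> J" and sm: "smooth_on J \<mu>" "smooth_on J \<xi>"
    and N: "open N" "envelope \<mu> \<xi> (s0, t0) \<in> N"
  obtains E where "open E" "(s0, t0) \<in> E" "\<forall>p\<in>E. envelope \<mu> \<xi> p \<in> N" "smooth_on E (envelope \<mu> \<xi>)"
proof -
  have o: "open (UNIV \<times> J :: (real \<times> real) set)" using J by (intro open_Times) auto
  note smF = smooth_on_envelope[OF J(1) sm]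
  have "open ((UNIV \<times> J) \<inter> envelope \<mu> \<xi> -` N)"
    using continuous_open_preimage[OF smooth_on_imp_continuous_on[OF smF] o N(1)] .
  then show thesis
    by (rule that) (use J N smooth_on_subset[OF smF] in auto)
qed

lemma envelope_has_derivative_singular:
  assumes J: "open J" "t0 \<in> J" and sm: "smooth_on J \<mu>" "smooth_on J \<xi>"
    and sing: "(deriv ^^ 2) \<mu> t0 + s0 * (deriv ^^ 2) \<xi> t0 = 0"
  shows "(envelope \<mu> \<xi> has_derivative (\<lambda>h. fst h *\<^sub>R ruling \<xi> t0)) (at (s0, t0))"
proof -
  have sing0: "- (deriv ^^ 2) \<mu> t0 - s0 * (deriv ^^ 2) \<xi> t0 = 0" using sing by linarith
  show ?thesis
    by (rule has_derivative_eq_rhs[OF envelope_has_derivative[OF J sm]])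
      (use sing0 in \<open>simp add: fun_eq_iff zero_prod_def\<close>)
qed

text \<open>The shift \<open>v = x + c / 3\<close> turns the cubic into
  \<open>v^3 + p v + q\<close>, and a double root means \<open>p = - 3 v^2\<close> and
  \<open>q = 2 v^3\<close>.\<close>

lemma cubic_double_root:
  fixes x a b c :: real
  assumes "x ^ 3 + (a + b * x + c * x\<^sup>2) = 0" "3 * x\<^sup>2 + (b + c * (2 * x)) = 0"
  shows "- (b - c\<^sup>2 / 3) / 3 = (x + c / 3)\<^sup>2"
    and "(a - b * c / 3 + 2 * c ^ 3 / 27) / 2 = (x + c / 3) ^ 3"
proof -
  have b: "b = - 3 * x\<^sup>2 - c * (2 * x)" using assms(2) by linarith
  have a: "a = - (x ^ 3) - b * x - c * x\<^sup>2" using assms(1) by linarith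
  show "- (b - c\<^sup>2 / 3) / 3 = (x + c / 3)\<^sup>2" "(a - b * c / 3 + 2 * c ^ 3 / 27) / 2 = (x + c / 3) ^ 3"
    unfolding a b by (simp_all add: field_simps power2_eq_square power3_eq_cube)
qed

text \<open>The shift removes the cubic term. A double root \<open>v\<close> of
  \<open>v^4 + u v^2 + b v + a\<close> has \<open>b = - 4 v^3 - 2 u v\<close> and
  \<open>a = 3 v^4 + u v^2\<close>, the two remaining components of the swallowtail.\<close>

lemma quartic_double_root:
  fixes x a b c d :: real
  assumes "x ^ 4 + (a + b * x + c * x\<^sup>2 + d * x ^ 3) = 0"
    "4 * x ^ 3 + (b + c * (2 * x) + d * (3 * x\<^sup>2)) = 0"
  defines "v \<equiv> x + d / 4" and "u \<equiv> c - 3 * d\<^sup>2 / 8"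
  shows "a - b * d / 4 + c * d\<^sup>2 / 16 - 3 * d ^ 4 / 256 = 3 * v ^ 4 + u * v\<^sup>2"
    and "- (b - c * d / 2 + d ^ 3 / 8) = 4 * v ^ 3 + 2 * u * v"
proof -
  have b: "b = - 4 * x ^ 3 - c * (2 * x) - d * (3 * x\<^sup>2)" using assms(2) by linarith
  have a: "a = - (x ^ 4) - b * x - c * x\<^sup>2 - d * x ^ 3" using assms(1) by linarith
  show "a - b * d / 4 + c * d\<^sup>2 / 16 - 3 * d ^ 4 / 256 = 3 * v ^ 4 + u * v\<^sup>2"
    "- (b - c * d / 2 + d ^ 3 / 8) = 4 * v ^ 3 + 2 * u * v"
    unfolding a b u_def v_def by (simp_all add: field_simps power2_eq_square power3_eq_cube power4_eq_xxxx)
qed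

theorem cuspidal_edge_envelope:
  fixes \<mu> \<xi> :: "real \<Rightarrow> real" and s0 t0 :: real
  assumes J: "open J" "t0 \<in> J" and sm: "smooth_on J \<mu>" "smooth_on J \<xi>"
    and M: "(deriv ^^ 2) \<mu> t0 + s0 * (deriv ^^ 2) \<xi> t0 = 0"
      "(deriv ^^ 3) \<mu> t0 + s0 * (deriv ^^ 3) \<xi> t0 \<noteq> 0"
    and \<xi>2: "(deriv ^^ 2) \<xi> t0 \<noteq> 0"
  shows "cuspidal_edge_at (envelope \<mu> \<xi>) (s0, t0)"
proof -
  define F where "F = envelope \<mu> \<xi>"
  have M': "(deriv ^^ k) \<mu> t0 + s0 * (deriv ^^ k) \<xi> t0 = 0" if "2 \<le> k" "k < 3" for k
    using that M(1) by (cases "k = 2") auto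
  obtain N a D where N: "open N" "F (s0, t0) \<in> N"
    and a: "\<And>i. smooth_on N (a i)" "\<And>i. a i (F (s0, t0)) = 0" "\<And>i. (a i has_derivative D i) (at (F (s0, t0)))"
    and ev: "\<forall>\<^sub>F p in nhds (s0, t0). F p \<in> N \<and>
       (snd p - t0) ^ 3 + (\<Sum>i<3. a i (F p) * (snd p - t0) ^ i) = 0 \<and>
       real 3 * (snd p - t0) ^ (3 - 1) + (\<Sum>i<3. a i (F p) * (real i * (snd p - t0) ^ (i - 1))) = 0"
    and ker: "\<And>V. D 0 V = 0 \<Longrightarrow> D 1 V = 0 \<Longrightarrow> D 2 V = 0 \<Longrightarrow> V = 0"
    and R: "D 0 (ruling \<xi> t0) = 0" "D 1 (ruling \<xi> t0) = 0" "D 2 (ruling \<xi> t0) \<noteq> 0"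
    using envelope_coefficients3[OF generic_polynomial_345(1) _ J sm M' M(2) \<xi>2] unfolding F_def by auto
  \<comment> \<open>Only two coefficients survive the completion of the cube. The abscissa serves as
    the missing coordinate: the common kernel of \<open>D 0\<close> and \<open>D 1\<close> is
    spanned by the ruling, along which the abscissa moves.\<close>
  define \<psi> where "\<psi> = (\<lambda>X. (fst X - s0, - (a 1 X - (a 2 X)\<^sup>2 / 3) / 3, (a 0 X - a 1 X * a 2 X / 3 + 2 * (a 2 X) ^ 3 / 27) / 2))"
  define v where "v = (\<lambda>p. snd p - t0 + a 2 (F p) / 3)"
  obtain E where E: "open E" "(s0, t0) \<in> E" "\<forall>p\<in>E. F p \<in> N" "smooth_on E F"
    unfolding F_def by (rule envelope_preimage[OF J sm N[unfolded F_def]])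
  have dF: "(F has_derivative (\<lambda>h. fst h *\<^sub>R ruling \<xi> t0)) (at (s0, t0))"
    unfolding F_def by (rule envelope_has_derivative_singular[OF J sm M(1)])
  have sma: "smooth_on E (\<lambda>p. a i (F p))" for i
    by (rule smooth_on_compose[OF a(1) E(1) N(1) E(4)]) (use E(3) in auto)
  have da: "((\<lambda>p. a i (F p)) has_derivative (\<lambda>h. D i (fst h *\<^sub>R ruling \<xi> t0))) (at (s0, t0))" for i
    by (rule has_derivative_compose[OF dF a(3)])
  have D0: "D i 0 = 0" for i
    using has_derivative_linear[OF a(3)] by (rule linear_0)
  have rul: "V = 0" if "D 0 V = 0" "D 1 V = 0" "fst V = 0" for V
  proof -
    define c where "c = D 2 V / D 2 (ruling \<xi> t0)"
    have "V - c *\<^sub>R ruling \<xi> t0 = 0"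
      by (rule ker) (use that R has_derivative_linear[OF a(3)] in \<open>simp_all add: linear_diff linear_cmul c_def\<close>)
    then have "V = c *\<^sub>R ruling \<xi> t0" by simp
    with that(3) show ?thesis by (simp add: ruling_def zero_prod_def)
  qed
  show ?thesis
    unfolding cuspidal_edge_at_def
  proof (rule envelope_equivalence[OF J sm M(1), of N \<psi> _ E v])
    show "smooth_on N \<psi>" unfolding \<psi>_def
      by (intro smooth_on_Pair smooth_on_diff smooth_on_add smooth_on_minus smooth_on_divide smooth_on_mult smooth_on_power
          smooth_on_fst smooth_on_id smooth_on_const a N(1)) auto
    show "smooth_on E v" unfolding v_def
      by (intro smooth_on_diff smooth_on_add smooth_on_divide smooth_on_snd smooth_on_id smooth_on_const sma E(1)) auto
    show "(\<psi> has_derivative (\<lambda>V. (fst V, - D 1 V / 3, D 0 V / 2))) (at (envelope \<mu> \<xi> (s0, t0)))"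
      unfolding \<psi>_def F_def[symmetric]
      by (auto intro!: derivative_eq_intros a(3) simp: a(2))
    show "(v has_derivative (\<lambda>h. snd h + D 2 (fst h *\<^sub>R ruling \<xi> t0) / 3)) (at (s0, t0))"
      unfolding v_def by (auto intro!: derivative_eq_intros da)
    show "\<forall>\<^sub>F p in nhds (s0, t0). \<psi> (envelope \<mu> \<xi> p) = (\<lambda>(u, v). (u, v\<^sup>2, v ^ 3)) (fst (\<psi> (envelope \<mu> \<xi> p)), v p)"
      using ev
    proof eventually_elim
      case (elim p)
      define \<tau> where "\<tau> = snd p - t0"
      have e: "\<tau> ^ 3 + (a 0 (F p) + a 1 (F p) * \<tau> + a 2 (F p) * \<tau>\<^sup>2) = 0" "3 * \<tau>\<^sup>2 + (a 1 (F p) + a 2 (F p) * (2 * \<tau>)) = 0"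
        using elim by (simp_all add: \<tau>_def numeral_eq_Suc)
      show ?case
        unfolding \<psi>_def v_def F_def[symmetric] \<tau>_def[symmetric]
        using cubic_double_root[OF e] by simp
    qed
    show "\<psi> (envelope \<mu> \<xi> (s0, t0)) = 0"
      unfolding F_def[symmetric] \<psi>_def by (simp add: a(2) zero_prod_def) (simp add: F_def envelope_def)
    show "v (s0, t0) = 0"
      unfolding v_def by (simp add: a(2))
    show "snd (0, 1) + D 2 (fst (0::real, 1::real) *\<^sub>R ruling \<xi> t0) / 3 \<noteq> 0"
      by (simp add: D0)
    show "V = 0" if "(fst V, - D 1 V / 3, D 0 V / 2) = 0" for V
      using that rul[of V] by (simp add: zero_prod_def)
    show "fst (fst (ruling \<xi> t0), - D 1 (ruling \<xi> t0) / 3, D 0 (ruling \<xi> t0) / 2) \<noteq> 0"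
      using R by (simp add: ruling_def)
  qed (use N E in \<open>simp_all add: F_def\<close>)
qed

theorem swallowtail_envelope:
  fixes \<mu> \<xi> :: "real \<Rightarrow> real" and s0 t0 :: real
  assumes J: "open J" "t0 \<in> J" and sm: "smooth_on J \<mu>" "smooth_on J \<xi>"
    and M: "(deriv ^^ 2) \<mu> t0 + s0 * (deriv ^^ 2) \<xi> t0 = 0"
      "(deriv ^^ 3) \<mu> t0 + s0 * (deriv ^^ 3) \<xi> t0 = 0"
      "(deriv ^^ 4) \<mu> t0 + s0 * (deriv ^^ 4) \<xi> t0 \<noteq> 0"
    and \<xi>2: "(deriv ^^ 2) \<xi> t0 \<noteq> 0"
  shows "swallowtail_at (envelope \<mu> \<xi>) (s0, t0)"
proof -
  define F where "F = envelope \<mu> \<xi>"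
  have M': "(deriv ^^ k) \<mu> t0 + s0 * (deriv ^^ k) \<xi> t0 = 0" if "2 \<le> k" "k < 4" for k
  proof -
    have "k = 2 \<or> k = 3" using that by auto
    then show ?thesis using M(1,2) by auto
  qed
  obtain N a D where N: "open N" "F (s0, t0) \<in> N"
    and a: "\<And>i. smooth_on N (a i)" "\<And>i. a i (F (s0, t0)) = 0" "\<And>i. (a i has_derivative D i) (at (F (s0, t0)))"
    and ev: "\<forall>\<^sub>F p in nhds (s0, t0). F p \<in> N \<and>
       (snd p - t0) ^ 4 + (\<Sum>i<4. a i (F p) * (snd p - t0) ^ i) = 0 \<and>
       real 4 * (snd p - t0) ^ (4 - 1) + (\<Sum>i<4. a i (F p) * (real i * (snd p - t0) ^ (i - 1))) = 0"
    and ker: "\<And>V. D 0 V = 0 \<Longrightarrow> D 1 V = 0 \<Longrightarrow> D 2 V = 0 \<Longrightarrow> V = 0"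
    and R: "D 0 (ruling \<xi> t0) = 0" "D 1 (ruling \<xi> t0) = 0" "D 2 (ruling \<xi> t0) \<noteq> 0"
    using envelope_coefficients4[OF generic_polynomial_345(2) _ J sm M' M(3) \<xi>2] unfolding F_def by auto
  \<comment> \<open>The coefficients of the depressed quartic differ from the original ones by terms
    of order at least two at the base point, so their differentials are unchanged.\<close>
  define a2 where "a2 = (\<lambda>X. a 2 X - 3 * (a 3 X)\<^sup>2 / 8)"
  define a1 where "a1 = (\<lambda>X. a 1 X - a 2 X * a 3 X / 2 + (a 3 X) ^ 3 / 8)"
  define a0 where "a0 = (\<lambda>X. a 0 X - a 1 X * a 3 X / 4 + a 2 X * (a 3 X)\<^sup>2 / 16 - 3 * (a 3 X) ^ 4 / 256)"
  define \<psi> where "\<psi> = (\<lambda>X. (a2 X, a0 X, - a1 X))"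
  define v where "v = (\<lambda>p. snd p - t0 + a 3 (F p) / 4)"
  obtain E where E: "open E" "(s0, t0) \<in> E" "\<forall>p\<in>E. F p \<in> N" "smooth_on E F"
    unfolding F_def by (rule envelope_preimage[OF J sm N[unfolded F_def]])
  have dF: "(F has_derivative (\<lambda>h. fst h *\<^sub>R ruling \<xi> t0)) (at (s0, t0))"
    unfolding F_def by (rule envelope_has_derivative_singular[OF J sm M(1)])
  have sma: "smooth_on E (\<lambda>p. a i (F p))" for i
    by (rule smooth_on_compose[OF a(1) E(1) N(1) E(4)]) (use E(3) in auto)
  have da: "((\<lambda>p. a i (F p)) has_derivative (\<lambda>h. D i (fst h *\<^sub>R ruling \<xi> t0))) (at (s0, t0))" for i
    by (rule has_derivative_compose[OF dF a(3)])
  have D0: "D i 0 = 0" for i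
    using has_derivative_linear[OF a(3)] by (rule linear_0)
  show ?thesis
    unfolding swallowtail_at_def
  proof (rule envelope_equivalence[OF J sm M(1), of N \<psi> _ E v])
    show "smooth_on N \<psi>" unfolding \<psi>_def a0_def a1_def a2_def
      by (intro smooth_on_Pair smooth_on_diff smooth_on_add smooth_on_minus smooth_on_divide smooth_on_mult smooth_on_power
          smooth_on_fst smooth_on_id smooth_on_const a N(1)) auto
    show "smooth_on E v" unfolding v_def
      by (intro smooth_on_diff smooth_on_add smooth_on_divide smooth_on_snd smooth_on_id smooth_on_const sma E(1)) auto
    show "(\<psi> has_derivative (\<lambda>V. (D 2 V, D 0 V, - D 1 V))) (at (envelope \<mu> \<xi> (s0, t0)))"
      unfolding \<psi>_def a0_def a1_def a2_def F_def[symmetric]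
      by (auto intro!: derivative_eq_intros a(3) simp: a(2))
    show "(v has_derivative (\<lambda>h. snd h + D 3 (fst h *\<^sub>R ruling \<xi> t0) / 4)) (at (s0, t0))"
      unfolding v_def by (auto intro!: derivative_eq_intros da)
    show "\<forall>\<^sub>F p in nhds (s0, t0). \<psi> (envelope \<mu> \<xi> p) = (\<lambda>(u, v). (u, 3 * v ^ 4 + u * v\<^sup>2, 4 * v ^ 3 + 2 * u * v)) (fst (\<psi> (envelope \<mu> \<xi> p)), v p)"
      using ev
    proof eventually_elim
      case (elim p)
      define \<tau> where "\<tau> = snd p - t0"
      have e: "\<tau> ^ 4 + (a 0 (F p) + a 1 (F p) * \<tau> + a 2 (F p) * \<tau>\<^sup>2 + a 3 (F p) * \<tau> ^ 3) = 0"
        "4 * \<tau> ^ 3 + (a 1 (F p) + a 2 (F p) * (2 * \<tau>) + a 3 (F p) * (3 * \<tau>\<^sup>2)) = 0"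
        using elim by (simp_all add: \<tau>_def numeral_eq_Suc)
      show ?case
        unfolding \<psi>_def a0_def a1_def a2_def v_def F_def[symmetric] \<tau>_def[symmetric]
        using quartic_double_root[OF e] by simp
    qed
    show "\<psi> (envelope \<mu> \<xi> (s0, t0)) = 0"
      unfolding F_def[symmetric] \<psi>_def a0_def a1_def a2_def by (simp add: a(2) zero_prod_def)
    show "v (s0, t0) = 0"
      unfolding v_def by (simp add: a(2))
    show "snd (0, 1) + D 3 (fst (0::real, 1::real) *\<^sub>R ruling \<xi> t0) / 4 \<noteq> 0"
      by (simp add: D0)
    show "V = 0" if "(D 2 V, D 0 V, - D 1 V) = 0" for V
      using that ker[of V] by (simp add: zero_prod_def)
    show "fst (D 2 (ruling \<xi> t0), D 0 (ruling \<xi> t0), - D 1 (ruling \<xi> t0)) \<noteq> 0"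
      using R by (simp add: ruling_def)
  qed (use N E in \<open>simp_all add: F_def\<close>)
qed

section \<open>Tschirnhaus transformation of the quintic\<close>

text \<open>Power sums of the roots of \<open>x\<^sup>5 + d x\<^sup>3 + c x\<^sup>2 + b x + a\<close>.\<close>

fun psum :: "real \<Rightarrow> real \<Rightarrow> real \<Rightarrow> real \<Rightarrow> nat \<Rightarrow> real" where
  "psum a b c d 0 = 5"
| "psum a b c d (Suc 0) = 0"
| "psum a b c d (Suc (Suc 0)) = - 2 * d"
| "psum a b c d (Suc (Suc (Suc 0))) = - 3 * c"
| "psum a b c d (Suc (Suc (Suc (Suc 0)))) = 2 * d\<^sup>2 - 4 * b"
| "psum a b c d (Suc (Suc (Suc (Suc (Suc k))))) = - d * psum a b c d (Suc (Suc (Suc k)))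
     - c * psum a b c d (Suc (Suc k)) - b * psum a b c d (Suc k) - a * psum a b c d k"

text \<open>Up to exponent 4 these are Newton's identities, checked by expansion; from 5 on the
  equation satisfied by each root, multiplied by a power, gives the recurrence.\<close>

lemma power_sums:
  fixes r1 r2 r3 r4 r5 :: complex
  assumes "[:of_real a, of_real b, of_real c, of_real d, 0, 1:]
    = [:-r1, 1:] * [:-r2, 1:] * [:-r3, 1:] * [:-r4, 1:] * [:-r5, 1:]"
  shows "r1 ^ k + r2 ^ k + r3 ^ k + r4 ^ k + r5 ^ k = of_real (psum a b c d k)"
proof -
  have root: "r ^ 5 = - of_real d * r ^ 3 - of_real c * r\<^sup>2 - of_real b * r - of_real a"
    if "r \<in> {r1, r2, r3, r4, r5}" for r
  proof -
    have "poly ([:-r1, 1:] * [:-r2, 1:] * [:-r3, 1:] * [:-r4, 1:] * [:-r5, 1:]) r = 0"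
      using that by (auto simp: poly_mult simp del: mult_pCons_left mult_pCons_right)
    then have "poly [:of_real a, of_real b, of_real c, of_real d, 0, 1:] r = 0"
      unfolding assms .
    then have "of_real a + r * (of_real b + r * (of_real c + r * (of_real d + r * (0 + r)))) = 0"
      by simp
    then show ?thesis by algebra
  qed
  have coeffs: "of_real a = - (r1 * r2 * r3 * r4 * r5)"
    "of_real b = r1*r2*r3*r4 + r1*r2*r3*r5 + r1*r2*r4*r5 + r1*r3*r4*r5 + r2*r3*r4*r5"
    "of_real c = - (r1*r2*r3 + r1*r2*r4 + r1*r2*r5 + r1*r3*r4 + r1*r3*r5 + r1*r4*r5 + r2*r3*r4 + r2*r3*r5 + r2*r4*r5 + r3*r4*r5)"
    "of_real d = r1*r2 + r1*r3 + r1*r4 + r1*r5 + r2*r3 + r2*r4 + r2*r5 + r3*r4 + r3*r5 + r4*r5"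
    "r1 + r2 + r3 + r4 + r5 = 0"
    using assms by (simp_all add: algebra_simps)
  have step: "r ^ (k + 5) = - of_real d * r ^ (k + 3) - of_real c * r ^ (k + 2) - of_real b * r ^ (k + 1) - of_real a * r ^ k"
    if "r \<in> {r1, r2, r3, r4, r5}" for r k
    unfolding power_add root[OF that] by (simp add: algebra_simps power3_eq_cube power2_eq_square)
  have r5: "r5 = - (r1 + r2 + r3 + r4)"
    using coeffs(5) by algebra
  show ?thesis
  proof (induction k rule: less_induct)
    case (less k)
    consider "k = 0" | "k = 1" | "k = 2" | "k = 3" | "k = 4" | m where "k = m + 5"
    proof -
      have "k < 5 \<or> k = (k - 5) + 5" by auto
      moreover have "k < 5 \<Longrightarrow> k = 0 \<or> k = 1 \<or> k = 2 \<or> k = 3 \<or> k = 4" by auto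
      ultimately show thesis using that by blast
    qed
    then show ?case
    proof cases
      case 2
      then show ?thesis using coeffs(5) by simp
    next
      case 3
      have "r1\<^sup>2 + r2\<^sup>2 + r3\<^sup>2 + r4\<^sup>2 + r5\<^sup>2 = - 2 * of_real d"
        unfolding coeffs(4) r5 by (simp add: power2_eq_square algebra_simps)
      then show ?thesis using 3 by (simp add: numeral_2_eq_2)
    next
      case 4
      have "r1 ^ 3 + r2 ^ 3 + r3 ^ 3 + r4 ^ 3 + r5 ^ 3 = - 3 * of_real c"
        unfolding coeffs(3) r5 by (simp add: power3_eq_cube algebra_simps)
      then show ?thesis using 4 by (simp add: numeral_3_eq_3)
    next
      case 5
      have "r1 ^ 4 + r2 ^ 4 + r3 ^ 4 + r4 ^ 4 + r5 ^ 4 = 2 * (of_real d)\<^sup>2 - 4 * of_real b"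
        unfolding coeffs(2,4) r5 by (simp add: power4_eq_xxxx power2_eq_square algebra_simps)
      then show ?thesis using 5 by (simp add: numeral_eq_Suc)
    next
      case (6 m)
      have p: "psum a b c d k = - d * psum a b c d (m + 3) - c * psum a b c d (m + 2) - b * psum a b c d (m + 1) - a * psum a b c d m"
        unfolding 6 by (simp add: numeral_eq_Suc)
      have IH: "of_real (psum a b c d i) = r1 ^ i + r2 ^ i + r3 ^ i + r4 ^ i + r5 ^ i" if "i < k" for i
        using less.IH[OF that] by simp
      have I: "of_real (psum a b c d (m + 3)) = r1 ^ (m + 3) + r2 ^ (m + 3) + r3 ^ (m + 3) + r4 ^ (m + 3) + r5 ^ (m + 3)"
        "of_real (psum a b c d (m + 2)) = r1 ^ (m + 2) + r2 ^ (m + 2) + r3 ^ (m + 2) + r4 ^ (m + 2) + r5 ^ (m + 2)"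
        "of_real (psum a b c d (m + 1)) = r1 ^ (m + 1) + r2 ^ (m + 1) + r3 ^ (m + 1) + r4 ^ (m + 1) + r5 ^ (m + 1)"
        "of_real (psum a b c d m) = r1 ^ m + r2 ^ m + r3 ^ m + r4 ^ m + r5 ^ m"
        by (rule IH, simp add: 6)+
      have r: "r1 ^ (m + 5) + r2 ^ (m + 5) + r3 ^ (m + 5) + r4 ^ (m + 5) + r5 ^ (m + 5)
        = - of_real d * (r1 ^ (m + 3) + r2 ^ (m + 3) + r3 ^ (m + 3) + r4 ^ (m + 3) + r5 ^ (m + 3))
          - of_real c * (r1 ^ (m + 2) + r2 ^ (m + 2) + r3 ^ (m + 2) + r4 ^ (m + 2) + r5 ^ (m + 2))
          - of_real b * (r1 ^ (m + 1) + r2 ^ (m + 1) + r3 ^ (m + 1) + r4 ^ (m + 1) + r5 ^ (m + 1))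
          - of_real a * (r1 ^ m + r2 ^ m + r3 ^ m + r4 ^ m + r5 ^ m)"
        using step[of r1 m] step[of r2 m] step[of r3 m] step[of r4 m] step[of r5 m]
        by (simp only: insert_iff simp_thms) (simp only: algebra_simps)
      show ?thesis
        unfolding p of_real_diff of_real_mult of_real_minus I unfolding 6(1) by (rule r)
    qed simp
  qed
qed

lemma quintic_double_root_factorization:
  fixes x a b c d :: real
  assumes "x ^ 5 + (a + b * x + c * x\<^sup>2 + d * x ^ 3) = 0"
    "5 * x ^ 4 + (b + c * (2 * x) + d * (3 * x\<^sup>2)) = 0"
  obtains r3 r4 r5 :: complex
  where "[:of_real a, of_real b, of_real c, of_real d, 0, 1:]
    = [:-of_real x, 1:] * [:-of_real x, 1:] * [:-r3, 1:] * [:-r4, 1:] * [:-r5, 1:]"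
proof -
  \<comment> \<open>\<open>B\<close> and \<open>C\<close> come from comparing coefficients in the
    product of \<open>(X - x)^2\<close> with \<open>X^3 + 2 x X^2 + B X + C\<close>; the two
    hypotheses are exactly what remains.\<close>
  define B where "B = d + 3 * x\<^sup>2"
  define C where "C = c + 2 * x * B - 2 * x ^ 3"
  define q :: "complex poly" where "q = [:of_real C, of_real B, of_real (2 * x), 1:]"
  have "degree q = 3" "lead_coeff q = 1" "q \<noteq> 0" by (simp_all add: q_def)
  then obtain A where A: "size A = 3" "q = (\<Prod>y\<in>#A. [:-y, 1:])"
    using alg_closed_imp_factorization[of q] by auto
  obtain r3 A1 where "A = add_mset r3 A1"
    using A(1) size_eq_Suc_imp_eq_union[of A 2] by auto
  moreover obtain r4 A2 where "A1 = add_mset r4 A2"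
    using A(1) calculation size_eq_Suc_imp_eq_union[of A1 1] by auto
  moreover obtain r5 A3 where "A2 = add_mset r5 A3"
    using A(1) calculation size_eq_Suc_imp_eq_union[of A2 0] by auto
  ultimately have "A = {#r3, r4, r5#}"
    using A(1) by simp
  then have q: "q = [:-r3, 1:] * [:-r4, 1:] * [:-r5, 1:]"
    using A(2) by (simp only: image_mset_add_mset prod_mset.add_mset image_mset_empty prod_mset.empty mult_1_right mult.assoc)
  have a: "a = x\<^sup>2 * C" and b: "b = - 2 * x * C + x\<^sup>2 * B" and c: "c = C - 2 * x * B + 2 * x ^ 3" and d: "d = B - 3 * x\<^sup>2"
    using assms by (simp_all add: B_def C_def) algebra+
  have "[:of_real a, of_real b, of_real c, of_real d, 0, 1:] = [:-of_real x, 1:] * [:-of_real x, 1:] * q"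
    unfolding a b c d q_def by (simp add: algebra_simps power2_eq_square power3_eq_cube)
  then show thesis
    unfolding q by (intro that[of r3 r4 r5]) (simp only: mult.assoc)
qed

text \<open>By Newton's identities, for a monic quintic without terms of degree four and three.\<close>

lemma double_root_power_sums:
  fixes v x y w :: complex
  assumes "v + v + x + y + w = 0" "v\<^sup>2 + v\<^sup>2 + x\<^sup>2 + y\<^sup>2 + w\<^sup>2 = 0"
  defines "S \<equiv> \<lambda>k. v ^ k + v ^ k + x ^ k + y ^ k + w ^ k"
  shows "S 4 / 4 = 5 * v ^ 4 + 2 * (- S 3 / 3) * v" and "- S 5 / 5 = (- S 3 / 3) * v\<^sup>2 + 4 * v ^ 5"
proof -
  \<comment> \<open>The product is the only freedom left: \<open>x\<close>, \<open>y\<close>,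
    \<open>w\<close> are the roots of \<open>z^3 + 2 v z^2 + 3 v^2 z - e\<close>, so all power sums
    are polynomials in \<open>v\<close> and \<open>e\<close>.\<close>
  define e where "e = x * y * w"
  have e1: "x + y + w = - 2 * v" using assms(1) by algebra
  have q1: "x\<^sup>2 + y\<^sup>2 + w\<^sup>2 = - 2 * v\<^sup>2" using assms(2) by algebra
  have e2: "x * y + x * w + y * w = 3 * v\<^sup>2"
  proof -
    have "2 * (x * y + x * w + y * w) = (x + y + w)\<^sup>2 - (x\<^sup>2 + y\<^sup>2 + w\<^sup>2)"
      by (simp add: power2_eq_square algebra_simps)
    also have "\<dots> = 2 * (3 * v\<^sup>2)"
      unfolding e1 q1 by (simp add: power2_eq_square)
    finally show ?thesis by algebra
  qed
  have root: "z ^ 3 = - 2 * v * z\<^sup>2 - 3 * v\<^sup>2 * z + e" if "z \<in> {x, y, w}" for z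
  proof -
    have "z ^ 3 = (x + y + w) * z\<^sup>2 - (x * y + x * w + y * w) * z + e"
      using that by (auto simp: e_def power3_eq_cube power2_eq_square algebra_simps)
    then show ?thesis unfolding e1 e2 by simp
  qed
  have p3: "x ^ 3 + y ^ 3 + w ^ 3 = 10 * v ^ 3 + 3 * e"
  proof -
    have "x ^ 3 + y ^ 3 + w ^ 3 = - 2 * v * (x\<^sup>2 + y\<^sup>2 + w\<^sup>2) - 3 * v\<^sup>2 * (x + y + w) + 3 * e"
      by (simp add: root algebra_simps)
    then show ?thesis unfolding e1 q1 by (simp add: power2_eq_square power3_eq_cube)
  qed
  have p4: "x ^ 4 + y ^ 4 + w ^ 4 = - 14 * v ^ 4 - 8 * e * v"
  proof -
    have q: "z ^ 4 = - 2 * v * z ^ 3 - 3 * v\<^sup>2 * z\<^sup>2 + e * z" if "z \<in> {x, y, w}" for z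
    proof -
      have "z ^ 4 = z * z ^ 3" by (simp add: power4_eq_xxxx power3_eq_cube)
      also have "\<dots> = z * (- 2 * v * z\<^sup>2 - 3 * v\<^sup>2 * z + e)"
        by (simp only: root[OF that])
      finally show ?thesis by (simp add: algebra_simps power2_eq_square power3_eq_cube)
    qed
    have "x ^ 4 + y ^ 4 + w ^ 4 = - 2 * v * (x ^ 3 + y ^ 3 + w ^ 3) - 3 * v\<^sup>2 * (x\<^sup>2 + y\<^sup>2 + w\<^sup>2) + e * (x + y + w)"
      by (subst q[of x], simp, subst q[of y], simp, subst q[of w], simp) (simp add: algebra_simps)
    also have "\<dots> = - 14 * v ^ 4 - 8 * e * v"
      unfolding e1 q1 p3 by (simp add: power2_eq_square power3_eq_cube power4_eq_xxxx algebra_simps)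
    finally show ?thesis .
  qed
  have p5: "x ^ 5 + y ^ 5 + w ^ 5 = - 2 * v ^ 5 + 5 * e * v\<^sup>2"
  proof -
    have q: "z ^ 5 = - 2 * v * z ^ 4 - 3 * v\<^sup>2 * z ^ 3 + e * z\<^sup>2" if "z \<in> {x, y, w}" for z
    proof -
      have "z ^ 5 = z\<^sup>2 * z ^ 3" by (simp add: flip: power_add)
      also have "\<dots> = z\<^sup>2 * (- 2 * v * z\<^sup>2 - 3 * v\<^sup>2 * z + e)"
        by (simp only: root[OF that])
      finally show ?thesis by (simp add: algebra_simps power2_eq_square power4_eq_xxxx power3_eq_cube)
    qed
    have "x ^ 5 + y ^ 5 + w ^ 5 = - 2 * v * (x ^ 4 + y ^ 4 + w ^ 4) - 3 * v\<^sup>2 * (x ^ 3 + y ^ 3 + w ^ 3) + e * (x\<^sup>2 + y\<^sup>2 + w\<^sup>2)"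
      by (subst q[of x], simp, subst q[of y], simp, subst q[of w], simp) (simp add: algebra_simps)
    also have "\<dots> = - 2 * v ^ 5 + 5 * e * v\<^sup>2"
      unfolding q1 p3 p4 by (simp add: eval_nat_numeral algebra_simps)
    finally show ?thesis .
  qed
  have S: "S 3 = 12 * v ^ 3 + 3 * e" "S 4 = - 12 * v ^ 4 - 8 * e * v" "S 5 = 5 * e * v\<^sup>2"
    unfolding S_def using p3 p4 p5 by algebra+
  show "S 4 / 4 = 5 * v ^ 4 + 2 * (- S 3 / 3) * v" "- S 5 / 5 = (- S 3 / 3) * v\<^sup>2 + 4 * v ^ 5"
    unfolding S by (simp_all add: eval_nat_numeral algebra_simps add_divide_distrib diff_divide_distrib)
qed

subsection \<open>Power sums of the transformed roots\<close>

text \<open>The linear coefficient is normalised to 1, so that near a small root the transformation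
  is a local diffeomorphism.\<close>

definition tpoly :: "real \<Rightarrow> real \<Rightarrow> real \<Rightarrow> real \<Rightarrow> real poly" where
  "tpoly c0 c2 c3 c4 = [:c0, 1, c2, c3, c4:]"

text \<open>The power sum of the transformed roots, written through \<open>psum\<close>: this is a
  polynomial in the coefficients and hence smooth, although the roots are not.\<close>

definition tsum :: "real \<Rightarrow> real \<Rightarrow> real \<Rightarrow> real \<Rightarrow> real \<Rightarrow> real \<Rightarrow> real \<Rightarrow> real \<Rightarrow> nat \<Rightarrow> real" where
  "tsum c0 c2 c3 c4 a b c d j = (\<Sum>k\<le>4 * j. coeff (tpoly c0 c2 c3 c4 ^ j) k * psum a b c d k)"

lemma poly_map_of_real_mult:
  "poly (map_poly complex_of_real (p * q)) z = poly (map_poly of_real p) z * poly (map_poly of_real q) z"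
proof -
  have add: "map_poly complex_of_real (p + q) = map_poly of_real p + map_poly of_real q" for p q
    by (rule poly_eqI) (simp add: coeff_map_poly)
  have smult: "map_poly complex_of_real (smult c p) = smult (of_real c) (map_poly of_real p)" for c p
    by (rule poly_eqI) (simp add: coeff_map_poly)
  show ?thesis
    by (induction p) (simp_all add: add smult map_poly_pCons algebra_simps)
qed

lemma poly_map_of_real_power:
  "poly (map_poly complex_of_real (p ^ j)) z = poly (map_poly of_real p) z ^ j"
  by (induction j) (simp_all add: poly_map_of_real_mult map_poly_1)

lemma degree_tpoly_power: "degree (tpoly c0 c2 c3 c4 ^ j) \<le> 4 * j"
proof -
  have "degree (tpoly c0 c2 c3 c4) \<le> 4"
    by (simp add: tpoly_def)
  then show ?thesis
    using degree_power_le[of "tpoly c0 c2 c3 c4" j] by (meson le_trans mult_le_mono1)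
qed

lemma tsum_eq:
  fixes r1 r2 r3 r4 r5 :: complex and c0 c2 c3 c4 :: real
  assumes "[:of_real a, of_real b, of_real c, of_real d, 0, 1:]
    = [:-r1, 1:] * [:-r2, 1:] * [:-r3, 1:] * [:-r4, 1:] * [:-r5, 1:]"
  defines "t \<equiv> \<lambda>r. poly (map_poly complex_of_real (tpoly c0 c2 c3 c4)) r"
  shows "of_real (tsum c0 c2 c3 c4 a b c d j) = t r1 ^ j + t r2 ^ j + t r3 ^ j + t r4 ^ j + t r5 ^ j"
proof -
  define q where "q = tpoly c0 c2 c3 c4 ^ j"
  have ev: "t r ^ j = (\<Sum>k\<le>4 * j. of_real (coeff q k) * r ^ k)" for r
  proof -
    have "t r ^ j = poly (map_poly of_real q) r"
      by (simp add: t_def q_def poly_map_of_real_power)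
    also have "\<dots> = (\<Sum>k\<le>degree q. of_real (coeff q k) * r ^ k)"
      by (simp add: poly_altdef coeff_map_poly degree_map_poly)
    also have "\<dots> = (\<Sum>k\<le>4 * j. of_real (coeff q k) * r ^ k)"
      by (rule sum.mono_neutral_left) (use degree_tpoly_power in \<open>auto simp: q_def coeff_eq_0\<close>)
    finally show ?thesis .
  qed
  have "of_real (tsum c0 c2 c3 c4 a b c d j) = (\<Sum>k\<le>4 * j. of_real (coeff q k) * (r1 ^ k + r2 ^ k + r3 ^ k + r4 ^ k + r5 ^ k))"
    unfolding power_sums[OF assms(1)] by (simp add: tsum_def q_def)
  also have "\<dots> = t r1 ^ j + t r2 ^ j + t r3 ^ j + t r4 ^ j + t r5 ^ j"
    unfolding ev by (simp add: sum.distrib algebra_simps)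
  finally show ?thesis .
qed

text \<open>If the first two power sums vanish, the transformed roots are those of
  \<open>z^5 + u z^2 + b z + a\<close> with \<open>u = - S 3 / 3\<close>,
  \<open>b = - S 4 / 4\<close>, \<open>a = - S 5 / 5\<close>. The double root \<open>x\<close>
  becomes the double root \<open>v\<close>, and solving for \<open>- b\<close> and \<open>a\<close>
  gives the two components of the butterfly.\<close>

lemma tschirnhaus_double_root:
  fixes x a b c d c0 c2 c3 c4 :: real
  assumes "x ^ 5 + (a + b * x + c * x\<^sup>2 + d * x ^ 3) = 0"
    "5 * x ^ 4 + (b + c * (2 * x) + d * (3 * x\<^sup>2)) = 0"
    and "tsum c0 c2 c3 c4 a b c d 1 = 0" "tsum c0 c2 c3 c4 a b c d 2 = 0"
  defines "S \<equiv> tsum c0 c2 c3 c4 a b c d" and "v \<equiv> poly (tpoly c0 c2 c3 c4) x"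
  shows "S 4 / 4 = 5 * v ^ 4 + 2 * (- S 3 / 3) * v" and "- S 5 / 5 = (- S 3 / 3) * v\<^sup>2 + 4 * v ^ 5"
proof -
  obtain r3 r4 r5 :: complex where r: "[:of_real a, of_real b, of_real c, of_real d, 0, 1:]
    = [:-of_real x, 1:] * [:-of_real x, 1:] * [:-r3, 1:] * [:-r4, 1:] * [:-r5, 1:]"
    by (rule quintic_double_root_factorization[OF assms(1,2)])
  define t where "t = (\<lambda>r. poly (map_poly complex_of_real (tpoly c0 c2 c3 c4)) r)"
  have tx: "t (of_real x) = of_real v"
    by (simp add: t_def v_def tpoly_def map_poly_pCons)
  note S = tsum_eq[OF r, of c0 c2 c3 c4, folded t_def S_def, unfolded tx]
  have "of_real v + of_real v + t r3 + t r4 + t r5 = 0"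
    using S[of 1] assms(3) by (simp add: S_def)
  moreover have "(of_real v)\<^sup>2 + (of_real v)\<^sup>2 + (t r3)\<^sup>2 + (t r4)\<^sup>2 + (t r5)\<^sup>2 = 0"
    using S[of 2] assms(4) by (simp add: S_def)
  ultimately have "of_real (S 4) / 4 = 5 * of_real v ^ 4 + 2 * (- of_real (S 3) / 3) * (of_real v :: complex)"
    "- of_real (S 5) / 5 = (- of_real (S 3) / 3) * (of_real v)\<^sup>2 + 4 * (of_real v :: complex) ^ 5"
    unfolding S by (rule double_root_power_sums)+
  then have "of_real (S 4 / 4) = (of_real (5 * v ^ 4 + 2 * (- S 3 / 3) * v) :: complex)"
    "of_real (- S 5 / 5) = (of_real ((- S 3 / 3) * v\<^sup>2 + 4 * v ^ 5) :: complex)"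
    by simp_all
  then show "S 4 / 4 = 5 * v ^ 4 + 2 * (- S 3 / 3) * v" "- S 5 / 5 = (- S 3 / 3) * v\<^sup>2 + 4 * v ^ 5"
    by (simp_all only: of_real_eq_iff)
qed

text \<open>If \<open>d = a h\<^sub>0 + b h\<^sub>1 + c h\<^sub>2\<close>, the sum of the squares of the transformed roots (with
  \<open>c0\<close> chosen so that their sum vanishes) lies in the ideal generated by \<open>a\<close>, \<open>b\<close>, \<open>c\<close>;
  \<open>tquad\<close> writes that sum in terms of the power sums \<open>p2, \<dots>, p8\<close> of the original roots, and
  \<open>tideal\<close> below lists the cofactors of \<open>a\<close>, \<open>b\<close>, \<open>c\<close>.\<close>

definition tquad ::
  "real \<Rightarrow> real \<Rightarrow> real \<Rightarrow> real \<Rightarrow> real \<Rightarrow> real \<Rightarrow> real \<Rightarrow> real \<Rightarrow> real \<Rightarrow> real \<Rightarrow> real \<Rightarrow> real" where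
  "tquad c2 c3 c4 T p2 p3 p4 p5 p6 p7 p8 =
     p2 + 2 * c2 * p3 + (c2\<^sup>2 + 2 * c3) * p4 + (2 * c4 + 2 * c2 * c3) * p5 + (c3\<^sup>2 + 2 * c2 * c4) * p6
     + 2 * c3 * c4 * p7 + c4\<^sup>2 * p8 - T * (c2 * p2 + c3 * p3 + c4 * p4) / 5"

definition tlin :: "real \<Rightarrow> real \<Rightarrow> real \<Rightarrow> real \<Rightarrow> real \<Rightarrow> real \<Rightarrow> real" where
  "tlin c2 c3 c4 b c d = c2 * (- 2 * d) + c3 * (- 3 * c) + c4 * (2 * d\<^sup>2 - 4 * b)"

lemma psum_values:
  "psum a b c d 2 = - 2 * d" "psum a b c d 3 = - 3 * c" "psum a b c d 4 = 2 * d\<^sup>2 - 4 * b"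
  "psum a b c d 5 = 5 * c * d - 5 * a" "psum a b c d 6 = - 2 * d ^ 3 + 6 * b * d + 3 * c\<^sup>2"
  "psum a b c d 7 = - 7 * c * d\<^sup>2 + 7 * a * d + 7 * b * c"
  "psum a b c d 8 = 2 * d ^ 4 - 8 * b * d\<^sup>2 - 8 * c\<^sup>2 * d + 8 * a * c + 4 * b\<^sup>2"
  by (simp_all add: numeral_eq_Suc algebra_simps)

lemma tsum_1: "tsum c0 c2 c3 c4 a b c d 1 = 5 * c0 + tlin c2 c3 c4 b c d"
proof -
  have "{..4 * 1 :: nat} = {0, 1, 2, 3, 4}" by auto
  then show ?thesis
    by (simp add: tsum_def tlin_def tpoly_def psum_values numeral_eq_Suc)
qed

lemma tsum_2:
  "tsum (- tlin c2 c3 c4 b c d / 5) c2 c3 c4 a b c d 2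
    = tquad c2 c3 c4 (tlin c2 c3 c4 b c d) (- 2 * d) (- 3 * c) (2 * d\<^sup>2 - 4 * b) (5 * c * d - 5 * a)
      (- 2 * d ^ 3 + 6 * b * d + 3 * c\<^sup>2) (- 7 * c * d\<^sup>2 + 7 * a * d + 7 * b * c)
      (2 * d ^ 4 - 8 * b * d\<^sup>2 - 8 * c\<^sup>2 * d + 8 * a * c + 4 * b\<^sup>2)"
proof -
  have s: "{..4 * 2 :: nat} = {0, 1, 2, 3, 4, 5, 6, 7, 8}" by auto
  have "tsum c0 c2 c3 c4 a b c d 2 = c0\<^sup>2 * 5 + 2 * c0 * (c2 * psum a b c d 2 + c3 * psum a b c d 3 + c4 * psum a b c d 4)
    + (psum a b c d 2 + 2 * c2 * psum a b c d 3 + (c2\<^sup>2 + 2 * c3) * psum a b c d 4 + (2 * c4 + 2 * c2 * c3) * psum a b c d 5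
    + (c3\<^sup>2 + 2 * c2 * c4) * psum a b c d 6 + 2 * c3 * c4 * psum a b c d 7 + c4\<^sup>2 * psum a b c d 8)" for c0
  proof -
    have "tpoly c0 c2 c3 c4 ^ 2 = [:c0\<^sup>2, 2 * c0, 2 * c0 * c2 + 1, 2 * c0 * c3 + 2 * c2, 2 * c0 * c4 + c2\<^sup>2 + 2 * c3,
      2 * c4 + 2 * c2 * c3, c3\<^sup>2 + 2 * c2 * c4, 2 * c3 * c4, c4\<^sup>2:]"
      by (simp add: tpoly_def power2_eq_square algebra_simps)
    then have "tsum c0 c2 c3 c4 a b c d 2 = c0\<^sup>2 * 5 + (2 * c0 * c2 + 1) * psum a b c d 2 + (2 * c0 * c3 + 2 * c2) * psum a b c d 3
      + (2 * c0 * c4 + c2\<^sup>2 + 2 * c3) * psum a b c d 4 + (2 * c4 + 2 * c2 * c3) * psum a b c d 5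
      + (c3\<^sup>2 + 2 * c2 * c4) * psum a b c d 6 + 2 * c3 * c4 * psum a b c d 7 + c4\<^sup>2 * psum a b c d 8"
      unfolding tsum_def s by (simp add: coeff_pCons)
    then show ?thesis by (simp add: algebra_simps)
  qed
  from this[of "- tlin c2 c3 c4 b c d / 5"] show ?thesis
    unfolding psum_values tquad_def tlin_def[symmetric] by (simp add: power2_eq_square)
qed

definition tideal :: "((real \<times> real \<times> real) \<times> (real \<times> real \<times> real)) \<times> (real \<times> real \<times> real) \<Rightarrow> real \<times> real \<times> real" where
  "tideal = (\<lambda>(((a, b, c), (h0, h1, h2)), (c2, c3, c4)).
     let d = a * h0 + b * h1 + c * h2; T = tlin c2 c3 c4 b c d in
     (tquad c2 c3 c4 T (- 2 * h0) 0 (2 * d * h0) (- 5) (- 2 * d\<^sup>2 * h0) (7 * d) (2 * d ^ 3 * h0 + 8 * c),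
      tquad c2 c3 c4 T (- 2 * h1) 0 (2 * d * h1 - 4) 0 (- 2 * d\<^sup>2 * h1 + 6 * d) (7 * c) (2 * d ^ 3 * h1 - 8 * d\<^sup>2 + 4 * b),
      tquad c2 c3 c4 T (- 2 * h2) (- 3) (2 * d * h2) (5 * d) (- 2 * d\<^sup>2 * h2 + 3 * c) (- 7 * d\<^sup>2) (2 * d ^ 3 * h2 - 8 * c * d)))"

lemma tideal_zero_imp:
  assumes "tideal (((a, b, c), (h0, h1, h2)), (c2, c3, c4)) = 0" and d: "d = a * h0 + b * h1 + c * h2"
  shows "tsum (- tlin c2 c3 c4 b c d / 5) c2 c3 c4 a b c d 2 = 0"
proof -
  define T where "T = tlin c2 c3 c4 b c d"
  define G0 where "G0 = tquad c2 c3 c4 T (- 2 * h0) 0 (2 * d * h0) (- 5) (- 2 * d\<^sup>2 * h0) (7 * d) (2 * d ^ 3 * h0 + 8 * c)"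
  define G1 where "G1 = tquad c2 c3 c4 T (- 2 * h1) 0 (2 * d * h1 - 4) 0 (- 2 * d\<^sup>2 * h1 + 6 * d) (7 * c) (2 * d ^ 3 * h1 - 8 * d\<^sup>2 + 4 * b)"
  define G2 where "G2 = tquad c2 c3 c4 T (- 2 * h2) (- 3) (2 * d * h2) (5 * d) (- 2 * d\<^sup>2 * h2 + 3 * c) (- 7 * d\<^sup>2) (2 * d ^ 3 * h2 - 8 * c * d)"
  have "tideal (((a, b, c), (h0, h1, h2)), (c2, c3, c4)) = (G0, G1, G2)"
    by (simp only: tideal_def Let_def case_prod_conv T_def G0_def G1_def G2_def d[symmetric])
  then have "G0 = 0" "G1 = 0" "G2 = 0"
    using assms(1) by (simp_all add: zero_prod_def)
  \<comment> \<open>With \<open>T\<close> as a separate argument \<open>tquad\<close> is linear in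
    the seven power sums, although the sum of squares itself is quadratic in them; so a combination
    of cofactors passes to the arguments.\<close>
  have lin: "a * tquad c2 c3 c4 T u2 u3 u4 u5 u6 u7 u8 + b * tquad c2 c3 c4 T v2 v3 v4 v5 v6 v7 v8
      + c * tquad c2 c3 c4 T w2 w3 w4 w5 w6 w7 w8
    = tquad c2 c3 c4 T (a * u2 + b * v2 + c * w2) (a * u3 + b * v3 + c * w3) (a * u4 + b * v4 + c * w4)
      (a * u5 + b * v5 + c * w5) (a * u6 + b * v6 + c * w6) (a * u7 + b * v7 + c * w7) (a * u8 + b * v8 + c * w8)"
    for u2 u3 u4 u5 u6 u7 u8 v2 v3 v4 v5 v6 v7 v8 w2 w3 w4 w5 w6 w7 w8
    by (simp add: tquad_def algebra_simps add_divide_distrib)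
  have eqs: "a * (- 2 * h0) + b * (- 2 * h1) + c * (- 2 * h2) = - 2 * d"
    "a * 0 + b * 0 + c * (- 3) = - 3 * c"
    "a * (2 * d * h0) + b * (2 * d * h1 - 4) + c * (2 * d * h2) = 2 * d\<^sup>2 - 4 * b"
    "a * (- 5) + b * 0 + c * (5 * d) = 5 * c * d - 5 * a"
    "a * (- 2 * d\<^sup>2 * h0) + b * (- 2 * d\<^sup>2 * h1 + 6 * d) + c * (- 2 * d\<^sup>2 * h2 + 3 * c) = - 2 * d ^ 3 + 6 * b * d + 3 * c\<^sup>2"
    "a * (7 * d) + b * (7 * c) + c * (- 7 * d\<^sup>2) = - 7 * c * d\<^sup>2 + 7 * a * d + 7 * b * c"
    "a * (2 * d ^ 3 * h0 + 8 * c) + b * (2 * d ^ 3 * h1 - 8 * d\<^sup>2 + 4 * b) + c * (2 * d ^ 3 * h2 - 8 * c * d)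
      = 2 * d ^ 4 - 8 * b * d\<^sup>2 - 8 * c\<^sup>2 * d + 8 * a * c + 4 * b\<^sup>2"
  proof -
    note d' = d[symmetric]
    show "a * (- 2 * h0) + b * (- 2 * h1) + c * (- 2 * h2) = - 2 * d" using d by algebra
    show "a * 0 + b * 0 + c * (- 3) = - 3 * c" by simp
    show "a * (2 * d * h0) + b * (2 * d * h1 - 4) + c * (2 * d * h2) = 2 * d\<^sup>2 - 4 * b"
    proof -
      have "a * (2 * d * h0) + b * (2 * d * h1 - 4) + c * (2 * d * h2) = 2 * d * (a * h0 + b * h1 + c * h2) - 4 * b" by (simp add: algebra_simps)
      also have "\<dots> = 2 * d\<^sup>2 - 4 * b" unfolding d' by (simp add: eval_nat_numeral algebra_simps)
      finally show ?thesis .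
    qed
    show "a * (- 5) + b * 0 + c * (5 * d) = 5 * c * d - 5 * a" by simp
    show "a * (- 2 * d\<^sup>2 * h0) + b * (- 2 * d\<^sup>2 * h1 + 6 * d) + c * (- 2 * d\<^sup>2 * h2 + 3 * c) = - 2 * d ^ 3 + 6 * b * d + 3 * c\<^sup>2"
    proof -
      have "a * (- 2 * d\<^sup>2 * h0) + b * (- 2 * d\<^sup>2 * h1 + 6 * d) + c * (- 2 * d\<^sup>2 * h2 + 3 * c) = - 2 * d\<^sup>2 * (a * h0 + b * h1 + c * h2) + 6 * b * d + 3 * c * c" by (simp add: algebra_simps)
      also have "\<dots> = - 2 * d ^ 3 + 6 * b * d + 3 * c\<^sup>2" unfolding d' by (simp add: eval_nat_numeral algebra_simps)
      finally show ?thesis .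
    qed
    show "a * (7 * d) + b * (7 * c) + c * (- 7 * d\<^sup>2) = - 7 * c * d\<^sup>2 + 7 * a * d + 7 * b * c" by simp
    show "a * (2 * d ^ 3 * h0 + 8 * c) + b * (2 * d ^ 3 * h1 - 8 * d\<^sup>2 + 4 * b) + c * (2 * d ^ 3 * h2 - 8 * c * d)
      = 2 * d ^ 4 - 8 * b * d\<^sup>2 - 8 * c\<^sup>2 * d + 8 * a * c + 4 * b\<^sup>2"
    proof -
      have "a * (2 * d ^ 3 * h0 + 8 * c) + b * (2 * d ^ 3 * h1 - 8 * d\<^sup>2 + 4 * b) + c * (2 * d ^ 3 * h2 - 8 * c * d) = 2 * d ^ 3 * (a * h0 + b * h1 + c * h2) + 8 * a * c - 8 * b * d\<^sup>2 + 4 * b * b - 8 * c * c * d" by (simp add: algebra_simps)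
      also have "\<dots> = 2 * d ^ 4 - 8 * b * d\<^sup>2 - 8 * c\<^sup>2 * d + 8 * a * c + 4 * b\<^sup>2" unfolding d' by (simp add: eval_nat_numeral algebra_simps)
      finally show ?thesis .
    qed
  qed
  have "a * G0 + b * G1 + c * G2 = tsum (- tlin c2 c3 c4 b c d / 5) c2 c3 c4 a b c d 2"
    unfolding G0_def G1_def G2_def lin eqs unfolding tsum_2 T_def ..
  then show ?thesis using \<open>G0 = 0\<close> \<open>G1 = 0\<close> \<open>G2 = 0\<close> by simp
qed

lemma smooth_on_tideal: "smooth_on UNIV tideal"
  unfolding tideal_def split_beta Let_def tquad_def tlin_def
  by (intro smooth_on_const smooth_on_id smooth_on_add smooth_on_diff smooth_on_minus
      smooth_on_mult smooth_on_power smooth_on_divide smooth_on_Pair smooth_on_fst smooth_on_snd open_UNIV) simp_all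

text \<open>At \<open>a = b = c = 0\<close> the system is triangular: the third equation determines
  \<open>c2\<close>, then the second \<open>c3\<close>, then the first \<open>c4\<close>, with
  coefficients \<open>- 6\<close>, \<open>- 8\<close>, \<open>- 10\<close>. This gives the starting
  values and the invertibility needed for the implicit function theorem.\<close>

lemma tschirnhaus_coefficients:
  fixes h :: "real \<times> real \<times> real"
  obtains W \<eta> where "open W" "(0, h) \<in> W" "smooth_on W \<eta>"
    "\<forall>w\<in>W. tideal (w, \<eta> w) = 0"
proof -
  obtain h0 h1 h2 where h: "h = (h0, h1, h2)" by (metis prod.collapse)
  define c2 where "c2 = - h2 / 3"
  define c3 where "c3 = (- h1 / 2 - c2\<^sup>2) / 2"
  define c4 where "c4 = - h0 / 5 - c2 * c3"
  have tid: "tideal ((0, h), y) = (- 2 * h0 - 10 * snd (snd y) - 10 * fst y * fst (snd y),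
      - 2 * h1 - 4 * (fst y)\<^sup>2 - 8 * fst (snd y), - 2 * h2 - 6 * fst y)" for y
  proof -
    obtain y2 y3 y4 where y: "y = (y2, y3, y4)" by (metis prod.collapse)
    have z: "(0 :: real \<times> real \<times> real) = (0, 0, 0)" by (simp add: zero_prod_def)
    show ?thesis
      unfolding z h y tideal_def case_prod_conv Let_def tquad_def tlin_def fst_conv snd_conv by (simp add: algebra_simps)
  qed
  have zero: "tideal ((0, h), (c2, c3, c4)) = 0"
    unfolding tid by (simp add: c2_def c3_def c4_def zero_prod_def field_simps)
  have inj: "v = 0" if "frechet_derivative tideal (at ((0, h), (c2, c3, c4))) (0, v) = 0" for v
  proof -
    have D: "(tideal has_derivative frechet_derivative tideal (at ((0, h), (c2, c3, c4)))) (at ((0, h), (c2, c3, c4)))"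
      by (rule smooth_on_has_derivative[OF smooth_on_tideal]) simp
    have d1: "((\<lambda>y. tideal ((0, h), y)) has_derivative (\<lambda>v. frechet_derivative tideal (at ((0, h), (c2, c3, c4))) (0, v))) (at (c2, c3, c4))"
      by (rule has_derivative_compose[where f = "\<lambda>y. ((0, h), y)" and f' = "\<lambda>v. (0, v)", OF _ D])
        (auto intro!: derivative_eq_intros simp: zero_prod_def)
    have d2: "((\<lambda>y. tideal ((0, h), y)) has_derivative (\<lambda>v. (- 10 * snd (snd v) - 10 * (c2 * fst (snd v) + fst v * c3),
        - 8 * c2 * fst v - 8 * fst (snd v), - 6 * fst v))) (at (c2, c3, c4))"
      unfolding tid by (auto intro!: derivative_eq_intros simp: fun_eq_iff algebra_simps)
    have "(- 10 * snd (snd v) - 10 * (c2 * fst (snd v) + fst v * c3), - 8 * c2 * fst v - 8 * fst (snd v), - 6 * fst v) = 0"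
      using fun_cong[OF has_derivative_unique[OF d1 d2], of v] that by simp
    then show "v = 0"
      by (cases v) (auto simp: zero_prod_def)
  qed
  obtain W \<eta> where "open W" "(0, h) \<in> W" "smooth_on W \<eta>" "\<And>w. w \<in> W \<Longrightarrow> (w, \<eta> w) \<in> UNIV \<and> tideal (w, \<eta> w) = 0"
    by (rule smooth_implicit_function[OF open_UNIV smooth_on_tideal _ zero]) (use inj in auto)
  then show thesis by (intro that) auto
qed

lemma quintic_depress:
  fixes x e0 e1 e2 e3 k :: real
  assumes "x ^ 5 + (e0 + e1 * x + e2 * x\<^sup>2 + e3 * x ^ 3 + k * x ^ 4) = 0"
    "5 * x ^ 4 + (e1 + e2 * (2 * x) + e3 * (3 * x\<^sup>2) + k * (4 * x ^ 3)) = 0"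
  defines "v \<equiv> x + k / 5" and "d \<equiv> e3 - 2 * k\<^sup>2 / 5" and "c \<equiv> e2 - 3 * k * e3 / 5 + 4 * k ^ 3 / 25"
    and "b \<equiv> e1 - 2 * k * e2 / 5 + 3 * k\<^sup>2 * e3 / 25 - 3 * k ^ 4 / 125"
    and "a \<equiv> e0 - k * e1 / 5 + k\<^sup>2 * e2 / 25 - k ^ 3 * e3 / 125 + 4 * k ^ 5 / 3125"
  shows "v ^ 5 + (a + b * v + c * v\<^sup>2 + d * v ^ 3) = 0"
    and "5 * v ^ 4 + (b + c * (2 * v) + d * (3 * v\<^sup>2)) = 0"
proof -
  define l where "l = k / 5"
  have k: "k = 5 * l" by (simp add: l_def)
  have e: "v ^ 5 + (a + b * v + c * v\<^sup>2 + d * v ^ 3) = x ^ 5 + (e0 + e1 * x + e2 * x\<^sup>2 + e3 * x ^ 3 + k * x ^ 4)"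
    "5 * v ^ 4 + (b + c * (2 * v) + d * (3 * v\<^sup>2)) = 5 * x ^ 4 + (e1 + e2 * (2 * x) + e3 * (3 * x\<^sup>2) + k * (4 * x ^ 3))"
    unfolding v_def a_def b_def c_def d_def k by (simp_all add: eval_nat_numeral algebra_simps)
  show "v ^ 5 + (a + b * v + c * v\<^sup>2 + d * v ^ 3) = 0" "5 * v ^ 4 + (b + c * (2 * v) + d * (3 * v\<^sup>2)) = 0"
    unfolding e by (rule assms)+
qed

lemma smooth_on_psum:
  assumes "open S" "smooth_on S a" "smooth_on S b" "smooth_on S c" "smooth_on S d"
  shows "smooth_on S (\<lambda>X. psum (a X) (b X) (c X) (d X) k)"
proof (induction k rule: less_induct)
  case (less k)
  have 5: "smooth_on S (\<lambda>X. psum (a X) (b X) (c X) (d X) (m + 5))" if m: "k = m + 5" for m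
  proof -
    have s: "smooth_on S (\<lambda>X. psum (a X) (b X) (c X) (d X) m)" "smooth_on S (\<lambda>X. psum (a X) (b X) (c X) (d X) (Suc m))"
      "smooth_on S (\<lambda>X. psum (a X) (b X) (c X) (d X) (Suc (Suc m)))" "smooth_on S (\<lambda>X. psum (a X) (b X) (c X) (d X) (Suc (Suc (Suc m))))"
      by (rule less.IH, simp add: m)+
    have "smooth_on S (\<lambda>X. - d X * psum (a X) (b X) (c X) (d X) (Suc (Suc (Suc m)))
      - c X * psum (a X) (b X) (c X) (d X) (Suc (Suc m)) - b X * psum (a X) (b X) (c X) (d X) (Suc m)
      - a X * psum (a X) (b X) (c X) (d X) m)"
      by (intro smooth_on_diff smooth_on_mult smooth_on_minus s assms)
    then show ?thesis by (simp add: numeral_eq_Suc)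
  qed
  show ?case
  proof (cases "k < 5")
    case True
    then have "k = 0 \<or> k = 1 \<or> k = 2 \<or> k = 3 \<or> k = 4" by auto
    then show ?thesis
      by (elim disjE) (auto simp: psum_values intro!: smooth_on_const smooth_on_diff smooth_on_mult
        smooth_on_power smooth_on_minus assms)
  next
    case False
    then show ?thesis using 5[of "k - 5"] by simp
  qed
qed

lemma psum_at_zero: "k \<ge> 1 \<Longrightarrow> psum 0 0 0 0 k = 0"
  by (induction "0::real" "0::real" "0::real" "0::real" k rule: psum.induct) auto

text \<open>At vanishing coefficients only the power sums of exponent 2 to 5 have a linear part,
  namely \<open>- k\<close> times the coefficient of degree \<open>5 - k\<close>. In the recurrence
  every later one is a coefficient times a power sum that vanishes there.\<close>

lemma psum_has_derivative:
  assumes "(a has_derivative a') (at X)" "(b has_derivative b') (at X)" "(c has_derivative c') (at X)" "(d has_derivative d') (at X)"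
    and z: "a X = 0" "b X = 0" "c X = 0" "d X = 0" and "k \<ge> 1"
  shows "((\<lambda>X. psum (a X) (b X) (c X) (d X) k) has_derivative
    (\<lambda>V. if k = 2 then - 2 * d' V else if k = 3 then - 3 * c' V else if k = 4 then - 4 * b' V
       else if k = 5 then - 5 * a' V else 0)) (at X)"
  using assms(9)
proof (induction k rule: less_induct)
  case (less k)
  have "k = 1 \<or> k = 2 \<or> k = 3 \<or> k = 4 \<or> k = (k - 5) + 5" using less.prems by auto
  then consider "k = 1" | "k = 2" | "k = 3" | "k = 4" | m where "k = m + 5"
    by blast
  then show ?case
  proof cases
    case 1
    then show ?thesis by simp
  next
    case 2
    then show ?thesis by (auto simp: psum_values intro!: derivative_eq_intros assms)
  next
    case 3
    then show ?thesis by (auto simp: psum_values intro!: derivative_eq_intros assms)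
  next
    case 4
    then show ?thesis by (auto simp: psum_values z intro!: derivative_eq_intros assms)
  next
    case (5 m)
    have ex: "\<exists>D. ((\<lambda>X. psum (a X) (b X) (c X) (d X) i) has_derivative D) (at X)" if "i < k" for i
    proof (cases "i = 0")
      case False
      then show ?thesis using less.IH[OF that] by auto
    qed (auto intro: has_derivative_const)
    obtain D0 D1 D2 D3 where D:
      "((\<lambda>X. psum (a X) (b X) (c X) (d X) m) has_derivative D0) (at X)"
      "((\<lambda>X. psum (a X) (b X) (c X) (d X) (Suc m)) has_derivative D1) (at X)"
      "((\<lambda>X. psum (a X) (b X) (c X) (d X) (Suc (Suc m))) has_derivative D2) (at X)"
      "((\<lambda>X. psum (a X) (b X) (c X) (d X) (Suc (Suc (Suc m)))) has_derivative D3) (at X)"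
      using ex[of m] ex[of "Suc m"] ex[of "Suc (Suc m)"] ex[of "Suc (Suc (Suc m))"] 5 by auto
    have "((\<lambda>X. - d X * psum (a X) (b X) (c X) (d X) (Suc (Suc (Suc m)))
      - c X * psum (a X) (b X) (c X) (d X) (Suc (Suc m)) - b X * psum (a X) (b X) (c X) (d X) (Suc m)
      - a X * psum (a X) (b X) (c X) (d X) m) has_derivative
      (\<lambda>V. (- d X * D3 V + - d' V * psum (a X) (b X) (c X) (d X) (Suc (Suc (Suc m))))
         - (c X * D2 V + c' V * psum (a X) (b X) (c X) (d X) (Suc (Suc m)))
         - (b X * D1 V + b' V * psum (a X) (b X) (c X) (d X) (Suc m))
         - (a X * D0 V + a' V * psum (a X) (b X) (c X) (d X) m))) (at X)"
      by (intro has_derivative_diff has_derivative_mult has_derivative_minus assms D)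
    then have "((\<lambda>X. psum (a X) (b X) (c X) (d X) k) has_derivative (\<lambda>V. - a' V * psum 0 0 0 0 m)) (at X)"
      unfolding 5 by (simp add: z psum_at_zero numeral_eq_Suc)
    then show ?thesis
      using 5 psum_at_zero[of m] by (cases "m = 0") (auto simp: mult.commute)
  qed
qed

lemma smooth_on_coeff_tpoly_power:
  assumes "open S" "smooth_on S c0" "smooth_on S c2" "smooth_on S c3" "smooth_on S c4"
  shows "smooth_on S (\<lambda>X. coeff (tpoly (c0 X) (c2 X) (c3 X) (c4 X) ^ j) k)"
proof (induction j arbitrary: k)
  case 0
  show ?case using assms(1) by (auto intro: smooth_on_const)
next
  case (Suc j)
  have c: "smooth_on S (\<lambda>X. coeff (tpoly (c0 X) (c2 X) (c3 X) (c4 X)) i)" for i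
  proof -
    consider "i = 0" | "i = 1" | "i = 2" | "i = 3" | "i = 4" | m where "i = m + 5"
      by (metis add.commute le_Suc_ex not_less less_antisym numeral_eq_Suc pred_numeral_simps less_Suc_eq less_one numeral_1_eq_Suc_0 numeral_2_eq_2 numeral_3_eq_3 semiring_norm(26,27,28) One_nat_def)
    then show ?thesis
      by cases (simp_all add: tpoly_def numeral_eq_Suc assms smooth_on_const)
  qed
  show ?case
    unfolding power_Suc coeff_mult by (intro smooth_on_sum smooth_on_mult assms(1) c Suc)
qed

text \<open>A polynomial without constant term has a \<open>j\<close>-th power starting in degree
  \<open>j\<close>. Applied to \<open>tpoly\<close> with \<open>c0 = 0\<close>, this makes the
  differentials of the transformed power sums triangular.\<close>

lemma coeff_pCons_0_power:
  "k < j \<Longrightarrow> coeff (pCons 0 q ^ j) k = 0" "coeff (pCons 0 q ^ j) j = (coeff q 0 :: real) ^ j"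
proof -
  have "pCons 0 q ^ j = monom 1 j * q ^ j"
  proof -
    have "pCons 0 q = monom 1 1 * q" by (simp add: monom_Suc)
    then show ?thesis by (simp add: power_mult_distrib monom_power)
  qed
  then have "coeff (pCons 0 q ^ j) k = (if j \<le> k then coeff (q ^ j) (k - j) else 0)" for k
    by (simp add: coeff_monom_mult)
  then show "k < j \<Longrightarrow> coeff (pCons 0 q ^ j) k = 0" "coeff (pCons 0 q ^ j) j = coeff q 0 ^ j"
    by (simp_all add: coeff_0_power)
qed

lemma tsum_has_derivative:
  fixes a b c d c0 c2 c3 c4 :: "'a::euclidean_space \<Rightarrow> real"
  assumes "open S" "X \<in> S"
    and c: "smooth_on S c0" "smooth_on S c2" "smooth_on S c3" "smooth_on S c4" "c0 X = 0"
    and der: "(a has_derivative a') (at X)" "(b has_derivative b') (at X)" "(c has_derivative c') (at X)" "(d has_derivative d') (at X)"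
    and z: "a X = 0" "b X = 0" "c X = 0" "d X = 0" and j: "j \<ge> 2"
  defines "C \<equiv> coeff (tpoly 0 (c2 X) (c3 X) (c4 X) ^ j)"
  shows "((\<lambda>X. tsum (c0 X) (c2 X) (c3 X) (c4 X) (a X) (b X) (c X) (d X) j) has_derivative
    (\<lambda>V. C 2 * (- 2 * d' V) + C 3 * (- 3 * c' V) + C 4 * (- 4 * b' V) + C 5 * (- 5 * a' V))) (at X)"
proof -
  define p where "p = (\<lambda>(k::nat) V. if k = 2 then - 2 * d' V else if k = 3 then - 3 * c' V else if k = 4 then - 4 * b' V
       else if k = 5 then - 5 * a' V else 0)"
  have "((\<lambda>X. coeff (tpoly (c0 X) (c2 X) (c3 X) (c4 X) ^ j) k * psum (a X) (b X) (c X) (d X) k) has_derivative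
      (\<lambda>V. C k * p k V)) (at X)" for k
  \<comment> \<open>The zeroth power sum is the constant 5, not a small quantity. Its coefficient is
    \<open>c0 ^ j\<close>, whose derivative vanishes since \<open>c0\<close> does and
    \<open>j \<ge> 2\<close>.\<close>
  proof (cases "k = 0")
    case True
    have dc0: "(c0 has_derivative frechet_derivative c0 (at X)) (at X)"
      by (rule smooth_on_has_derivative[OF c(1) assms(2)])
    have "((\<lambda>X. c0 X ^ j * 5) has_derivative (\<lambda>V. 0)) (at X)"
      using c(5) j by (auto intro!: derivative_eq_intros dc0 simp: power_0_left)
    then show ?thesis
      using True by (simp add: p_def coeff_0_power tpoly_def)
  next
    case False
    define q where "q = (\<lambda>X. coeff (tpoly (c0 X) (c2 X) (c3 X) (c4 X) ^ j) k)"
    have "smooth_on S q" unfolding q_def by (rule smooth_on_coeff_tpoly_power[OF assms(1) c(1-4)])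
    then have dq: "(q has_derivative frechet_derivative q (at X)) (at X)"
      using assms(2) by (rule smooth_on_has_derivative)
    have "((\<lambda>X. q X * psum (a X) (b X) (c X) (d X) k) has_derivative
      (\<lambda>V. q X * p k V + frechet_derivative q (at X) V * psum (a X) (b X) (c X) (d X) k)) (at X)"
      unfolding p_def by (intro has_derivative_mult dq psum_has_derivative[OF der z]) (use False in simp)
    then show ?thesis
      using False by (simp add: z psum_at_zero q_def C_def c(5))
  qed
  then have "((\<lambda>X. tsum (c0 X) (c2 X) (c3 X) (c4 X) (a X) (b X) (c X) (d X) j) has_derivative
      (\<lambda>V. \<Sum>k\<le>4 * j. C k * p k V)) (at X)"
    unfolding tsum_def by (intro has_derivative_sum)
  moreover have "(\<Sum>k\<le>4 * j. C k * p k V) = C 2 * (- 2 * d' V) + C 3 * (- 3 * c' V) + C 4 * (- 4 * b' V) + C 5 * (- 5 * a' V)" for V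
  proof -
    have "(\<Sum>k\<le>4 * j. C k * p k V) = (\<Sum>k\<in>{2, 3, 4, 5}. C k * p k V)"
      using j by (intro sum.mono_neutral_right) (auto simp: p_def)
    then show ?thesis by (simp add: p_def)
  qed
  ultimately show ?thesis by simp
qed

lemma smooth_on_tsum:
  assumes "open S" "smooth_on S c0" "smooth_on S c2" "smooth_on S c3" "smooth_on S c4"
    "smooth_on S a" "smooth_on S b" "smooth_on S c" "smooth_on S d"
  shows "smooth_on S (\<lambda>X. tsum (c0 X) (c2 X) (c3 X) (c4 X) (a X) (b X) (c X) (d X) j)"
  unfolding tsum_def
  by (intro smooth_on_sum smooth_on_mult smooth_on_coeff_tpoly_power smooth_on_psum assms)

theorem butterfly_envelope:
  fixes \<mu> \<xi> :: "real \<Rightarrow> real" and s0 t0 :: real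
  assumes J: "open J" "t0 \<in> J" and sm: "smooth_on J \<mu>" "smooth_on J \<xi>"
    and M: "(deriv ^^ 2) \<mu> t0 + s0 * (deriv ^^ 2) \<xi> t0 = 0"
      "(deriv ^^ 3) \<mu> t0 + s0 * (deriv ^^ 3) \<xi> t0 = 0"
      "(deriv ^^ 4) \<mu> t0 + s0 * (deriv ^^ 4) \<xi> t0 = 0"
      "(deriv ^^ 5) \<mu> t0 + s0 * (deriv ^^ 5) \<xi> t0 \<noteq> 0"
    and \<xi>2: "(deriv ^^ 2) \<xi> t0 \<noteq> 0"
  shows "butterfly_at (envelope \<mu> \<xi>) (s0, t0)"
proof -
  define F where "F = envelope \<mu> \<xi>"
  define X0 where "X0 = F (s0, t0)"
  have M': "(deriv ^^ k) \<mu> t0 + s0 * (deriv ^^ k) \<xi> t0 = 0" if "2 \<le> k" "k < 5" for k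
  proof -
    have "k = 2 \<or> k = 3 \<or> k = 4" using that by auto
    then show ?thesis using M(1,2,3) by auto
  qed
  obtain N e D where N: "open N" "X0 \<in> N"
    and e: "\<And>i. smooth_on N (e i)" "\<And>i. e i X0 = 0" "\<And>i. (e i has_derivative D i) (at X0)"
    and ev: "\<forall>\<^sub>F p in nhds (s0, t0). F p \<in> N \<and>
       (snd p - t0) ^ 5 + (\<Sum>i<5. e i (F p) * (snd p - t0) ^ i) = 0 \<and>
       real 5 * (snd p - t0) ^ (5 - 1) + (\<Sum>i<5. e i (F p) * (real i * (snd p - t0) ^ (i - 1))) = 0"
    and ker: "\<And>V. D 0 V = 0 \<Longrightarrow> D 1 V = 0 \<Longrightarrow> D 2 V = 0 \<Longrightarrow> V = 0"
    and R: "D 0 (ruling \<xi> t0) = 0" "D 1 (ruling \<xi> t0) = 0" "D 2 (ruling \<xi> t0) \<noteq> 0"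
    using envelope_coefficients5[OF generic_polynomial_345(3) _ J sm M' M(4) \<xi>2] unfolding F_def X0_def by auto
  define a where "a = (\<lambda>X. e 0 X - e 4 X * e 1 X / 5 + (e 4 X)\<^sup>2 * e 2 X / 25 - e 4 X ^ 3 * e 3 X / 125 + 4 * e 4 X ^ 5 / 3125)"
  define b where "b = (\<lambda>X. e 1 X - 2 * e 4 X * e 2 X / 5 + 3 * (e 4 X)\<^sup>2 * e 3 X / 25 - 3 * e 4 X ^ 4 / 125)"
  define c where "c = (\<lambda>X. e 2 X - 3 * e 4 X * e 3 X / 5 + 4 * e 4 X ^ 3 / 25)"
  define d where "d = (\<lambda>X. e 3 X - 2 * (e 4 X)\<^sup>2 / 5)"
  have sma: "smooth_on N a" "smooth_on N b" "smooth_on N c" "smooth_on N d"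
    unfolding a_def b_def c_def d_def
    by (intro smooth_on_add smooth_on_diff smooth_on_mult smooth_on_divide smooth_on_power smooth_on_const e N(1); simp)+
  have z: "a X0 = 0" "b X0 = 0" "c X0 = 0" "d X0 = 0"
    by (simp_all add: a_def b_def c_def d_def e(2))
  have da: "(a has_derivative D 0) (at X0)" "(b has_derivative D 1) (at X0)" "(c has_derivative D 2) (at X0)"
    "(d has_derivative D 3) (at X0)"
    unfolding a_def b_def c_def d_def by (auto intro!: derivative_eq_intros e(3) simp: e(2))
  \<comment> \<open>\<open>(a, b, c)\<close> is a local coordinate system of the target. In it
    \<open>d\<close> is a function vanishing at 0, and Hadamard's lemma writes it as
    \<open>a h0 + b h1 + c h2\<close>.\<close>
  define A where "A = (\<lambda>X. (a X, b X, c X))"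
  have smA: "smooth_on N A" unfolding A_def by (intro smooth_on_Pair sma N(1))
  have dA: "(A has_derivative (\<lambda>V. (D 0 V, D 1 V, D 2 V))) (at X0)"
    unfolding A_def by (intro has_derivative_Pair da)
  have AX0: "A X0 = 0" by (simp add: A_def z zero_prod_def)
  obtain U V g where U: "U \<subseteq> N" "X0 \<in> U" "diffeo_between U V A g"
    by (rule smooth_local_inverse[OF N(1) smA N(2)])
      (use ker in \<open>simp add: frechet_derivative_unique[OF dA] zero_prod_def\<close>)
  have V: "open V" "0 \<in> V" "open U" "smooth_on V g" "\<And>w. w \<in> V \<Longrightarrow> g w \<in> U" "\<And>X. X \<in> U \<Longrightarrow> g (A X) = X" "smooth_on U A"
    using U AX0 by (auto simp: diffeo_between_def)
  obtain r where r: "r > 0" "ball 0 r \<subseteq> V" using V(1,2) open_contains_ball by blast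
  have smdg: "smooth_on (ball 0 r) (\<lambda>w. d (g w))"
    by (rule smooth_on_compose[OF sma(4) open_ball N(1) smooth_on_subset[OF V(4) r(2)]]) (use V(5) r(2) U(1) in blast)
  have gz: "d (g 0) = 0" using V(6)[OF U(2)] by (simp add: AX0 z)
  obtain hh where hh: "\<And>i. i \<in> Basis \<Longrightarrow> smooth_on (ball 0 (r / 2)) (hh i)"
    "\<And>w. w \<in> ball 0 (r / 2) \<Longrightarrow> d (g w) = (\<Sum>i\<in>Basis. (w \<bullet> i) *\<^sub>R hh i w)"
    by (rule hadamard_quotient[OF smdg gz, of "r / 2"]) (use r in auto)
  define N1 where "N1 = U \<inter> A -` ball 0 (r / 2)"
  have N1: "open N1" "X0 \<in> N1" "N1 \<subseteq> N"
    using continuous_open_preimage[OF smooth_on_imp_continuous_on[OF V(7)] V(3) open_ball, of 0 "r / 2"] U r AX0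
    by (auto simp: N1_def)
  define h where "h = (\<lambda>X. (hh (1, 0, 0) (A X), hh (0, 1, 0) (A X), hh (0, 0, 1) (A X)))"
  have smh: "smooth_on N1 h"
    unfolding h_def
    by (intro smooth_on_Pair N1(1) smooth_on_compose[OF hh(1) N1(1) open_ball smooth_on_subset[OF smA N1(3)]])
      (auto simp: N1_def Basis_real3)
  have dh: "d X = a X * fst (h X) + b X * fst (snd (h X)) + c X * snd (snd (h X))" if "X \<in> N1" for X
  proof -
    have "d X = d (g (A X))" using that V(6) by (auto simp: N1_def)
    also have "\<dots> = (\<Sum>i\<in>Basis. (A X \<bullet> i) *\<^sub>R hh i (A X))" using that by (intro hh(2)) (auto simp: N1_def)
    finally show ?thesis by (simp add: Basis_real3 A_def h_def)
  qed
  obtain W \<eta> where W: "open W" "(0, h X0) \<in> W" "smooth_on W \<eta>" "\<forall>w\<in>W. tideal (w, \<eta> w) = 0"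
    by (rule tschirnhaus_coefficients)
  have smw: "smooth_on N1 (\<lambda>X. (A X, h X))"
    by (intro smooth_on_Pair N1(1) smh smooth_on_subset[OF smA N1(3)])
  define N2 where "N2 = N1 \<inter> (\<lambda>X. (A X, h X)) -` W"
  have N2: "open N2" "X0 \<in> N2" "N2 \<subseteq> N1" "N2 \<subseteq> N"
    using continuous_open_preimage[OF smooth_on_imp_continuous_on[OF smw] N1(1) W(1)] N1 W(2) AX0
    by (auto simp: N2_def)
  define y where "y = (\<lambda>X. \<eta> (A X, h X))"
  have smy: "smooth_on N2 y"
    unfolding y_def
    by (rule smooth_on_compose[OF W(3) N2(1) W(1) smooth_on_subset[OF smw N2(3)]]) (auto simp: N2_def)
  define c2 where "c2 = (\<lambda>X. fst (y X))"
  define c3 where "c3 = (\<lambda>X. fst (snd (y X)))"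
  define c4 where "c4 = (\<lambda>X. snd (snd (y X)))"
  define c0 where "c0 = (\<lambda>X. - tlin (c2 X) (c3 X) (c4 X) (b X) (c X) (d X) / 5)"
  note sma2 = smooth_on_subset[OF sma(1) N2(4)] smooth_on_subset[OF sma(2) N2(4)]
    smooth_on_subset[OF sma(3) N2(4)] smooth_on_subset[OF sma(4) N2(4)]
  have smc: "smooth_on N2 c2" "smooth_on N2 c3" "smooth_on N2 c4"
    unfolding c2_def c3_def c4_def by (intro smooth_on_fst smooth_on_snd smy N2(1))+
  have smc0: "smooth_on N2 c0"
    unfolding c0_def tlin_def
    by (intro smooth_on_add smooth_on_diff smooth_on_minus smooth_on_mult smooth_on_divide smooth_on_power
        smooth_on_const smc sma2 N2(1)) simp
  have c00: "c0 X0 = 0" by (simp add: c0_def tlin_def z)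
  define S where "S = (\<lambda>j X. tsum (c0 X) (c2 X) (c3 X) (c4 X) (a X) (b X) (c X) (d X) j)"
  have S12: "S 1 X = 0" "S 2 X = 0" if X: "X \<in> N2" for X
  proof -
    show "S 1 X = 0" unfolding S_def tsum_1 by (simp add: c0_def)
    obtain h0 h1 h2 where hX: "h X = (h0, h1, h2)" by (metis prod.collapse)
    have "tideal (((a X, b X, c X), (h0, h1, h2)), (c2 X, c3 X, c4 X)) = 0"
      using W(4) X by (auto simp: N2_def A_def hX c2_def c3_def c4_def y_def)
    moreover have "d X = a X * h0 + b X * h1 + c X * h2"
      using dh[of X] X N2(3) by (auto simp: hX)
    ultimately show "S 2 X = 0"
      unfolding S_def c0_def by (rule tideal_zero_imp)
  qed
  have smS: "smooth_on N2 (S j)" for j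
    unfolding S_def by (intro smooth_on_tsum N2(1) smc smc0 sma2)
  define C where "C = (\<lambda>j. coeff (tpoly 0 (c2 X0) (c3 X0) (c4 X0) ^ j))"
  have C: "C j k = (if k < j then 0 else 1)" if "k \<le> j" for j k
    using that coeff_pCons_0_power(1)[where k = k and j = j and q = "[:1, c2 X0, c3 X0, c4 X0:]"]
      coeff_pCons_0_power(2)[where j = j and q = "[:1, c2 X0, c3 X0, c4 X0:]"]
    by (cases "k = j") (auto simp: C_def tpoly_def)
  have dS: "(S j has_derivative (\<lambda>V. C j 2 * (- 2 * D 3 V) + C j 3 * (- 3 * D 2 V) + C j 4 * (- 4 * D 1 V) + C j 5 * (- 5 * D 0 V))) (at X0)"
    if "j \<ge> 2" for j
    unfolding S_def C_def
    by (rule tsum_has_derivative[OF N2(1,2) smc0 smc c00 da z that])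
  have dS5: "(S 5 has_derivative (\<lambda>V. - 5 * D 0 V)) (at X0)"
    using dS[of 5] by (simp add: C)
  have dS4: "(S 4 has_derivative (\<lambda>V. - 4 * D 1 V - 5 * C 4 5 * D 0 V)) (at X0)"
    using dS[of 4] by (simp add: C mult_ac)
  have dS3: "(S 3 has_derivative (\<lambda>V. - 3 * D 2 V - 4 * C 3 4 * D 1 V - 5 * C 3 5 * D 0 V)) (at X0)"
    using dS[of 3] by (simp add: C mult_ac)
  \<comment> \<open>The differentials of \<open>S 5\<close>, \<open>S 4\<close>, \<open>S 3\<close>
    start with multiples of \<open>D 0\<close>, \<open>D 1\<close>, \<open>D 2\<close> and otherwise
    involve only differentials of lower index; so \<open>\<psi>\<close> inherits invertibility from
    the coefficients.\<close>
  define \<psi> where "\<psi> = (\<lambda>X. (- S 3 X / 3, S 4 X / 4, - S 5 X / 5))"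
  obtain E where E: "open E" "(s0, t0) \<in> E" "\<forall>p\<in>E. F p \<in> N2" "smooth_on E F"
    using N2(2) unfolding F_def X0_def by (rule envelope_preimage[OF J sm N2(1)])
  have dF: "(F has_derivative (\<lambda>h. fst h *\<^sub>R ruling \<xi> t0)) (at (s0, t0))"
    unfolding F_def by (rule envelope_has_derivative_singular[OF J sm M(1)])
  have smFE: "smooth_on E (\<lambda>p. f (F p))" if "smooth_on N2 f" for f :: "_ \<Rightarrow> real"
    by (rule smooth_on_compose[OF that E(1) N2(1) E(4)]) (use E(3) in auto)
  have dFf: "((\<lambda>p. f (F p)) has_derivative (\<lambda>h. frechet_derivative f (at X0) (fst h *\<^sub>R ruling \<xi> t0))) (at (s0, t0))"
    if "smooth_on N2 f" for f :: "_ \<Rightarrow> real"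
    by (rule has_derivative_compose[OF dF]) (use smooth_on_has_derivative[OF that N2(2)] in \<open>simp add: X0_def\<close>)
  have D0: "frechet_derivative f (at X0) 0 = 0" if "smooth_on N2 f" for f :: "_ \<Rightarrow> real"
    using has_derivative_linear[OF smooth_on_has_derivative[OF that N2(2)]] by (rule linear_0)
  have sme4: "smooth_on N2 (e 4)" by (rule smooth_on_subset[OF e(1) N2(4)])
  \<comment> \<open>\<open>x\<close> is the root of the depressed quintic and \<open>v\<close> its
    image under the transformation. The base root is 0 and \<open>tpoly\<close> has linear
    coefficient 1, so \<open>v\<close> has derivative 1 in the \<open>t\<close> direction.\<close>
  define x where "x = (\<lambda>p. snd p - t0 + e 4 (F p) / 5)"
  define v where "v = (\<lambda>p. c0 (F p) + x p + c2 (F p) * x p ^ 2 + c3 (F p) * x p ^ 3 + c4 (F p) * x p ^ 4)"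
  have smx: "smooth_on E x"
    unfolding x_def by (intro smooth_on_add smooth_on_diff smooth_on_divide smooth_on_snd smooth_on_id smooth_on_const smFE sme4 E(1)) simp
  have x0: "x (s0, t0) = 0" by (simp add: x_def e(2) flip: X0_def)
  define x' where "x' = (\<lambda>h. snd h + frechet_derivative (e 4) (at X0) (fst h *\<^sub>R ruling \<xi> t0) / 5)"
  have dx: "(x has_derivative x') (at (s0, t0))"
    unfolding x_def x'_def by (auto intro!: derivative_eq_intros dFf sme4)
  have dv: "(v has_derivative (\<lambda>h. frechet_derivative c0 (at X0) (fst h *\<^sub>R ruling \<xi> t0) + x' h)) (at (s0, t0))"
    unfolding v_def
    by (auto intro!: derivative_eq_intros dx dFf smc smc0 simp: x0)
  have vpoly: "v p = poly (tpoly (c0 (F p)) (c2 (F p)) (c3 (F p)) (c4 (F p))) (x p)" for p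
    by (simp add: v_def tpoly_def eval_nat_numeral algebra_simps)
  show ?thesis
    unfolding butterfly_at_def
  proof (rule envelope_equivalence[OF J sm M(1) N2(1), of \<psi> _ E v])
    show "envelope \<mu> \<xi> (s0, t0) \<in> N2" using N2(2) by (simp add: X0_def F_def)
    show "smooth_on N2 \<psi>" unfolding \<psi>_def
      by (intro smooth_on_Pair smooth_on_divide smooth_on_minus smooth_on_const smS N2(1)) auto
    show "smooth_on E v" unfolding v_def
      by (intro smooth_on_add smooth_on_mult smooth_on_power smFE smc smc0 smx E(1))
    show "(\<psi> has_derivative (\<lambda>V. (D 2 V + (4 * C 3 4 * D 1 V + 5 * C 3 5 * D 0 V) / 3, - D 1 V - 5 * C 4 5 * D 0 V / 4, D 0 V)))
        (at (envelope \<mu> \<xi> (s0, t0)))"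
      unfolding \<psi>_def F_def[symmetric] X0_def[symmetric]
      by (auto intro!: derivative_eq_intros dS3 dS4 dS5 simp: fun_eq_iff field_simps)
    show "(v has_derivative (\<lambda>h. frechet_derivative c0 (at X0) (fst h *\<^sub>R ruling \<xi> t0) + x' h)) (at (s0, t0))"
      by (rule dv)
    show "\<psi> (envelope \<mu> \<xi> (s0, t0)) = 0"
      unfolding F_def[symmetric] X0_def[symmetric]
      by (simp add: \<psi>_def S_def tsum_def z psum_at_zero zero_prod_def sum.atMost_shift c00 coeff_0_power tpoly_def)
    show "v (s0, t0) = 0" by (simp add: v_def x0 c00 flip: X0_def)
    show "frechet_derivative c0 (at X0) (fst (0::real, 1::real) *\<^sub>R ruling \<xi> t0) + x' (0, 1) \<noteq> 0"
      by (simp add: x'_def D0 smc0 sme4)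
    show "V = 0" if "(D 2 V + (4 * C 3 4 * D 1 V + 5 * C 3 5 * D 0 V) / 3, - D 1 V - 5 * C 4 5 * D 0 V / 4, D 0 V) = 0" for V
    proof -
      have "D 0 V = 0" using that by (simp add: zero_prod_def)
      moreover from this have "D 1 V = 0" using that by (simp add: zero_prod_def)
      moreover from calculation have "D 2 V = 0" using that by (simp add: zero_prod_def)
      ultimately show ?thesis by (rule ker)
    qed
    show "fst (D 2 (ruling \<xi> t0) + (4 * C 3 4 * D 1 (ruling \<xi> t0) + 5 * C 3 5 * D 0 (ruling \<xi> t0)) / 3,
        - D 1 (ruling \<xi> t0) - 5 * C 4 5 * D 0 (ruling \<xi> t0) / 4, D 0 (ruling \<xi> t0)) \<noteq> 0"
      using R by simp
    have "\<forall>\<^sub>F p in nhds (s0, t0). p \<in> E"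
      using E(1,2) by (rule eventually_nhds_in_open)
    with ev show "\<forall>\<^sub>F p in nhds (s0, t0). \<psi> (envelope \<mu> \<xi> p)
      = (\<lambda>(u, v). (u, 5 * v ^ 4 + 2 * u * v, u * v\<^sup>2 + 4 * v ^ 5)) (fst (\<psi> (envelope \<mu> \<xi> p)), v p)"
    proof eventually_elim
      case (elim p)
      define X where "X = F p"
      define \<tau> where "\<tau> = snd p - t0"
      have X: "X \<in> N2" using elim E(3) by (simp add: X_def)
      have e: "\<tau> ^ 5 + (e 0 X + e 1 X * \<tau> + e 2 X * \<tau>\<^sup>2 + e 3 X * \<tau> ^ 3 + e 4 X * \<tau> ^ 4) = 0"
        "5 * \<tau> ^ 4 + (e 1 X + e 2 X * (2 * \<tau>) + e 3 X * (3 * \<tau>\<^sup>2) + e 4 X * (4 * \<tau> ^ 3)) = 0"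
        using elim by (simp_all add: X_def \<tau>_def numeral_eq_Suc)
      have "x p = \<tau> + e 4 X / 5" by (simp add: x_def X_def \<tau>_def)
      then have q: "x p ^ 5 + (a X + b X * x p + c X * (x p)\<^sup>2 + d X * x p ^ 3) = 0"
        "5 * x p ^ 4 + (b X + c X * (2 * x p) + d X * (3 * (x p)\<^sup>2)) = 0"
        using quintic_depress[OF e] unfolding a_def b_def c_def d_def by simp_all
      have "S 4 X / 4 = 5 * v p ^ 4 + 2 * (- S 3 X / 3) * v p" "- S 5 X / 5 = (- S 3 X / 3) * (v p)\<^sup>2 + 4 * v p ^ 5"
        using tschirnhaus_double_root[OF q, of "c0 X" "c2 X" "c3 X" "c4 X"] S12[OF X]
        unfolding vpoly X_def[symmetric] S_def by blast+
      then show ?case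
        unfolding F_def[symmetric] X_def[symmetric] by (simp add: \<psi>_def)
    qed
  qed (use E in \<open>simp_all add: F_def\<close>)
qed

section \<open>Growth of map germs\<close>

definition lower_growth :: "('a::real_normed_vector \<Rightarrow> 'b::real_normed_vector) \<Rightarrow> 'a \<Rightarrow> nat \<Rightarrow> bool" where
  "lower_growth f a m \<longleftrightarrow> (\<exists>K. \<forall>\<^sub>F x in nhds a. norm (x - a) ^ m \<le> K * norm (f x - f a))"

lemma has_derivative_imp_linear_bound:
  assumes "(f has_derivative f') (at a)"
  shows "\<exists>K>0. \<forall>\<^sub>F x in nhds a. norm (f x - f a) \<le> K * norm (x - a)"
proof -
  have bl: "bounded_linear f'" using assms by (rule has_derivative_bounded_linear)
  obtain d where d: "d > 0" "\<And>x. norm (x - a) < d \<Longrightarrow> norm (f x - f a - f' (x - a)) \<le> 1 * norm (x - a)"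
    using assms unfolding has_derivative_at_alt by (meson zero_less_one)
  have "norm (f x - f a) \<le> (onorm f' + 1) * norm (x - a)" if "norm (x - a) < d" for x
  proof -
    have "norm (f x - f a) \<le> norm (f' (x - a)) + norm (f x - f a - f' (x - a))"
      by (rule norm_triangle_sub)
    also have "\<dots> \<le> onorm f' * norm (x - a) + 1 * norm (x - a)"
      by (intro add_mono onorm[OF bl] d that)
    finally show ?thesis by (simp add: algebra_simps)
  qed
  then have "\<forall>\<^sub>F x in nhds a. norm (f x - f a) \<le> (onorm f' + 1) * norm (x - a)"
    unfolding eventually_nhds_metric using d(1) by (auto simp: dist_norm)
  moreover have "onorm f' + 1 > 0" using onorm_pos_le[OF bl] by simp
  ultimately show ?thesis by blast
qed

text \<open>The equivalence costs only constants: a Lipschitz bound at the base point for the target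
  diffeomorphism and one for the inverse of the source diffeomorphism.\<close>

lemma lower_growth_equivalent:
  assumes "right_left_equivalent f a g b" "isCont f a" "lower_growth g b m"
  shows "lower_growth f a m"
proof -
  from assms(1) obtain U U' \<phi> \<phi>' V V' \<psi> \<psi>' where
    \<phi>: "diffeo_between U U' \<phi> \<phi>'" "a \<in> U" "\<phi> a = b" and
    \<psi>: "diffeo_between V V' \<psi> \<psi>'" "f a \<in> V" "\<psi> (f a) = g b" and
    ev: "\<forall>\<^sub>F x in nhds a. f x \<in> V \<and> \<psi> (f x) = g (\<phi> x)"
    unfolding right_left_equivalent_def by blast
  have d\<psi>: "(\<psi> has_derivative frechet_derivative \<psi> (at (f a))) (at (f a))"
    and d\<phi>': "(\<phi>' has_derivative frechet_derivative \<phi>' (at b)) (at b)"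
    and d\<phi>: "(\<phi> has_derivative frechet_derivative \<phi> (at a)) (at a)"
    using \<phi> \<psi> by (auto simp: diffeo_between_def intro: smooth_on_has_derivative)
  obtain K where K: "K > 0" "\<forall>\<^sub>F y in nhds (f a). norm (\<psi> y - \<psi> (f a)) \<le> K * norm (y - f a)"
    using has_derivative_imp_linear_bound[OF d\<psi>] by blast
  obtain L where L: "L > 0" "\<forall>\<^sub>F y in nhds b. norm (\<phi>' y - \<phi>' b) \<le> L * norm (y - b)"
    using has_derivative_imp_linear_bound[OF d\<phi>'] by blast
  obtain c where c: "\<forall>\<^sub>F y in nhds b. norm (y - b) ^ m \<le> c * norm (g y - g b)"
    using assms(3) unfolding lower_growth_def by blast
  have cf: "filterlim f (nhds (f a)) (nhds a)"
    using assms(2) by (simp add: isCont_def tendsto_at_iff_tendsto_nhds)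
  have c\<phi>: "filterlim \<phi> (nhds b) (nhds a)"
    using has_derivative_continuous[OF d\<phi>] \<phi>(3) by (metis isCont_def tendsto_at_iff_tendsto_nhds)
  have evU: "\<forall>\<^sub>F x in nhds a. x \<in> U"
    using \<phi>(1,2) by (auto simp: diffeo_between_def intro: eventually_nhds_in_open)
  have "\<forall>\<^sub>F x in nhds a. norm (x - a) ^ m \<le> (L ^ m * \<bar>c\<bar> * K) * norm (f x - f a)"
    using ev evU filterlim_iff[THEN iffD1, OF cf, rule_format, OF K(2)]
      filterlim_iff[THEN iffD1, OF c\<phi>, rule_format, OF L(2)]
      filterlim_iff[THEN iffD1, OF c\<phi>, rule_format, OF c]
  proof eventually_elim
    case (elim x)
    have "\<phi>' (\<phi> x) = x" "\<phi>' b = a" using \<phi> elim(2) by (auto simp: diffeo_between_def)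
    then have "norm (x - a) ^ m \<le> (L * norm (\<phi> x - b)) ^ m"
      using elim(4) by (intro power_mono) auto
    also have "\<dots> = L ^ m * norm (\<phi> x - b) ^ m" by (rule power_mult_distrib)
    also have "\<dots> \<le> L ^ m * (c * norm (g (\<phi> x) - g b))"
      using elim(5) L(1) by (intro mult_left_mono) auto
    also have "\<dots> \<le> L ^ m * (\<bar>c\<bar> * (K * norm (f x - f a)))"
    proof (intro mult_left_mono mult_mono)
      show "norm (g (\<phi> x) - g b) \<le> K * norm (f x - f a)" using elim(1,3) \<psi>(3) by simp
    qed (use L(1) in auto)
    finally show ?case by (simp add: mult_ac)
  qed
  then show ?thesis unfolding lower_growth_def by blast
qed

lemma right_left_equivalent_sym:
  assumes "right_left_equivalent f a g b"
  shows "right_left_equivalent g b f a"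
proof -
  from assms obtain U U' \<phi> \<phi>' V V' \<psi> \<psi>' where
    \<phi>: "diffeo_between U U' \<phi> \<phi>'" "a \<in> U" "\<phi> a = b" and
    \<psi>: "diffeo_between V V' \<psi> \<psi>'" "f a \<in> V" "\<psi> (f a) = g b" and
    ev: "\<forall>\<^sub>F x in nhds a. f x \<in> V \<and> \<psi> (f x) = g (\<phi> x)"
    unfolding right_left_equivalent_def by blast
  have 1: "diffeo_between U' U \<phi>' \<phi>" "diffeo_between V' V \<psi>' \<psi>"
    using \<phi>(1) \<psi>(1) by (auto simp: diffeo_between_def)
  have 2: "b \<in> U'" "\<phi>' b = a" "g b \<in> V'" "\<psi>' (g b) = f a"
    using \<phi> \<psi> by (auto simp: diffeo_between_def)
  have "(\<phi>' has_derivative frechet_derivative \<phi>' (at b)) (at b)"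
    using 1(1) 2(1) by (auto simp: diffeo_between_def intro: smooth_on_has_derivative)
  then have c: "filterlim \<phi>' (nhds a) (nhds b)"
    using has_derivative_continuous 2(2) by (fastforce simp: isCont_def tendsto_at_iff_tendsto_nhds)
  have evU: "\<forall>\<^sub>F y in nhds b. y \<in> U'"
    using 1(1) 2(1) by (auto simp: diffeo_between_def intro: eventually_nhds_in_open)
  have "\<forall>\<^sub>F y in nhds b. g y \<in> V' \<and> \<psi>' (g y) = f (\<phi>' y)"
    using evU filterlim_iff[THEN iffD1, OF c, rule_format, OF ev]
  proof eventually_elim
    case (elim y)
    have "\<phi> (\<phi>' y) = y" using elim(1) \<phi>(1) by (simp add: diffeo_between_def)
    then show ?case using elim(2) \<psi>(1) by (auto simp: diffeo_between_def)
  qed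
  then show ?thesis
    unfolding right_left_equivalent_def using 1 2 by blast
qed

lemma lower_growth_mono:
  assumes "lower_growth f a m" "m \<le> k"
  shows "lower_growth f a k"
proof -
  obtain K where K: "\<forall>\<^sub>F x in nhds a. norm (x - a) ^ m \<le> K * norm (f x - f a)"
    using assms(1) unfolding lower_growth_def by blast
  have "\<forall>\<^sub>F x in nhds a. norm (x - a) < 1"
    unfolding eventually_nhds_metric by (auto simp: dist_norm intro!: exI[of _ 1])
  with K have "\<forall>\<^sub>F x in nhds a. norm (x - a) ^ k \<le> K * norm (f x - f a)"
  proof eventually_elim
    case (elim x)
    have "norm (x - a) ^ k \<le> norm (x - a) ^ m"
      using elim(2) assms(2) by (intro power_decreasing) auto
    with elim(1) show ?case by linarith
  qed
  then show ?thesis unfolding lower_growth_def by blast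
qed

lemma not_lower_growth:
  fixes f :: "'a::real_normed_vector \<Rightarrow> 'b::real_normed_vector"
  assumes "norm v = 1" "order_ge (\<lambda>\<tau>. norm (f (a + \<tau> *\<^sub>R v) - f a)) (Suc m)"
  shows "\<not> lower_growth f a m"
proof
  assume "lower_growth f a m"
  then obtain K where K: "\<forall>\<^sub>F x in nhds a. norm (x - a) ^ m \<le> K * norm (f x - f a)"
    unfolding lower_growth_def by blast
  have "((\<lambda>\<tau>. a + \<tau> *\<^sub>R v) \<longlongrightarrow> a + 0 *\<^sub>R v) (at 0)"
    by (intro tendsto_intros)
  then have "\<forall>\<^sub>F \<tau> in at 0. norm (\<tau> *\<^sub>R v) ^ m \<le> K * norm (f (a + \<tau> *\<^sub>R v) - f a)"
    using filterlim_iff[THEN iffD1, of _ "nhds a", rule_format, OF _ K] by fastforce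
  then have *: "\<forall>\<^sub>F \<tau> in at 0. \<bar>\<tau>\<bar> ^ m \<le> K * norm (f (a + \<tau> *\<^sub>R v) - f a)"
    using assms(1) by simp
  obtain C where C: "\<forall>\<^sub>F \<tau> in at 0. \<bar>norm (f (a + \<tau> *\<^sub>R v) - f a)\<bar> \<le> C * \<bar>\<tau>\<bar> ^ Suc m"
    using assms(2) unfolding order_ge_def by blast
  have "order_ge (\<lambda>\<tau>. 1 * \<tau> ^ m) (Suc m)"
    unfolding order_ge_def
  proof (rule exI, rule eventually_mono[OF eventually_conj[OF * C]])
    fix \<tau> :: real
    assume h: "\<bar>\<tau>\<bar> ^ m \<le> K * norm (f (a + \<tau> *\<^sub>R v) - f a) \<and> \<bar>norm (f (a + \<tau> *\<^sub>R v) - f a)\<bar> \<le> C * \<bar>\<tau>\<bar> ^ Suc m"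
    have "\<bar>1 * \<tau> ^ m\<bar> \<le> K * norm (f (a + \<tau> *\<^sub>R v) - f a)" using h by (simp add: power_abs)
    also have "\<dots> \<le> \<bar>K\<bar> * norm (f (a + \<tau> *\<^sub>R v) - f a)" by (intro mult_right_mono) auto
    also have "\<dots> \<le> \<bar>K\<bar> * (C * \<bar>\<tau>\<bar> ^ Suc m)" using h by (intro mult_left_mono) auto
    finally show "\<bar>1 * \<tau> ^ m\<bar> \<le> (\<bar>K\<bar> * C) * \<bar>\<tau>\<bar> ^ Suc m" by (simp only: mult.assoc)
  qed
  then show False using order_ge_monom_imp by fastforce
qed

text \<open>The two coordinates may be estimated separately, since the power of the norm is at most
  \<open>2 ^ m\<close> times the sum of their powers. Near \<open>a\<close> the first power is at
  most its base because \<open>m > 0\<close>.\<close>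

lemma lower_growthI:
  fixes f :: "real \<times> real \<Rightarrow> 'b::real_normed_vector"
  assumes "0 < m" and "\<forall>\<^sub>F p in nhds a. \<bar>fst p - fst a\<bar> \<le> norm (f p - f a) \<and> \<bar>snd p - snd a\<bar> ^ m \<le> K * norm (f p - f a)"
  shows "lower_growth f a m"
proof -
  have "\<forall>\<^sub>F p in nhds a. norm (p - a) < 1"
    unfolding eventually_nhds_metric by (auto simp: dist_norm intro!: exI[of _ 1])
  with assms(2) have "\<forall>\<^sub>F p in nhds a. norm (p - a) ^ m \<le> (2 ^ m * (1 + K)) * norm (f p - f a)"
  proof eventually_elim
    case (elim p)
    define x where "x = \<bar>fst p - fst a\<bar>"
    define y where "y = \<bar>snd p - snd a\<bar>"
    have x: "x < 1" using norm_fst_le[of "fst (p - a)" "snd (p - a)"] elim(2) by (simp add: x_def minus_prod_def)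
    have "norm (p - a) \<le> x + y"
      using norm_Pair_le[of "fst p - fst a" "snd p - snd a"] by (simp add: x_def y_def minus_prod_def)
    also have "\<dots> \<le> 2 * max x y" by simp
    finally have "norm (p - a) ^ m \<le> (2 * max x y) ^ m" by (intro power_mono) auto
    also have "\<dots> = 2 ^ m * max x y ^ m" by (rule power_mult_distrib)
    also have "\<dots> \<le> 2 ^ m * (x ^ m + y ^ m)"
      by (intro mult_left_mono) (auto simp: max_def x_def y_def)
    also have "x ^ m \<le> x"
      using x assms(1) power_decreasing[of 1 m x] by (simp add: x_def)
    finally have "norm (p - a) ^ m \<le> 2 ^ m * (x + y ^ m)" by simp
    also have "\<dots> \<le> 2 ^ m * ((1 + K) * norm (f p - f a))"
      using elim(1) by (intro mult_left_mono) (auto simp: x_def y_def distrib_right)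
    finally show ?case by (simp add: mult_ac)
  qed
  then show ?thesis unfolding lower_growth_def by blast
qed

lemma lower_growth_modelI:
  fixes A B :: "real \<Rightarrow> real \<Rightarrow> real"
  assumes "0 < m" "A 0 0 = 0" "B 0 0 = 0"
    and le: "\<And>u v. \<bar>v\<bar> < 1 \<Longrightarrow> \<bar>v\<bar> ^ m \<le> \<bar>u\<bar> + \<bar>A u v\<bar> + \<bar>B u v\<bar>"
  shows "lower_growth (\<lambda>(u, v). (u, A u v, B u v)) (0, 0) m"
proof (rule lower_growthI[where K = 3])
  have "\<forall>\<^sub>F p in nhds (0 :: real \<times> real). norm p < 1"
    unfolding eventually_nhds_metric by (auto simp: dist_norm intro!: exI[of _ 1])
  then show "\<forall>\<^sub>F p in nhds (0, 0). \<bar>fst p - fst (0, 0)\<bar> \<le> norm ((case p of (u, v) \<Rightarrow> (u, A u v, B u v)) - (case (0, 0) of (u, v) \<Rightarrow> (u, A u v, B u v))) \<and>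
      \<bar>snd p - snd (0, 0)\<bar> ^ m \<le> 3 * norm ((case p of (u, v) \<Rightarrow> (u, A u v, B u v)) - (case (0, 0) of (u, v) \<Rightarrow> (u, A u v, B u v)))"
    unfolding zero_prod_def
  proof eventually_elim
    case (elim p)
    obtain u v where p: "p = (u, v)" by (cases p)
    have "\<bar>v\<bar> < 1" using elim norm_snd_le[of v u] by (simp add: p)
    then have "\<bar>v\<bar> ^ m \<le> 3 * norm (u, A u v, B u v)" "\<bar>u\<bar> \<le> norm (u, A u v, B u v)"
      using le[of v u] norm_fst_le[of u "(A u v, B u v)"] norm_snd_le[of "(A u v, B u v)" u]
        norm_fst_le[of "A u v" "B u v"] norm_snd_le[of "B u v" "A u v"] by simp_all
    then show ?case by (simp add: p assms)
  qed
qed (rule assms(1))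

text \<open>The component of lowest degree in \<open>v\<close> controls the power of
  \<open>v\<close> up to a multiple of \<open>u\<close>, and \<open>u\<close> is itself a
  component.\<close>

lemma lower_growth_models:
  "lower_growth (\<lambda>(u, v). (u, v\<^sup>2, v ^ 3) :: real \<times> real \<times> real) (0, 0) 2"
  "lower_growth (\<lambda>(u, v). (u, 3 * v ^ 4 + u * v\<^sup>2, 4 * v ^ 3 + 2 * u * v) :: real \<times> real \<times> real) (0, 0) 3"
  "lower_growth (\<lambda>(u, v). (u, 5 * v ^ 4 + 2 * u * v, u * v\<^sup>2 + 4 * v ^ 5) :: real \<times> real \<times> real) (0, 0) 4"
proof -
  have uv: "\<bar>2 * u * v\<bar> \<le> 2 * \<bar>u\<bar>" if "\<bar>v\<bar> < 1" for u v :: real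
    using that mult_left_mono[of "\<bar>v\<bar>" 1 "2 * \<bar>u\<bar>"] by (simp add: abs_mult)
  show "lower_growth (\<lambda>(u, v). (u, v\<^sup>2, v ^ 3) :: real \<times> real \<times> real) (0, 0) 2"
    by (rule lower_growth_modelI) auto
  show "lower_growth (\<lambda>(u, v). (u, 3 * v ^ 4 + u * v\<^sup>2, 4 * v ^ 3 + 2 * u * v) :: real \<times> real \<times> real) (0, 0) 3"
  proof (rule lower_growth_modelI)
    fix u v :: real assume "\<bar>v\<bar> < 1"
    then have "\<bar>4 * v ^ 3\<bar> \<le> \<bar>4 * v ^ 3 + 2 * u * v\<bar> + 2 * \<bar>u\<bar>" using uv[of v u] by linarith
    then show "\<bar>v\<bar> ^ 3 \<le> \<bar>u\<bar> + \<bar>3 * v ^ 4 + u * v\<^sup>2\<bar> + \<bar>4 * v ^ 3 + 2 * u * v\<bar>"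
      by (simp add: abs_mult power_abs)
  qed auto
  show "lower_growth (\<lambda>(u, v). (u, 5 * v ^ 4 + 2 * u * v, u * v\<^sup>2 + 4 * v ^ 5) :: real \<times> real \<times> real) (0, 0) 4"
  proof (rule lower_growth_modelI)
    fix u v :: real assume "\<bar>v\<bar> < 1"
    then have "\<bar>5 * v ^ 4\<bar> \<le> \<bar>5 * v ^ 4 + 2 * u * v\<bar> + 2 * \<bar>u\<bar>" using uv[of v u] by linarith
    then show "\<bar>v\<bar> ^ 4 \<le> \<bar>u\<bar> + \<bar>5 * v ^ 4 + 2 * u * v\<bar> + \<bar>u * v\<^sup>2 + 4 * v ^ 5\<bar>"
      by (simp add: abs_mult power_abs)
  qed auto
qed

lemma order_ge_norm_Pair:
  fixes f g :: "real \<Rightarrow> real"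
  assumes "order_ge f m" "order_ge g m"
  shows "order_ge (\<lambda>\<tau>. norm (0 :: real, f \<tau>, g \<tau>)) m"
proof -
  obtain C D where "\<forall>\<^sub>F \<tau> in at 0. \<bar>f \<tau>\<bar> \<le> C * \<bar>\<tau>\<bar> ^ m" "\<forall>\<^sub>F \<tau> in at 0. \<bar>g \<tau>\<bar> \<le> D * \<bar>\<tau>\<bar> ^ m"
    using assms unfolding order_ge_def by blast
  then have "\<forall>\<^sub>F \<tau> in at 0. \<bar>norm (0 :: real, f \<tau>, g \<tau>)\<bar> \<le> (C + D) * \<bar>\<tau>\<bar> ^ m"
  proof eventually_elim
    case (elim \<tau>)
    have "norm (0 :: real, f \<tau>, g \<tau>) \<le> \<bar>f \<tau>\<bar> + \<bar>g \<tau>\<bar>"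
      using norm_Pair_le[of "f \<tau>" "g \<tau>"] norm_Pair_le[of "0 :: real" "(f \<tau>, g \<tau>)"] by simp
    with elim show ?case by (simp add: distrib_right)
  qed
  then show ?thesis unfolding order_ge_def by blast
qed

text \<open>On the line \<open>u = 0\<close> the swallowtail is of order 3 and the butterfly of
  order 4, too small for the next lower exponent.\<close>

lemma not_lower_growth_models:
  "\<not> lower_growth (\<lambda>(u, v). (u, 3 * v ^ 4 + u * v\<^sup>2, 4 * v ^ 3 + 2 * u * v) :: real \<times> real \<times> real) (0, 0) 2"
  "\<not> lower_growth (\<lambda>(u, v). (u, 5 * v ^ 4 + 2 * u * v, u * v\<^sup>2 + 4 * v ^ 5) :: real \<times> real \<times> real) (0, 0) 3"
proof -
  have "order_ge (\<lambda>\<tau>. norm (0 :: real, 3 * \<tau> ^ 4, 4 * \<tau> ^ 3)) (Suc 2)"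
    "order_ge (\<lambda>\<tau>. norm (0 :: real, 5 * \<tau> ^ 4, 4 * \<tau> ^ 5)) (Suc 3)"
    by (intro order_ge_norm_Pair order_ge_monom; simp)+
  then show "\<not> lower_growth (\<lambda>(u, v). (u, 3 * v ^ 4 + u * v\<^sup>2, 4 * v ^ 3 + 2 * u * v) :: real \<times> real \<times> real) (0, 0) 2"
    "\<not> lower_growth (\<lambda>(u, v). (u, 5 * v ^ 4 + 2 * u * v, u * v\<^sup>2 + 4 * v ^ 5) :: real \<times> real \<times> real) (0, 0) 3"
    by (intro not_lower_growth[where v = "(0, 1)"]; simp)+
qed

lemma order_ge_taylor_at:
  fixes f g :: "real \<Rightarrow> real"
  assumes J: "open J" "t0 \<in> J" and sm: "smooth_on J f" "smooth_on J g"
  shows "order_ge (\<lambda>\<tau>. (f (t0 + \<tau>) + s * g (t0 + \<tau>)) -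
    (\<Sum>i<n. ((deriv ^^ i) f t0 + s * (deriv ^^ i) g t0) / fact i * \<tau> ^ i)) n"
proof -
  define h where "h = (\<lambda>x. f x + s * g x)"
  have smh: "smooth_on J h"
    unfolding h_def by (intro smooth_on_add smooth_on_mult smooth_on_const J sm)
  obtain r where r: "r > 0" "ball t0 r \<subseteq> J" using J open_contains_ball by blast
  have "smooth_on (ball 0 r) (\<lambda>\<tau>. h (t0 + \<tau>))"
    by (rule smooth_on_compose[OF smh open_ball J(1)])
      (use r(2) in \<open>auto intro!: smooth_on_add smooth_on_const smooth_on_id simp: subset_iff dist_norm\<close>)
  note taylor = order_ge_taylor[OF r(1) this, of n]
  have "(deriv ^^ i) (\<lambda>\<tau>. h (t0 + \<tau>)) 0 = (deriv ^^ i) f t0 + s * (deriv ^^ i) g t0" for i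
    using deriv_iterate_shift[OF J(1) smh, of t0 0 i] deriv_iterate_linear[OF J(1) sm J(2), of i s] J(2)
    by (simp add: h_def)
  with taylor show ?thesis by (simp add: h_def)
qed

lemma envelope_vanishing_order:
  fixes \<mu> \<xi> :: "real \<Rightarrow> real"
  assumes J: "open J" "t0 \<in> J" and sm: "smooth_on J \<mu>" "smooth_on J \<xi>" and n: "2 \<le> n"
    and M: "\<And>k. 2 \<le> k \<Longrightarrow> k < n \<Longrightarrow> (deriv ^^ k) \<mu> t0 + s0 * (deriv ^^ k) \<xi> t0 = 0"
  shows "order_ge (\<lambda>\<tau>. (deriv \<mu> (t0 + \<tau>) + s0 * deriv \<xi> (t0 + \<tau>)) - (deriv \<mu> t0 + s0 * deriv \<xi> t0)
      - ((deriv ^^ n) \<mu> t0 + s0 * (deriv ^^ n) \<xi> t0) / fact (n - 1) * \<tau> ^ (n - 1)) n"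
    and "order_ge (\<lambda>\<tau>. (\<mu> (t0 + \<tau>) + s0 * \<xi> (t0 + \<tau>)) - (\<mu> t0 + s0 * \<xi> t0) - \<tau> * (deriv \<mu> t0 + s0 * deriv \<xi> t0)) n"
proof -
  obtain k where k: "n = Suc (Suc k)" using n by (metis add_2_eq_Suc le_Suc_ex)
  have it: "(deriv ^^ i) (deriv f) = (deriv ^^ Suc i) f" for i and f :: "real \<Rightarrow> real"
    by (simp add: funpow_swap1)
  have "(\<Sum>i<n. ((deriv ^^ i) (deriv \<mu>) t0 + s0 * (deriv ^^ i) (deriv \<xi>) t0) / fact i * \<tau> ^ i)
    = (deriv \<mu> t0 + s0 * deriv \<xi> t0) + ((deriv ^^ n) \<mu> t0 + s0 * (deriv ^^ n) \<xi> t0) / fact (n - 1) * \<tau> ^ (n - 1)" for \<tau>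
  proof -
    have "(\<Sum>i<k. ((deriv ^^ Suc (Suc i)) \<mu> t0 + s0 * (deriv ^^ Suc (Suc i)) \<xi> t0) / fact (Suc i) * \<tau> ^ Suc i) = 0"
      by (rule sum.neutral) (use M k in \<open>auto simp del: funpow.simps\<close>)
    then show ?thesis
      unfolding it k sum.lessThan_Suc[where n = "Suc k"] sum.lessThan_Suc_shift[where n = k] by simp
  qed
  then show "order_ge (\<lambda>\<tau>. (deriv \<mu> (t0 + \<tau>) + s0 * deriv \<xi> (t0 + \<tau>)) - (deriv \<mu> t0 + s0 * deriv \<xi> t0)
      - ((deriv ^^ n) \<mu> t0 + s0 * (deriv ^^ n) \<xi> t0) / fact (n - 1) * \<tau> ^ (n - 1)) n"
    using order_ge_taylor_at[OF J smooth_on_deriv(1)[OF J(1) sm(1)] smooth_on_deriv(1)[OF J(1) sm(2)], of s0 n]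
    by (simp add: algebra_simps)
  have "(\<Sum>i<n. ((deriv ^^ i) \<mu> t0 + s0 * (deriv ^^ i) \<xi> t0) / fact i * \<tau> ^ i)
    = (\<mu> t0 + s0 * \<xi> t0) + \<tau> * (deriv \<mu> t0 + s0 * deriv \<xi> t0)" for \<tau>
  proof -
    have "(\<Sum>i<k. ((deriv ^^ Suc (Suc i)) \<mu> t0 + s0 * (deriv ^^ Suc (Suc i)) \<xi> t0) / fact (Suc (Suc i)) * \<tau> ^ Suc (Suc i)) = 0"
      by (rule sum.neutral) (use M k in \<open>auto simp del: funpow.simps\<close>)
    then show ?thesis
      unfolding k sum.lessThan_Suc_shift by simp
  qed
  then show "order_ge (\<lambda>\<tau>. (\<mu> (t0 + \<tau>) + s0 * \<xi> (t0 + \<tau>)) - (\<mu> t0 + s0 * \<xi> t0) - \<tau> * (deriv \<mu> t0 + s0 * deriv \<xi> t0)) n"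
    using order_ge_taylor_at[OF J sm, of s0 n] by (simp add: algebra_simps)
qed

text \<open>The first component controls \<open>s - s0\<close>. Up to a multiple of it, the second
  component is minus the increment of the derivative of \<open>\<mu> + s0 * \<xi>\<close>, whose
  leading term has order exactly \<open>n - 1\<close>.\<close>

lemma lower_growth_envelope:
  fixes \<mu> \<xi> :: "real \<Rightarrow> real"
  assumes J: "open J" "t0 \<in> J" and sm: "smooth_on J \<mu>" "smooth_on J \<xi>" and n: "2 \<le> n"
    and M: "\<And>k. 2 \<le> k \<Longrightarrow> k < n \<Longrightarrow> (deriv ^^ k) \<mu> t0 + s0 * (deriv ^^ k) \<xi> t0 = 0"
    and Mn: "(deriv ^^ n) \<mu> t0 + s0 * (deriv ^^ n) \<xi> t0 \<noteq> 0"
  shows "lower_growth (envelope \<mu> \<xi>) (s0, t0) (n - 1)"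
proof -
  define g where "g = (\<lambda>\<tau>. (deriv \<mu> (t0 + \<tau>) + s0 * deriv \<xi> (t0 + \<tau>)) - (deriv \<mu> t0 + s0 * deriv \<xi> t0))"
  define c where "c = ((deriv ^^ n) \<mu> t0 + s0 * (deriv ^^ n) \<xi> t0) / fact (n - 1)"
  have c: "c \<noteq> 0" using Mn by (simp add: c_def)
  obtain C where "\<forall>\<^sub>F \<tau> in at 0. \<bar>g \<tau> - c * \<tau> ^ (n - 1)\<bar> \<le> C * \<bar>\<tau>\<bar> ^ n"
    using envelope_vanishing_order(1)[OF J sm n M] unfolding g_def c_def order_ge_def by blast
  then have C: "\<forall>\<^sub>F \<tau> in nhds 0. \<bar>g \<tau> - c * \<tau> ^ (n - 1)\<bar> \<le> C * \<bar>\<tau>\<bar> ^ n"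
    using n by (simp add: eventually_nhds_conv_at g_def power_0_left)
  have "((\<lambda>\<tau>. C * \<bar>\<tau>\<bar>) \<longlongrightarrow> C * \<bar>0\<bar>) (nhds 0)" by (intro tendsto_intros filterlim_ident)
  then have "\<forall>\<^sub>F \<tau> in nhds 0. C * \<bar>\<tau>\<bar> < \<bar>c\<bar> / 2"
    by (rule order_tendstoD) (use c in simp)
  with C have g0: "\<forall>\<^sub>F \<tau> in nhds 0. \<bar>c\<bar> / 2 * \<bar>\<tau>\<bar> ^ (n - 1) \<le> \<bar>g \<tau>\<bar>"
  proof eventually_elim
    case (elim \<tau>)
    have "\<bar>\<tau>\<bar> ^ n = \<bar>\<tau>\<bar> * \<bar>\<tau>\<bar> ^ (n - 1)" using n by (cases n) auto
    then have "C * \<bar>\<tau>\<bar> ^ n \<le> \<bar>c\<bar> / 2 * \<bar>\<tau>\<bar> ^ (n - 1)"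
      using elim(2) mult_right_mono[of "C * \<bar>\<tau>\<bar>" "\<bar>c\<bar> / 2" "\<bar>\<tau>\<bar> ^ (n - 1)"] by (simp add: mult_ac)
    moreover have "\<bar>c * \<tau> ^ (n - 1)\<bar> = \<bar>c\<bar> * \<bar>\<tau>\<bar> ^ (n - 1)" by (simp add: abs_mult power_abs)
    moreover have "\<bar>c * \<tau> ^ (n - 1)\<bar> \<le> \<bar>g \<tau>\<bar> + \<bar>g \<tau> - c * \<tau> ^ (n - 1)\<bar>" by linarith
    ultimately show ?case using elim(1) by (simp add: field_simps)
  qed
  have "((\<lambda>p. snd p - t0) \<longlongrightarrow> snd (s0, t0) - t0) (nhds (s0, t0))"
    by (intro tendsto_intros filterlim_ident)
  then have lim: "filterlim (\<lambda>p. snd p - t0) (nhds 0) (nhds (s0, t0))" by simp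
  have g: "\<forall>\<^sub>F p in nhds (s0, t0). \<bar>c\<bar> / 2 * \<bar>snd p - t0\<bar> ^ (n - 1) \<le> \<bar>g (snd p - t0)\<bar>"
    by (rule filterlim_iff[THEN iffD1, OF lim, rule_format, OF g0])
  have c\<xi>: "isCont (deriv \<xi>) t0"
    using smooth_on_imp_continuous_on[OF smooth_on_deriv(1)[OF J(1) sm(2)]] J by (simp add: continuous_on_eq_continuous_at)
  have "((\<lambda>p. snd p) \<longlongrightarrow> snd (s0, t0)) (nhds (s0, t0))"
    by (intro tendsto_intros filterlim_ident)
  then have "(snd \<longlongrightarrow> t0) (nhds (s0, t0))" by simp
  from tendsto_rabs[OF isCont_tendsto_compose[OF c\<xi> this]]
  have \<xi>': "\<forall>\<^sub>F p in nhds (s0, t0). \<bar>deriv \<xi> (snd p)\<bar> < \<bar>deriv \<xi> t0\<bar> + 1"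
    by (rule order_tendstoD) simp
  show ?thesis
  proof (rule lower_growthI[where K = "(\<bar>deriv \<xi> t0\<bar> + 2) * 2 / \<bar>c\<bar>"])
    show "\<forall>\<^sub>F p in nhds (s0, t0). \<bar>fst p - fst (s0, t0)\<bar> \<le> norm (envelope \<mu> \<xi> p - envelope \<mu> \<xi> (s0, t0)) \<and>
        \<bar>snd p - snd (s0, t0)\<bar> ^ (n - 1) \<le> (\<bar>deriv \<xi> t0\<bar> + 2) * 2 / \<bar>c\<bar> * norm (envelope \<mu> \<xi> p - envelope \<mu> \<xi> (s0, t0))"
      using g \<xi>'
    proof eventually_elim
      case (elim p)
      obtain s t where p: "p = (s, t)" by (cases p)
      define d where "d = - g (t - t0) - (s - s0) * deriv \<xi> t"
      define N where "N = norm (envelope \<mu> \<xi> p - envelope \<mu> \<xi> (s0, t0))"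
      define z where "z = snd (snd (envelope \<mu> \<xi> p - envelope \<mu> \<xi> (s0, t0)))"
      have "envelope \<mu> \<xi> p - envelope \<mu> \<xi> (s0, t0) = (s - s0, d, z)"
        unfolding prod_eq_iff z_def by (simp add: envelope_def p d_def g_def algebra_simps)
      then have N: "\<bar>s - s0\<bar> \<le> N" "\<bar>d\<bar> \<le> N"
        using norm_fst_le[of "s - s0" "(d, z)"] norm_snd_le[of "(d, z)" "s - s0"] norm_fst_le[of d z]
        by (simp_all add: N_def)
      have "\<bar>(s - s0) * deriv \<xi> t\<bar> \<le> N * (\<bar>deriv \<xi> t0\<bar> + 1)"
        unfolding abs_mult using elim(2) N(1) by (intro mult_mono) (auto simp: p)
      then have "\<bar>g (t - t0)\<bar> \<le> N + N * (\<bar>deriv \<xi> t0\<bar> + 1)"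
        using N(2) by (simp add: d_def)
      then have "\<bar>c\<bar> / 2 * \<bar>t - t0\<bar> ^ (n - 1) \<le> (\<bar>deriv \<xi> t0\<bar> + 2) * N"
        using elim(1) by (simp add: p algebra_simps)
      then have "\<bar>t - t0\<bar> ^ (n - 1) \<le> (\<bar>deriv \<xi> t0\<bar> + 2) * 2 / \<bar>c\<bar> * N"
        using c by (simp add: field_simps)
      with N(1) show ?case by (simp add: p N_def)
    qed
  qed (use n in simp)
qed

text \<open>Along \<open>s = s0\<close> both varying components are of order \<open>n\<close>. Here
  the derivatives vanish up to and including \<open>n\<close>, one step further than in
  \<open>lower_growth_envelope\<close>.\<close>

lemma not_lower_growth_envelope:
  fixes \<mu> \<xi> :: "real \<Rightarrow> real"
  assumes J: "open J" "t0 \<in> J" and sm: "smooth_on J \<mu>" "smooth_on J \<xi>"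
    and M: "\<And>k. 2 \<le> k \<Longrightarrow> k \<le> n \<Longrightarrow> (deriv ^^ k) \<mu> t0 + s0 * (deriv ^^ k) \<xi> t0 = 0" and n: "2 \<le> n"
  shows "\<not> lower_growth (envelope \<mu> \<xi>) (s0, t0) (n - 1)"
proof (rule not_lower_growth[where v = "(0, 1)"])
  define g where "g = (\<lambda>\<tau>. (deriv \<mu> (t0 + \<tau>) + s0 * deriv \<xi> (t0 + \<tau>)) - (deriv \<mu> t0 + s0 * deriv \<xi> t0))"
  define h where "h = (\<lambda>\<tau>. (\<mu> (t0 + \<tau>) + s0 * \<xi> (t0 + \<tau>)) - (\<mu> t0 + s0 * \<xi> t0) - \<tau> * (deriv \<mu> t0 + s0 * deriv \<xi> t0))"
  have M': "\<And>k. 2 \<le> k \<Longrightarrow> k < n \<Longrightarrow> (deriv ^^ k) \<mu> t0 + s0 * (deriv ^^ k) \<xi> t0 = 0" using M by simp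
  have g: "order_ge g n" and h: "order_ge h n"
    using envelope_vanishing_order[OF J sm n M'] M[OF n] unfolding g_def h_def by auto
  have "order_ge (\<lambda>\<tau>. norm (0 :: real, - g \<tau>, h \<tau> - (t0 + \<tau>) * g \<tau>)) n"
  proof (intro order_ge_norm_Pair order_ge_minus order_ge_diff g h order_ge_mult[OF _ g])
    show "((\<lambda>\<tau>. t0 + \<tau>) \<longlongrightarrow> t0 + 0) (at 0)" by (intro tendsto_intros)
  qed
  moreover have "envelope \<mu> \<xi> ((s0, t0) + \<tau> *\<^sub>R (0, 1)) - envelope \<mu> \<xi> (s0, t0) = (0, - g \<tau>, h \<tau> - (t0 + \<tau>) * g \<tau>)" for \<tau>
    by (simp add: envelope_def g_def h_def algebra_simps)
  ultimately show "order_ge (\<lambda>\<tau>. norm (envelope \<mu> \<xi> ((s0, t0) + \<tau> *\<^sub>R (0, 1)) - envelope \<mu> \<xi> (s0, t0))) (Suc (n - 1))"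
    using n by simp
qed simp

text \<open>The backward implications are the three normal form theorems. For the forward ones, the
  least exponent of the model fixes which derivative is the first not to vanish; the butterfly also
  has to be separated from the case \<open>M 3 = M 4 = M 5 = 0\<close>, where exponent 4
  fails.\<close>

theorem envelope_singularities:
  fixes \<mu> \<xi> :: "real \<Rightarrow> real" and s0 t0 :: real
  defines "M \<equiv> \<lambda>k. (deriv ^^ k) \<mu> t0 + s0 * (deriv ^^ k) \<xi> t0"
  assumes J: "open J" "t0 \<in> J" and sm: "smooth_on J \<mu>" "smooth_on J \<xi>"
    and M2: "M 2 = 0" and \<xi>2: "(deriv ^^ 2) \<xi> t0 \<noteq> 0"
  shows "cuspidal_edge_at (envelope \<mu> \<xi>) (s0, t0) \<longleftrightarrow> M 3 \<noteq> 0"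
    and "swallowtail_at (envelope \<mu> \<xi>) (s0, t0) \<longleftrightarrow> M 3 = 0 \<and> M 4 \<noteq> 0"
    and "butterfly_at (envelope \<mu> \<xi>) (s0, t0) \<longleftrightarrow> M 3 = 0 \<and> M 4 = 0 \<and> M 5 \<noteq> 0"
proof -
  define F where "F = envelope \<mu> \<xi>"
  have contF: "isCont F (s0, t0)"
    using smooth_on_imp_continuous_on[OF smooth_on_envelope[OF J(1) sm]] J
    by (auto simp: F_def continuous_on_eq_continuous_at open_Times)
  have cont_models: "isCont (\<lambda>(u, v). (u, v\<^sup>2, v ^ 3) :: real \<times> real \<times> real) (0, 0)"
    "isCont (\<lambda>(u, v). (u, 3 * v ^ 4 + u * v\<^sup>2, 4 * v ^ 3 + 2 * u * v) :: real \<times> real \<times> real) (0, 0)"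
    "isCont (\<lambda>(u, v). (u, 5 * v ^ 4 + 2 * u * v, u * v\<^sup>2 + 4 * v ^ 5) :: real \<times> real \<times> real) (0, 0)"
    unfolding split_beta by (intro continuous_intros)+
  have z2: "M k = 0" if "2 \<le> k" "k < 3" for k
    using that M2 by (cases "k = 2") auto
  have z3: "M k = 0" if "M 3 = 0" "2 \<le> k" "k < 4" for k
    using that z2[of k] by (cases "k = 3") auto
  have z4: "M k = 0" if "M 3 = 0" "M 4 = 0" "2 \<le> k" "k < 5" for k
    using that z3[of k] by (cases "k = 4") auto
  have z5: "M k = 0" if "M 3 = 0" "M 4 = 0" "M 5 = 0" "2 \<le> k" "k < 6" for k
    using that z4[of k] by (cases "k = 5") auto
  have pos: "lower_growth F (s0, t0) (n - 1)" if "M n \<noteq> 0" "2 \<le> n" "\<And>k. 2 \<le> k \<Longrightarrow> k < n \<Longrightarrow> M k = 0" for n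
    using lower_growth_envelope[OF J sm that(2), of s0] that(1,3) unfolding M_def F_def by blast
  have neg: "\<not> lower_growth F (s0, t0) (n - 1)" if "2 \<le> n" "\<And>k. 2 \<le> k \<Longrightarrow> k < Suc n \<Longrightarrow> M k = 0" for n
    using not_lower_growth_envelope[OF J sm _ that(1), of s0] that(2) unfolding M_def F_def by (simp add: less_Suc_eq_le)
  have g3: "M 3 \<noteq> 0 \<Longrightarrow> lower_growth F (s0, t0) 2" using pos[of 3, OF _ _ z2] by simp
  have g4: "M 3 = 0 \<Longrightarrow> M 4 \<noteq> 0 \<Longrightarrow> lower_growth F (s0, t0) 3" using pos[of 4, OF _ _ z3] by simp
  have n3: "\<not> lower_growth F (s0, t0) 2" if "M 3 = 0"
    by (rule neg[of 3, simplified]) (rule z3[OF that])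
  have n4: "\<not> lower_growth F (s0, t0) 3" if "M 3 = 0" "M 4 = 0"
    by (rule neg[of 4, simplified]) (rule z4[OF that])
  have n5: "\<not> lower_growth F (s0, t0) 4" if "M 3 = 0" "M 4 = 0" "M 5 = 0"
    by (rule neg[of 5, simplified]) (rule z5[OF that])
  show "cuspidal_edge_at (envelope \<mu> \<xi>) (s0, t0) \<longleftrightarrow> M 3 \<noteq> 0"
  proof
    assume "cuspidal_edge_at (envelope \<mu> \<xi>) (s0, t0)"
    from lower_growth_equivalent[OF this[unfolded cuspidal_edge_at_def, folded F_def] contF lower_growth_models(1)]
    show "M 3 \<noteq> 0" using n3 by blast
  next
    assume "M 3 \<noteq> 0"
    then show "cuspidal_edge_at (envelope \<mu> \<xi>) (s0, t0)"
      using cuspidal_edge_envelope[OF J sm _ _ \<xi>2, of s0] M2 by (simp add: M_def)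
  qed
  show "swallowtail_at (envelope \<mu> \<xi>) (s0, t0) \<longleftrightarrow> M 3 = 0 \<and> M 4 \<noteq> 0"
  proof
    assume "swallowtail_at (envelope \<mu> \<xi>) (s0, t0)"
    note eq = this[unfolded swallowtail_at_def, folded F_def]
    have "lower_growth F (s0, t0) 3" "\<not> lower_growth F (s0, t0) 2"
      using lower_growth_equivalent[OF eq contF lower_growth_models(2)] not_lower_growth_models(1)
        lower_growth_equivalent[OF right_left_equivalent_sym[OF eq] cont_models(2)] by blast+
    then show "M 3 = 0 \<and> M 4 \<noteq> 0" using g3 n4 by blast
  next
    assume "M 3 = 0 \<and> M 4 \<noteq> 0"
    then show "swallowtail_at (envelope \<mu> \<xi>) (s0, t0)"
      using swallowtail_envelope[OF J sm _ _ _ \<xi>2, of s0] M2 by (simp add: M_def)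
  qed
  show "butterfly_at (envelope \<mu> \<xi>) (s0, t0) \<longleftrightarrow> M 3 = 0 \<and> M 4 = 0 \<and> M 5 \<noteq> 0"
  proof
    assume "butterfly_at (envelope \<mu> \<xi>) (s0, t0)"
    note eq = this[unfolded butterfly_at_def, folded F_def]
    have "lower_growth F (s0, t0) 4" "\<not> lower_growth F (s0, t0) 3"
      using lower_growth_equivalent[OF eq contF lower_growth_models(3)] not_lower_growth_models(2)
        lower_growth_equivalent[OF right_left_equivalent_sym[OF eq] cont_models(3)] by blast+
    moreover from this have "\<not> lower_growth F (s0, t0) 2"
      using lower_growth_mono[of F "(s0, t0)" 2 3] by auto
    ultimately show "M 3 = 0 \<and> M 4 = 0 \<and> M 5 \<noteq> 0" using g3 g4 n5 by blast
  next
    assume "M 3 = 0 \<and> M 4 = 0 \<and> M 5 \<noteq> 0"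
    then show "butterfly_at (envelope \<mu> \<xi>) (s0, t0)"
      using butterfly_envelope[OF J sm _ _ _ _ \<xi>2, of s0] M2 by (simp add: M_def)
  qed
qed

section \<open>Integral manifolds of non-generic type\<close>

lemma right_left_equivalent_cong:
  assumes "\<forall>\<^sub>F x in nhds a. f x = f' x"
  shows "right_left_equivalent f a g b \<longleftrightarrow> right_left_equivalent f' a g b"
proof -
  have *: "right_left_equivalent f' a g b" if eq: "\<forall>\<^sub>F x in nhds a. f x = f' x" and f: "right_left_equivalent f a g b" for f f'
  proof -
    have a: "f a = f' a" using eq by (rule eventually_nhds_x_imp_x)
    from f obtain U U' \<phi> \<phi>' V V' \<psi> \<psi>' where
      h: "diffeo_between U U' \<phi> \<phi>'" "a \<in> U" "\<phi> a = b" "diffeo_between V V' \<psi> \<psi>'" "f a \<in> V" "\<psi> (f a) = g b"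
      and ev: "\<forall>\<^sub>F x in nhds a. f x \<in> V \<and> \<psi> (f x) = g (\<phi> x)"
      unfolding right_left_equivalent_def by blast
    have "\<forall>\<^sub>F x in nhds a. f' x \<in> V \<and> \<psi> (f' x) = g (\<phi> x)"
      using ev eq by eventually_elim simp
    then show ?thesis
      unfolding right_left_equivalent_def using h[unfolded a] by blast
  qed
  have "\<forall>\<^sub>F x in nhds a. f' x = f x" using assms by eventually_elim simp
  then show ?thesis using *[of f f'] *[of f' f] assms by blast
qed

lemma frechet_derivative_jet:
  fixes \<alpha> :: "jet \<Rightarrow> real"
  assumes "(\<alpha> has_derivative \<alpha>') (at m)"
  shows "\<alpha>' (h1, h2, h3, h4, h5)
    = h1 * pd_x \<alpha> m + h2 * pd_y \<alpha> m + h3 * pd_z \<alpha> m + h4 * pd_p \<alpha> m + h5 * pd_q \<alpha> m"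
proof -
  have lin: "linear \<alpha>'" using assms by (rule has_derivative_linear)
  have e: "(h1, h2, h3, h4, h5) = h1 *\<^sub>R (1, 0, 0, 0, 0) + (h2 *\<^sub>R (0, 1, 0, 0, 0) + (h3 *\<^sub>R (0, 0, 1, 0, 0) +
      (h4 *\<^sub>R (0, 0, 0, 1, 0) + h5 *\<^sub>R (0, 0, 0, 0, 1 :: real))))"
    by simp
  show ?thesis
    unfolding e linear_add[OF lin] linear_scale[OF lin] pd_x_def pd_y_def pd_z_def pd_p_def pd_q_def frechet_derivative_unique[OF assms]
    by simp
qed

locale integral_manifold =
  fixes D W :: "jet set" and \<alpha> :: "jet \<Rightarrow> real" and \<Psi> :: "jet \<Rightarrow> jet"
    and A :: "real set" and U :: "(real \<times> real \<times> real \<times> real) set"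
  assumes D: "open D" "smooth_on D \<alpha>"
    and inv: "involutive_type D \<alpha>" and ng: "non_generic_type D \<alpha>"
    and A: "open A" "is_interval A"
    and W: "W \<subseteq> D" "diffeo_between W (A \<times> U) (Phi2 \<alpha>) \<Psi>"
begin

lemma \<Psi>_coordinates:
  assumes "x \<in> A" "(a, m, p, q) \<in> U"
  obtains y z where "\<Psi> (x, a, m, p, q) = (x, y, z, p, q)" "(x, y, z, p, q) \<in> D"
    "\<alpha> (x, y, z, p, q) = a" "z = m + p * x + q * y"
proof -
  obtain x' y z p' q' where P: "\<Psi> (x, a, m, p, q) = (x', y, z, p', q')" by (metis prod.collapse)
  have "Phi2 \<alpha> (\<Psi> (x, a, m, p, q)) = (x, a, m, p, q)" "\<Psi> (x, a, m, p, q) \<in> D"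
    using W assms by (auto simp: diffeo_between_def)
  then show thesis
    using that[of y z] P by (auto simp: Phi2_def)
qed

lemma \<alpha>_has_derivative: "m \<in> D \<Longrightarrow> (\<alpha> has_derivative frechet_derivative \<alpha> (at m)) (at m)"
  using D(2) by (rule smooth_on_has_derivative)

lemma \<alpha>_types:
  assumes "(x, y, z, p, q) \<in> D"
  defines "m \<equiv> (x, y, z, p, q)"
  shows "pd_x \<alpha> m + p * pd_z \<alpha> m = \<alpha> m * (pd_y \<alpha> m + q * pd_z \<alpha> m)"
    and "x * (pd_y \<alpha> m + q * pd_z \<alpha> m) = - 1"
  using inv ng assms(1) unfolding involutive_type_def non_generic_type_def m_def by (fastforce simp: Let_def)+

lemma \<beta>_constant:
  assumes "(a, m, p, q) \<in> U" "x1 \<in> A" "x2 \<in> A"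
  shows "beta2 \<alpha> (\<Psi> (x1, a, m, p, q)) = beta2 \<alpha> (\<Psi> (x2, a, m, p, q))"
proof -
  define Y where "Y = (\<lambda>x. fst (snd (\<Psi> (x, a, m, p, q))))"
  have co: "\<Psi> (x, a, m, p, q) = (x, Y x, m + p * x + q * Y x, p, q) \<and> (x, Y x, m + p * x + q * Y x, p, q) \<in> D
      \<and> \<alpha> (x, Y x, m + p * x + q * Y x, p, q) = a" if x: "x \<in> A" for x
  proof -
    obtain y z where *: "\<Psi> (x, a, m, p, q) = (x, y, z, p, q)" "(x, y, z, p, q) \<in> D"
      "\<alpha> (x, y, z, p, q) = a" "z = m + p * x + q * y"
      by (rule \<Psi>_coordinates[OF x assms(1)])
    have "Y x = y" by (simp add: Y_def *(1))
    then show ?thesis using * by simp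
  qed
  then have \<Psi>: "\<Psi> (x, a, m, p, q) = (x, Y x, m + p * x + q * Y x, p, q)" and inD: "(x, Y x, m + p * x + q * Y x, p, q) \<in> D"
    and \<alpha>: "\<alpha> (x, Y x, m + p * x + q * Y x, p, q) = a" if "x \<in> A" for x
    using that by simp_all
  have "\<exists>y'. (Y has_real_derivative y') (at x)" if x: "x \<in> A" for x
  proof -
    have smA: "smooth_on A (\<lambda>x. (x, a, m, p, q))"
      by (intro smooth_on_Pair smooth_on_id smooth_on_const A)
    have "smooth_on A (\<lambda>x. \<Psi> (x, a, m, p, q))"
      by (rule smooth_on_compose[OF _ A(1) _ smA, of "A \<times> U"]) (use W(2) assms(1) in \<open>auto simp: diffeo_between_def\<close>)
    then have "smooth_on A Y"
      unfolding Y_def by (intro smooth_on_fst smooth_on_snd A)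
    then show ?thesis using smooth_on_deriv(2)[OF A(1) _ x] by blast
  qed
  then obtain Y' where Y': "\<And>x. x \<in> A \<Longrightarrow> (Y has_real_derivative Y' x) (at x)" by metis
  have "Y' x = - a" if x: "x \<in> A" for x
  proof -
    define n where "n = (x, Y x, m + p * x + q * Y x, p, q)"
    have "((\<lambda>x. (x, Y x, m + p * x + q * Y x, p, q)) has_derivative (\<lambda>h. (h, h * Y' x, p * h + q * (h * Y' x), 0, 0))) (at x)"
      using Y'[OF x, unfolded has_field_derivative_def] by (auto intro!: derivative_eq_intros simp: mult_ac zero_prod_def)
    from has_derivative_compose[OF this, of \<alpha>, OF \<alpha>_has_derivative[OF inD[OF x]]]
    have "((\<lambda>x. \<alpha> (x, Y x, m + p * x + q * Y x, p, q)) has_derivative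
        (\<lambda>h. frechet_derivative \<alpha> (at n) (h, h * Y' x, p * h + q * (h * Y' x), 0, 0))) (at x)"
      by (simp add: n_def)
    then have "((\<lambda>x. a) has_derivative
        (\<lambda>h. frechet_derivative \<alpha> (at n) (h, h * Y' x, p * h + q * (h * Y' x), 0, 0))) (at x)"
      by (rule has_derivative_transform_within_open[OF _ A(1) x]) (use \<alpha> in auto)
    from fun_cong[OF has_derivative_unique[OF this has_derivative_const], of 1]
    have "pd_x \<alpha> n + Y' x * pd_y \<alpha> n + (p + q * Y' x) * pd_z \<alpha> n = 0"
      using frechet_derivative_jet[OF \<alpha>_has_derivative[OF inD[OF x]], of 1 "Y' x" "p + q * Y' x" 0 0] by (simp add: n_def)
    then have "(pd_x \<alpha> n + p * pd_z \<alpha> n) + Y' x * (pd_y \<alpha> n + q * pd_z \<alpha> n) = 0"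
      by (simp add: algebra_simps)
    \<comment> \<open>Differentiating \<open>\<alpha> = a\<close> along the curve and inserting the
      involutive equation leaves a product. Its second factor is nonzero by the non-generic
      equation, hence \<open>Y' = - a\<close>.\<close>
    then have "(a + Y' x) * (pd_y \<alpha> n + q * pd_z \<alpha> n) = 0"
      unfolding \<alpha>_types(1)[OF inD[OF x], folded n_def] using \<alpha>[OF x] by (simp add: n_def algebra_simps)
    then show ?thesis
      using \<alpha>_types(2)[OF inD[OF x], folded n_def] by auto
  qed
  then have "((\<lambda>x. Y x + a * x) has_real_derivative 0) (at x)" if "x \<in> A" for x
    using Y'[OF that] that by (auto intro!: derivative_eq_intros)
  then obtain c where "\<forall>x\<in>A. Y x + a * x = c"
    using has_field_derivative_zero_constant[OF is_interval_convex[OF A(2)]] by (metis has_field_derivative_at_within)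
  then show ?thesis using \<Psi> \<alpha> assms(2,3) by (simp add: beta2_def)
qed

lemma beta2_bar_eq:
  assumes "(a, m, p, q) \<in> U" "x \<in> A"
  shows "beta2_bar \<alpha> \<Psi> A (a, m, p, q) = beta2 \<alpha> (\<Psi> (x, a, m, p, q))"
  unfolding beta2_bar_def
proof (rule the_equality)
  show "\<forall>x\<^sub>0\<in>A. beta2 \<alpha> (\<Psi> (x\<^sub>0, a, m, p, q)) = beta2 \<alpha> (\<Psi> (x, a, m, p, q))"
    using \<beta>_constant[OF assms(1) _ assms(2)] by blast
qed (use assms(2) in auto)

lemma \<Psi>_envelope:
  assumes "(s, deriv \<xi> t, \<mu> t, \<xi> t, t) \<in> A \<times> U"
    and "(\<mu> has_real_derivative - beta2_bar \<alpha> \<Psi> A (deriv \<xi> t, \<mu> t, \<xi> t, t)) (at t)"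
  defines "m \<equiv> (s, fst (snd (envelope \<mu> \<xi> (s, t))), snd (snd (envelope \<mu> \<xi> (s, t))), \<xi> t, t)"
  shows "\<Psi> (s, deriv \<xi> t, \<mu> t, \<xi> t, t) = m" "m \<in> D" "\<alpha> m = deriv \<xi> t"
proof -
  have sU: "s \<in> A" "(deriv \<xi> t, \<mu> t, \<xi> t, t) \<in> U" using assms(1) by auto
  obtain y z where *: "\<Psi> (s, deriv \<xi> t, \<mu> t, \<xi> t, t) = (s, y, z, \<xi> t, t)" "(s, y, z, \<xi> t, t) \<in> D"
    "\<alpha> (s, y, z, \<xi> t, t) = deriv \<xi> t" "z = \<mu> t + \<xi> t * s + t * y"
    by (rule \<Psi>_coordinates[OF sU])
  have "deriv \<mu> t = - (y + deriv \<xi> t * s)"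
    using DERIV_imp_deriv[OF assms(2)] unfolding beta2_bar_eq[OF sU(2,1)] by (simp add: beta2_def *(1,3))
  then have y: "y = - deriv \<mu> t - s * deriv \<xi> t" by simp
  have "m = (s, y, z, \<xi> t, t)"
    unfolding m_def envelope_def *(4) y by (simp add: algebra_simps)
  then show "\<Psi> (s, deriv \<xi> t, \<mu> t, \<xi> t, t) = m" "m \<in> D" "\<alpha> m = deriv \<xi> t"
    using * by simp_all
qed

lemma F2_eq_envelope:
  assumes "(s, deriv \<xi> t, \<mu> t, \<xi> t, t) \<in> A \<times> U"
    and "(\<mu> has_real_derivative - beta2_bar \<alpha> \<Psi> A (deriv \<xi> t, \<mu> t, \<xi> t, t)) (at t)"
  shows "F2 \<Psi> \<xi> \<mu> (s, t) = envelope \<mu> \<xi> (s, t)"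
  by (simp add: F2_def phi2_def psi2_def \<Psi>_envelope(1)[OF assms] prod_eq_iff) (simp add: envelope_def)

text \<open>For fixed \<open>s\<close>, differentiate \<open>\<alpha> = \<xi>'\<close> in
  \<open>t\<close>. On the manifold \<open>dz = t dy\<close>, so \<open>y\<close> and
  \<open>z\<close> enter through \<open>Y' * (\<alpha>_y + t \<alpha>_z)\<close>, which is
  \<open>- Y' / s\<close> by the non-generic equation; the terms with \<open>\<xi>''\<close> then
  cancel. That equation also excludes \<open>s = 0\<close>.\<close>

lemma G_eq:
  fixes \<xi> \<mu> :: "real \<Rightarrow> real"
  assumes J: "open J" "t \<in> J" and sm: "smooth_on J \<xi>" "smooth_on J \<mu>"
    and U: "\<And>t. t \<in> J \<Longrightarrow> (s, deriv \<xi> t, \<mu> t, \<xi> t, t) \<in> A \<times> U"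
    and \<mu>': "\<And>t. t \<in> J \<Longrightarrow> (\<mu> has_real_derivative - beta2_bar \<alpha> \<Psi> A (deriv \<xi> t, \<mu> t, \<xi> t, t)) (at t)"
  defines "m \<equiv> Theta2 \<Psi> \<xi> \<mu> (s, t)"
  shows "pd_q \<alpha> m + \<alpha> m * pd_p \<alpha> m = - (deriv ^^ 2) \<mu> t / s" and "s \<noteq> 0"
proof -
  define Y where "Y = (\<lambda>t. - deriv \<mu> t - s * deriv \<xi> t)"
  define Z where "Z = (\<lambda>t. \<mu> t + s * \<xi> t + t * Y t)"
  define n where "n = (\<lambda>t. (s, Y t, Z t, \<xi> t, t))"
  have n: "\<Psi> (s, deriv \<xi> t, \<mu> t, \<xi> t, t) = n t" "n t \<in> D" "\<alpha> (n t) = deriv \<xi> t" if "t \<in> J" for t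
    using \<Psi>_envelope[OF U[OF that] \<mu>'[OF that]] by (simp_all add: n_def Y_def Z_def envelope_def)
  have m: "m = n t" using n(1)[OF J(2)] by (simp add: m_def Theta2_def)
  define Y' where "Y' = - (deriv ^^ 2) \<mu> t - s * (deriv ^^ 2) \<xi> t"
  have d: "(\<xi> has_real_derivative deriv \<xi> t) (at t)" "(\<mu> has_real_derivative deriv \<mu> t) (at t)"
    "(deriv \<xi> has_real_derivative (deriv ^^ 2) \<xi> t) (at t)" "(deriv \<mu> has_real_derivative (deriv ^^ 2) \<mu> t) (at t)"
    using smooth_on_deriv(2)[OF J(1) sm(1) J(2)] smooth_on_deriv(2)[OF J(1) sm(2) J(2)]
      smooth_on_deriv(2)[OF J(1) smooth_on_deriv(1)[OF J(1) sm(1)] J(2)]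
      smooth_on_deriv(2)[OF J(1) smooth_on_deriv(1)[OF J(1) sm(2)] J(2)] by (simp_all add: numeral_2_eq_2)
  have dY: "(Y has_real_derivative Y') (at t)"
    unfolding Y_def Y'_def by (auto intro!: derivative_eq_intros d)
  have dZ: "(Z has_real_derivative t * Y') (at t)"
  proof -
    have "(Z has_real_derivative deriv \<mu> t + s * deriv \<xi> t + (1 * Y t + Y' * t)) (at t)"
      unfolding Z_def by (intro DERIV_add DERIV_cmult DERIV_mult DERIV_ident d dY)
    then show ?thesis by (simp add: Y_def mult_ac)
  qed
  have "(n has_derivative (\<lambda>h. (0, h * Y', h * (t * Y'), h * deriv \<xi> t, h))) (at t)"
    unfolding n_def
    using dY[unfolded has_field_derivative_def] dZ[unfolded has_field_derivative_def] d(1)[unfolded has_field_derivative_def]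
    by (auto intro!: derivative_eq_intros simp: mult_ac)
  from has_derivative_compose[OF this \<alpha>_has_derivative[OF n(2)[OF J(2)]]]
  have "(deriv \<xi> has_derivative (\<lambda>h. frechet_derivative \<alpha> (at (n t)) (0, h * Y', h * (t * Y'), h * deriv \<xi> t, h))) (at t)"
    by (rule has_derivative_transform_within_open[OF _ J]) (use n in auto)
  from fun_cong[OF has_derivative_unique[OF this d(3)[unfolded has_field_derivative_def]], of 1]
  have e: "Y' * pd_y \<alpha> m + t * Y' * pd_z \<alpha> m + deriv \<xi> t * pd_p \<alpha> m + pd_q \<alpha> m = (deriv ^^ 2) \<xi> t"
    using frechet_derivative_jet[OF \<alpha>_has_derivative[OF n(2)[OF J(2)]], of 0 Y' "t * Y'" "deriv \<xi> t" 1] by (simp add: m)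
  have g: "s * (pd_y \<alpha> m + t * pd_z \<alpha> m) = - 1"
    using \<alpha>_types(2)[OF n(2)[OF J(2), unfolded n_def]] by (simp add: m n_def)
  then show s: "s \<noteq> 0" by auto
  have "s * (pd_q \<alpha> m + \<alpha> m * pd_p \<alpha> m) = s * (deriv ^^ 2) \<xi> t - Y' * (s * (pd_y \<alpha> m + t * pd_z \<alpha> m))"
    using n(3)[OF J(2)] by (simp add: m[symmetric] e[symmetric] algebra_simps)
  also have "\<dots> = - (deriv ^^ 2) \<mu> t"
    unfolding g by (simp add: Y'_def)
  finally show "pd_q \<alpha> m + \<alpha> m * pd_p \<alpha> m = - (deriv ^^ 2) \<mu> t / s"
    using s by (simp add: field_simps)
qed

end

lemma envelope_singular_points:
  fixes \<mu> \<xi> :: "real \<Rightarrow> real"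
  assumes J: "open J" "t \<in> J" and sm: "smooth_on J \<mu>" "smooth_on J \<xi>"
    and "dim (range (frechet_derivative (envelope \<mu> \<xi>) (at (s, t)))) < 2"
  shows "(deriv ^^ 2) \<mu> t + s * (deriv ^^ 2) \<xi> t = 0"
proof (rule ccontr)
  assume M: "(deriv ^^ 2) \<mu> t + s * (deriv ^^ 2) \<xi> t \<noteq> 0"
  define c where "c = - (deriv ^^ 2) \<mu> t - s * (deriv ^^ 2) \<xi> t"
  have c: "c \<noteq> 0" using M by (simp add: c_def)
  define L where "L = frechet_derivative (envelope \<mu> \<xi>) (at (s, t))"
  have L: "L = (\<lambda>(h, k). h *\<^sub>R ruling \<xi> t + (k * c) *\<^sub>R (0, 1, t))"
    unfolding L_def c_def by (rule frechet_derivative_unique[OF envelope_has_derivative[OF J sm]])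
  have "L (1, 0) = ruling \<xi> t" "L (0, 1) = (0, c, c * t)" by (simp_all add: L zero_prod_def)
  then have "{ruling \<xi> t, (0, c, c * t)} \<subseteq> range L" by (metis empty_subsetI insert_subset rangeI)
  moreover have "ruling \<xi> t \<notin> span {(0, c, c * t)}"
    by (auto simp: ruling_def span_singleton)
  then have "independent {ruling \<xi> t, (0, c, c * t)}"
    using c by (intro independent_insertI) (auto simp: zero_prod_def independent_empty)
  ultimately have "card {ruling \<xi> t, (0, c, c * t)} \<le> dim (range L)"
    by (rule independent_card_le_dim)
  moreover have "ruling \<xi> t \<noteq> (0, c, c * t)" by (simp add: ruling_def)
  ultimately show False using assms(5) by (simp add: L_def)
qed

theorem theorem6p37:
  fixes D W :: "jet set" and \<alpha> :: "jet \<Rightarrow> real" and \<Psi> :: "jet \<Rightarrow> jet"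
    and A I J :: "real set" and U :: "(real \<times> real \<times> real \<times> real) set"
    and \<xi> \<mu> :: "real \<Rightarrow> real" and G :: "real \<times> real \<Rightarrow> real" and s0 t0 :: real
  assumes "open D" and "smooth_on D \<alpha>"
    and "involutive_type D \<alpha>" and "non_generic_type D \<alpha>"
    and "open A" and "is_interval A" and "open U"
    and "W \<subseteq> D" and "diffeo_between W (A \<times> U) (Phi2 \<alpha>) \<Psi>"
    and "open I" and "is_interval I" and "open J" and "is_interval J"
    and "smooth_on J \<xi>" and "smooth_on J \<mu>"
    and "\<And>s t. s \<in> I \<Longrightarrow> t \<in> J \<Longrightarrow> (s, deriv \<xi> t, \<mu> t, \<xi> t, t) \<in> A \<times> U"
    and "\<And>t. t \<in> J \<Longrightarrow>
      (\<mu> has_real_derivative - beta2_bar \<alpha> \<Psi> A (deriv \<xi> t, \<mu> t, \<xi> t, t)) (at t)"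
    and "G = (\<lambda>m. pd_q \<alpha> m + \<alpha> m * pd_p \<alpha> m) \<circ> Theta2 \<Psi> \<xi> \<mu>"
    and "(s0, t0) \<in> singular_points (F2 \<Psi> \<xi> \<mu>) (I \<times> J)"
    and "deriv (\<lambda>s. G (s, t0)) s0 \<noteq> 0"
  shows "(cuspidal_edge_at (F2 \<Psi> \<xi> \<mu>) (s0, t0) \<longleftrightarrow>
            deriv (\<lambda>t. G (s0, t)) t0 - (deriv ^^ 3) \<xi> t0 \<noteq> 0)
       \<and> (swallowtail_at (F2 \<Psi> \<xi> \<mu>) (s0, t0) \<longleftrightarrow>
            deriv (\<lambda>t. G (s0, t)) t0 - (deriv ^^ 3) \<xi> t0 = 0 \<and>
            (deriv ^^ 2) (\<lambda>t. G (s0, t)) t0 - (deriv ^^ 4) \<xi> t0 \<noteq> 0)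
       \<and> (butterfly_at (F2 \<Psi> \<xi> \<mu>) (s0, t0) \<longleftrightarrow>
            deriv (\<lambda>t. G (s0, t)) t0 - (deriv ^^ 3) \<xi> t0 = 0 \<and>
            (deriv ^^ 2) (\<lambda>t. G (s0, t)) t0 - (deriv ^^ 4) \<xi> t0 = 0 \<and>
            (deriv ^^ 3) (\<lambda>t. G (s0, t)) t0 - (deriv ^^ 5) \<xi> t0 \<noteq> 0)"
proof -
  interpret integral_manifold D W \<alpha> \<Psi> A U
    by unfold_locales (use assms in auto)
  note I = \<open>open I\<close> and J = \<open>open J\<close> and sm = \<open>smooth_on J \<mu>\<close> \<open>smooth_on J \<xi>\<close>
  note dom = assms(16) and ode = assms(17) and sing = assms(19) and Gs = assms(20)
  have st: "s0 \<in> I" "t0 \<in> J" using sing by (auto simp: singular_points_def)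
  have open_IJ: "open (I \<times> J)" using I J by (rule open_Times)
  have F: "F2 \<Psi> \<xi> \<mu> p = envelope \<mu> \<xi> p" if "p \<in> I \<times> J" for p
    using that F2_eq_envelope dom ode by (cases p) auto
  have G: "G (s, t) = - (deriv ^^ 2) \<mu> t / s" "s \<noteq> 0" if "s \<in> I" "t \<in> J" for s t
    using G_eq[OF J that(2) sm(2,1), of s] dom ode that(1) by (simp_all add: \<open>G = _\<close>)
  define M where "M = (\<lambda>k. (deriv ^^ k) \<mu> t0 + s0 * (deriv ^^ k) \<xi> t0)"
  have s0: "s0 \<noteq> 0" using G(2) st by blast
  \<comment> \<open>The singular set is defined by the derivative of \<open>F2\<close>, which agrees
    with the envelope only on \<open>I \<times> J\<close>; this is open, so the derivatives agree as
    well.\<close>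
  have M2: "M 2 = 0"
  proof -
    have "(envelope \<mu> \<xi> has_derivative frechet_derivative (envelope \<mu> \<xi>) (at (s0, t0))) (at (s0, t0))"
      using smooth_on_has_derivative[OF smooth_on_envelope[OF J sm]] st by simp
    then have "(F2 \<Psi> \<xi> \<mu> has_derivative frechet_derivative (envelope \<mu> \<xi>) (at (s0, t0))) (at (s0, t0))"
      by (rule has_derivative_transform_within_open[OF _ open_IJ]) (use st F in auto)
    then have "frechet_derivative (F2 \<Psi> \<xi> \<mu>) (at (s0, t0)) = frechet_derivative (envelope \<mu> \<xi>) (at (s0, t0))"
      by (rule frechet_derivative_unique)
    then show ?thesis
      using envelope_singular_points[OF J st(2) sm, of s0] sing by (simp add: singular_points_def M_def)
  qed
  \<comment> \<open>With \<open>t0\<close> fixed, \<open>G\<close> is a constant times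
    \<open>1 / s\<close>; so \<open>G_s \<noteq> 0\<close> means
    \<open>\<mu>''(t0) \<noteq> 0\<close>, and at a singular point this is equivalent to
    \<open>\<xi>''(t0) \<noteq> 0\<close>, because \<open>s0 \<noteq> 0\<close>.\<close>
  have "\<forall>\<^sub>F s in nhds s0. G (s, t0) = - (deriv ^^ 2) \<mu> t0 / s"
    using eventually_nhds_in_open[OF I st(1)] by eventually_elim (use G(1) st(2) in blast)
  then have "deriv (\<lambda>s. G (s, t0)) s0 = deriv (\<lambda>s. - (deriv ^^ 2) \<mu> t0 / s) s0"
    by (intro deriv_cong_ev) auto
  also have "\<dots> = (deriv ^^ 2) \<mu> t0 / s0\<^sup>2"
    by (rule DERIV_imp_deriv) (use s0 in \<open>auto intro!: derivative_eq_intros simp: power2_eq_square\<close>)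
  finally have "(deriv ^^ 2) \<mu> t0 \<noteq> 0" using Gs by auto
  then have \<xi>2: "(deriv ^^ 2) \<xi> t0 \<noteq> 0" using M2 by (auto simp: M_def)
  have Gt: "(deriv ^^ k) (\<lambda>t. G (s0, t)) t = - (deriv ^^ (k + 2)) \<mu> t / s0" if "t \<in> J" for k t
    using that
  proof (induction k arbitrary: t)
    case 0
    then show ?case using G(1) st(1) by (simp add: numeral_2_eq_2)
  next
    case (Suc k)
    have "\<forall>\<^sub>F x in nhds t. (deriv ^^ k) (\<lambda>t. G (s0, t)) x = - (deriv ^^ (k + 2)) \<mu> x / s0"
      using eventually_nhds_in_open[OF J Suc.prems] by eventually_elim (rule Suc.IH)
    then have "deriv ((deriv ^^ k) (\<lambda>t. G (s0, t))) t = deriv (\<lambda>x. - (deriv ^^ (k + 2)) \<mu> x / s0) t"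
      by (intro deriv_cong_ev) auto
    also have "\<dots> = - deriv ((deriv ^^ (k + 2)) \<mu>) t / s0"
      by (rule DERIV_imp_deriv)
        (rule DERIV_cdivide[OF DERIV_minus[OF smooth_on_deriv(2)[OF J smooth_on_deriv_iterate[OF J sm(1)] Suc.prems]]])
    finally show ?case by simp
  qed
  \<comment> \<open>Since \<open>G\<close> already contains the second derivative of
    \<open>\<mu>\<close>, its \<open>k\<close>-th derivative in \<open>t\<close> is paired with the
    derivative of \<open>\<xi>\<close> of order \<open>k + 2\<close>.\<close>
  have *: "(deriv ^^ k) (\<lambda>t. G (s0, t)) t0 - (deriv ^^ l) \<xi> t0 = - M l / s0" if "l = k + 2" for k l
    using s0 unfolding Gt[OF st(2)] M_def that by (simp add: field_simps)
  have cond: "deriv (\<lambda>t. G (s0, t)) t0 - (deriv ^^ 3) \<xi> t0 = - M 3 / s0"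
    "(deriv ^^ 2) (\<lambda>t. G (s0, t)) t0 - (deriv ^^ 4) \<xi> t0 = - M 4 / s0"
    "(deriv ^^ 3) (\<lambda>t. G (s0, t)) t0 - (deriv ^^ 5) \<xi> t0 = - M 5 / s0"
    using *[of 3 1] *[of 4 2] *[of 5 3] by simp_all
  have ev: "\<forall>\<^sub>F p in nhds (s0, t0). F2 \<Psi> \<xi> \<mu> p = envelope \<mu> \<xi> p"
    by (rule eventually_mono[OF eventually_nhds_in_open[OF open_IJ]]) (use st F in auto)
  have nz: "- M l / s0 = 0 \<longleftrightarrow> M l = 0" for l using s0 by simp
  show ?thesis
    unfolding cond nz cuspidal_edge_at_def swallowtail_at_def butterfly_at_def right_left_equivalent_cong[OF ev]
    using envelope_singularities[OF J st(2) sm M2[unfolded M_def] \<xi>2]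
    unfolding M_def cuspidal_edge_at_def swallowtail_at_def butterfly_at_def by (intro conjI)
qed

end
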